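(* Let $d\ge2$. For all $r\in(0,1]$ and all $q\in(\frac{2d}{2+d},2]$, there is a constant $c$ such that for all $\boldsymbol v\in\boldsymbol H^r(D)$ with $\nabla\cdot\boldsymbol v\in L^q(D)$ and all $h\in\mathcal H$, we have $$\inf_{\boldsymbol v_h\in\boldsymbol P^{\mathrm d}_k(\mathcal T_h)}\|\boldsymbol v-\boldsymbol v_h\|_{\boldsymbol L^2(D)}\le c\,\bigg\{\sum_{K\in\mathcal T_h}\Big\{h_K^{2r}|\boldsymbol v|_{\boldsymbol H^r(K)}^2+h_K^{2+2d(\frac12-\frac1q)}\|\nabla\cdot\boldsymbol v\|_{L^q(K)}^2\Big\}\bigg\}^{\frac12}.$$ Moreover, assuming that $\gamma^{\mathrm d}(\boldsymbol v)=0$, we also have $$\inf_{\boldsymbol v_h\in\boldsymbol P^{\mathrm d}_{k,0}(\mathcal T_h)}\|\boldsymbol v-\boldsymbol v_h\|_{\boldsymbol L^2(D)}\le c\,\bigg\{\sum_{K\in\mathcal T_h}\Big\{h_K^{2r}|\boldsymbol v|_{\boldsymbol H^r(K)}^2+h_K^{2+2d(\frac12-\frac1q)}\|\nabla\cdot\boldsymbol v\|_{L^q(K)}^2\Big\}\bigg\}^{\frac12}.$$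
   Context: $D\subset\mathbb R^d$, $d\ge2$, is a (bounded, open, connected) polyhedral Lipschitz domain with boundary $\partial D$ and unit outward normal $\boldsymbol n_D$. $\mathbb N=\{0,1,2,\dots\}$ and $k\in\mathbb N$ is a fixed polynomial degree. $(\mathcal T_h)_{h\in\mathcal H}$ is a shape-regular family of affine, matching, simplicial meshes (closed cells $K$), each covering $D$ exactly; $h_K$ is the diameter of $K$, and shape-regularity means that the ratio of $h_K$ to the diameter of the largest ball contained in $K$ is bounded uniformly over $K\in\mathcal T_h$ and $h\in\mathcal H$. Boldface denotes $\mathbb R^d$-valued fields and spaces of such fields. $\boldsymbol H^r=\boldsymbol W^{r,2}$ is the (fractional-order) Sobolev space; $|\cdot|_{\boldsymbol H^r(K)}$ is the Sobolev--Slobodeckij seminorm if $r\in(0,1)$ and the $L^2$-norm of the gradient if $r=1$. The constant $c$ may depend only on $r$, $q$, the mesh shape-regularity, the space dimension $d$, and the polynomial degree $k$. Normal trace: for $\boldsymbol v\in\boldsymbol L^2(D)$ with $\nabla\cdot\boldsymbol v\in L^q(D)$, $q\in(\frac{2d}{2+d},2]$, $\gamma^{\mathrm d}(\boldsymbol v)\in H^{-\frac12}(\partial D)$ is defined by $\langle\gamma^{\mathrm d}(\boldsymbol v),w\rangle_{\partial D}:=\int_D(\boldsymbol v\cdot\nabla l(w)+(\nabla\cdot\boldsymbol v)l(w))\,\mathrm dx$ for all $w\in H^{\frac12}(\partial D)$, where $l(w)\in H^1(D)$ is any lifting of $w$; for smooth $\boldsymbol v$, $\gamma^{\mathrm d}(\boldsymbol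 v)=\boldsymbol v_{|\partial D}\cdot\boldsymbol n_D$. Finite elements: $\boldsymbol{RT}^k(K)$ is the restriction to $K$ of the Raviart--Thomas polynomials $\mathbb P_k^d+\boldsymbol x\,\mathbb P_k$, where $\mathbb P_k$ denotes polynomials of total degree at most $k$. $\boldsymbol P^{\mathrm d}_k(\mathcal T_h):=\{\boldsymbol v_h\in\boldsymbol H(\mathrm{div};D):\boldsymbol v_{h|K}\in\boldsymbol{RT}^k(K)\ \forall K\in\mathcal T_h\}$ and $\boldsymbol P^{\mathrm d}_{k,0}(\mathcal T_h):=\{\boldsymbol v_h\in\boldsymbol P^{\mathrm d}_k(\mathcal T_h):\gamma^{\mathrm d}(\boldsymbol v_h)=0\}$. *)

theory Defs
  imports "HOL-Analysis.Analysis"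
begin

section \<open>Lebesgue spaces\<close>

text \<open>Functions on an open set \<open>U\<close> are represented by total functions whose values outside \<open>U\<close>
  are irrelevant. All the notions below are insensitive to changes on null sets.\<close>

definition Lspace :: "real \<Rightarrow> 'a::euclidean_space set \<Rightarrow> ('a \<Rightarrow> 'b::euclidean_space) set" where
  "Lspace p U = {f. f \<in> borel_measurable (lebesgue_on U) \<and>
                    integrable (lebesgue_on U) (\<lambda>x. norm (f x) powr p)}"

definition Lnorm :: "real \<Rightarrow> 'a::euclidean_space set \<Rightarrow> ('a \<Rightarrow> 'b::euclidean_space) \<Rightarrow> real" where
  "Lnorm p U f = (LINT x|lebesgue_on U. norm (f x) powr p) powr (1 / p)"

definition locally_integrable_on :: "('a::euclidean_space \<Rightarrow> 'b::euclidean_space) \<Rightarrow> 'a set \<Rightarrow> bool" where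
  "locally_integrable_on f U \<longleftrightarrow> (\<forall>C. compact C \<and> C \<subseteq> U \<longrightarrow> f absolutely_integrable_on C)"


section \<open>Smooth functions and weak derivatives\<close>

primrec iterated_deriv :: "'a list \<Rightarrow> ('a::euclidean_space \<Rightarrow> real) \<Rightarrow> 'a \<Rightarrow> real" where
  "iterated_deriv [] f = f"
| "iterated_deriv (b # bs) f = (\<lambda>x. frechet_derivative (iterated_deriv bs f) (at x) b)"

text \<open>\<open>C\<^sup>\<infinity>\<close>: each iterated partial derivative is differentiable everywhere, hence also continuous.\<close>

definition smooth :: "('a::euclidean_space \<Rightarrow> real) \<Rightarrow> bool" where
  "smooth f \<longleftrightarrow> (\<forall>bs x. set bs \<subseteq> Basis \<longrightarrow> iterated_deriv bs f differentiable (at x))"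

definition grad :: "('a::euclidean_space \<Rightarrow> real) \<Rightarrow> 'a \<Rightarrow> 'a" where
  "grad f x = (\<Sum>b\<in>Basis. frechet_derivative f (at x) b *\<^sub>R b)"

definition test_functions :: "'a::euclidean_space set \<Rightarrow> ('a \<Rightarrow> real) set" where
  "test_functions U = {\<phi>. smooth \<phi> \<and> compact (closure {x. \<phi> x \<noteq> 0}) \<and> closure {x. \<phi> x \<noteq> 0} \<subseteq> U}"

definition has_weak_grad :: "'a::euclidean_space set \<Rightarrow> ('a \<Rightarrow> real) \<Rightarrow> ('a \<Rightarrow> 'a) \<Rightarrow> bool" where
  "has_weak_grad U f G \<longleftrightarrow>
     locally_integrable_on f U \<and> locally_integrable_on G U \<and>
     (\<forall>\<phi>\<in>test_functions U.
        (LINT x|lebesgue_on U. f x *\<^sub>R grad \<phi> x) = - (LINT x|lebesgue_on U. \<phi> x *\<^sub>R G x))"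

definition has_weak_div :: "'a::euclidean_space set \<Rightarrow> ('a \<Rightarrow> 'a) \<Rightarrow> ('a \<Rightarrow> real) \<Rightarrow> bool" where
  "has_weak_div U v g \<longleftrightarrow>
     locally_integrable_on v U \<and> locally_integrable_on g U \<and>
     (\<forall>\<phi>\<in>test_functions U.
        (LINT x|lebesgue_on U. v x \<bullet> grad \<phi> x) = - (LINT x|lebesgue_on U. g x * \<phi> x))"

text \<open>Weak derivatives on open sets are unique up to null sets; the choice of a representative
  is immaterial. Both constants are meaningful only if the derivative exists.\<close>

definition weak_grad :: "'a::euclidean_space set \<Rightarrow> ('a \<Rightarrow> real) \<Rightarrow> 'a \<Rightarrow> 'a" where
  "weak_grad U f = (SOME G. has_weak_grad U f G)"

definition weak_div :: "'a::euclidean_space set \<Rightarrow> ('a \<Rightarrow> 'a) \<Rightarrow> 'a \<Rightarrow> real" where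
  "weak_div U v = (SOME g. has_weak_div U v g)"


section \<open>Sobolev spaces\<close>

text \<open>\<open>H\<^sup>r(U)\<close>, intended for \<open>0 < r \<le> 1\<close>. For \<open>r = 1\<close> the gradient is taken componentwise, with the
  Frobenius norm in the seminorm; for \<open>r < 1\<close> this is the Sobolev--Slobodeckij space.
  The integrand vanishes on the diagonal since \<open>0 / 0 = 0\<close>.\<close>

definition slobodeckij_kernel ::
    "real \<Rightarrow> ('a::euclidean_space \<Rightarrow> 'b::euclidean_space) \<Rightarrow> 'a \<times> 'a \<Rightarrow> real" where
  "slobodeckij_kernel r f = (\<lambda>(x, y). (norm (f x - f y))\<^sup>2 / norm (x - y) powr (real DIM('a) + 2 * r))"

definition sobolev :: "real \<Rightarrow> 'a::euclidean_space set \<Rightarrow> ('a \<Rightarrow> 'b::euclidean_space) set" where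
  "sobolev r U = {f \<in> Lspace 2 U.
     if r = 1
     then \<forall>i\<in>Basis. (\<exists>G. has_weak_grad U (\<lambda>x. f x \<bullet> i) G) \<and> weak_grad U (\<lambda>x. f x \<bullet> i) \<in> Lspace 2 U
     else integrable (lebesgue_on U \<Otimes>\<^sub>M lebesgue_on U) (slobodeckij_kernel r f)}"

definition sobolev_seminorm ::
    "real \<Rightarrow> 'a::euclidean_space set \<Rightarrow> ('a \<Rightarrow> 'b::euclidean_space) \<Rightarrow> real" where
  "sobolev_seminorm r U f =
     (if r = 1
      then sqrt (\<Sum>i\<in>Basis. (Lnorm 2 U (weak_grad U (\<lambda>x. f x \<bullet> i)))\<^sup>2)
      else sqrt (integral\<^sup>L (lebesgue_on U \<Otimes>\<^sub>M lebesgue_on U) (slobodeckij_kernel r f)))"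

text \<open>Square-integrable fields whose divergence is in \<open>L\<^sup>q\<close>; \<open>Hdiv 2 U\<close> is the usual \<open>H(div; U)\<close>.\<close>

definition Hdiv :: "real \<Rightarrow> 'a::euclidean_space set \<Rightarrow> ('a \<Rightarrow> 'a) set" where
  "Hdiv q U = {v \<in> Lspace 2 U. (\<exists>g. has_weak_div U v g) \<and> weak_div U v \<in> Lspace q U}"


section \<open>Boundary traces\<close>

text \<open>The surface measure on a subset of the boundary is the \<open>(d - 1)\<close>-dimensional Hausdorff measure,
  normalised so that it agrees with Lebesgue measure on hyperplanes. The boundedness condition is
  needed because the library's \<^const>\<open>diameter\<close> is unspecified on unbounded sets.\<close>

definition hausdorff_premeasure :: "nat \<Rightarrow> real \<Rightarrow> 'a::euclidean_space set \<Rightarrow> ennreal" where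
  "hausdorff_premeasure s \<delta> A =
     (INF C\<in>{C :: nat \<Rightarrow> 'a set. A \<subseteq> (\<Union>i. C i) \<and> (\<forall>i. bounded (C i) \<and> diameter (C i) \<le> \<delta>)}.
        \<Sum>i. ennreal (unit_ball_vol (real s) * (diameter (C i) / 2) ^ s))"

definition hausdorff_outer_measure :: "nat \<Rightarrow> 'a::euclidean_space set \<Rightarrow> ennreal" where
  "hausdorff_outer_measure s A = (SUP \<delta>\<in>{0<..}. hausdorff_premeasure s \<delta> A)"

definition surface_measure :: "'a::euclidean_space set \<Rightarrow> 'a measure" where
  "surface_measure S =
     restrict_space (measure_of UNIV (sets borel) (hausdorff_outer_measure (DIM('a) - 1))) S"

text \<open>\<open>w\<close> is the trace of \<open>l \<in> H\<^sup>1(D)\<close>: the graph of the trace operator is the closure, in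
  \<open>H\<^sup>1(D) \<times> L\<^sup>2(\<partial>D)\<close>, of the graph of the restriction map on smooth functions.\<close>

definition has_trace :: "'a::euclidean_space set \<Rightarrow> ('a \<Rightarrow> real) \<Rightarrow> ('a \<Rightarrow> real) \<Rightarrow> bool" where
  "has_trace D l w \<longleftrightarrow>
     l \<in> sobolev 1 D \<and> w \<in> borel_measurable (surface_measure (frontier D)) \<and>
     (\<exists>u. (\<forall>n. smooth (u n)) \<and>
          (\<lambda>n. Lnorm 2 D (\<lambda>x. u n x - l x)) \<longlonglongrightarrow> 0 \<and>
          (\<lambda>n. sobolev_seminorm 1 D (\<lambda>x. u n x - l x)) \<longlonglongrightarrow> 0 \<and>
          (\<lambda>n. \<integral>\<^sup>+x. ennreal ((u n x - w x)\<^sup>2) \<partial>surface_measure (frontier D)) \<longlonglongrightarrow> 0)"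

text \<open>\<open>H\<^sup>1\<^sup>/\<^sup>2(\<partial>D)\<close> as the range of the trace operator on \<open>H\<^sup>1(D)\<close>.\<close>

definition boundary_H_half :: "'a::euclidean_space set \<Rightarrow> ('a \<Rightarrow> real) set" where
  "boundary_H_half D = {w. \<exists>l. has_trace D l w}"

text \<open>\<open>F\<close> is the normal trace of \<open>v\<close>, as a functional on \<open>H\<^sup>1\<^sup>/\<^sup>2(\<partial>D)\<close>; any lifting \<open>l\<close> of \<open>w\<close>
  may be used to compute \<open>F w\<close>.\<close>

definition has_normal_trace ::
    "'a::euclidean_space set \<Rightarrow> ('a \<Rightarrow> 'a) \<Rightarrow> (('a \<Rightarrow> real) \<Rightarrow> real) \<Rightarrow> bool" where
  "has_normal_trace D v F \<longleftrightarrow>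
     (\<forall>w\<in>boundary_H_half D. \<forall>l. has_trace D l w \<longrightarrow>
        F w = (LINT x|lebesgue_on D. v x \<bullet> weak_grad D l x + weak_div D v x * l x))"


section \<open>Domains and meshes\<close>

text \<open>Near each boundary point \<open>D\<close> is the strict epigraph, in some direction \<open>e\<close>, of a Lipschitz
  function of the coordinates orthogonal to \<open>e\<close>.\<close>

definition lipschitz_boundary :: "'a::euclidean_space set \<Rightarrow> bool" where
  "lipschitz_boundary D \<longleftrightarrow>
     (\<forall>x\<in>frontier D. \<exists>\<rho>>0. \<exists>e L. \<exists>\<phi> :: 'a \<Rightarrow> real.
        norm e = 1 \<and> L-lipschitz_on {y. y \<bullet> e = 0} \<phi> \<and>
        (\<forall>y\<in>ball x \<rho>. y \<in> D \<longleftrightarrow> \<phi> (y - (y \<bullet> e) *\<^sub>R e) < y \<bullet> e))"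

definition polyhedral_lipschitz_domain :: "'a::euclidean_space set \<Rightarrow> bool" where
  "polyhedral_lipschitz_domain D \<longleftrightarrow>
     D \<noteq> {} \<and> open D \<and> bounded D \<and> connected D \<and> lipschitz_boundary D \<and>
     (\<exists>P. finite P \<and> (\<forall>p\<in>P. polytope p) \<and> closure D = \<Union>P)"

text \<open>\<^const>\<open>triangulation\<close> asks that any two cells meet in a common (possibly empty) face.\<close>

definition simplicial_mesh :: "'a::euclidean_space set \<Rightarrow> 'a set set \<Rightarrow> bool" where
  "simplicial_mesh D \<T> \<longleftrightarrow>
     triangulation \<T> \<and> (\<forall>K\<in>\<T>. int DIM('a) simplex K) \<and> \<Union>\<T> = closure D"

definition inball_diameter :: "'a::euclidean_space set \<Rightarrow> real" where
  "inball_diameter K = Sup {diameter (cball x \<rho>) |x \<rho>. \<rho> \<ge> 0 \<and> cball x \<rho> \<subseteq> K}"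

definition shape_regular_mesh_family ::
    "real \<Rightarrow> 'a::euclidean_space set \<Rightarrow> 'h set \<Rightarrow> ('h \<Rightarrow> 'a set set) \<Rightarrow> bool" where
  "shape_regular_mesh_family \<sigma> D H \<T> \<longleftrightarrow>
     (\<forall>h\<in>H. simplicial_mesh D (\<T> h) \<and> (\<forall>K\<in>\<T> h. diameter K / inball_diameter K \<le> \<sigma>))"


section \<open>Raviart--Thomas finite elements\<close>

definition multi_indices :: "nat \<Rightarrow> ('a::euclidean_space \<Rightarrow> nat) set" where
  "multi_indices k = {\<alpha>. (\<forall>b. b \<notin> Basis \<longrightarrow> \<alpha> b = 0) \<and> sum \<alpha> Basis \<le> k}"

definition polys :: "nat \<Rightarrow> ('a::euclidean_space \<Rightarrow> real) set" where
  "polys k = {p. \<exists>c. p = (\<lambda>x. \<Sum>\<alpha>\<in>multi_indices k. c \<alpha> * (\<Prod>b\<in>Basis. (x \<bullet> b) ^ \<alpha> b))}"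

definition RT_polys :: "nat \<Rightarrow> ('a::euclidean_space \<Rightarrow> 'a) set" where
  "RT_polys k = {\<lambda>x. p x + s x *\<^sub>R x |p s. (\<forall>b\<in>Basis. (\<lambda>x. p x \<bullet> b) \<in> polys k) \<and> s \<in> polys k}"

text \<open>The polynomial identity on each cell is only required almost everywhere: the tangential
  components of \<open>v\<close> are in general discontinuous across the common face of two closed cells.\<close>

definition RT_space :: "nat \<Rightarrow> 'a::euclidean_space set \<Rightarrow> 'a set set \<Rightarrow> ('a \<Rightarrow> 'a) set" where
  "RT_space k D \<T> =
     {v \<in> Hdiv 2 D. \<forall>K\<in>\<T>. \<exists>p\<in>RT_polys k. AE x in lebesgue_on K. v x = p x}"

definition RT_space0 :: "nat \<Rightarrow> 'a::euclidean_space set \<Rightarrow> 'a set set \<Rightarrow> ('a \<Rightarrow> 'a) set" where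
  "RT_space0 k D \<T> = {v \<in> RT_space k D \<T>. has_normal_trace D v (\<lambda>_. 0)}"

end

theory Submission
  imports Defs
begin

text \<open>
  Lowest-order elements suffice. On each cell \<open>K\<close> the field \<open>v\<close> is approximated by a constant \<open>a K\<close>
  with the help of a fractional Poincare inequality, and the piecewise constant field is corrected by
  Raviart--Thomas shape functions so that the normal fluxes match across the facets. The size of the
  correction is controlled by the jumps of the fluxes of the constants. Since \<open>v\<close> has a weak
  divergence, testing with a bump function \<open>\<phi>\<close> centered at the barycenter of a facet expresses the
  jump through \<open>\<integral> (a K - v) \<bullet> grad \<phi>\<close> and \<open>\<integral> div v \<phi>\<close> over the adjacent cells; no trace of \<open>v\<close> on the
  facet is needed, so that every \<open>r > 0\<close> is allowed.

  Surface integrals are avoided: the integral of \<open>u\<close> over the facet opposite to the vertex \<open>z\<close> is, up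
  to a factor, \<open>\<integral> (x - z) \<bullet> grad u + d u\<close> over \<open>K\<close>, which is the derivative of the integral of \<open>u\<close>
  over the dilations of \<open>K\<close> about \<open>z\<close>.
\<close>

section \<open>Smooth functions\<close>

text \<open>The scaling explains the weights. A bump of radius comparable to the mesh size h has a
  gradient of order 1/h, so a jump is at most of order |K|^(1/2)/h times the L2 error of the
  constants plus |K|^(1-1/q) times the L^q norm of the divergence. A shape function carrying this
  flux has L2 norm of order h |K|^(-1/2) times the jump, which leaves the L2 error itself and
  h^(1+d(1/2-1/q)) times the divergence norm. All constants are explicit expressions in d, \<sigma>
  and q, so that uniformity over domains, meshes and fields can be read off. A constant is itself a
  lowest-order Raviart-Thomas field, hence the correction merely alters coefficients. Two obstacles
  remain at the boundary. A bump centered at a boundary facet is no test function on D, and cells on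
  the far side of the facet may reach into its support; it is cut off there, at no cost in the
  estimate. And a vanishing normal trace has to be tested with all liftings in H^1; it is shown for
  smooth functions and extended by density.\<close>

definition flat :: "nat \<Rightarrow> real \<Rightarrow> real" where
  "flat k t = (if t \<le> 0 then 0 else exp (- inverse t) * inverse t ^ k)"

lemma flat_nonneg: "0 \<le> flat k t"
  by (simp add: flat_def)

lemma flat_pos: "0 < t \<Longrightarrow> 0 < flat k t"
  by (simp add: flat_def)

lemma flat_eq_0: "t \<le> 0 \<Longrightarrow> flat k t = 0"
  by (simp add: flat_def)

lemma flat_0_le_1: "flat 0 t \<le> 1"
  by (simp add: flat_def)

lemma flat_tendsto_0: "(flat k \<longlongrightarrow> 0) (at 0)"
proof -
  have "((\<lambda>x. x ^ k / exp x) \<longlongrightarrow> (0::real)) at_top"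
    by (rule tendsto_power_div_exp_0)
  then have "((\<lambda>t. inverse t ^ k / exp (inverse t)) \<longlongrightarrow> (0::real)) (at_right 0)"
    by (rule filterlim_compose[OF _ filterlim_inverse_at_top_right])
  then have "(flat k \<longlongrightarrow> 0) (at_right 0)"
    by (rule Lim_transform_eventually)
      (auto simp: flat_def eventually_at_right_field exp_minus field_simps intro!: exI[of _ 1])
  moreover have "(flat k \<longlongrightarrow> 0) (at_left 0)"
    by (rule Lim_transform_eventually[OF tendsto_const])
      (auto simp: flat_def eventually_at_left_field intro!: exI[of _ "-1"])
  ultimately show ?thesis
    by (simp add: filterlim_split_at)
qed

text \<open>Each derivative is again a linear combination of members of the family; the power of 1/t
  is a parameter for exactly this reason.\<close>

lemma flat_has_real_derivative:
  "(flat k has_real_derivative (flat (k + 2) t - real k * flat (k + 1) t)) (at t)"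
proof -
  consider "t < 0" | "t > 0" | "t = 0" by linarith
  then show ?thesis
  proof cases
    case 1
    have "((\<lambda>t. 0) has_real_derivative 0) (at t)" by simp
    then have "(flat k has_real_derivative 0) (at t)"
      by (rule has_field_derivative_transform_within_open[where S="{..<0}"])
        (use 1 in \<open>auto simp: flat_def\<close>)
    then show ?thesis using 1 by (simp add: flat_def)
  next
    case 2
    have "((\<lambda>t. exp (- inverse t) * inverse t ^ k) has_real_derivative
        (flat (k + 2) t - real k * flat (k + 1) t)) (at t)"
      using 2
      by (auto intro!: derivative_eq_intros simp: flat_def power2_eq_square)
        (cases k; simp add: field_simps)
    then show ?thesis
      by (rule has_field_derivative_transform_within_open[where S="{0<..}"])
        (use 2 in \<open>auto simp: flat_def\<close>)
  next
    case 3
    \<comment> \<open>Division by \<open>h\<close> raises the index by one, so the difference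
      quotient at 0 is \<open>flat (Suc k)\<close>, whose limit is known.\<close>
    have "((\<lambda>h. (flat k (0 + h) - flat k 0) / h) \<longlongrightarrow> 0) (at 0)"
      by (rule Lim_transform_eventually[OF flat_tendsto_0[of "Suc k"]])
        (auto simp: flat_def field_simps)
    then show ?thesis using 3 by (simp add: flat_def has_field_derivative_iff)
  qed
qed

text \<open>\<open>smooth\<close> speaks about all iterated partial derivatives at once. A syntactic
  class that is closed under directional derivatives reduces it to a single structural induction.
  Every bump, cut-off and box approximation below is built from these constructors;
  \<open>flat\<close> supplies the compact supports.\<close>

inductive_set elementary :: "('a::euclidean_space \<Rightarrow> real) set" where
  const: "(\<lambda>_. c) \<in> elementary"
| inner: "(\<lambda>x. x \<bullet> a) \<in> elementary"
| add: "f \<in> elementary \<Longrightarrow> g \<in> elementary \<Longrightarrow> (\<lambda>x. f x + g x) \<in> elementary"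
| mult: "f \<in> elementary \<Longrightarrow> g \<in> elementary \<Longrightarrow> (\<lambda>x. f x * g x) \<in> elementary"
| inverse: "f \<in> elementary \<Longrightarrow> (\<And>x. f x \<noteq> 0) \<Longrightarrow> (\<lambda>x. inverse (f x)) \<in> elementary"
| flat: "f \<in> elementary \<Longrightarrow> (\<lambda>x. flat k (f x)) \<in> elementary"

lemma elementary_minus: "f \<in> elementary \<Longrightarrow> (\<lambda>x. - f x) \<in> elementary"
  using elementary.mult[OF elementary.const[of "-1"], of f] by simp

lemma elementary_diff: "f \<in> elementary \<Longrightarrow> g \<in> elementary \<Longrightarrow> (\<lambda>x. f x - g x) \<in> elementary"
  using elementary.add[OF _ elementary_minus, of f g] by simp

lemma elementary_sum: "(\<And>i. i \<in> I \<Longrightarrow> f i \<in> elementary) \<Longrightarrow> (\<lambda>x. \<Sum>i\<in>I. f i x) \<in> elementary"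
  by (induction I rule: infinite_finite_induct) (auto intro: elementary.intros)

lemma elementary_prod: "(\<And>i. i \<in> I \<Longrightarrow> f i \<in> elementary) \<Longrightarrow> (\<lambda>x. \<Prod>i\<in>I. f i x) \<in> elementary"
  by (induction I rule: infinite_finite_induct) (auto intro: elementary.intros)

lemma elementary_norm_sq: "(\<lambda>x::'a::euclidean_space. (norm (x - a))\<^sup>2) \<in> elementary"
proof -
  have "(\<lambda>x::'a. \<Sum>b\<in>Basis. (x \<bullet> b - a \<bullet> b) * (x \<bullet> b - a \<bullet> b)) \<in> elementary"
    by (intro elementary_sum elementary.mult elementary_diff elementary.inner elementary.const)
  then show ?thesis
    unfolding power2_norm_eq_inner euclidean_inner[of "_ - a" "_ - a"]
    by (simp add: inner_diff_left)
qed

lemma elementary_derivative: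
  assumes "f \<in> elementary"
  shows "\<exists>f'. (\<forall>x. (f has_derivative f' x) (at x)) \<and> (\<forall>b. (\<lambda>x. f' x b) \<in> elementary)"
  using assms
proof induction
  case (const c)
  show ?case by (auto intro!: exI[of _ "\<lambda>_ _. 0"] elementary.const)
next
  case (inner a)
  show ?case
    by (auto intro!: exI[of _ "\<lambda>_ h. h \<bullet> a"] elementary.const derivative_eq_intros)
next
  case (add f g)
  then obtain f' g' where "\<forall>x. (f has_derivative f' x) (at x)" "\<forall>b. (\<lambda>x. f' x b) \<in> elementary"
    "\<forall>x. (g has_derivative g' x) (at x)" "\<forall>b. (\<lambda>x. g' x b) \<in> elementary" by blast
  then show ?case
    by (intro exI[of _ "\<lambda>x h. f' x h + g' x h"]) (auto intro!: elementary.add has_derivative_add)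
next
  case (mult f g)
  then obtain f' g' where "\<forall>x. (f has_derivative f' x) (at x)" "\<forall>b. (\<lambda>x. f' x b) \<in> elementary"
    "\<forall>x. (g has_derivative g' x) (at x)" "\<forall>b. (\<lambda>x. g' x b) \<in> elementary" by blast
  with mult show ?case
    by (intro exI[of _ "\<lambda>x h. f x * g' x h + f' x h * g x"])
      (auto intro!: elementary.add elementary.mult has_derivative_mult)
next
  case (inverse f)
  then obtain f' where "\<forall>x. (f has_derivative f' x) (at x)" "\<forall>b. (\<lambda>x. f' x b) \<in> elementary" by blast
  with inverse show ?case
    by (intro exI[of _ "\<lambda>x h. - (inverse (f x) * f' x h * inverse (f x))"])
      (auto intro!: elementary_minus elementary.mult elementary.inverse has_derivative_inverse)
next
  case (flat f k)
  then obtain f' where f': "\<And>x. (f has_derivative f' x) (at x)" "\<forall>b. (\<lambda>x. f' x b) \<in> elementary" by blast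
  have "((\<lambda>x. flat k (f x)) has_derivative
      (\<lambda>h. (flat (k + 2) (f x) - real k * flat (k + 1) (f x)) * f' x h)) (at x)" for x
    using has_derivative_compose[OF f'(1)
        flat_has_real_derivative[of k "f x", unfolded has_field_derivative_def]]
    by simp
  with flat f'(2) show ?case
    by (intro exI[of _ "\<lambda>x h. (flat (k + 2) (f x) - real k * flat (k + 1) (f x)) * f' x h"])
      (auto intro!: elementary_diff elementary.mult elementary.flat elementary.const)
qed

lemma elementary_smooth:
  assumes "f \<in> elementary"
  shows "smooth f"
proof -
  have "iterated_deriv bs f \<in> elementary" for bs
  proof (induction bs)
    case (Cons b bs)
    then obtain f' where f': "\<And>x. (iterated_deriv bs f has_derivative f' x) (at x)"
      "\<forall>b. (\<lambda>x. f' x b) \<in> elementary" using elementary_derivative by blast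
    have "frechet_derivative (iterated_deriv bs f) (at x) = f' x" for x
      using frechet_derivative_at[OF f'(1)] by simp
    with f'(2) show ?case by simp
  qed (use assms in simp)
  then show ?thesis
    unfolding smooth_def using elementary_derivative differentiable_def by blast
qed

lemma smooth_has_derivative:
  fixes u :: "'a::euclidean_space \<Rightarrow> real"
  assumes "smooth u"
  shows "(u has_derivative (\<lambda>h. grad u x \<bullet> h)) (at x)"
proof -
  have "u differentiable (at x)"
    using assms unfolding smooth_def by (force dest: spec[of _ "[]"])
  then have D: "(u has_derivative frechet_derivative u (at x)) (at x)"
    using frechet_derivative_works by blast
  interpret l: linear "frechet_derivative u (at x)"
    using D has_derivative_linear by blast
  have "frechet_derivative u (at x) h = grad u x \<bullet> h" for h
  proof -
    have "frechet_derivative u (at x) (\<Sum>b\<in>Basis. (h \<bullet> b) *\<^sub>R b) = grad u x \<bullet> h"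
      by (simp add: grad_def l.sum l.scaleR inner_sum_left)
        (rule sum.cong, auto simp: inner_commute)
    then show ?thesis by (simp add: euclidean_representation)
  qed
  then have "frechet_derivative u (at x) = (\<lambda>h. grad u x \<bullet> h)" by blast
  with D show ?thesis by metis
qed

lemma grad_unique:
  assumes "(u has_derivative (\<lambda>h. g \<bullet> h)) (at x)"
  shows "grad u x = g"
  by (simp add: grad_def flip: frechet_derivative_at[OF assms]) (simp add: euclidean_representation)

lemma continuous_on_grad:
  assumes "smooth u"
  shows "continuous_on S (grad u)"
proof -
  have "continuous_on S (\<lambda>x. frechet_derivative u (at x) b)" if "b \<in> Basis" for b
  proof -
    have "iterated_deriv [b] u differentiable (at x)" for x
      using assms that unfolding smooth_def by (metis empty_set empty_subsetI insert_subset list.simps(15))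
    then show ?thesis
      by (auto intro!: continuous_at_imp_continuous_on differentiable_imp_continuous_within)
  qed
  then show ?thesis
    unfolding grad_def by (intro continuous_intros)
qed

lemma continuous_on_smooth: "smooth u \<Longrightarrow> continuous_on S u"
  by (meson continuous_at_imp_continuous_on has_derivative_continuous smooth_has_derivative)

text \<open>The test functions in the definition of weak derivatives are arbitrary smooth functions,
  not only \<open>elementary\<close> ones, hence the induction over iterated derivatives. Shifted
  test functions occur in \<open>weak_increment\<close>.\<close>

lemma smooth_translate:
  assumes "smooth u"
  shows "smooth (\<lambda>x. u (x + a))" and "grad (\<lambda>x. u (x + a)) x = grad u (x + a)"
proof -
  have frechet_translate: "frechet_derivative (\<lambda>x. f (x + a)) (at x) = frechet_derivative f (at (x + a))"
    if "f differentiable (at (x + a))" for f :: "'a \<Rightarrow> real" and x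
  proof -
    have "((\<lambda>x. f (x + a)) has_derivative (\<lambda>h. frechet_derivative f (at (x + a)) h)) (at x)"
      by (rule has_derivative_compose[where f="\<lambda>x. x + a"])
        (use that frechet_derivative_works in \<open>auto intro!: derivative_eq_intros\<close>)
    then show ?thesis using frechet_derivative_at by metis
  qed
  have *: "iterated_deriv bs (\<lambda>x. u (x + a)) = (\<lambda>x. iterated_deriv bs u (x + a))" if "set bs \<subseteq> Basis" for bs
    using that
  proof (induction bs)
    case (Cons b bs)
    then have "iterated_deriv bs u differentiable (at x)" for x
      using assms by (auto simp: smooth_def)
    with Cons show ?case by (auto simp: frechet_translate)
  qed simp
  show "smooth (\<lambda>x. u (x + a))"
    unfolding smooth_def
  proof (intro allI impI)
    fix bs :: "'a list" and x
    assume bs: "set bs \<subseteq> Basis"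
    then have "iterated_deriv bs u differentiable (at (x + a))"
      using assms by (auto simp: smooth_def)
    then have "(iterated_deriv bs u \<circ> (\<lambda>x. x + a)) differentiable (at x)"
      by (intro differentiable_chain_at derivative_intros)
    then show "iterated_deriv bs (\<lambda>x. u (x + a)) differentiable (at x)"
      by (simp add: *[OF bs] comp_def)
  qed
  have "u differentiable (at (x + a))"
    using assms unfolding smooth_def by (force dest: spec[of _ "[]"])
  then show "grad (\<lambda>x. u (x + a)) x = grad u (x + a)"
    by (simp add: grad_def frechet_translate)
qed

section \<open>Changes of variables\<close>

text \<open>Uniqueness of translation-invariant measures, by Weil's argument: computing
  \<open>\<integral>\<integral> 1\<^sub>A(x) 1\<^sub>B(y - x)\<close> in both orders shows that \<open>\<mu>(A) \<lambda>(B) = \<lambda>(A) \<mu>(-B)\<close>.\<close>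

lemma translation_invariant_measure:
  fixes M :: "'a::euclidean_space measure"
  assumes sets: "sets M = sets borel" and "sigma_finite_measure M"
    and trans: "\<And>a A. A \<in> sets borel \<Longrightarrow> emeasure M ((\<lambda>x. x + a) ` A) = emeasure M A"
    and A: "A \<in> sets borel" and B: "B \<in> sets borel"
  shows "emeasure M A * emeasure lborel B = emeasure lborel A * emeasure M (uminus ` B)"
proof -
  interpret M: sigma_finite_measure M by fact
  interpret P: pair_sigma_finite M "lborel :: 'a measure" ..
  have [measurable_cong]: "sets M = sets borel" by fact
  have [measurable]: "A \<in> sets borel" "B \<in> sets borel" by fact+
  have vimage_image: "(\<lambda>y. y + - x) -` S = (\<lambda>y. y + x) ` S" for x :: 'a and S
    by (force simp: image_iff)
  have borel_image: "(\<lambda>y. y + x) ` S \<in> sets borel" if "S \<in> sets borel" for x :: 'a and S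
    unfolding vimage_image[symmetric] using that by (intro measurable_sets_borel[of _ borel]) auto
  have um: "uminus ` B = uminus -` B" by (force simp: image_iff)
  have um_borel: "uminus ` B \<in> sets borel"
    unfolding um by (rule measurable_sets_borel[of _ borel]) auto
  have lb: "emeasure lborel ((\<lambda>y. y + x) ` S) = emeasure lborel S" if "S \<in> sets borel" for x :: 'a and S
  proof -
    have "emeasure lborel S = emeasure (distr lborel borel ((+) (- x))) S"
      by (simp only: lborel_distr_plus)
    also have "\<dots> = emeasure lborel ((\<lambda>y. y + - x) -` S)"
    proof -
      have "(+) (- x) -` S = (\<lambda>y. y + - x) -` S" by auto
      then show ?thesis using that by (simp add: emeasure_distr)
    qed
    finally show ?thesis by (simp only: vimage_image)
  qed
  have "emeasure M A * emeasure lborel B = (\<integral>\<^sup>+x. (\<integral>\<^sup>+y. indicator A x * indicator B (y - x) \<partial>lborel) \<partial>M)"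
  proof -
    have "(\<integral>\<^sup>+y. indicator A x * indicator B (y - x) \<partial>lborel) = indicator A x * emeasure lborel B" for x
    proof -
      have "(\<integral>\<^sup>+y. indicator B (y - x) \<partial>lborel) = (\<integral>\<^sup>+y. indicator ((\<lambda>y. y + x) ` B) y \<partial>lborel)"
        by (rule nn_integral_cong) (auto simp: indicator_def image_iff algebra_simps)
      also have "\<dots> = emeasure lborel B"
        using lb[OF B] borel_image[OF B] by simp
      finally show ?thesis by (simp add: nn_integral_cmult)
    qed
    then show ?thesis using A by (simp add: nn_integral_multc sets)
  qed
  also have "\<dots> = (\<integral>\<^sup>+y. (\<integral>\<^sup>+x. indicator A x * indicator B (y - x) \<partial>M) \<partial>lborel)"
    by (rule P.Fubini'[symmetric]) measurable
  also have "\<dots> = (\<integral>\<^sup>+y. (\<integral>\<^sup>+x. indicator A (x + y) * indicator (uminus ` B) x \<partial>M) \<partial>lborel)"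
  proof (rule nn_integral_cong)
    fix y :: 'a
    have "(\<integral>\<^sup>+x. indicator A x * indicator B (y - x) \<partial>M)
        = emeasure M (A \<inter> (\<lambda>x. x + y) ` (uminus ` B))"
    proof -
      have "(\<integral>\<^sup>+x. indicator A x * indicator B (y - x) \<partial>M)
          = (\<integral>\<^sup>+x. indicator (A \<inter> (\<lambda>x. x + y) ` (uminus ` B)) x \<partial>M)"
        by (rule nn_integral_cong) (auto simp: indicator_def image_iff algebra_simps)
      then show ?thesis using A borel_image[OF um_borel, of y] by (simp add: sets)
    qed
    also have "A \<inter> (\<lambda>x. x + y) ` (uminus ` B) = (\<lambda>x. x + y) ` ((\<lambda>x. x + - y) ` A \<inter> uminus ` B)"
      by (subst image_Int) (simp_all add: inj_def image_image)
    also have "emeasure M \<dots> = emeasure M ((\<lambda>x. x + - y) ` A \<inter> uminus ` B)"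
      using borel_image[OF A, of "-y"] um_borel by (intro trans) auto
    also have "\<dots> = (\<integral>\<^sup>+x. indicator ((\<lambda>x. x + - y) ` A \<inter> uminus ` B) x \<partial>M)"
      using borel_image[OF A, of "-y"] um_borel by (simp add: sets)
    also have "\<dots> = (\<integral>\<^sup>+x. indicator A (x + y) * indicator (uminus ` B) x \<partial>M)"
      by (rule nn_integral_cong) (auto simp: indicator_def image_iff algebra_simps)
    finally show "(\<integral>\<^sup>+x. indicator A x * indicator B (y - x) \<partial>M) = \<dots>" .
  qed
  also have "\<dots> = (\<integral>\<^sup>+x. (\<integral>\<^sup>+y. indicator A (x + y) * indicator (uminus ` B) x \<partial>lborel) \<partial>M)"
  proof (rule P.Fubini')
    define B' where "B' = uminus ` B"
    have [measurable]: "B' \<in> sets borel" using um_borel by (simp add: B'_def)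
    show "(\<lambda>(x, y). indicator A (x + y) * indicator (uminus ` B) x :: ennreal) \<in> borel_measurable (M \<Otimes>\<^sub>M lborel)"
      unfolding B'_def[symmetric] by measurable
  qed
  also have "\<dots> = (\<integral>\<^sup>+x. emeasure lborel A * indicator (uminus ` B) x \<partial>M)"
  proof (rule nn_integral_cong)
    fix x :: 'a
    have "(\<integral>\<^sup>+y. indicator A (x + y) \<partial>lborel) = (\<integral>\<^sup>+y. indicator ((\<lambda>y. y + - x) ` A) y \<partial>lborel)"
      by (rule nn_integral_cong) (auto simp: indicator_def image_iff algebra_simps)
    also have "\<dots> = emeasure lborel A"
      by (subst nn_integral_indicator) (use borel_image[OF A, of "- x"] lb[OF A, of "- x"] in simp_all)
    finally show "(\<integral>\<^sup>+y. indicator A (x + y) * indicator (uminus ` B) x \<partial>lborel)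
        = emeasure lborel A * indicator (uminus ` B) x"
      by (simp add: nn_integral_multc)
  qed
  also have "\<dots> = emeasure lborel A * emeasure M (uminus ` B)"
    using um_borel by (simp add: sets nn_integral_cmult)
  finally show ?thesis .
qed

lemma distr_linear_lborel:
  fixes f :: "'a::euclidean_space \<Rightarrow> 'a"
  assumes "linear f" "bij f"
  obtains c where "distr lborel borel f = density lborel (\<lambda>_. ennreal c)" "0 < c"
proof -
  define g where "g = inv f"
  have lg: "linear g"
    unfolding g_def using assms by (simp add: bij_is_inj inj_linear_imp_inv_linear)
  have fg: "f (g x) = x" "g (f x) = x" for x
    using assms by (auto simp: g_def bij_is_surj surj_f_inv_f bij_is_inj)
  have [measurable]: "f \<in> borel_measurable borel" "g \<in> borel_measurable borel"
    using assms(1) lg by (auto intro!: borel_measurable_continuous_onI linear_continuous_on simp: linear_conv_bounded_linear)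
  define M where "M = distr lborel borel f"
  have sets: "sets M = sets borel" by (simp add: M_def)
  have em: "emeasure M A = emeasure lborel (f -` A)" if "A \<in> sets borel" for A
    using that by (simp add: M_def emeasure_distr)
  have vi: "f -` A = g ` A" for A by (auto simp: fg image_iff intro!: bexI[of _ "f _"])
  have bounded: "emeasure M A < \<infinity>" if "A \<in> sets borel" "bounded A" for A
  proof -
    have "bounded (g ` A)"
      using that lg by (simp add: bounded_linear_image linear_conv_bounded_linear)
    then show ?thesis using emeasure_bounded_finite[of "g ` A"] that by (simp add: em vi)
  qed
  have sf: "sigma_finite_measure M"
  proof
    show "\<exists>A. countable A \<and> A \<subseteq> sets M \<and> \<Union>A = space M \<and> (\<forall>a\<in>A. emeasure M a \<noteq> \<infinity>)"
      by (intro exI[of _ "range (\<lambda>n::nat. ball 0 (real n))"])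
        (use bounded reals_Archimedean2 in \<open>auto simp: M_def order.strict_iff_order\<close>)
  qed
  have trans: "emeasure M ((\<lambda>x. x + a) ` A) = emeasure M A" if A: "A \<in> sets borel" for a A
  proof -
    have *: "(\<lambda>x. x + a) ` A = (\<lambda>x. x + - a) -` A" by (force simp: image_iff)
    have bor: "(\<lambda>x. x + a) ` A \<in> sets borel"
      unfolding * using that by (intro measurable_sets_borel[of _ borel]) auto
    have "f -` (\<lambda>x. x + a) ` A = (\<lambda>y. - g a + y) -` (f -` A)"
    proof -
      have "f (x - g a) = f x - a" for x
        by (simp add: linear_diff[OF assms(1)] fg)
      then show ?thesis by (auto simp: image_iff intro!: bexI[of _ "f _ - a"])
    qed
    moreover have "f -` A \<in> sets borel" by (rule measurable_sets_borel[OF _ A]) auto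
    moreover have "emeasure lborel ((+) (- g a) -` S) = emeasure lborel S" if "S \<in> sets borel" for S
      using that lborel_distr_plus[of "- g a"] emeasure_distr[of "(+) (- g a)" lborel borel S] by simp
    moreover have "(+) (- g a) = (\<lambda>y. - g a + y)" by auto
    ultimately show ?thesis
      using that bor by (simp add: em)
  qed
  \<comment> \<open>The ball is symmetric, so the reflected set in the invariance identity is the
    ball itself, and it has a finite positive volume by which to divide.\<close>
  define B :: "'a set" where "B = ball 0 1"
  have B: "B \<in> sets borel" and "uminus ` B = B" by (auto simp: B_def image_iff intro!: bexI[of _ "- _"])
  define \<beta> where "\<beta> = measure lborel B"
  have \<beta>: "emeasure lborel B = ennreal \<beta>" "0 < \<beta>"
    using emeasure_bounded_finite[of "ball (0::'a) 1"]
    by (auto simp: \<beta>_def B_def less_top content_ball_pos intro!: emeasure_eq_ennreal_measure)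
  define \<mu> where "\<mu> = enn2real (emeasure M B)"
  have \<mu>: "emeasure M B = ennreal \<mu>" "0 \<le> \<mu>"
    using bounded[OF B] by (auto simp: \<mu>_def B_def less_top)
  have key: "emeasure M A = ennreal (\<mu> / \<beta>) * emeasure lborel A" if "A \<in> sets borel" for A
  proof -
    have "emeasure M A * ennreal \<beta> = emeasure lborel A * ennreal \<mu>"
      using translation_invariant_measure[OF sets sf trans that B] \<beta> \<mu> \<open>uminus ` B = B\<close> by simp
    then have "ennreal (1 / \<beta>) * ennreal \<beta> * emeasure M A = ennreal (1 / \<beta>) * ennreal \<mu> * emeasure lborel A"
      by (simp add: mult.assoc) (simp add: mult.commute)
    moreover have "ennreal (1 / \<beta>) * ennreal \<beta> = 1" "ennreal (1 / \<beta>) * ennreal \<mu> = ennreal (\<mu> / \<beta>)"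
      using \<beta>(2) \<mu>(2) by (simp_all flip: ennreal_mult)
    ultimately show ?thesis by simp
  qed
  have eq: "M = density lborel (\<lambda>_. ennreal (\<mu> / \<beta>))"
    by (rule measure_eqI) (auto simp: sets emeasure_density nn_integral_cmult key)
  moreover have "\<mu> \<noteq> 0"
  proof
    assume "\<mu> = 0"
    then have "emeasure M UNIV = 0" by (simp add: key)
    then show False by (simp add: em)
  qed
  ultimately show ?thesis
    using that[of "\<mu> / \<beta>"] \<beta> \<mu> by (auto simp: M_def)
qed

text \<open>A single factor serves all sets and integrands, so it can be identified afterwards from
  the integrand 1.\<close>

lemma integral_affine_image:
  fixes T :: "'a::euclidean_space \<Rightarrow> 'a" and G :: "'a \<Rightarrow> real"
  assumes "linear f" "bij f" and T: "\<And>x. T x = f x + t"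
  obtains c where "0 < c"
    and "\<And>K (G :: 'a \<Rightarrow> real). K \<in> sets borel \<Longrightarrow> T ` K \<in> sets borel \<Longrightarrow> G \<in> borel_measurable borel \<Longrightarrow>
          (LINT x:K|lborel. G (T x)) = c * (LINT y:T ` K|lborel. G y)"
proof -
  obtain c where c: "distr lborel borel f = density lborel (\<lambda>_. ennreal c)" "0 < c"
    using distr_linear_lborel[OF assms(1,2)] by blast
  have [measurable]: "f \<in> borel_measurable borel"
    using assms(1) by (auto intro!: borel_measurable_continuous_onI linear_continuous_on simp: linear_conv_bounded_linear)
  have injT: "inj T" using assms(2) by (auto simp: T inj_def bij_def)
  show ?thesis
  proof (rule that[OF c(2)])
    fix K and G :: "'a \<Rightarrow> real"
    assume [measurable]: "K \<in> sets borel" "T ` K \<in> sets borel" "G \<in> borel_measurable borel"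
    let ?H = "\<lambda>y. indicator (T ` K) y *\<^sub>R G y"
    have "(LINT x:K|lborel. G (T x)) = (LINT x|lborel. ?H (f x + t))"
      unfolding set_lebesgue_integral_def
      by (intro Bochner_Integration.integral_cong) (auto simp: indicator_def T[symmetric] inj_eq[OF injT])
    also have "\<dots> = (LINT y|distr lborel borel f. ?H (y + t))"
      by (subst integral_distr) auto
    also have "\<dots> = c * (LINT y|lborel. ?H (y + t))"
      using c(2) by (simp add: c(1) integral_density)
    also have "(LINT y|lborel. ?H (y + t)) = (LINT y|distr lborel borel ((+) t). ?H y)"
      by (subst integral_distr) (auto simp: add.commute)
    also have "distr lborel borel ((+) t) = (lborel :: 'a measure)"
      by (rule lborel_distr_plus)
    finally show "(LINT x:K|lborel. G (T x)) = c * (LINT y:T ` K|lborel. G y)"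
      by (simp add: set_lebesgue_integral_def)
  qed
qed

text \<open>The factor is explicit here because it is differentiated with respect to
  \<open>t\<close> in \<open>cone_flux_as_limit\<close>.\<close>

lemma integral_dilation:
  fixes z :: "'a::euclidean_space" and G :: "'a \<Rightarrow> real"
  assumes "0 < t" and [measurable]: "K \<in> sets borel" "(\<lambda>x. z + t *\<^sub>R (x - z)) ` K \<in> sets borel" "G \<in> borel_measurable borel"
  shows "(LINT y:(\<lambda>x. z + t *\<^sub>R (x - z)) ` K|lborel. G y) = t ^ DIM('a) * (LINT x:K|lborel. G (z + t *\<^sub>R (x - z)))"
proof -
  let ?T = "\<lambda>x. z + t *\<^sub>R (x - z)"
  have T: "?T x = (z - t *\<^sub>R z) + t *\<^sub>R x" for x by (simp add: algebra_simps)
  have [measurable]: "(\<lambda>x. z - t *\<^sub>R z + t *\<^sub>R x) ` K \<in> sets borel"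
    using assms(3) by (simp add: T)
  have inj: "inj ?T" using assms(1) by (auto simp: inj_def)
  let ?H = "\<lambda>y. indicator (?T ` K) y *\<^sub>R G y"
  have "(LINT y|lborel. ?H y) = (LINT y|density (distr lborel borel (\<lambda>x. (z - t *\<^sub>R z) + t *\<^sub>R x)) (\<lambda>_. \<bar>t\<bar> ^ DIM('a)). ?H y)"
    using lborel_affine[of t "z - t *\<^sub>R z"] assms(1) by simp
  also have "\<dots> = (LINT y|distr lborel borel (\<lambda>x. (z - t *\<^sub>R z) + t *\<^sub>R x). \<bar>t\<bar> ^ DIM('a) * ?H y)"
    by (subst integral_density) auto
  also have "\<dots> = (LINT x|lborel. t ^ DIM('a) * ?H (?T x))"
    using assms(1) by (subst integral_distr) (auto simp: T)
  also have "\<dots> = (LINT x|lborel. t ^ DIM('a) * (indicator K x *\<^sub>R G (?T x)))"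
    by (intro Bochner_Integration.integral_cong) (auto simp: indicator_def inj_eq[OF inj] image_iff assms(1)[THEN less_imp_neq, symmetric])
  finally show ?thesis by (simp add: set_lebesgue_integral_def)
qed

section \<open>The fundamental lemma of the calculus of variations\<close>

text \<open>The positive and the negative part of \<open>g\<close> are densities of two finite
  measures that agree on boxes, an intersection-stable generator of the Borel sets. Hence the
  measures agree, and so do their densities almost everywhere.\<close>

lemma AE_zero_if_box_integrals_zero:
  fixes g :: "'a::euclidean_space \<Rightarrow> real"
  assumes g: "integrable lborel g" and 0: "\<And>a b. (LINT x:box a b|lborel. g x) = 0"
  shows "AE x in lborel. g x = 0"
proof -
  note [measurable] = borel_measurable_integrable[OF g]
  let ?p = "\<lambda>x. ennreal (g x)" and ?n = "\<lambda>x. ennreal (- g x)"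
  have fin: "integral\<^sup>N lborel ?p \<noteq> \<infinity>" "integral\<^sup>N lborel ?n \<noteq> \<infinity>"
    using g by (auto simp: real_integrable_def)
  have "density lborel ?p = density lborel ?n"
  proof (rule measure_eqI_generator_eq)
    show "Int_stable (range (\<lambda>(a, b). box a b :: 'a set))"
      by (auto simp: Int_stable_def box_Int_box)
    show "emeasure (density lborel ?p) X = emeasure (density lborel ?n) X"
      if X: "X \<in> range (\<lambda>(a, b). box a b)" for X
    proof -
      obtain a b where X: "X = box a b" using X by auto
      let ?G = "\<lambda>x. indicator X x *\<^sub>R g x"
      have int: "integrable lborel ?G" by (intro integrable_mult_indicator g) (simp add: X)
      then have "(LINT x|lborel. ?G x) = enn2real (\<integral>\<^sup>+x. ennreal (?G x) \<partial>lborel) - enn2real (\<integral>\<^sup>+x. ennreal (- ?G x) \<partial>lborel)"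
        by (rule real_lebesgue_integral_def)
      moreover have "(LINT x|lborel. ?G x) = 0" using 0[of a b] by (simp add: X set_lebesgue_integral_def)
      moreover have "(\<integral>\<^sup>+x. ennreal (?G x) \<partial>lborel) \<noteq> \<infinity>" "(\<integral>\<^sup>+x. ennreal (- ?G x) \<partial>lborel) \<noteq> \<infinity>"
        using int by (auto simp: real_integrable_def)
      ultimately have "enn2real (\<integral>\<^sup>+x. ennreal (?G x) \<partial>lborel) = enn2real (\<integral>\<^sup>+x. ennreal (- ?G x) \<partial>lborel)"
        "(\<integral>\<^sup>+x. ennreal (?G x) \<partial>lborel) < top" "(\<integral>\<^sup>+x. ennreal (- ?G x) \<partial>lborel) < top"
        by (auto simp: less_top)
      then have "(\<integral>\<^sup>+x. ennreal (?G x) \<partial>lborel) = (\<integral>\<^sup>+x. ennreal (- ?G x) \<partial>lborel)"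
        using ennreal_enn2real by metis
      moreover have "emeasure (density lborel ?p) X = (\<integral>\<^sup>+x. ennreal (?G x) \<partial>lborel)"
        by (simp add: emeasure_density X) (auto intro!: nn_integral_cong simp: indicator_def)
      moreover have "emeasure (density lborel ?n) X = (\<integral>\<^sup>+x. ennreal (- ?G x) \<partial>lborel)"
        by (simp add: emeasure_density X) (auto intro!: nn_integral_cong simp: indicator_def)
      ultimately show ?thesis by simp
    qed
    show "sets (density lborel ?p) = sigma_sets UNIV (range (\<lambda>(a, b). box a b))"
      "sets (density lborel ?n) = sigma_sets UNIV (range (\<lambda>(a, b). box a b))"
      by (simp_all add: borel_eq_box)
    show "range (\<lambda>n. box (- (real n *\<^sub>R One)) (real n *\<^sub>R One)) \<subseteq> range (\<lambda>(a, b). box a b :: 'a set)" by auto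
    show "(\<Union>n. box (- (real n *\<^sub>R One)) (real n *\<^sub>R One) :: 'a set) = UNIV"
      by (rule UN_box_eq_UNIV)
    show "emeasure (density lborel ?p) (box (- (real n *\<^sub>R One)) (real n *\<^sub>R One)) \<noteq> \<infinity>" for n
    proof -
      have "emeasure (density lborel ?p) (box (- (real n *\<^sub>R One)) (real n *\<^sub>R One)) \<le> integral\<^sup>N lborel ?p"
        by (simp add: emeasure_density) (intro nn_integral_mono, auto simp: indicator_def)
      then show ?thesis using fin(1) by (auto simp: top_unique)
    qed
  qed auto
  then have "AE x in lborel. ?p x = ?n x"
    using fin by (subst (asm) finite_density_unique) auto
  then show ?thesis
    by eventually_elim (metis abs_le_zero_iff abs_real_def ennreal_eq_0_iff ennreal_inj linorder_le_cases neg_0_le_iff_le neg_le_0_iff_le)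
qed

lemma flat_0_tendsto_1:
  assumes "0 < t"
  shows "(\<lambda>n. flat 0 (real n * t)) \<longlonglongrightarrow> 1"
proof -
  have "(\<lambda>n. exp (- inverse (real n * t))) \<longlonglongrightarrow> exp (- 0)"
    using assms by (intro tendsto_intros tendsto_inverse_0_at_top filterlim_tendsto_pos_mult_at_top[OF tendsto_const]
       filterlim_at_top_mult_tendsto_pos[OF tendsto_const] filterlim_real_sequentially)
  then have "(\<lambda>n. exp (- inverse (real n * t))) \<longlonglongrightarrow> 1" by simp
  moreover have "eventually (\<lambda>n. exp (- inverse (real n * t)) = flat 0 (real n * t)) sequentially"
    using eventually_gt_at_top[of 0] by eventually_elim (use assms in \<open>auto simp: flat_def mult_le_0_iff\<close>)
  ultimately show ?thesis by (rule Lim_transform_eventually)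
qed

text \<open>Each factor of the product tends to 1 strictly inside the box and vanishes outside; the
  bound by the indicator of the closed box provides the domination when passing to the
  limit.\<close>

lemma test_functions_approximate_box:
  fixes a b :: "'a::euclidean_space"
  assumes "cbox a b \<subseteq> U"
  obtains \<phi> where "\<And>n. \<phi> n \<in> test_functions U" "\<And>n x. \<bar>\<phi> n x\<bar> \<le> indicator (cbox a b) x"
    "\<And>x. (\<lambda>n. \<phi> n x) \<longlonglongrightarrow> indicator (box a b) x"
proof -
  define \<phi> :: "nat \<Rightarrow> 'a \<Rightarrow> real" where
    "\<phi> n x = (\<Prod>i\<in>Basis. flat 0 (real n * (x \<bullet> i - a \<bullet> i)) * flat 0 (real n * (b \<bullet> i - x \<bullet> i)))" for n x
  have smooth: "smooth (\<phi> n)" for n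
    unfolding \<phi>_def
    by (intro elementary_smooth elementary_prod elementary.mult elementary.flat elementary_diff elementary.inner elementary.const)
  have zero: "\<phi> n x = 0" if "x \<notin> box a b" for n x
  proof -
    obtain i where i: "i \<in> Basis" "\<not> (a \<bullet> i < x \<bullet> i \<and> x \<bullet> i < b \<bullet> i)"
      using \<open>x \<notin> box a b\<close> by (auto simp: mem_box)
    then have "flat 0 (real n * (x \<bullet> i - a \<bullet> i)) * flat 0 (real n * (b \<bullet> i - x \<bullet> i)) = 0"
      by (auto simp: flat_def mult_le_0_iff)
    then show ?thesis using i(1) by (auto simp: \<phi>_def)
  qed
  have le1: "\<bar>\<phi> n x\<bar> \<le> 1" for n x
    unfolding \<phi>_def abs_prod
    by (intro prod_le_1) (auto simp: abs_mult flat_nonneg intro!: mult_le_one flat_0_le_1)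
  have supp: "closure {x. \<phi> n x \<noteq> 0} \<subseteq> cbox a b" for n
    by (intro closure_minimal) (use zero box_subset_cbox in \<open>auto, blast\<close>)
  then have "compact (closure {x. \<phi> n x \<noteq> 0})" for n
    by (meson bounded_cbox bounded_subset closed_closure compact_eq_bounded_closed)
  with smooth supp assms have "\<phi> n \<in> test_functions U" for n
    by (force simp: test_functions_def)
  moreover have "\<bar>\<phi> n x\<bar> \<le> indicator (cbox a b) x" for n x
    using le1 zero box_subset_cbox[of a b] by (cases "x \<in> cbox a b") (auto, metis abs_zero subsetD zero order_refl)
  moreover have "(\<lambda>n. \<phi> n x) \<longlonglongrightarrow> indicator (box a b) x" for x
  proof (cases "x \<in> box a b")
    case True
    then have "(\<lambda>n. \<phi> n x) \<longlonglongrightarrow> (\<Prod>i\<in>(Basis::'a set). 1 * 1)"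
      unfolding \<phi>_def by (intro tendsto_prod tendsto_mult flat_0_tendsto_1) (auto simp: mem_box)
    then show ?thesis using True by simp
  qed (simp add: zero)
  ultimately show ?thesis using that by blast
qed


lemma lebesgue_on_integral_eq:
  fixes f :: "'a::euclidean_space \<Rightarrow> 'b::euclidean_space"
  assumes "S \<in> sets lebesgue"
  shows "integral\<^sup>L (lebesgue_on S) f = (LINT x:S|lebesgue. f x)"
    and "integrable (lebesgue_on S) f \<longleftrightarrow> set_integrable lebesgue S f"
  using assms by (simp_all add: integral_restrict_space integrable_restrict_space
      set_lebesgue_integral_def set_integrable_def)

text \<open>Test functions approximating a box give, by dominated convergence, vanishing integrals
  over all boxes whose closed version lies in \<open>U\<close>. On one such box the function is
  integrable, so a Borel representative vanishes almost everywhere there; countably many boxes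
  exhaust \<open>U\<close>, and their boundaries are null.\<close>

lemma fundamental_lemma:
  fixes f :: "'a::euclidean_space \<Rightarrow> real"
  assumes U: "open U" and f: "locally_integrable_on f U"
    and 0: "\<And>\<phi>. \<phi> \<in> test_functions U \<Longrightarrow> (LINT x|lebesgue_on U. f x * \<phi> x) = 0"
  shows "AE x in lebesgue. x \<in> U \<longrightarrow> f x = 0"
proof -
  have box0: "(LINT x:box a b|lebesgue. f x) = 0" if ab: "cbox a b \<subseteq> U" for a b
  proof -
    obtain \<phi> where \<phi>: "\<And>n. \<phi> n \<in> test_functions U" "\<And>n x. \<bar>\<phi> n x\<bar> \<le> indicator (cbox a b) x"
      "\<And>x. (\<lambda>n. \<phi> n x) \<longlonglongrightarrow> indicator (box a b) x"
      using test_functions_approximate_box[OF ab] by blast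
    have int: "integrable lebesgue (\<lambda>x. indicator (cbox a b) x * f x)"
      using f ab by (auto simp: locally_integrable_on_def set_integrable_def)
    have \<phi>0: "\<phi> n x = 0" if "x \<notin> cbox a b" for n x
      using \<phi>(2)[of n x] that by simp
    have eq: "(LINT x|lebesgue_on U. f x * \<phi> n x) = (LINT x|lebesgue. indicator (cbox a b) x * f x * \<phi> n x)" for n
    proof -
      have "(LINT x|lebesgue_on U. f x * \<phi> n x) = (LINT x:U|lebesgue. f x * \<phi> n x)"
        using U by (intro lebesgue_on_integral_eq) auto
      also have "\<dots> = (LINT x|lebesgue. indicator (cbox a b) x * f x * \<phi> n x)"
        unfolding set_lebesgue_integral_def
        by (rule Bochner_Integration.integral_cong) (use ab \<phi>0 in \<open>auto simp: indicator_def\<close>)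
      finally show ?thesis .
    qed
    have meas: "\<phi> n \<in> borel_measurable lebesgue" for n
      using \<phi>(1)[of n] by (auto simp: test_functions_def intro!: measurable_completion borel_measurable_continuous_onI continuous_on_smooth)
    have "(\<lambda>n. LINT x|lebesgue. indicator (cbox a b) x * f x * \<phi> n x)
        \<longlonglongrightarrow> (LINT x|lebesgue. indicator (cbox a b) x * f x * indicator (box a b) x)"
    proof (rule integral_dominated_convergence)
      show "(\<lambda>x. indicator (cbox a b) x * f x * indicator (box a b) x) \<in> borel_measurable lebesgue"
        by (rule borel_measurable_times[OF borel_measurable_integrable[OF int]])
          (auto intro!: borel_measurable_indicator)
      show "(\<lambda>x. indicator (cbox a b) x * f x * \<phi> n x) \<in> borel_measurable lebesgue" for n
        by (rule borel_measurable_times[OF borel_measurable_integrable[OF int] meas])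
      show "integrable lebesgue (\<lambda>x. norm (indicator (cbox a b) x * f x))"
        using int by (rule integrable_norm)
      show "AE x in lebesgue. (\<lambda>n. indicator (cbox a b) x * f x * \<phi> n x)
          \<longlonglongrightarrow> indicator (cbox a b) x * f x * indicator (box a b) x"
        using \<phi>(3) by (auto intro!: tendsto_mult)
      show "AE x in lebesgue. norm (indicator (cbox a b) x * f x * \<phi> n x) \<le> norm (indicator (cbox a b) x * f x)" for n
      proof (rule AE_I2)
        fix x
        show "norm (indicator (cbox a b) x * f x * \<phi> n x) \<le> norm (indicator (cbox a b) x * f x)"
          using \<phi>(2)[of n x] by (cases "x \<in> cbox a b") (auto simp: abs_mult intro!: mult_left_le)
      qed
    qed
    then have "(LINT x|lebesgue. indicator (cbox a b) x * f x * indicator (box a b) x) = 0"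
      using 0[OF \<phi>(1)] by (auto simp: eq dest: LIMSEQ_unique[OF tendsto_const])
    also have "(\<lambda>x. indicator (cbox a b) x * f x * indicator (box a b) x) = (\<lambda>x. indicator (box a b) x *\<^sub>R f x)"
      using box_subset_cbox[of a b] by (force simp: indicator_def fun_eq_iff)
    finally show ?thesis by (simp add: set_lebesgue_integral_def)
  qed
  have box_AE: "AE x in lebesgue. x \<in> box A B \<longrightarrow> f x = 0" if AB: "cbox A B \<subseteq> U" for A B
  proof -
    define F where "F = (\<lambda>x. indicator (box A B) x *\<^sub>R f x)"
    have "set_integrable lebesgue (cbox A B) f"
      using f AB by (auto simp: locally_integrable_on_def)
    then have int: "integrable lebesgue F"
      unfolding F_def set_integrable_def[symmetric] by (rule set_integrable_subset) (auto simp: box_subset_cbox)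
    obtain g where g: "g \<in> borel_measurable lborel" "AE x in lborel. F x = g x"
      using completion_ex_borel_measurable_real[OF borel_measurable_integrable[OF int]] by blast
    have gm: "g \<in> borel_measurable lebesgue" by (rule measurable_completion[OF g(1)])
    have Fg: "AE x in lebesgue. F x = g x" by (rule AE_completion[OF g(2)])
    have "integrable lebesgue g"
      by (rule integrable_cong_AE_imp[OF int gm Fg])
    then have "integrable lborel g" using integrable_completion[OF g(1)] by simp
    moreover have "(LINT x:box a b|lborel. g x) = 0" for a b
    proof -
      \<comment> \<open>Integrals of \<open>f\<close> are known to vanish only over boxes inside
        \<open>U\<close>. The truncated function reduces an arbitrary box to its intersection with
        \<open>box A B\<close>, which is again a box, possibly empty.\<close>
      obtain a' b' where ab': "box a b \<inter> box A B = box a' b'" using box_Int_box by blast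
      have "(LINT x:box a b|lborel. g x) = (LINT x|lebesgue. indicator (box a b) x *\<^sub>R g x)"
        unfolding set_lebesgue_integral_def using g(1)
        by (intro integral_completion[symmetric]) auto
      also have "\<dots> = (LINT x|lebesgue. indicator (box a b) x *\<^sub>R F x)"
        using gm borel_measurable_integrable[OF int] Fg
        by (intro integral_cong_AE borel_measurable_scaleR borel_measurable_indicator) auto
      also have "\<dots> = (LINT x:box a' b'|lebesgue. f x)"
        unfolding set_lebesgue_integral_def F_def ab'[symmetric]
        by (rule Bochner_Integration.integral_cong) (auto simp: indicator_def)
      also have "\<dots> = 0"
      proof (cases "box a' b' = {}")
        case False
        have "cbox a' b' \<subseteq> cbox A B"
        proof -
          have "cbox a' b' = closure (box a' b')" using False by (simp add: closure_box)
          also have "\<dots> \<subseteq> closure (box A B)" by (rule closure_mono) (use ab' in auto)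
          also have "\<dots> \<subseteq> cbox A B" by (rule closure_minimal) (auto simp: box_subset_cbox)
          finally show ?thesis .
        qed
        then show ?thesis using AB by (intro box0) auto
      qed (simp add: set_lebesgue_integral_def)
      finally show ?thesis .
    qed
    ultimately have "AE x in lborel. g x = 0" by (rule AE_zero_if_box_integrals_zero)
    then have "AE x in lebesgue. g x = 0" by (rule AE_completion)
    with Fg show ?thesis by eventually_elim (auto simp: F_def)
  qed
  obtain \<D> where \<D>: "countable \<D>" "\<D> \<subseteq> Pow U" "\<And>X. X \<in> \<D> \<Longrightarrow> \<exists>a b. X = cbox a b" "\<Union>\<D> = U"
    using open_countable_Union_open_cbox[OF U] by metis
  have "AE x in lebesgue. \<forall>X\<in>\<D>. x \<in> X \<longrightarrow> f x = 0"
  proof (subst AE_ball_countable[OF \<D>(1)], rule)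
    fix X assume "X \<in> \<D>"
    then obtain a b where X: "X = cbox a b" "cbox a b \<subseteq> U" using \<D> by blast
    have "negligible (cbox a b - box a b)" by (rule negligible_frontier_interval)
    then have "AE x in lebesgue. x \<notin> cbox a b - box a b"
      by (intro AE_not_in) (simp only: negligible_iff_null_sets)
    with box_AE[OF X(2)] show "AE x in lebesgue. x \<in> X \<longrightarrow> f x = 0"
      by eventually_elim (auto simp: X)
  qed
  then show ?thesis
    by eventually_elim (use \<D>(4) in blast)
qed

lemma fundamental_lemma_vector:
  fixes f :: "'a::euclidean_space \<Rightarrow> 'b::euclidean_space"
  assumes U: "open U" and f: "locally_integrable_on f U"
    and 0: "\<And>\<phi>. \<phi> \<in> test_functions U \<Longrightarrow> (LINT x|lebesgue_on U. \<phi> x *\<^sub>R f x) = 0"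
  shows "AE x in lebesgue. x \<in> U \<longrightarrow> f x = 0"
proof -
  have "AE x in lebesgue. x \<in> U \<longrightarrow> f x \<bullet> b = 0" if b: "b \<in> Basis" for b
  proof (rule fundamental_lemma[OF U])
    show "locally_integrable_on (\<lambda>x. f x \<bullet> b) U"
      using f unfolding locally_integrable_on_def by (auto intro: absolutely_integrable_component)
    fix \<phi> assume \<phi>: "\<phi> \<in> test_functions U"
    show "(LINT x|lebesgue_on U. (f x \<bullet> b) * \<phi> x) = 0"
    proof (cases "integrable (lebesgue_on U) (\<lambda>x. \<phi> x *\<^sub>R f x)")
      case True
      then have "(LINT x|lebesgue_on U. (\<phi> x *\<^sub>R f x) \<bullet> b) = (LINT x|lebesgue_on U. \<phi> x *\<^sub>R f x) \<bullet> b"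
        by (intro integral_inner_left)
      then show ?thesis using 0[OF \<phi>] by (simp add: mult.commute)
    next
      \<comment> \<open>A non-integrable vector field has integral 0 by convention, which would say
        nothing about its components. The case is impossible: \<phi> is bounded with compact
        support, and \<open>f\<close> is integrable on that support.\<close>
      case False
      have C: "compact (closure {x. \<phi> x \<noteq> 0})" "closure {x. \<phi> x \<noteq> 0} \<subseteq> U" "continuous_on UNIV \<phi>"
        using \<phi> by (auto simp: test_functions_def continuous_on_smooth)
      define C where "C = closure {x. \<phi> x \<noteq> 0}"
      have CU: "compact C" "C \<subseteq> U" using C by (auto simp: C_def)
      have f0: "\<phi> x = 0" if "x \<notin> C" for x
        using that closure_subset[of "{x. \<phi> x \<noteq> 0}"] by (auto simp: C_def)
      obtain M where M: "\<And>x. x \<in> C \<Longrightarrow> norm (\<phi> x) \<le> M"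
        using compact_imp_bounded[OF compact_continuous_image[OF continuous_on_subset[OF C(3)] CU(1)]]
        by (auto simp: bounded_iff)
      have "integrable lebesgue (\<lambda>x. indicator C x *\<^sub>R f x)"
        using f CU by (auto simp: locally_integrable_on_def set_integrable_def)
      then have "integrable lebesgue (\<lambda>x. M *\<^sub>R (indicator C x *\<^sub>R f x))"
        by (rule integrable_scaleR_right)
      then have "integrable lebesgue (\<lambda>x. \<phi> x *\<^sub>R (indicator C x *\<^sub>R f x))"
      proof (rule Bochner_Integration.integrable_bound)
        show "(\<lambda>x. \<phi> x *\<^sub>R indicator C x *\<^sub>R f x) \<in> borel_measurable lebesgue"
          by (rule borel_measurable_scaleR[OF _ borel_measurable_integrable[OF \<open>integrable lebesgue (\<lambda>x. indicator C x *\<^sub>R f x)\<close>]])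
            (use C(3) in \<open>auto intro!: measurable_completion borel_measurable_continuous_onI\<close>)
      qed (use M in \<open>force simp: indicator_def mult_right_mono\<close>)
      also have "(\<lambda>x. \<phi> x *\<^sub>R (indicator C x *\<^sub>R f x)) = (\<lambda>x. indicator U x *\<^sub>R (\<phi> x *\<^sub>R f x))"
        using CU f0 by (force simp: indicator_def fun_eq_iff)
      finally have "integrable (lebesgue_on U) (\<lambda>x. \<phi> x *\<^sub>R f x)"
        using U by (simp add: lebesgue_on_integral_eq set_integrable_def)
      with False show ?thesis by blast
    qed
  qed
  then have "AE x in lebesgue. \<forall>b\<in>Basis. x \<in> U \<longrightarrow> f x \<bullet> b = 0"
    by (subst AE_ball_countable) (auto intro: countable_finite)
  then show ?thesis
    by eventually_elim (auto intro: euclidean_eqI)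
qed

section \<open>Fluxes through the base of a cone\<close>

text \<open>Continuous differentiability instead of \<open>smooth\<close>: closure under
  differences, products and affine substitutions is then immediate, without iterated
  derivatives.\<close>

definition C1 :: "('a::euclidean_space \<Rightarrow> real) \<Rightarrow> bool" where
  "C1 u \<longleftrightarrow> (\<forall>x. (u has_derivative (\<lambda>h. grad u x \<bullet> h)) (at x)) \<and> continuous_on UNIV (grad u)"

lemma C1I:
  assumes "\<And>x. (u has_derivative (\<lambda>h. g x \<bullet> h)) (at x)" "continuous_on UNIV g"
  shows "C1 u" and "grad u = g"
proof -
  show eq: "grad u = g" using grad_unique[OF assms(1)] by auto
  show "C1 u" using assms by (simp add: C1_def eq)
qed

lemma smooth_C1: "smooth u \<Longrightarrow> C1 u"
  by (simp add: C1_def smooth_has_derivative continuous_on_grad)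

lemma C1_has_derivative: "C1 u \<Longrightarrow> (u has_derivative (\<lambda>h. grad u x \<bullet> h)) (at x within S)"
  by (auto simp: C1_def intro: has_derivative_at_withinI)

lemma C1_continuous:
  assumes "C1 u"
  shows "continuous_on S u" "continuous_on S (grad u)"
  using assms C1_has_derivative[OF assms]
  by (auto simp: C1_def intro: continuous_on_subset has_derivative_continuous_on[where f'="\<lambda>x h. grad u x \<bullet> h"])

lemma C1_measurable [measurable_dest]:
  assumes "C1 u"
  shows "u \<in> borel_measurable borel" "grad u \<in> borel_measurable borel"
  using C1_continuous[OF assms] by (auto intro: borel_measurable_continuous_onI)

lemma C1_diff:
  assumes "C1 u" "C1 w"
  shows "C1 (\<lambda>x. u x - w x)" and "grad (\<lambda>x. u x - w x) = (\<lambda>x. grad u x - grad w x)"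
proof -
  have *: "((\<lambda>x. u x - w x) has_derivative (\<lambda>h. (grad u x - grad w x) \<bullet> h)) (at x)" for x
    using assms unfolding C1_def inner_diff_left by (intro has_derivative_diff) auto
  show "C1 (\<lambda>x. u x - w x)" "grad (\<lambda>x. u x - w x) = (\<lambda>x. grad u x - grad w x)"
    by (rule C1I[OF *]; use assms in \<open>auto simp: C1_def intro: continuous_on_diff\<close>)+
qed

lemma C1_mult:
  assumes "C1 u" "C1 w"
  shows "C1 (\<lambda>x. u x * w x)" and "grad (\<lambda>x. u x * w x) = (\<lambda>x. u x *\<^sub>R grad w x + w x *\<^sub>R grad u x)"
proof -
  have *: "((\<lambda>x. u x * w x) has_derivative (\<lambda>h. (u x *\<^sub>R grad w x + w x *\<^sub>R grad u x) \<bullet> h)) (at x)" for x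
    using has_derivative_mult[OF C1_has_derivative[OF assms(1)] C1_has_derivative[OF assms(2)], of x UNIV]
    by (simp add: inner_add_left algebra_simps)
  show "C1 (\<lambda>x. u x * w x)" "grad (\<lambda>x. u x * w x) = (\<lambda>x. u x *\<^sub>R grad w x + w x *\<^sub>R grad u x)"
    by (rule C1I[OF *]; intro continuous_intros C1_continuous assms)+
qed

lemma C1_compose_affine:
  fixes T :: "'a::euclidean_space \<Rightarrow> 'a"
  assumes "C1 u" "linear f" and T: "\<And>x. T x = f x + t"
  shows "C1 (\<lambda>x. u (T x))" and "grad (\<lambda>x. u (T x)) x \<bullet> h = grad u (T x) \<bullet> f h"
proof -
  have bl: "bounded_linear f" using assms(2) by (simp add: linear_conv_bounded_linear)
  have ad: "f h \<bullet> w = h \<bullet> adjoint f w" for h w using adjoint_works[OF assms(2)] by simp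
  have lad: "bounded_linear (adjoint f)"
    using assms(2) by (simp add: adjoint_linear linear_conv_bounded_linear[symmetric])
  have contT: "continuous_on S T" for S
    using bl by (simp add: T[abs_def] linear_continuous_on continuous_on_add)
  have Td: "(T has_derivative f) (at x)" for x
    unfolding T[abs_def] by (auto intro!: derivative_eq_intros bounded_linear_imp_has_derivative bl)
  have *: "((\<lambda>x. u (T x)) has_derivative (\<lambda>h. adjoint f (grad u (T x)) \<bullet> h)) (at x)" for x
    using has_derivative_compose[OF Td C1_has_derivative[OF assms(1), of _ UNIV]]
    by (simp add: ad inner_commute)
  have c: "continuous_on UNIV (\<lambda>x. adjoint f (grad u (T x)))"
    by (intro bounded_linear.continuous_on[OF lad] continuous_on_compose2[OF C1_continuous(2)[OF assms(1), of UNIV] contT]) auto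
  show "C1 (\<lambda>x. u (T x))" by (rule C1I(1)[OF * c])
  show "grad (\<lambda>x. u (T x)) x \<bullet> h = grad u (T x) \<bullet> f h"
    by (simp add: C1I(2)[OF * c] ad inner_commute)
qed

lemma grad_eq_0:
  assumes "open S" "x \<in> S" "\<And>y. y \<in> S \<Longrightarrow> u y = 0"
  shows "grad u x = 0"
proof (rule grad_unique)
  have "((\<lambda>_. 0) has_derivative (\<lambda>h. 0)) (at x)" by simp
  then show "(u has_derivative (\<lambda>h. 0 \<bullet> h)) (at x)"
    using has_derivative_transform_within_open[of "\<lambda>_. 0" "\<lambda>h. 0" x UNIV S u] assms by simp
qed

text \<open>By the divergence theorem this is, for a cone with apex \<open>z\<close>, the product of the height and
  the integral of \<open>u\<close> over the base.\<close>

definition cone_flux :: "'a::euclidean_space set \<Rightarrow> 'a \<Rightarrow> ('a \<Rightarrow> real) \<Rightarrow> real" where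
  "cone_flux K z u = (LINT x:K|lborel. (x - z) \<bullet> grad u x + real DIM('a) * u x)"

lemma compact_emeasure_lt_top: "compact K \<Longrightarrow> emeasure lborel K < top"
  for K :: "'a::euclidean_space set"
  using emeasure_bounded_finite[OF compact_imp_bounded, of K] by simp

lemma set_integrable_compact:
  fixes f :: "'a::euclidean_space \<Rightarrow> 'b::euclidean_space"
  assumes "compact K" "continuous_on K f"
  shows "set_integrable lborel K f"
  using borel_integrable_compact[OF assms] by (simp add: set_integrable_def)

lemma cone_flux_integrable:
  assumes "C1 u" "compact K"
  shows "set_integrable lborel K (\<lambda>x. (x - z) \<bullet> grad u x + real n * u x)"
  by (intro set_integrable_compact continuous_intros C1_continuous assms)

lemma cone_flux_diff:
  assumes "C1 u" "C1 w" "compact K"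
  shows "cone_flux K z (\<lambda>x. u x - w x) = cone_flux K z u - cone_flux K z w"
proof -
  have "cone_flux K z u - cone_flux K z w = (LINT x:K|lborel. ((x - z) \<bullet> grad u x + real DIM('a) * u x)
      - ((x - z) \<bullet> grad w x + real DIM('a) * w x))"
    unfolding cone_flux_def by (intro set_integral_diff(2)[symmetric] cone_flux_integrable assms)
  then show ?thesis
    unfolding cone_flux_def by (simp add: C1_diff[OF assms(1,2)] algebra_simps)
qed

text \<open>The volume factor of \<open>T\<close> is not known, so it is eliminated by comparison
  with the integral of 1; hence the products with the measures of both sets. The integrand is
  affinely invariant because the linear part \<open>f\<close> maps \<open>x - z\<close> to
  \<open>T x - T z\<close>.\<close>

lemma cone_flux_affine_image:
  fixes T :: "'a::euclidean_space \<Rightarrow> 'a"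
  assumes "C1 u" "compact K" "linear f" "bij f" and T: "\<And>x. T x = f x + t"
  shows "cone_flux K z (\<lambda>x. u (T x)) * measure lborel (T ` K) = measure lborel K * cone_flux (T ` K) (T z) u"
proof -
  obtain c where c: "\<And>K (G :: 'a \<Rightarrow> real). K \<in> sets borel \<Longrightarrow> T ` K \<in> sets borel \<Longrightarrow> G \<in> borel_measurable borel \<Longrightarrow>
          (LINT x:K|lborel. G (T x)) = c * (LINT y:T ` K|lborel. G y)"
    using integral_affine_image[OF assms(3,4) T] by metis
  have bl: "bounded_linear f" using assms(3) by (simp add: linear_conv_bounded_linear)
  have "continuous_on K T"
    using bl by (simp add: T[abs_def] linear_continuous_on continuous_on_add)
  then have TK: "compact (T ` K)" using assms(2) by (rule compact_continuous_image)
  have K: "K \<in> sets borel" "T ` K \<in> sets borel" using assms(2) TK by (auto simp: borel_compact)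
  have fin: "emeasure lborel K < \<infinity>" "emeasure lborel (T ` K) < \<infinity>"
    using compact_emeasure_lt_top[OF assms(2)] compact_emeasure_lt_top[OF TK] by simp_all
  have "measure lborel K = c * measure lborel (T ` K)"
    using c[OF K, of "\<lambda>_. 1"] fin K by (simp add: set_integral_const less_top)
  moreover have "cone_flux K z (\<lambda>x. u (T x)) = c * cone_flux (T ` K) (T z) u"
  proof -
    have "(x - z) \<bullet> grad (\<lambda>x. u (T x)) x = (T x - T z) \<bullet> grad u (T x)" for x
    proof -
      have "(x - z) \<bullet> grad (\<lambda>x. u (T x)) x = grad u (T x) \<bullet> f (x - z)"
        using C1_compose_affine(2)[OF assms(1,3) T] by (simp add: inner_commute)
      also have "f (x - z) = T x - T z" by (simp add: T linear_diff[OF assms(3)])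
      finally show ?thesis by (simp add: inner_commute)
    qed
    then show ?thesis
      unfolding cone_flux_def
      by (simp, subst c[OF K, of "\<lambda>y. (y - T z) \<bullet> grad u y + real DIM('a) * u y", symmetric])
        (use C1_measurable[OF assms(1)] in auto)
  qed
  ultimately show ?thesis by simp
qed

text \<open>The derivative at 1 is taken along a sequence, with a mean value bound as dominating
  constant. If the dilations lie in \<open>K\<close>, the difference only involves \<open>u\<close>
  on the shell between \<open>K\<close> and its dilation; this is how the values of \<open>u\<close>
  near the base come to decide about the flux.\<close>

lemma cone_flux_as_limit:
  fixes K :: "'a::euclidean_space set"
  assumes u: "C1 u" and K: "compact K"
    and t: "\<And>n. 0 < t n" "\<And>n. t n < 1" "t \<longlonglongrightarrow> 1"
  shows "(\<lambda>n. ((LINT x:K|lborel. u x) - (LINT x:(\<lambda>x. z + t n *\<^sub>R (x - z)) ` K|lborel. u x)) / (1 - t n))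
           \<longlonglongrightarrow> cone_flux K z u"
proof -
  define d where "d = DIM('a)"
  define F where "F s x = s ^ d * u (z + s *\<^sub>R (x - z))" for s x
  define F' where "F' s x = real d * s ^ (d - 1) * u (z + s *\<^sub>R (x - z)) + s ^ d * (grad u (z + s *\<^sub>R (x - z)) \<bullet> (x - z))" for s x
  have deriv: "((\<lambda>s. F s x) has_real_derivative F' s x) (at s within S)" for s x S
  proof -
    have "((\<lambda>s. u (z + s *\<^sub>R (x - z))) has_derivative (\<lambda>h. grad u (z + s *\<^sub>R (x - z)) \<bullet> (h *\<^sub>R (x - z)))) (at s within S)"
      by (rule has_derivative_compose[OF _ C1_has_derivative[OF u, of _ UNIV]]) (auto intro!: derivative_eq_intros)
    then have "((\<lambda>s. u (z + s *\<^sub>R (x - z))) has_real_derivative (grad u (z + s *\<^sub>R (x - z)) \<bullet> (x - z))) (at s within S)"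
      by (simp add: has_field_derivative_def mult_commute_abs)
    then show ?thesis unfolding F_def F'_def
      by (auto intro!: derivative_eq_intros)
  qed
  have cont: "continuous_on S (\<lambda>p. F' (fst p) (snd p))" for S
    unfolding F'_def
    by (intro continuous_intros continuous_on_compose2[OF C1_continuous(1)[OF u, of UNIV]]
        continuous_on_compose2[OF C1_continuous(2)[OF u, of UNIV]]) auto
  have "compact ((\<lambda>p. F' (fst p) (snd p)) ` ({0..1} \<times> K))"
    by (rule compact_continuous_image[OF cont]) (use K in \<open>auto intro: compact_Times\<close>)
  then obtain M where M: "\<And>s x. s \<in> {0..1} \<Longrightarrow> x \<in> K \<Longrightarrow> \<bar>F' s x\<bar> \<le> M"
    by (force dest!: compact_imp_bounded simp: bounded_iff)
  have F1: "F 1 x = u x" for x by (simp add: F_def)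
  have bound: "\<bar>(u x - F (t n) x) / (1 - t n)\<bar> \<le> M" if "x \<in> K" for n x
  proof -
    have "norm (F 1 x - F (t n) x) \<le> M * norm (1 - t n)"
      by (rule field_differentiable_bound[where S="{0..1}", OF _ deriv]) (use t(1,2)[of n] M[OF _ that] less_imp_le in auto)
    then show ?thesis using t(2)[of n] by (simp add: F1 abs_div field_simps)
  qed
  have lim: "(\<lambda>n. (u x - F (t n) x) / (1 - t n)) \<longlonglongrightarrow> (x - z) \<bullet> grad u x + real d * u x" for x
  proof -
    have "((\<lambda>s. (F s x - F 1 x) / (s - 1)) \<longlongrightarrow> F' 1 x) (at 1)"
      using deriv[of x 1 UNIV] by (simp add: has_field_derivative_iff)
    moreover have "filterlim t (at 1) sequentially"
      using t by (simp add: filterlim_at less_imp_neq)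
    ultimately have "(\<lambda>n. (F (t n) x - F 1 x) / (t n - 1)) \<longlonglongrightarrow> F' 1 x"
      by (rule filterlim_compose)
    moreover have "(F (t n) x - F 1 x) / (t n - 1) = (u x - F (t n) x) / (1 - t n)" for n
      by (metis F1 minus_diff_eq minus_divide_divide)
    ultimately show ?thesis by (simp add: F'_def inner_commute add.commute)
  qed
  have [measurable]: "K \<in> sets borel" using K by (simp add: borel_compact)
  have contF: "continuous_on S (F s)" for s S
    unfolding F_def by (intro continuous_intros continuous_on_compose2[OF C1_continuous(1)[OF u, of UNIV]]) auto
  have "(\<lambda>n. LINT x|lborel. indicator K x *\<^sub>R ((u x - F (t n) x) / (1 - t n)))
      \<longlonglongrightarrow> (LINT x|lborel. indicator K x *\<^sub>R ((x - z) \<bullet> grad u x + real d * u x))"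
  proof (rule integral_dominated_convergence)
    show "(\<lambda>x. indicat_real K x *\<^sub>R ((x - z) \<bullet> grad u x + real d * u x)) \<in> borel_measurable lborel"
      using C1_measurable[OF u] by measurable
    show "(\<lambda>x. indicat_real K x *\<^sub>R ((u x - F (t n) x) / (1 - t n))) \<in> borel_measurable lborel" for n
      using C1_measurable[OF u] borel_measurable_continuous_onI[OF contF[of UNIV "t n"]] by measurable
    show "integrable lborel (\<lambda>x. indicat_real K x *\<^sub>R M)"
      using borel_integrable_compact[OF K continuous_on_const, of M] by simp
    show "AE x in lborel. (\<lambda>n. indicat_real K x *\<^sub>R ((u x - F (t n) x) / (1 - t n)))
        \<longlonglongrightarrow> indicat_real K x *\<^sub>R ((x - z) \<bullet> grad u x + real d * u x)"
      using lim by (intro AE_I2 tendsto_scaleR tendsto_const)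
    show "AE x in lborel. norm (indicat_real K x *\<^sub>R ((u x - F (t n) x) / (1 - t n))) \<le> indicat_real K x *\<^sub>R M" for n
      using bound by (intro AE_I2) (auto simp: indicator_def)
  qed
  moreover have "(LINT x|lborel. indicator K x *\<^sub>R ((u x - F (t n) x) / (1 - t n)))
     = ((LINT x:K|lborel. u x) - (LINT x:(\<lambda>x. z + t n *\<^sub>R (x - z)) ` K|lborel. u x)) / (1 - t n)" for n
  proof -
    have "compact ((\<lambda>x. z + t n *\<^sub>R (x - z)) ` K)"
      by (rule compact_continuous_image[OF _ K]) (intro continuous_intros)
    then have "(LINT x:(\<lambda>x. z + t n *\<^sub>R (x - z)) ` K|lborel. u x) = t n ^ DIM('a) * (LINT x:K|lborel. u (z + t n *\<^sub>R (x - z)))"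
      using t(1)[of n] C1_measurable[OF u] by (intro integral_dilation) (auto simp: borel_compact)
    also have "\<dots> = (LINT x:K|lborel. F (t n) x)"
      by (simp add: F_def d_def)
    finally have "(LINT x:K|lborel. u x) - (LINT x:(\<lambda>x. z + t n *\<^sub>R (x - z)) ` K|lborel. u x) = (LINT x:K|lborel. u x - F (t n) x)"
      by (simp add: set_integral_diff set_integrable_compact K C1_continuous u contF)
    then show ?thesis by (simp add: set_lebesgue_integral_def)
  qed
  ultimately show ?thesis
    by (simp only: cone_flux_def set_lebesgue_integral_def d_def)
qed

lemma dilation_sequence:
  obtains t :: "nat \<Rightarrow> real" where "\<And>n. 0 < t n" "\<And>n. t n < 1" "t \<longlonglongrightarrow> 1"
proof (rule that[of "\<lambda>n. 1 - inverse (real (Suc (Suc n)))"])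
  show "(\<lambda>n. 1 - inverse (real (Suc (Suc n)))) \<longlonglongrightarrow> 1"
    using tendsto_diff[OF tendsto_const LIMSEQ_inverse_real_of_nat[THEN LIMSEQ_Suc], of 1] by simp
qed (auto simp: field_simps)

lemma measure_dilation:
  fixes z :: "'a::euclidean_space"
  assumes "0 < t" "compact K"
  shows "measure lborel ((\<lambda>x. z + t *\<^sub>R (x - z)) ` K) = t ^ DIM('a) * measure lborel K"
proof -
  have c: "compact ((\<lambda>x. z + t *\<^sub>R (x - z)) ` K)"
    by (rule compact_continuous_image[OF _ assms(2)]) (intro continuous_intros)
  have fin: "emeasure lborel S < \<infinity>" if "compact S" for S :: "'a set"
    using that by (simp add: compact_emeasure_lt_top)
  show ?thesis
    using integral_dilation[of t K z "\<lambda>_. 1"] assms c fin[OF c] fin[OF assms(2)]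
    by (simp add: borel_compact set_integral_const less_top)
qed

text \<open>On the shell \<open>u\<close> is at most of order 1 - t, and the shell has relative
  volume 1 - t^d. After division by 1 - t the difference quotient is still bounded by a multiple of
  1 - t^d, which tends to 0.\<close>

lemma cone_flux_zero:
  assumes u: "C1 u" and K: "compact K"
    and star: "\<And>t. 0 < t \<Longrightarrow> t < 1 \<Longrightarrow> (\<lambda>x. z + t *\<^sub>R (x - z)) ` K \<subseteq> K"
    and small: "\<And>t x. t0 < t \<Longrightarrow> 0 < t \<Longrightarrow> t < 1 \<Longrightarrow> x \<in> K \<Longrightarrow> x \<notin> (\<lambda>x. z + t *\<^sub>R (x - z)) ` K \<Longrightarrow> \<bar>u x\<bar> \<le> C * (1 - t)"
    and t0: "t0 < 1"
  shows "cone_flux K z u = 0"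
proof -
  obtain t :: "nat \<Rightarrow> real" where t: "\<And>n. 0 < t n" "\<And>n. t n < 1" "t \<longlonglongrightarrow> 1" using dilation_sequence by blast
  let ?D = "\<lambda>n. ((LINT x:K|lborel. u x) - (LINT x:(\<lambda>x. z + t n *\<^sub>R (x - z)) ` K|lborel. u x)) / (1 - t n)"
  have "eventually (\<lambda>n. \<bar>?D n\<bar> \<le> C * (1 - t n ^ DIM('a)) * measure lborel K) sequentially"
    using order_tendstoD(1)[OF t(3) t0]
  proof eventually_elim
    case (elim n)
    define L where "L = (\<lambda>x. z + t n *\<^sub>R (x - z)) ` K"
    have L: "compact L" unfolding L_def
      by (rule compact_continuous_image[OF _ K]) (intro continuous_intros)
    have sub: "L \<subseteq> K" using star[of "t n"] t by (simp add: L_def)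
    have [measurable]: "K \<in> sets borel" "L \<in> sets borel" using K L by (auto simp: borel_compact)
    have fin: "emeasure lborel K < \<infinity>" using K by (simp add: compact_emeasure_lt_top)
    have fin': "emeasure lborel (K - L) < \<infinity>"
      using emeasure_mono[of "K - L" K lborel] fin by (auto intro: le_less_trans)
    have ui: "set_integrable lborel K u" by (intro set_integrable_compact K C1_continuous u)
    have "(LINT x:K|lborel. u x) = (LINT x:L|lborel. u x) + (LINT x:K - L|lborel. u x)"
      using sub set_integral_Un[of L "K - L" lborel u] set_integrable_subset[OF ui]
      by (auto simp: Un_absorb1)
    then have "\<bar>(LINT x:K|lborel. u x) - (LINT x:L|lborel. u x)\<bar> = \<bar>LINT x:K - L|lborel. u x\<bar>" by simp
    also have "\<dots> \<le> (LINT x:K - L|lborel. \<bar>u x\<bar>)"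
      using set_integral_norm_bound[OF set_integrable_subset[OF ui, of "K - L"]] by simp
    also have "\<dots> \<le> (LINT x:K - L|lborel. C * (1 - t n))"
    proof (intro set_integral_mono set_integrable_abs set_integrable_subset[OF ui])
      show "set_integrable lborel (K - L) (\<lambda>_. C * (1 - t n))"
        using fin' unfolding set_integrable_def
        by (intro integrable_scaleR_left integrable_real_indicator) auto
      show "\<bar>u x\<bar> \<le> C * (1 - t n)" if "x \<in> K - L" for x
        using small[of "t n" x] elim t(1,2)[of n] that by (auto simp: L_def)
    qed auto
    also have "\<dots> = C * (1 - t n) * measure lborel (K - L)"
      using fin' by (simp add: set_integral_const less_top)
    also have "measure lborel (K - L) = measure lborel K - measure lborel L"
      using fin sub by (intro measure_Diff) (auto simp: less_top)
    also have "\<dots> = (1 - t n ^ DIM('a)) * measure lborel K"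
      using measure_dilation[OF t(1)[of n] K, of z] by (simp add: L_def algebra_simps)
    finally show ?case using t(2)[of n] by (simp add: L_def abs_div field_simps)
  qed
  moreover have "(\<lambda>n. C * (1 - t n ^ DIM('a)) * measure lborel K) \<longlonglongrightarrow> C * (1 - 1 ^ DIM('a)) * measure lborel K"
    by (intro tendsto_intros t(3))
  ultimately have "?D \<longlonglongrightarrow> 0"
    by (intro Lim_null_comparison[of ?D]) auto
  with cone_flux_as_limit[OF u K t] show ?thesis by (rule LIMSEQ_unique)
qed

text \<open>By positivity the shell may be replaced by any part \<open>S\<close> of it. The volume
  of this part is at least \<open>a\<close> times 1 - t, and the factor 1 - t cancels in the
  difference quotient.\<close>

lemma cone_flux_lower_bound:
  assumes u: "C1 u" and K: "compact K"
    and star: "\<And>t. 0 < t \<Longrightarrow> t < 1 \<Longrightarrow> (\<lambda>x. z + t *\<^sub>R (x - z)) ` K \<subseteq> K"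
    and pos: "\<And>x. x \<in> K \<Longrightarrow> 0 \<le> u x"
    and S: "\<And>t. t0 < t \<Longrightarrow> 0 < t \<Longrightarrow> t < 1 \<Longrightarrow> \<exists>S\<in>sets borel. S \<subseteq> K - (\<lambda>x. z + t *\<^sub>R (x - z)) ` K \<and>
              a * (1 - t) \<le> measure lborel S \<and> (\<forall>x\<in>S. m \<le> u x)"
    and t0: "t0 < 1" and m: "0 \<le> m"
  shows "m * a \<le> cone_flux K z u"
proof -
  obtain t :: "nat \<Rightarrow> real" where t: "\<And>n. 0 < t n" "\<And>n. t n < 1" "t \<longlonglongrightarrow> 1" using dilation_sequence by blast
  let ?D = "\<lambda>n. ((LINT x:K|lborel. u x) - (LINT x:(\<lambda>x. z + t n *\<^sub>R (x - z)) ` K|lborel. u x)) / (1 - t n)"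
  have "eventually (\<lambda>n. m * a \<le> ?D n) sequentially"
    using order_tendstoD(1)[OF t(3) t0]
  proof eventually_elim
    case (elim n)
    define L where "L = (\<lambda>x. z + t n *\<^sub>R (x - z)) ` K"
    have L: "compact L" unfolding L_def
      by (rule compact_continuous_image[OF _ K]) (intro continuous_intros)
    have sub: "L \<subseteq> K" using star[of "t n"] t by (simp add: L_def)
    obtain S where S: "S \<in> sets borel" "S \<subseteq> K - L" "a * (1 - t n) \<le> measure lborel S" "\<And>x. x \<in> S \<Longrightarrow> m \<le> u x"
      using S[of "t n"] elim t by (auto simp: L_def)
    have [measurable]: "K \<in> sets borel" "L \<in> sets borel" "S \<in> sets borel" using K L S by (auto simp: borel_compact)
    have "emeasure lborel K < \<infinity>" using K by (simp add: compact_emeasure_lt_top)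
    then have fin: "emeasure lborel S < \<infinity>"
      using emeasure_mono[of S K lborel] S by (auto intro: le_less_trans)
    have ui: "set_integrable lborel K u" by (intro set_integrable_compact K C1_continuous u)
    have "(LINT x:K|lborel. u x) = (LINT x:L|lborel. u x) + (LINT x:K - L|lborel. u x)"
      using sub set_integral_Un[of L "K - L" lborel u] set_integrable_subset[OF ui]
      by (auto simp: Un_absorb1)
    moreover have "(LINT x:S|lborel. m) \<le> (LINT x:S|lborel. u x)"
      using S fin by (intro set_integral_mono set_integrable_subset[OF ui]) (auto simp: set_integrable_def less_top)
    moreover have "(LINT x:S|lborel. m) = m * measure lborel S"
      using fin by (simp add: set_integral_const less_top)
    moreover have "(LINT x:S|lborel. u x) \<le> (LINT x:K - L|lborel. u x)"
      using S pos set_integrable_subset[OF ui, of S] set_integrable_subset[OF ui, of "K - L"]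
      unfolding set_lebesgue_integral_def set_integrable_def
      by (intro integral_mono) (auto simp: indicator_def)
    moreover have "m * (a * (1 - t n)) \<le> m * measure lborel S"
      using S(3) m by (rule mult_left_mono)
    ultimately have "m * a * (1 - t n) \<le> (LINT x:K|lborel. u x) - (LINT x:L|lborel. u x)" by simp
    then show ?case using t(2)[of n] by (simp add: L_def pos_le_divide_eq)
  qed
  then show ?thesis
    using cone_flux_as_limit[OF u K t] by (intro tendsto_lowerbound) auto
qed

text \<open>A large ball is star-shaped about every apex \<open>a\<close> of norm at most 1, and
  \<open>u\<close> vanishes in its outer shells, so the flux about each such apex is zero. The
  fluxes about 0 and about \<open>a\<close> differ by the integral of the derivative of
  \<open>u\<close> in direction \<open>a\<close>.\<close>

lemma integral_grad_compact_support:
  fixes u :: "'a::euclidean_space \<Rightarrow> real"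
  assumes u: "C1 u" and C: "compact C" and 0: "\<And>x. x \<notin> C \<Longrightarrow> u x = 0"
  shows "(LINT x|lborel. grad u x) = 0"
proof -
  obtain \<rho> where \<rho>: "0 < \<rho>" "C \<subseteq> cball 0 \<rho>"
    using bounded_subset_ballD[OF compact_imp_bounded[OF C], of 0] ball_subset_cball by blast
  define R where "R = \<rho> + 2"
  define K :: "'a set" where "K = cball 0 R"
  have K: "compact K" by (simp add: K_def)
  have flux: "cone_flux K a u = 0" if a: "norm a \<le> 1" for a
  proof (rule cone_flux_zero[OF u K, where C=0 and ?t0.0="1 - 1 / (R + 1)"])
    show "(\<lambda>x. a + t *\<^sub>R (x - a)) ` K \<subseteq> K" if t: "0 < t" "t < 1" for t
    proof clarify
      fix x assume "x \<in> K"
      have "norm (a + t *\<^sub>R (x - a)) = norm ((1 - t) *\<^sub>R a + t *\<^sub>R x)" by (simp add: algebra_simps)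
      also have "\<dots> \<le> (1 - t) * norm a + t * norm x"
        using t by (intro norm_triangle_le) simp
      also have "\<dots> \<le> (1 - t) * R + t * R"
        using a t \<rho> \<open>x \<in> K\<close> by (intro add_mono mult_left_mono) (auto simp: K_def R_def)
      finally show "a + t *\<^sub>R (x - a) \<in> K" by (simp add: K_def algebra_simps)
    qed
    show "\<bar>u x\<bar> \<le> 0 * (1 - t)"
      if t: "1 - 1 / (R + 1) < t" "0 < t" "t < 1" and x: "x \<in> K" "x \<notin> (\<lambda>x. a + t *\<^sub>R (x - a)) ` K" for t x
    proof -
      have "x \<notin> C"
      proof
        assume "x \<in> C"
        then have nx: "norm x \<le> R - 2" using \<rho> by (auto simp: R_def)
        let ?y = "a + (1 / t) *\<^sub>R (x - a)"
        have eq: "x = a + t *\<^sub>R (?y - a)" using t by simp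
        have "t * norm ?y = norm (x - (1 - t) *\<^sub>R a)"
          using t by (simp flip: norm_scaleR[of t, unfolded abs_of_pos[OF t(2)]] add: algebra_simps)
        also have "\<dots> \<le> norm x + (1 - t)"
          using a t by (intro norm_triangle_le_diff) (auto intro!: mult_left_le)
        also have "\<dots> \<le> t * R"
        proof -
          \<comment> \<open>The value of \<open>t0\<close> was chosen to give this bound, which
            keeps the preimage of a point of the support inside the ball although the apex may be
            off its center.\<close>
          have "(1 - t) * (R + 1) < 1" using t(1) \<rho> by (simp add: R_def field_simps)
          then show ?thesis using nx by (simp add: algebra_simps)
        qed
        finally have "?y \<in> K" using t by (simp add: K_def)
        with eq x(2) show False by blast
      qed
      then show ?thesis using 0 by simp
    qed
  qed (use \<rho> in \<open>auto simp: R_def\<close>)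
  have gi: "set_integrable lborel K (grad u)"
    by (intro set_integrable_compact K C1_continuous u)
  have K0: "(LINT x:K|lborel. grad u x) \<bullet> a = 0" if a: "norm a \<le> 1" for a
  proof -
    have "cone_flux K 0 u - cone_flux K a u = (LINT x:K|lborel. a \<bullet> grad u x)"
    proof -
      have "cone_flux K 0 u - cone_flux K a u = (LINT x:K|lborel. ((x - 0) \<bullet> grad u x + real DIM('a) * u x)
        - ((x - a) \<bullet> grad u x + real DIM('a) * u x))"
        unfolding cone_flux_def by (intro set_integral_diff(2)[symmetric] cone_flux_integrable u K)
      then show ?thesis by (simp add: algebra_simps)
    qed
    also have "\<dots> = (LINT x:K|lborel. grad u x) \<bullet> a"
      using gi by (subst inner_commute) (simp add: set_lebesgue_integral_def set_integrable_def flip: integral_inner_left inner_scaleR_left)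
    finally show ?thesis using flux[of 0] flux[OF a] by simp
  qed
  have "(LINT x|lborel. grad u x) = (LINT x:K|lborel. grad u x)"
    unfolding set_lebesgue_integral_def
  proof (rule Bochner_Integration.integral_cong)
    fix x
    have "grad u x = 0" if "x \<notin> K"
      by (rule grad_eq_0[of "- C"]) (use C compact_imp_closed 0 that \<rho> in \<open>auto simp: K_def R_def\<close>)
    then show "grad u x = indicator K x *\<^sub>R grad u x" by (auto simp: indicator_def)
  qed simp
  moreover have "(LINT x:K|lborel. grad u x) = 0"
    by (rule euclidean_eqI) (simp add: K0)
  ultimately show ?thesis by simp
qed

section \<open>Simplices and barycentric coordinates\<close>

text \<open>Taking extreme points recovers the vertices from the cell as a point set, so that a mesh
  can remain a family of sets.\<close>

definition vertices :: "'a::euclidean_space set \<Rightarrow> 'a set" where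
  "vertices K = {x. x extreme_point_of K}"

text \<open>The gradient of the barycentric coordinate of \<open>z\<close>: the coordinate falls by
  1 along every edge leaving \<open>z\<close>. For a full-dimensional simplex its negative is the
  outward normal of the opposite facet divided by the height over that facet.\<close>

definition bary_grad :: "'a::euclidean_space set \<Rightarrow> 'a \<Rightarrow> 'a" where
  "bary_grad K z = (SOME g. \<forall>w\<in>vertices K - {z}. g \<bullet> (z - w) = 1)"

definition bary :: "'a::euclidean_space set \<Rightarrow> 'a \<Rightarrow> 'a \<Rightarrow> real" where
  "bary K z x = 1 + bary_grad K z \<bullet> (x - z)"

lemma bary_diff: "bary K z x - bary K z y = bary_grad K z \<bullet> (x - y)"
  by (simp add: bary_def inner_diff_right)

lemma bary_dilation: "bary K z (y + s *\<^sub>R (x - y)) = (1 - s) * bary K z y + s * bary K z x"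
  by (simp add: bary_def inner_diff_right inner_add_right algebra_simps)

lemma continuous_on_bary [continuous_intros]: "continuous_on S (bary K z)"
  unfolding bary_def[abs_def] by (intro continuous_intros)

lemma bary_affine_combination:
  assumes "finite V" "sum u V = 1"
  shows "bary K z (\<Sum>v\<in>V. u v *\<^sub>R v) = (\<Sum>v\<in>V. u v * bary K z v)"
proof -
  have "(\<Sum>v\<in>V. u v * bary K z v) = (\<Sum>v\<in>V. u v * (1 - bary_grad K z \<bullet> z)) + bary_grad K z \<bullet> (\<Sum>v\<in>V. u v *\<^sub>R v)"
    by (simp add: bary_def inner_sum_right algebra_simps sum.distrib sum_subtractf)
  also have "(\<Sum>v\<in>V. u v * (1 - bary_grad K z \<bullet> z)) = 1 - bary_grad K z \<bullet> z"
    using assms(2) by (simp flip: sum_distrib_right)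
  finally show ?thesis by (simp add: bary_def inner_diff_right)
qed

lemma set_integral_finite_sum:
  fixes f :: "'i \<Rightarrow> 'a \<Rightarrow> 'b::{banach, second_countable_topology}"
  assumes "\<And>i. i \<in> I \<Longrightarrow> set_integrable M A (f i)"
  shows "(LINT x:A|M. \<Sum>i\<in>I. f i x) = (\<Sum>i\<in>I. LINT x:A|M. f i x)"
  using assms unfolding set_lebesgue_integral_def set_integrable_def scaleR_sum_right
  by (rule Bochner_Integration.integral_sum)

context
  fixes K :: "'a::euclidean_space set"
  assumes K: "int DIM('a) simplex K"
begin

lemma simplex_vertices:
  shows "\<not> affine_dependent (vertices K)" "finite (vertices K)" "card (vertices K) = Suc DIM('a)"
    "K = convex hull vertices K"
proof -
  obtain C where C: "\<not> affine_dependent C" "int (card C) = int DIM('a) + 1" "K = convex hull C"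
    using K by (auto simp: simplex_def)
  then have "vertices K = C"
    by (auto simp: vertices_def extreme_point_of_convex_hull_affine_independent)
  with C show "\<not> affine_dependent (vertices K)" "finite (vertices K)" "card (vertices K) = Suc DIM('a)"
    "K = convex hull vertices K"
    by (auto simp: aff_independent_finite)
qed

lemma vertices_subset: "vertices K \<subseteq> K"
  by (auto simp: vertices_def extreme_point_of_def)

text \<open>Here the choice operator is shown to have a witness. The edges at a fixed vertex
  \<open>w\<close> are linearly independent, hence some linear form takes the value 1 on the edge to
  \<open>z\<close> and 0 on the others; it is represented by a vector.\<close>

lemma bary_grad_vertices:
  assumes z: "z \<in> vertices K" and w: "w \<in> vertices K" "w \<noteq> z"
  shows "bary_grad K z \<bullet> (z - w) = 1"
proof -
  let ?V = "vertices K"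
  have "independent ((\<lambda>x. - w + x) ` (?V - {w}))"
    using simplex_vertices(1) affine_dependent_iff_dependent2[OF w(1)] by simp
  from linear_independent_extend[OF this, of "\<lambda>x. if x = z - w then 1 else 0 :: real"]
  obtain l :: "'a \<Rightarrow> real" where l: "linear l" "\<forall>x\<in>(\<lambda>x. - w + x) ` (?V - {w}). l x = (if x = z - w then 1 else 0)"
    by (elim exE conjE) (rule that; assumption)
  have l2: "l (x - w) = (if x = z then 1 else 0)" if "x \<in> ?V - {w}" for x
    using l(2) that by auto
  have lr: "l x = (\<Sum>b\<in>Basis. l b *\<^sub>R b) \<bullet> x" for x
  proof -
    have "l (\<Sum>b\<in>Basis. (x \<bullet> b) *\<^sub>R b) = (\<Sum>b\<in>Basis. (x \<bullet> b) *\<^sub>R l b)"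
      by (simp add: linear_sum[OF l(1)] linear_cmul[OF l(1)])
    then have "l x = (\<Sum>b\<in>Basis. (x \<bullet> b) * l b)" by (simp add: euclidean_representation)
    also have "\<dots> = (\<Sum>b\<in>Basis. l b *\<^sub>R b) \<bullet> x"
      unfolding inner_sum_left by (rule sum.cong) (simp_all add: inner_commute mult.commute)
    finally show ?thesis .
  qed
  have "l (z - v) = 1" if v: "v \<in> ?V - {z}" for v
  proof -
    have "l (z - v) = l (z - w) - l (v - w)" by (simp add: linear_diff[OF l(1)])
    moreover have "l (z - w) = 1" using l2[of z] z w by simp
    moreover have "l (v - w) = 0"
      using l2[of v] v linear_0[OF l(1)] by (cases "v = w") auto
    ultimately show ?thesis by simp
  qed
  then have "\<forall>v\<in>?V - {z}. (\<Sum>b\<in>Basis. l b *\<^sub>R b) \<bullet> (z - v) = 1" by (simp flip: lr)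
  then have "\<forall>v\<in>?V - {z}. bary_grad K z \<bullet> (z - v) = 1"
    unfolding bary_grad_def by (rule someI)
  then show ?thesis using w by blast
qed

lemma bary_vertex:
  assumes "z \<in> vertices K" "w \<in> vertices K"
  shows "bary K z w = (if w = z then 1 else 0)"
proof -
  have "bary K z w = 1 - bary_grad K z \<bullet> (z - w)" by (simp add: bary_def inner_diff_right)
  then show ?thesis using bary_grad_vertices[OF assms] by auto
qed

lemma bary_representation: "(\<Sum>z\<in>vertices K. bary K z x) = 1" "(\<Sum>z\<in>vertices K. bary K z x *\<^sub>R z) = x"
proof -
  let ?V = "vertices K"
  have "x \<in> affine hull ?V"
    using affine_independent_span_eq[OF simplex_vertices(1)] simplex_vertices(3) by simp
  then obtain u where u: "sum u ?V = 1" "(\<Sum>v\<in>?V. u v *\<^sub>R v) = x"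
    by (auto simp: affine_hull_finite simplex_vertices(2))
  have "bary K z x = u z" if "z \<in> ?V" for z
  proof -
    have "bary K z x = (\<Sum>v\<in>?V. u v * bary K z v)"
      using bary_affine_combination[OF simplex_vertices(2) u(1)] u(2) by simp
    also have "\<dots> = (\<Sum>v\<in>?V. if v = z then u v else 0)"
      by (rule sum.cong) (auto simp: bary_vertex that)
    finally show ?thesis using that simplex_vertices(2) by simp
  qed
  then show "(\<Sum>z\<in>?V. bary K z x) = 1" "(\<Sum>z\<in>?V. bary K z x *\<^sub>R z) = x" using u by simp_all
qed

lemma mem_simplex_iff: "x \<in> K \<longleftrightarrow> (\<forall>z\<in>vertices K. 0 \<le> bary K z x)"
proof
  assume "x \<in> K"
  then obtain u where u: "\<forall>v\<in>vertices K. 0 \<le> u v" "sum u (vertices K) = 1" "(\<Sum>v\<in>vertices K. u v *\<^sub>R v) = x"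
    using simplex_vertices(4) by (auto simp: convex_hull_finite simplex_vertices(2))
  then have "bary K z x = (\<Sum>v\<in>vertices K. u v * bary K z v)" for z
    using bary_affine_combination[OF simplex_vertices(2), of u K z] by simp
  then show "\<forall>z\<in>vertices K. 0 \<le> bary K z x"
    using u by (auto intro!: sum_nonneg simp: bary_vertex)
next
  assume "\<forall>z\<in>vertices K. 0 \<le> bary K z x"
  then have "x \<in> convex hull vertices K"
    using bary_representation[of x]
    by (auto simp: convex_hull_finite simplex_vertices(2) intro!: exI[of _ "\<lambda>z. bary K z x"])
  then show "x \<in> K" using simplex_vertices(4) by simp
qed

lemma bary_le_1:
  assumes "x \<in> K" "z \<in> vertices K"
  shows "bary K z x \<le> 1"
proof -
  have "bary K z x \<le> (\<Sum>z\<in>vertices K. bary K z x)"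
    using assms mem_simplex_iff simplex_vertices(2) by (intro member_le_sum) auto
  then show ?thesis by (simp add: bary_representation)
qed

text \<open>These are the two identities of \<open>bary_representation\<close>, differentiated in
  the direction \<open>a\<close>. Together they write the constant \<open>a\<close> as a combination
  of the fields x - z with coefficients -(a . grad \<lambda>_z), where \<lambda>_z is the coordinate
  of z, that is, as a lowest-order Raviart-Thomas field.\<close>

lemma sum_bary_grad: "(\<Sum>z\<in>vertices K. a \<bullet> bary_grad K z) = 0" "(\<Sum>z\<in>vertices K. (a \<bullet> bary_grad K z) *\<^sub>R z) = a"
proof -
  have *: "a \<bullet> bary_grad K z = bary K z a - bary K z 0" for z
    using bary_diff[of K z a 0] by (simp add: inner_commute)
  show "(\<Sum>z\<in>vertices K. a \<bullet> bary_grad K z) = 0"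
    by (simp add: * sum_subtractf bary_representation)
  show "(\<Sum>z\<in>vertices K. (a \<bullet> bary_grad K z) *\<^sub>R z) = a"
    by (simp add: * scaleR_diff_left sum_subtractf bary_representation)
qed

lemma ex_other_vertex:
  obtains w where "w \<in> vertices K" "w \<noteq> z"
proof -
  have "\<not> vertices K \<subseteq> {z}"
    using simplex_vertices(3) card_mono[of "{z}" "vertices K"] by auto
  then show ?thesis using that by blast
qed

lemma bary_grad_nonzero: "z \<in> vertices K \<Longrightarrow> bary_grad K z \<noteq> 0"
  using bary_grad_vertices ex_other_vertex[of z] by (metis inner_zero_left zero_neq_one)

text \<open>Dilation by \<open>t\<close> about \<open>z\<close> maps the coordinate l of
  \<open>z\<close> to 1 - t + t l and multiplies the other coordinates by \<open>t\<close>. The part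
  removed is therefore the slab along the opposite facet on which the coordinate of \<open>z\<close>
  is less than 1 - t.\<close>

lemma simplex_dilation_eq:
  assumes z: "z \<in> vertices K" and t: "0 < t" "t < 1"
  shows "(\<lambda>x. z + t *\<^sub>R (x - z)) ` K = {x \<in> K. 1 - t \<le> bary K z x}"
proof (intro equalityI subsetI)
  fix y assume "y \<in> (\<lambda>x. z + t *\<^sub>R (x - z)) ` K"
  then obtain x where x: "x \<in> K" "y = z + t *\<^sub>R (x - z)" by auto
  then have "bary K w y = (1 - t) * bary K w z + t * bary K w x" for w by (simp add: bary_dilation)
  then show "y \<in> {x \<in> K. 1 - t \<le> bary K z x}"
    using x t z mem_simplex_iff[of x] mem_simplex_iff[of y] by (auto simp: bary_vertex)
next
  fix x assume x: "x \<in> {x \<in> K. 1 - t \<le> bary K z x}"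
  define y where "y = z + (1 / t) *\<^sub>R (x - z)"
  have b: "bary K w y = (1 - 1 / t) * bary K w z + 1 / t * bary K w x" for w
    unfolding y_def by (rule bary_dilation)
  have "0 \<le> bary K w y" if "w \<in> vertices K" for w
  proof (cases "w = z")
    case True
    have "bary K w y = (t - 1 + bary K z x) / t" using t z by (simp add: b True bary_vertex field_simps)
    then show ?thesis using t x by simp
  next
    case False
    then show ?thesis using x t z that mem_simplex_iff[of x] by (simp add: b bary_vertex)
  qed
  then have "y \<in> K" by (simp add: mem_simplex_iff)
  moreover have "x = z + t *\<^sub>R (y - z)" using t by (simp add: y_def)
  ultimately show "x \<in> (\<lambda>x. z + t *\<^sub>R (x - z)) ` K" by blast
qed

lemma C1_lipschitz_on_simplex:
  assumes u: "C1 u"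
  obtains M where "0 \<le> M" "\<And>x y. x \<in> K \<Longrightarrow> y \<in> K \<Longrightarrow> \<bar>u x - u y\<bar> \<le> M * norm (x - y)"
proof -
  have "bounded (grad u ` K)"
    by (intro compact_imp_bounded compact_continuous_image C1_continuous u compact_simplex[OF K])
  then obtain M where M: "0 < M" "\<And>x. x \<in> K \<Longrightarrow> norm (grad u x) \<le> M" by (auto simp: bounded_pos)
  have "\<bar>u x - u y\<bar> \<le> M * norm (x - y)" if xy: "x \<in> K" "y \<in> K" for x y
  proof -
    have "norm (u x - u y) \<le> M * norm (x - y)"
    proof (rule differentiable_bound[OF convex_simplex[OF K] C1_has_derivative[OF u] _ xy])
      fix x assume "x \<in> K"
      then show "onorm ((\<bullet>) (grad u x)) \<le> M"
        using M by (intro onorm_bound) (auto intro!: order_trans[OF Cauchy_Schwarz_ineq2] mult_right_mono)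
    qed
    then show ?thesis by simp
  qed
  with M(1) show ?thesis by (intro that[of M]) auto
qed

text \<open>A point of the slab next to the facet, with coordinate l < 1 - t, is projected from
  \<open>z\<close> onto the facet. The projection is at distance at most l times the diameter, and
  \<open>u\<close> vanishes there, so Lipschitz continuity gives a bound of order 1 - t.\<close>

lemma cone_flux_facet_zero:
  assumes u: "C1 u" and z: "z \<in> vertices K" and 0: "\<And>x. x \<in> K \<Longrightarrow> bary K z x = 0 \<Longrightarrow> u x = 0"
  shows "cone_flux K z u = 0"
proof -
  obtain M where M: "0 \<le> M" "\<And>x y. x \<in> K \<Longrightarrow> y \<in> K \<Longrightarrow> \<bar>u x - u y\<bar> \<le> M * norm (x - y)"
    using C1_lipschitz_on_simplex[OF u] by blast
  show ?thesis
  proof (rule cone_flux_zero[OF u compact_simplex[OF K], where ?t0.0=0 and C="M * diameter K"])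
    show "(\<lambda>x. z + t *\<^sub>R (x - z)) ` K \<subseteq> K" if "0 < t" "t < 1" for t
      using simplex_dilation_eq[OF z that] by simp
    fix t :: real and x
    assume t: "0 < t" "t < 1" and x: "x \<in> K" "x \<notin> (\<lambda>x. z + t *\<^sub>R (x - z)) ` K"
    define l where "l = bary K z x"
    have l: "0 \<le> l" "l < 1 - t"
      using x z simplex_dilation_eq[OF z t] mem_simplex_iff[of x] by (auto simp: l_def)
    define y where "y = z + (1 / (1 - l)) *\<^sub>R (x - z)"
    have b: "bary K w y = (1 - 1 / (1 - l)) * bary K w z + 1 / (1 - l) * bary K w x" for w
      unfolding y_def by (rule bary_dilation)
    have bz: "bary K z y = 0" using l t z by (simp add: b bary_vertex flip: l_def) (simp add: field_simps)
    have "0 \<le> bary K w y" if "w \<in> vertices K" for w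
      using x(1) l t mem_simplex_iff[of x] that z bz by (cases "w = z") (auto simp: b bary_vertex)
    then have y: "y \<in> K" by (simp add: mem_simplex_iff)
    have "x - y = l *\<^sub>R (z - y)"
    proof -
      have "(1 - l) *\<^sub>R (y - z) = x - z" using l t by (simp add: y_def)
      then show ?thesis by (simp add: algebra_simps)
    qed
    then have "norm (x - y) = l * norm (z - y)" using l by simp
    also have "\<dots> \<le> l * diameter K"
      using l y z vertices_subset diameter_bounded_bound[OF compact_imp_bounded[OF compact_simplex[OF K]], of z y]
      by (auto intro!: mult_left_mono simp: dist_norm)
    also have "\<dots> \<le> (1 - t) * diameter K"
      using l diameter_ge_0[OF compact_imp_bounded[OF compact_simplex[OF K]]] by (intro mult_right_mono) auto
    finally have "M * norm (x - y) \<le> M * ((1 - t) * diameter K)" using M(1) by (rule mult_left_mono)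
    then show "\<bar>u x\<bar> \<le> M * diameter K * (1 - t)"
      using M(2)[OF x(1) y] 0[OF y bz] by (simp add: mult_ac)
  qed simp
qed

text \<open>This is the divergence theorem for the constant field \<open>a\<close>. The weights sum
  to zero over the vertices, which removes everything independent of \<open>z\<close>; the terms
  containing \<open>z\<close> reproduce \<open>a\<close> by \<open>sum_bary_grad\<close>.\<close>

lemma integral_const_inner_grad:
  assumes u: "C1 u"
  shows "(LINT x:K|lborel. a \<bullet> grad u x) = (\<Sum>z\<in>vertices K. - (a \<bullet> bary_grad K z) * cone_flux K z u)"
proof -
  let ?n = "real DIM('a)"
  have "(\<Sum>z\<in>vertices K. - (a \<bullet> bary_grad K z) * cone_flux K z u)
      = (\<Sum>z\<in>vertices K. LINT x:K|lborel. - (a \<bullet> bary_grad K z) * ((x - z) \<bullet> grad u x + ?n * u x))"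
    by (simp only: cone_flux_def set_integral_mult_right)
  also have "\<dots> = (LINT x:K|lborel. \<Sum>z\<in>vertices K. - (a \<bullet> bary_grad K z) * ((x - z) \<bullet> grad u x + ?n * u x))"
    by (intro set_integral_finite_sum[symmetric] set_integrable_mult_right impI cone_flux_integrable u compact_simplex[OF K])
  also have "\<dots> = (LINT x:K|lborel. a \<bullet> grad u x)"
  proof -
    have "(\<Sum>z\<in>vertices K. - (a \<bullet> bary_grad K z) * ((x - z) \<bullet> grad u x + ?n * u x)) = a \<bullet> grad u x" for x
    proof -
      have "(\<Sum>z\<in>vertices K. - (a \<bullet> bary_grad K z) * ((x - z) \<bullet> grad u x + ?n * u x))
        = (\<Sum>z\<in>vertices K. (a \<bullet> bary_grad K z) * (- (x \<bullet> grad u x + ?n * u x)) + ((a \<bullet> bary_grad K z) *\<^sub>R z) \<bullet> grad u x)"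
        by (rule sum.cong) (auto simp: algebra_simps)
      also have "\<dots> = (\<Sum>z\<in>vertices K. a \<bullet> bary_grad K z) * (- (x \<bullet> grad u x + ?n * u x)) + (\<Sum>z\<in>vertices K. (a \<bullet> bary_grad K z) *\<^sub>R z) \<bullet> grad u x"
        by (simp only: sum.distrib sum_distrib_right inner_sum_left)
      finally show ?thesis by (simp add: sum_bary_grad)
    qed
    then show ?thesis by simp
  qed
  finally show ?thesis by simp
qed

text \<open>Only a copy of \<open>K\<close>, contracted by \<open>s\<close> towards the point
  \<open>y\<close> of the facet, is taken into account. Its shell has thickness (1 - t) / s relative
  to the copy, whose volume is s^d times that of \<open>K\<close>; this leaves the exponent d - 1,
  the dimension of the facet.\<close>

lemma cone_flux_simplex_lower_bound:
  assumes u: "C1 u" and z: "z \<in> vertices K" and pos: "\<And>x. x \<in> K \<Longrightarrow> 0 \<le> u x"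
    and y: "y \<in> K" "bary K z y = 0" and s: "0 < s" "s \<le> 1"
    and m: "0 \<le> m" "\<And>x. x \<in> K \<Longrightarrow> m \<le> u (y + s *\<^sub>R (x - y))"
  shows "m * (measure lborel K * s ^ (DIM('a) - 1)) \<le> cone_flux K z u"
proof (rule cone_flux_lower_bound[OF u compact_simplex[OF K], where ?t0.0="1 - s"])
  show "(\<lambda>x. z + t *\<^sub>R (x - z)) ` K \<subseteq> K" if "0 < t" "t < 1" for t
    using simplex_dilation_eq[OF z that] by simp
  fix t assume t: "1 - s < t" "0 < t" "t < 1"
  \<comment> \<open>Since \<open>y\<close> has coordinate 0, the contraction multiplies the
    coordinate of \<open>z\<close> by \<open>s\<close>, and the slab of width 1 - t in
    \<open>K\<close> pulls back to one of width (1 - t) / s. The choice \<open>t0 = 1 - s\<close>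
    keeps this width below 1.\<close>
  define t' where "t' = 1 - (1 - t) / s"
  have t': "0 < t'" "t' < 1" using t s by (auto simp: t'_def field_simps)
  define D where "D = (\<lambda>x. y + s *\<^sub>R (x - y))"
  define K' where "K' = (\<lambda>x. z + t' *\<^sub>R (x - z)) ` K"
  have K': "compact K'" unfolding K'_def
    by (rule compact_continuous_image[OF _ compact_simplex[OF K]]) (intro continuous_intros)
  have K'_eq: "K' = {x \<in> K. 1 - t' \<le> bary K z x}"
    unfolding K'_def by (rule simplex_dilation_eq[OF z t'])
  have contD: "continuous_on A D" for A unfolding D_def by (intro continuous_intros)
  have cD: "compact (D ` K)" "compact (D ` K')"
    by (intro compact_continuous_image[OF contD] compact_simplex[OF K] K')+
  have injD: "D x = D x' \<Longrightarrow> x = x'" for x x' using s by (auto simp: D_def)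
  have DK: "D x \<in> K" if "x \<in> K" for x
  proof -
    have "bary K w (D x) = (1 - s) * bary K w y + s * bary K w x" for w by (simp add: D_def bary_dilation)
    then show ?thesis
      using that y s mem_simplex_iff[of x] mem_simplex_iff[of y] by (simp add: mem_simplex_iff[of "D x"])
  qed
  let ?S = "D ` K - D ` K'"
  show "\<exists>S\<in>sets borel. S \<subseteq> K - (\<lambda>x. z + t *\<^sub>R (x - z)) ` K \<and>
      measure lborel K * s ^ (DIM('a) - 1) * (1 - t) \<le> measure lborel S \<and> (\<forall>x\<in>S. m \<le> u x)"
  proof (intro bexI[of _ ?S] conjI ballI)
    show "?S \<in> sets borel" using cD by (auto simp: borel_compact)
    show "?S \<subseteq> K - (\<lambda>x. z + t *\<^sub>R (x - z)) ` K"
    proof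
      fix x' assume "x' \<in> ?S"
      then obtain x where x: "x \<in> K" "x' = D x" "x \<notin> K'" by auto
      then have "bary K z x < (1 - t) / s" by (auto simp: K'_eq t'_def)
      moreover have "bary K z x' = s * bary K z x"
        unfolding x(2) D_def bary_dilation using y by simp
      ultimately have "bary K z x' < 1 - t" using s by (simp add: field_simps)
      then show "x' \<in> K - (\<lambda>x. z + t *\<^sub>R (x - z)) ` K"
        using DK[OF x(1)] simplex_dilation_eq[OF z t(2,3)] by (auto simp: x(2))
    qed
    show "m \<le> u x" if "x \<in> ?S" for x using that m(2) by (auto simp: D_def)
    have "measure lborel ?S = measure lborel (D ` K) - measure lborel (D ` K')"
      using cD compact_emeasure_lt_top[OF cD(1)] by (intro measure_Diff) (auto simp: borel_compact K'_eq)
    also have "\<dots> = s ^ DIM('a) * measure lborel K - s ^ DIM('a) * (t' ^ DIM('a) * measure lborel K)"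
      using measure_dilation[OF s(1) compact_simplex[OF K], of y] measure_dilation[OF s(1) K', of y]
        measure_dilation[OF t'(1) compact_simplex[OF K], of z] by (simp add: D_def K'_def)
    also have "\<dots> = s ^ DIM('a) * measure lborel K * (1 - t' ^ DIM('a))" by (simp add: algebra_simps)
    also have "\<dots> \<ge> s ^ DIM('a) * measure lborel K * (1 - t')"
      using t' s power_decreasing[of 1 "DIM('a)" t'] by (intro mult_left_mono) (auto simp: Suc_le_eq)
    also have "s ^ DIM('a) * measure lborel K * (1 - t') = measure lborel K * s ^ (DIM('a) - 1) * (1 - t)"
      using s power_Suc[of s "DIM('a) - 1"] by (simp add: t'_def)
    finally show "measure lborel K * s ^ (DIM('a) - 1) * (1 - t) \<le> measure lborel ?S" .
  qed
qed (use pos s m in auto)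

lemma interior_simplex_nonempty: "interior K \<noteq> {}"
proof -
  have "affine hull K = UNIV"
    using affine_independent_span_eq[OF simplex_vertices(1)] simplex_vertices(3,4)
    by (metis affine_hull_convex_hull)
  then have "rel_interior K = interior K" by (rule rel_interior_interior)
  moreover have "K \<noteq> {}" using vertices_subset ex_other_vertex by blast
  ultimately show ?thesis using rel_interior_eq_empty[OF convex_simplex[OF K]] by simp
qed

lemma measure_simplex_pos: "0 < measure lborel K"
proof -
  obtain x e where e: "0 < e" "ball x e \<subseteq> K"
    using interior_simplex_nonempty by (auto simp: mem_interior)
  have "0 < measure lborel (ball x e)" using e by (simp add: content_ball_pos)
  also have "\<dots> \<le> measure lborel K"
    using e compact_simplex[OF K] compact_emeasure_lt_top[OF compact_simplex[OF K]]
    by (intro measure_mono_fmeasurable) (auto simp: fmeasurable_def borel_compact)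
  finally show ?thesis .
qed

text \<open>Along the diameter of an inscribed ball in the direction of the gradient, the coordinate
  changes by the norm of the gradient times that diameter, while on \<open>K\<close> its values lie
  between 0 and 1.\<close>

lemma norm_bary_grad_inball:
  assumes "z \<in> vertices K"
  shows "norm (bary_grad K z) * inball_diameter K \<le> 1"
proof -
  let ?g = "bary_grad K z"
  have g: "norm ?g > 0" using bary_grad_nonzero[OF assms] by simp
  have "inball_diameter K \<le> 1 / norm ?g"
    unfolding inball_diameter_def
  proof (rule cSup_least)
    obtain w where "w \<in> K" using vertices_subset ex_other_vertex by blast
    then show "{diameter (cball x \<rho>) |x \<rho>. 0 \<le> \<rho> \<and> cball x \<rho> \<subseteq> K} \<noteq> {}"
      by (auto intro!: exI[of _ w] exI[of _ "0::real"])
    fix D assume "D \<in> {diameter (cball x \<rho>) |x \<rho>. 0 \<le> \<rho> \<and> cball x \<rho> \<subseteq> K}"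
    then obtain x \<rho> where D: "D = diameter (cball x \<rho>)" "0 \<le> \<rho>" "cball x \<rho> \<subseteq> K" by auto
    let ?u = "(\<rho> / norm ?g) *\<^sub>R ?g"
    have "norm ?u = \<rho>" using g D by simp
    then have "x + ?u \<in> K" "x - ?u \<in> K" using D(3) by (auto simp: subset_eq dist_norm)
    then have "bary K z (x + ?u) \<le> 1" "0 \<le> bary K z (x - ?u)"
      using bary_le_1 mem_simplex_iff assms by auto
    then have "bary K z (x + ?u) - bary K z (x - ?u) \<le> 1" by simp
    moreover have "bary K z (x + ?u) - bary K z (x - ?u) = 2 * \<rho> * norm ?g"
      using g by (simp add: bary_diff inner_add_right power2_eq_square flip: power2_norm_eq_inner)
    ultimately show "D \<le> 1 / norm ?g" using D g by (simp add: field_simps)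
  qed
  then show ?thesis using g by (simp add: field_simps)
qed

lemma inball_witness:
  assumes "e < inball_diameter K"
  obtains x \<rho> where "0 \<le> \<rho>" "cball x \<rho> \<subseteq> K" "e < 2 * \<rho>"
proof -
  obtain w where "w \<in> K" using vertices_subset ex_other_vertex by blast
  then have "{diameter (cball x \<rho>) |x \<rho>. 0 \<le> \<rho> \<and> cball x \<rho> \<subseteq> K} \<noteq> {}"
    by (auto intro!: exI[of _ w] exI[of _ "0::real"])
  from less_cSupD[OF this assms[unfolded inball_diameter_def]] show ?thesis
    using that by (auto split: if_splits)
qed

lemma inball_diameter_pos: "0 < inball_diameter K"
proof -
  obtain x e where e: "0 < e" "ball x e \<subseteq> K"
    using interior_simplex_nonempty by (auto simp: mem_interior)
  then have c: "cball x (e / 2) \<subseteq> K" by (force simp: subset_eq)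
  have "bdd_above {diameter (cball x \<rho>) |x \<rho>. 0 \<le> \<rho> \<and> cball x \<rho> \<subseteq> K}"
    using compact_imp_bounded[OF compact_simplex[OF K]] by (auto intro!: bdd_aboveI[of _ "diameter K"] diameter_subset simp del: diameter_cball)
  then have "diameter (cball x (e / 2)) \<le> inball_diameter K"
    unfolding inball_diameter_def using c e by (intro cSup_upper) (auto intro!: exI[of _ x] exI[of _ "e / 2"])
  then show ?thesis using e by simp
qed

lemma diameter_simplex_pos: "0 < diameter K"
proof -
  obtain z where z: "z \<in> vertices K" using ex_other_vertex by blast
  obtain w where w: "w \<in> vertices K" "w \<noteq> z" using ex_other_vertex by blast
  have "0 < dist z w" using w by simp
  also have "\<dots> \<le> diameter K"
    using z w vertices_subset by (intro diameter_bounded_bound compact_imp_bounded compact_simplex[OF K]) auto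
  finally show ?thesis .
qed

lemma measure_simplex_upper: "measure lborel K \<le> unit_ball_vol (real DIM('a)) * diameter K ^ DIM('a)"
proof -
  obtain z where z: "z \<in> K" using vertices_subset ex_other_vertex by blast
  have "K \<subseteq> cball z (diameter K)"
    using z diameter_bounded_bound[OF compact_imp_bounded[OF compact_simplex[OF K]]] by auto
  then have "measure lborel K \<le> measure lborel (cball z (diameter K))"
    using compact_simplex[OF K] compact_emeasure_lt_top[OF compact_cball]
    by (intro measure_mono_fmeasurable) (auto simp: fmeasurable_def borel_compact)
  then show ?thesis
    using diameter_simplex_pos by (simp add: content_cball)
qed

section \<open>Bounds in terms of the shape-regularity constant\<close>

context
  fixes \<sigma> :: real
  assumes \<sigma>: "diameter K / inball_diameter K \<le> \<sigma>"
begin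

lemma shape_constant_pos: "0 < \<sigma>"
  using \<sigma> divide_pos_pos[OF diameter_simplex_pos inball_diameter_pos] by linarith

lemma norm_bary_grad_le:
  assumes "z \<in> vertices K"
  shows "norm (bary_grad K z) \<le> \<sigma> / diameter K"
proof -
  have "norm (bary_grad K z) \<le> 1 / inball_diameter K"
    using norm_bary_grad_inball[OF assms] inball_diameter_pos by (simp add: field_simps)
  also have "\<dots> \<le> \<sigma> / diameter K"
    using \<sigma> inball_diameter_pos diameter_simplex_pos by (simp add: field_simps)
  finally show ?thesis .
qed

text \<open>The supremum in \<open>inball_diameter\<close> is only approached, so a ball with
  diameter above one half of it is used. Its radius exceeds a quarter of
  \<open>inball_diameter\<close>, hence the 4.\<close>

lemma measure_simplex_lower:
  "unit_ball_vol (real DIM('a)) * (diameter K / (4 * \<sigma>)) ^ DIM('a) \<le> measure lborel K"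
proof -
  have *: "inball_diameter K / 2 < inball_diameter K" using inball_diameter_pos by simp
  obtain x \<rho> where \<rho>: "0 \<le> \<rho>" "cball x \<rho> \<subseteq> K" "inball_diameter K / 2 < 2 * \<rho>"
    by (rule inball_witness[OF *])
  have "diameter K \<le> inball_diameter K * \<sigma>" using \<sigma> inball_diameter_pos by (simp add: pos_divide_le_eq mult.commute)
  also have "\<dots> \<le> (4 * \<rho>) * \<sigma>" using \<rho>(3) shape_constant_pos by (intro mult_right_mono) auto
  finally have "diameter K / (4 * \<sigma>) \<le> \<rho>"
    using shape_constant_pos by (simp add: pos_divide_le_eq mult_ac)
  then have "unit_ball_vol (real DIM('a)) * (diameter K / (4 * \<sigma>)) ^ DIM('a) \<le> unit_ball_vol (real DIM('a)) * \<rho> ^ DIM('a)"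
    using diameter_simplex_pos shape_constant_pos
    by (intro mult_left_mono power_mono) (auto intro!: less_imp_le)
  also have "\<dots> = measure lborel (cball x \<rho>)" using \<rho> by (simp add: content_cball)
  also have "\<dots> \<le> measure lborel K"
    using \<rho> compact_simplex[OF K] compact_emeasure_lt_top[OF compact_simplex[OF K]]
    by (intro measure_mono_fmeasurable) (auto simp: fmeasurable_def borel_compact)
  finally show ?thesis .
qed

end

end

text \<open>Both coordinates are affine and vanish at the vertices of the common facet, so they are
  proportional, the factor being the value at \<open>z\<^sub>1\<close>. Evaluating at
  \<open>z\<^sub>2\<close> shows that the two factors are inverse to each other and share their
  sign.\<close>

lemma bary_opposite:
  fixes K\<^sub>1 K\<^sub>2 :: "'a::euclidean_space set"
  assumes K: "int DIM('a) simplex K\<^sub>1" "int DIM('a) simplex K\<^sub>2"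
    and z: "z\<^sub>1 \<in> vertices K\<^sub>1" "z\<^sub>2 \<in> vertices K\<^sub>2" and F: "vertices K\<^sub>1 - {z\<^sub>1} = vertices K\<^sub>2 - {z\<^sub>2}"
  shows "bary K\<^sub>2 z\<^sub>2 x = bary K\<^sub>2 z\<^sub>2 z\<^sub>1 * bary K\<^sub>1 z\<^sub>1 x" and "bary K\<^sub>2 z\<^sub>2 z\<^sub>1 * bary K\<^sub>1 z\<^sub>1 z\<^sub>2 = 1"
proof -
  show *: "bary K\<^sub>2 z\<^sub>2 x = bary K\<^sub>2 z\<^sub>2 z\<^sub>1 * bary K\<^sub>1 z\<^sub>1 x" for x
  proof -
    note V = simplex_vertices[OF K(1)]
    have "bary K\<^sub>2 z\<^sub>2 x = bary K\<^sub>2 z\<^sub>2 (\<Sum>v\<in>vertices K\<^sub>1. bary K\<^sub>1 v x *\<^sub>R v)"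
      by (simp add: bary_representation[OF K(1)])
    also have "\<dots> = (\<Sum>v\<in>vertices K\<^sub>1. bary K\<^sub>1 v x * bary K\<^sub>2 z\<^sub>2 v)"
      by (rule bary_affine_combination[OF V(2) bary_representation(1)[OF K(1)]])
    also have "\<dots> = bary K\<^sub>1 z\<^sub>1 x * bary K\<^sub>2 z\<^sub>2 z\<^sub>1"
      by (subst sum.remove[OF V(2) z(1)]) (use F in \<open>auto simp: bary_vertex[OF K(2)] z(2)\<close>)
    finally show ?thesis by (simp add: mult.commute)
  qed
  show "bary K\<^sub>2 z\<^sub>2 z\<^sub>1 * bary K\<^sub>1 z\<^sub>1 z\<^sub>2 = 1"
    using *[of z\<^sub>2] bary_vertex[OF K(2) z(2) z(2)] by simp
qed

text \<open>The affine map that fixes the common facet and sends one apex to the other carries the first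
  simplex onto the second. It changes \<open>u\<close> by a function vanishing on the facet.\<close>

lemma cone_flux_common_facet:
  fixes K\<^sub>1 K\<^sub>2 :: "'a::euclidean_space set"
  assumes K: "int DIM('a) simplex K\<^sub>1" "int DIM('a) simplex K\<^sub>2"
    and z: "z\<^sub>1 \<in> vertices K\<^sub>1" "z\<^sub>2 \<in> vertices K\<^sub>2" and F: "vertices K\<^sub>1 - {z\<^sub>1} = vertices K\<^sub>2 - {z\<^sub>2}"
    and u: "C1 u"
  shows "cone_flux K\<^sub>1 z\<^sub>1 u / measure lborel K\<^sub>1 = cone_flux K\<^sub>2 z\<^sub>2 u / measure lborel K\<^sub>2"
proof -
  let ?g = "bary_grad K\<^sub>1 z\<^sub>1"
  define f where "f w = w + (?g \<bullet> w) *\<^sub>R (z\<^sub>2 - z\<^sub>1)" for w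
  define T where "T x = x + bary K\<^sub>1 z\<^sub>1 x *\<^sub>R (z\<^sub>2 - z\<^sub>1)" for x
  define t where "t = (1 - ?g \<bullet> z\<^sub>1) *\<^sub>R (z\<^sub>2 - z\<^sub>1)"
  have lf: "linear f" unfolding f_def by (intro linearI) (auto simp: algebra_simps)
  have T: "T x = f x + t" for x
    by (simp add: T_def f_def t_def bary_def algebra_simps inner_diff_right)
  have "bij f"
  proof -
    have "w = 0" if "f w = 0" for w
    proof -
      have "?g \<bullet> f w = (?g \<bullet> w) * bary K\<^sub>1 z\<^sub>1 z\<^sub>2"
        by (simp add: f_def bary_def inner_add_right algebra_simps)
      then have "?g \<bullet> w = 0" using that bary_opposite(2)[OF K z F] by auto
      then show ?thesis using that by (simp add: f_def)
    qed
    then have "inj f" using linear_injective_0[OF lf] by blast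
    then show ?thesis by (simp add: bij_def linear_injective_imp_surjective[OF lf])
  qed
  have Tz: "T z\<^sub>1 = z\<^sub>2" by (simp add: T_def bary_def)
  have TF: "T w = w" if "w \<in> vertices K\<^sub>1 - {z\<^sub>1}" for w
    using that bary_vertex[OF K(1) z(1), of w] by (simp add: T_def)
  have "T ` K\<^sub>1 = K\<^sub>2"
  proof -
    have "T ` vertices K\<^sub>1 = insert (T z\<^sub>1) (T ` (vertices K\<^sub>1 - {z\<^sub>1}))" using z(1) by blast
    also have "T ` (vertices K\<^sub>1 - {z\<^sub>1}) = vertices K\<^sub>1 - {z\<^sub>1}" using TF by force
    also have "insert (T z\<^sub>1) (vertices K\<^sub>1 - {z\<^sub>1}) = vertices K\<^sub>2" using F z(2) Tz by auto
    finally have TV: "T ` vertices K\<^sub>1 = vertices K\<^sub>2" .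
    have Tim: "T ` S = (\<lambda>x. t + x) ` f ` S" for S by (auto simp: T image_image add.commute)
    have "T ` K\<^sub>1 = T ` (convex hull vertices K\<^sub>1)" using simplex_vertices(4)[OF K(1)] by simp
    also have "\<dots> = convex hull (T ` vertices K\<^sub>1)"
      unfolding Tim convex_hull_translation convex_hull_linear_image[OF lf] ..
    finally show ?thesis using simplex_vertices(4)[OF K(2)] TV by simp
  qed
  then have "cone_flux K\<^sub>1 z\<^sub>1 (\<lambda>x. u (T x)) * measure lborel K\<^sub>2 = measure lborel K\<^sub>1 * cone_flux K\<^sub>2 z\<^sub>2 u"
    using cone_flux_affine_image[OF u compact_simplex[OF K(1)] lf \<open>bij f\<close> T, of z\<^sub>1] Tz by simp
  moreover have "cone_flux K\<^sub>1 z\<^sub>1 (\<lambda>x. u (T x)) - cone_flux K\<^sub>1 z\<^sub>1 u = 0"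
    using C1_compose_affine(1)[OF u lf T] u
    by (subst cone_flux_diff[symmetric])
      (auto intro!: cone_flux_facet_zero[OF K(1)] C1_diff z compact_simplex[OF K(1)] simp: T_def)
  ultimately show ?thesis
    using measure_simplex_pos[OF K(1)] measure_simplex_pos[OF K(2)] by (simp add: field_simps)
qed

section \<open>Weak derivatives\<close>

lemma test_function_support:
  assumes "\<phi> \<in> test_functions U"
  shows "\<exists>C. compact C \<and> C \<subseteq> U \<and> (\<forall>x. x \<notin> C \<longrightarrow> \<phi> x = 0) \<and> (\<forall>x. x \<notin> C \<longrightarrow> grad \<phi> x = 0)"
proof -
  define C where "C = closure {x. \<phi> x \<noteq> 0}"
  have 0: "\<phi> x = 0" if "x \<notin> C" for x
    using that closure_subset[of "{x. \<phi> x \<noteq> 0}"] by (auto simp: C_def)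
  moreover have "grad \<phi> x = 0" if "x \<notin> C" for x
  proof (rule grad_eq_0[of "- C"])
    show "open (- C)" unfolding C_def by (intro open_Compl closed_closure)
  qed (use 0 that in \<open>simp_all\<close>)
  moreover have "compact C" "C \<subseteq> U" using assms by (auto simp: test_functions_def C_def)
  ultimately show ?thesis by blast
qed

lemma test_function_C1: "\<phi> \<in> test_functions U \<Longrightarrow> C1 \<phi>"
  by (simp add: test_functions_def smooth_C1)

lemma test_functions_mono: "U \<subseteq> V \<Longrightarrow> test_functions U \<subseteq> test_functions V"
  by (auto simp: test_functions_def)

text \<open>A general bilinear pairing covers the products of a function with \<phi>, of a scalar
  with grad \<phi> and the inner product of a field with grad \<phi> at once.\<close>

lemma locally_integrable_product:
  fixes f :: "'a::euclidean_space \<Rightarrow> 'b::euclidean_space" and w :: "'a \<Rightarrow> 'c::euclidean_space"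
    and h :: "'c \<Rightarrow> 'b \<Rightarrow> 'd::euclidean_space"
  assumes "bilinear h" and w: "continuous_on UNIV w" and f: "locally_integrable_on f U"
    and C: "compact C" "C \<subseteq> U" and 0: "\<And>x. x \<notin> C \<Longrightarrow> w x = 0"
  shows "set_integrable lebesgue U (\<lambda>x. h (w x) (f x))"
proof -
  have "set_integrable lebesgue C (\<lambda>x. h (w x) (f x))"
  proof (rule absolutely_integrable_bounded_measurable_product[where h=h])
    show "w \<in> borel_measurable (lebesgue_on C)"
      using w C by (intro continuous_imp_measurable_on_sets_lebesgue) (auto intro: continuous_on_subset lmeasurable_compact fmeasurableD)
    show "bounded (w ` C)"
      by (intro compact_imp_bounded compact_continuous_image C) (auto intro: continuous_on_subset[OF w])
  qed (use assms in \<open>auto simp: locally_integrable_on_def intro: lmeasurable_compact fmeasurableD\<close>)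
  moreover have "(\<lambda>x. indicator C x *\<^sub>R h (w x) (f x)) = (\<lambda>x. indicator U x *\<^sub>R h (w x) (f x))"
    using C(2) 0 bilinear_lzero[OF assms(1)] by (force simp: indicator_def fun_eq_iff)
  ultimately show ?thesis by (simp add: set_integrable_def)
qed

lemma test_function_integrable:
  fixes f :: "'a::euclidean_space \<Rightarrow> 'b::euclidean_space" and v :: "'a \<Rightarrow> 'a"
  assumes "\<phi> \<in> test_functions U" "open U"
  shows "locally_integrable_on f U \<Longrightarrow> integrable (lebesgue_on U) (\<lambda>x. \<phi> x *\<^sub>R f x)"
    and "locally_integrable_on f' U \<Longrightarrow> integrable (lebesgue_on U) (\<lambda>x. f' x *\<^sub>R grad \<phi> x)"
    and "locally_integrable_on v U \<Longrightarrow> integrable (lebesgue_on U) (\<lambda>x. v x \<bullet> grad \<phi> x)"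
proof -
  obtain C where C: "compact C" "C \<subseteq> U" "\<And>x. x \<notin> C \<Longrightarrow> \<phi> x = 0" "\<And>x. x \<notin> C \<Longrightarrow> grad \<phi> x = 0"
    using test_function_support[OF assms(1)] by blast
  note c = C1_continuous[OF test_function_C1[OF assms(1)], of UNIV]
  have U: "U \<in> sets lebesgue" using assms(2) by auto
  have b: "bilinear (\<lambda>(x::'a) y. y \<bullet> x)" "bilinear (\<lambda>(x::'a) (y::real). y *\<^sub>R x)" "bilinear (\<lambda>(x::real) (y::'b). x *\<^sub>R y)"
    by (auto simp: bilinear_def intro!: linearI simp: inner_add algebra_simps)
  show "locally_integrable_on f U \<Longrightarrow> integrable (lebesgue_on U) (\<lambda>x. \<phi> x *\<^sub>R f x)"
    unfolding lebesgue_on_integral_eq(2)[OF U]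
    by (rule locally_integrable_product[OF b(3) c(1) _ C(1-3)])
  show "locally_integrable_on f' U \<Longrightarrow> integrable (lebesgue_on U) (\<lambda>x. f' x *\<^sub>R grad \<phi> x)"
    unfolding lebesgue_on_integral_eq(2)[OF U]
    by (rule locally_integrable_product[OF b(2) c(2) _ C(1,2,4)])
  show "locally_integrable_on v U \<Longrightarrow> integrable (lebesgue_on U) (\<lambda>x. v x \<bullet> grad \<phi> x)"
    unfolding lebesgue_on_integral_eq(2)[OF U]
    by (rule locally_integrable_product[OF b(1) c(2) _ C(1,2,4)])
qed

lemma locally_integrable_on_diff:
  "locally_integrable_on f U \<Longrightarrow> locally_integrable_on g U \<Longrightarrow> locally_integrable_on (\<lambda>x. f x - g x) U"
  by (auto simp: locally_integrable_on_def)

lemma AE_eq_if_weakly_equal: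
  fixes f g :: "'a::euclidean_space \<Rightarrow> 'b::euclidean_space"
  assumes U: "open U" and f: "locally_integrable_on f U" and g: "locally_integrable_on g U"
    and eq: "\<And>\<phi>. \<phi> \<in> test_functions U \<Longrightarrow>
      (LINT x|lebesgue_on U. \<phi> x *\<^sub>R f x) = (LINT x|lebesgue_on U. \<phi> x *\<^sub>R g x)"
  shows "AE x in lebesgue. x \<in> U \<longrightarrow> f x = g x"
proof -
  have "AE x in lebesgue. x \<in> U \<longrightarrow> f x - g x = 0"
  proof (rule fundamental_lemma_vector[OF U locally_integrable_on_diff[OF f g]])
    fix \<phi> assume \<phi>: "\<phi> \<in> test_functions U"
    show "(LINT x|lebesgue_on U. \<phi> x *\<^sub>R (f x - g x)) = 0"
      using test_function_integrable(1)[OF \<phi> U f] test_function_integrable(1)[OF \<phi> U g] eq[OF \<phi>]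
      by (simp add: scaleR_diff_right)
  qed
  then show ?thesis by simp
qed

lemma has_weak_grad_unique:
  assumes "open U" "has_weak_grad U f G" "has_weak_grad U f G'"
  shows "AE x in lebesgue. x \<in> U \<longrightarrow> G x = G' x"
  using assms by (intro AE_eq_if_weakly_equal) (auto simp: has_weak_grad_def)

lemma has_weak_div_unique:
  assumes "open U" "has_weak_div U v g" "has_weak_div U v g'"
  shows "AE x in lebesgue. x \<in> U \<longrightarrow> g x = g' x"
  using assms by (intro AE_eq_if_weakly_equal) (auto simp: has_weak_div_def mult.commute)

lemma weak_grad_works: "has_weak_grad U f G \<Longrightarrow> has_weak_grad U f (weak_grad U f)"
  unfolding weak_grad_def by (rule someI[of "has_weak_grad U f"])

lemma weak_div_works: "has_weak_div U v g \<Longrightarrow> has_weak_div U v (weak_div U v)"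
  unfolding weak_div_def by (rule someI[of "has_weak_div U v"])

lemma weak_grad_AE:
  "open U \<Longrightarrow> has_weak_grad U f G \<Longrightarrow> AE x in lebesgue. x \<in> U \<longrightarrow> weak_grad U f x = G x"
  using has_weak_grad_unique weak_grad_works by blast

lemma weak_div_AE:
  "open U \<Longrightarrow> has_weak_div U v g \<Longrightarrow> AE x in lebesgue. x \<in> U \<longrightarrow> weak_div U v x = g x"
  using has_weak_div_unique weak_div_works by blast

lemma integral_lebesgue_on_support:
  fixes F :: "'a::euclidean_space \<Rightarrow> 'b::euclidean_space"
  assumes "U \<in> sets lebesgue" "V \<in> sets lebesgue" "\<And>x. x \<notin> U \<inter> V \<Longrightarrow> F x = 0"
  shows "integral\<^sup>L (lebesgue_on U) F = integral\<^sup>L (lebesgue_on V) F"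
proof -
  have "indicator U x *\<^sub>R F x = indicator V x *\<^sub>R F x" for x
    using assms(3)[of x] by (auto simp: indicator_def)
  then show ?thesis
    unfolding lebesgue_on_integral_eq(1)[OF assms(1)] lebesgue_on_integral_eq(1)[OF assms(2)] set_lebesgue_integral_def
    by (simp only:)
qed

lemma has_weak_grad_subset:
  assumes "has_weak_grad U f G" "V \<subseteq> U" "open V" "open U"
  shows "has_weak_grad V f G"
  unfolding has_weak_grad_def
proof (intro conjI ballI)
  show "locally_integrable_on f V" "locally_integrable_on G V"
    using assms unfolding has_weak_grad_def locally_integrable_on_def by blast+
  fix \<phi> assume \<phi>: "\<phi> \<in> test_functions V"
  obtain C where C: "compact C" "C \<subseteq> V" "\<And>x. x \<notin> C \<Longrightarrow> \<phi> x = 0" "\<And>x. x \<notin> C \<Longrightarrow> grad \<phi> x = 0"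
    using test_function_support[OF \<phi>] by blast
  have "(LINT x|lebesgue_on V. f x *\<^sub>R grad \<phi> x) = (LINT x|lebesgue_on U. f x *\<^sub>R grad \<phi> x)"
    "(LINT x|lebesgue_on V. \<phi> x *\<^sub>R G x) = (LINT x|lebesgue_on U. \<phi> x *\<^sub>R G x)"
    using C assms by (intro integral_lebesgue_on_support; force)+
  then show "(LINT x|lebesgue_on V. f x *\<^sub>R grad \<phi> x) = - (LINT x|lebesgue_on V. \<phi> x *\<^sub>R G x)"
    using assms(1) \<phi> test_functions_mono[OF assms(2)] by (auto simp: has_weak_grad_def)
qed

lemma has_weak_grad_diff:
  assumes "has_weak_grad U f F" "has_weak_grad U g G" "open U"
  shows "has_weak_grad U (\<lambda>x. f x - g x) (\<lambda>x. F x - G x)"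
  unfolding has_weak_grad_def
proof (intro conjI ballI locally_integrable_on_diff)
  fix \<phi> assume \<phi>: "\<phi> \<in> test_functions U"
  note i = test_function_integrable(1,2)[OF \<phi> assms(3)]
  have "integrable (lebesgue_on U) (\<lambda>x. \<phi> x *\<^sub>R F x)" "integrable (lebesgue_on U) (\<lambda>x. \<phi> x *\<^sub>R G x)"
    "integrable (lebesgue_on U) (\<lambda>x. f x *\<^sub>R grad \<phi> x)" "integrable (lebesgue_on U) (\<lambda>x. g x *\<^sub>R grad \<phi> x)"
    using assms by (auto simp: has_weak_grad_def intro!: i)
  then show "(LINT x|lebesgue_on U. (f x - g x) *\<^sub>R grad \<phi> x) = - (LINT x|lebesgue_on U. \<phi> x *\<^sub>R (F x - G x))"
    using assms(1,2) \<phi> by (simp add: has_weak_grad_def scaleR_diff_right scaleR_diff_left)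
qed (use assms in \<open>auto simp: has_weak_grad_def\<close>)

lemma locally_integrable_on_continuous:
  fixes f :: "'a::euclidean_space \<Rightarrow> 'b::euclidean_space"
  assumes "continuous_on UNIV f"
  shows "locally_integrable_on f U"
  unfolding locally_integrable_on_def
proof (intro allI impI)
  fix C assume C: "compact C \<and> C \<subseteq> U"
  then have "set_integrable lborel C f"
    by (intro set_integrable_compact) (auto intro: continuous_on_subset[OF assms])
  then show "f absolutely_integrable_on C"
    using assms C unfolding set_integrable_def
    by (subst integrable_completion) (auto intro!: borel_measurable_scaleR borel_measurable_continuous_onI simp: borel_compact)
qed

lemma integral_lebesgue_on_lborel:
  fixes F :: "'a::euclidean_space \<Rightarrow> 'b::euclidean_space"
  assumes "F \<in> borel_measurable borel" "S \<in> sets borel"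
  shows "integral\<^sup>L (lebesgue_on S) F = (LINT x:S|lborel. F x)"
  using assms by (subst lebesgue_on_integral_eq)
    (auto simp: set_lebesgue_integral_def intro!: integral_completion)

text \<open>By the product rule this is \<open>integral_grad_compact_support\<close> for the product
  of \<open>u\<close> with the test function.\<close>

lemma smooth_has_weak_grad:
  assumes u: "smooth u" and U: "open U"
  shows "has_weak_grad U u (grad u)"
  unfolding has_weak_grad_def
proof (intro conjI ballI)
  note cu = C1_continuous[OF smooth_C1[OF u]]
  show lu: "locally_integrable_on u U" "locally_integrable_on (grad u) U"
    by (intro locally_integrable_on_continuous cu)+
  fix \<phi> assume \<phi>: "\<phi> \<in> test_functions U"
  obtain C where C: "compact C" "C \<subseteq> U" "\<And>x. x \<notin> C \<Longrightarrow> \<phi> x = 0" "\<And>x. x \<notin> C \<Longrightarrow> grad \<phi> x = 0"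
    using test_function_support[OF \<phi>] by blast
  note m = C1_mult[OF smooth_C1[OF u] test_function_C1[OF \<phi>]]
  have "(LINT x|lebesgue_on U. u x *\<^sub>R grad \<phi> x) + (LINT x|lebesgue_on U. \<phi> x *\<^sub>R grad u x)
      = (LINT x|lebesgue_on U. u x *\<^sub>R grad \<phi> x + \<phi> x *\<^sub>R grad u x)"
    by (intro Bochner_Integration.integral_add[symmetric] test_function_integrable[OF \<phi> U] lu)
  also have "\<dots> = (LINT x|lebesgue_on UNIV. u x *\<^sub>R grad \<phi> x + \<phi> x *\<^sub>R grad u x)"
    using C U by (intro integral_lebesgue_on_support) (auto simp: subset_eq)
  also have "\<dots> = (LINT x|lborel. grad (\<lambda>x. u x * \<phi> x) x)"
    using C1_measurable(2)[OF m(1)] by (subst integral_lebesgue_on_lborel) (simp_all add: m(2) set_lebesgue_integral_def)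
  also have "\<dots> = 0"
    by (rule integral_grad_compact_support[OF m(1) C(1)]) (simp add: C)
  finally show "(LINT x|lebesgue_on U. u x *\<^sub>R grad \<phi> x) = - (LINT x|lebesgue_on U. \<phi> x *\<^sub>R grad u x)"
    by (simp add: eq_neg_iff_add_eq_0)
qed

section \<open>Lebesgue spaces\<close>

lemma Lspace_2_iff:
  "f \<in> Lspace 2 U \<longleftrightarrow> f \<in> borel_measurable (lebesgue_on U) \<and> integrable (lebesgue_on U) (\<lambda>x. (norm (f x))\<^sup>2)"
  by (simp add: Lspace_def)

lemma Lnorm_nonneg: "0 \<le> Lnorm p U f"
  by (simp add: Lnorm_def)

lemma Lnorm_2_eq: "Lnorm 2 U f = sqrt (LINT x|lebesgue_on U. (norm (f x))\<^sup>2)"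
  by (simp add: Lnorm_def powr_half_sqrt)

lemma Lnorm_2_sq: "(Lnorm 2 U f)\<^sup>2 = (LINT x|lebesgue_on U. (norm (f x))\<^sup>2)"
  by (simp add: Lnorm_2_eq)

lemma norm_add_sq_le: "(norm (a + b))\<^sup>2 \<le> 2 * (norm a)\<^sup>2 + 2 * (norm b)\<^sup>2"
  for a b :: "'b::real_normed_vector"
proof -
  have "(norm (a + b))\<^sup>2 \<le> (norm a + norm b)\<^sup>2" by (intro power_mono norm_triangle_ineq) auto
  also have "\<dots> \<le> 2 * (norm a)\<^sup>2 + 2 * (norm b)\<^sup>2"
    using sum_squares_bound[of "norm a" "norm b"] by (simp add: power2_sum)
  finally show ?thesis .
qed

lemma Lspace_2_bound:
  fixes f :: "'a::euclidean_space \<Rightarrow> 'b::euclidean_space"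
  assumes "f \<in> borel_measurable (lebesgue_on U)" "integrable (lebesgue_on U) g" "\<And>x. (norm (f x))\<^sup>2 \<le> g x"
  shows "f \<in> Lspace 2 U"
proof -
  have "integrable (lebesgue_on U) (\<lambda>x. (norm (f x))\<^sup>2)"
  proof (rule Bochner_Integration.integrable_bound[OF assms(2)])
    show "AE x in lebesgue_on U. norm ((norm (f x))\<^sup>2) \<le> norm (g x)"
      using assms(3) by (intro AE_I2) (auto intro: order_trans[OF _ abs_ge_self])
  qed (use assms(1) in auto)
  with assms(1) show ?thesis by (simp add: Lspace_2_iff)
qed

lemma Lspace_2_add: "f \<in> Lspace 2 U \<Longrightarrow> g \<in> Lspace 2 U \<Longrightarrow> (\<lambda>x. f x + g x) \<in> Lspace 2 U"
  by (rule Lspace_2_bound[where g="\<lambda>x. 2 * (norm (f x))\<^sup>2 + 2 * (norm (g x))\<^sup>2"])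
    (auto simp: Lspace_2_iff intro!: norm_add_sq_le)

lemma Lspace_2_minus: "f \<in> Lspace 2 U \<Longrightarrow> (\<lambda>x. - f x) \<in> Lspace 2 U"
  by (auto simp: Lspace_2_iff)

lemma Lspace_2_diff: "f \<in> Lspace 2 U \<Longrightarrow> g \<in> Lspace 2 U \<Longrightarrow> (\<lambda>x. f x - g x) \<in> Lspace 2 U"
  using Lspace_2_add[OF _ Lspace_2_minus] by force

lemma Lspace_2_component: "f \<in> Lspace 2 U \<Longrightarrow> i \<in> Basis \<Longrightarrow> (\<lambda>x. f x \<bullet> i) \<in> Lspace 2 U"
  by (rule Lspace_2_bound[where g="\<lambda>x. (norm (f x))\<^sup>2"])
    (auto simp: Lspace_2_iff abs_le_square_iff[symmetric] intro!: Basis_le_norm)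

lemma measurable_lebesgue_on_subset:
  assumes "f \<in> borel_measurable (lebesgue_on U)" "V \<subseteq> U"
  shows "f \<in> borel_measurable (lebesgue_on V)"
  using measurable_restrict_mono[OF assms] .

lemma integrable_lebesgue_on_subset:
  fixes f :: "'a::euclidean_space \<Rightarrow> 'b::euclidean_space"
  assumes "integrable (lebesgue_on U) f" "V \<subseteq> U" "V \<in> sets lebesgue" "U \<in> sets lebesgue"
  shows "integrable (lebesgue_on V) f"
  using assms by (auto simp: lebesgue_on_integral_eq intro: set_integrable_subset)

lemma Lspace_subset:
  assumes "f \<in> Lspace p U" "V \<subseteq> U" "V \<in> sets lebesgue" "U \<in> sets lebesgue"
  shows "f \<in> Lspace p V"
  using assms by (auto simp: Lspace_def intro: measurable_lebesgue_on_subset integrable_lebesgue_on_subset)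

lemma bounded_in_Lspace_2:
  fixes f :: "'a::euclidean_space \<Rightarrow> 'b::euclidean_space"
  assumes "f \<in> borel_measurable (lebesgue_on U)" "U \<in> lmeasurable" "\<And>x. x \<in> U \<Longrightarrow> norm (f x) \<le> M"
  shows "f \<in> Lspace 2 U"
proof -
  have "integrable (lebesgue_on U) (\<lambda>x. (norm (f x))\<^sup>2)"
  proof (rule Bochner_Integration.integrable_bound)
    show "integrable (lebesgue_on U) (\<lambda>x. M\<^sup>2)"
      by (rule finite_measure.integrable_const[OF finite_measure_lebesgue_on[OF assms(2)]])
    show "AE x in lebesgue_on U. norm ((norm (f x))\<^sup>2) \<le> norm (M\<^sup>2)"
      using assms(2,3) by (intro AE_I2) (auto intro!: power_mono)
  qed (use assms(1) in auto)
  with assms(1) show ?thesis by (simp add: Lspace_2_iff)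
qed

text \<open>Cauchy-Schwarz with the constant 2, obtained by integrating a weighted Young inequality
  and then choosing the weight; the 2 only enters explicit constants.\<close>

lemma integral_inner_bound:
  fixes f g :: "'a::euclidean_space \<Rightarrow> 'b::euclidean_space"
  assumes f: "f \<in> Lspace 2 U" and g: "g \<in> Lspace 2 U"
  shows "integrable (lebesgue_on U) (\<lambda>x. f x \<bullet> g x)"
    and "\<bar>LINT x|lebesgue_on U. f x \<bullet> g x\<bar> \<le> 2 * Lnorm 2 U f * Lnorm 2 U g"
proof -
  let ?M = "lebesgue_on U"
  have fi: "integrable ?M (\<lambda>x. (norm (f x))\<^sup>2)" and gi: "integrable ?M (\<lambda>x. (norm (g x))\<^sup>2)"
    using f g by (auto simp: Lspace_2_iff)
  have young: "\<bar>a \<bullet> b\<bar> \<le> t * (norm a)\<^sup>2 + (norm b)\<^sup>2 / t" if "0 < t" for a b :: 'b and t :: real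
  proof -
    have "norm a * norm b \<le> t * (norm a)\<^sup>2 + (norm b)\<^sup>2 / t"
    proof (cases "norm b \<le> t * norm a")
      case True
      then have "norm a * norm b \<le> norm a * (t * norm a)" by (intro mult_left_mono) auto
      then show ?thesis using that by (simp add: power2_eq_square mult_ac add_increasing2)
    next
      case False
      then have "norm a \<le> norm b / t" using that by (simp add: field_simps)
      then have "norm a * norm b \<le> norm b / t * norm b" by (intro mult_right_mono) auto
      then show ?thesis using that by (simp add: power2_eq_square add_increasing)
    qed
    then show ?thesis using Cauchy_Schwarz_ineq2[of a b] by linarith
  qed
  show int: "integrable ?M (\<lambda>x. f x \<bullet> g x)"
  proof (rule Bochner_Integration.integrable_bound)
    show "integrable ?M (\<lambda>x. 1 * (norm (f x))\<^sup>2 + (norm (g x))\<^sup>2 / 1)" using fi gi by simp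
    show "(\<lambda>x. f x \<bullet> g x) \<in> borel_measurable ?M" using f g by (auto simp: Lspace_2_iff)
    show "AE x in ?M. norm (f x \<bullet> g x) \<le> norm (1 * (norm (f x))\<^sup>2 + (norm (g x))\<^sup>2 / 1)"
      using young[of 1] by (intro AE_I2) (auto intro: order_trans[OF _ abs_ge_self])
  qed
  let ?A = "Lnorm 2 U f" and ?B = "Lnorm 2 U g" and ?I = "\<bar>LINT x|lebesgue_on U. f x \<bullet> g x\<bar>"
  have t: "?I \<le> t * ?A\<^sup>2 + ?B\<^sup>2 / t" if "0 < t" for t
  proof -
    have "?I \<le> (LINT x|?M. \<bar>f x \<bullet> g x\<bar>)" by (rule integral_abs_bound)
    also have "\<dots> \<le> (LINT x|?M. t * (norm (f x))\<^sup>2 + (norm (g x))\<^sup>2 / t)"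
      using int fi gi young[OF that] by (intro integral_mono) auto
    also have "\<dots> = t * ?A\<^sup>2 + ?B\<^sup>2 / t" using fi gi by (simp add: Lnorm_2_sq)
    finally show ?thesis .
  qed
  have AB: "0 \<le> ?A" "0 \<le> ?B" by (auto simp: Lnorm_nonneg)
  \<comment> \<open>The right weight is the quotient of the norms, but this may be 0 or undefined.
    Adding \<open>e\<close> to both norms and letting \<open>e\<close> tend to 0 covers these cases
    as well.\<close>
  have lim: "((\<lambda>e. (?B + e) / (?A + e) * ?A\<^sup>2 + ?B\<^sup>2 / ((?B + e) / (?A + e))) \<longlongrightarrow> 2 * ?A * ?B) (at_right 0)"
  proof -
    have 1: "((\<lambda>e. (?B + e) / (?A + e) * ?A\<^sup>2) \<longlongrightarrow> ?A * ?B) (at_right 0)"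
    proof (cases "?A = 0")
      case False
      then have "((\<lambda>e. (?B + e) / (?A + e) * ?A\<^sup>2) \<longlongrightarrow> (?B + 0) / (?A + 0) * ?A\<^sup>2) (at_right 0)"
        by (intro tendsto_intros) auto
      then show ?thesis using False by (simp add: power2_eq_square mult.commute)
    qed simp
    have 2: "((\<lambda>e. ?B\<^sup>2 / ((?B + e) / (?A + e))) \<longlongrightarrow> ?A * ?B) (at_right 0)"
    proof (cases "?B = 0")
      case False
      then have "((\<lambda>e. ?B\<^sup>2 * (?A + e) / (?B + e)) \<longlongrightarrow> ?B\<^sup>2 * (?A + 0) / (?B + 0)) (at_right 0)"
        by (intro tendsto_intros) auto
      then show ?thesis using False by (simp add: power2_eq_square mult.commute)
    qed simp
    show ?thesis using tendsto_add[OF 1 2] by (simp add: mult.assoc)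
  qed
  show "?I \<le> 2 * ?A * ?B"
  proof (rule tendsto_lowerbound[OF lim])
    show "\<forall>\<^sub>F e in at_right 0. ?I \<le> (?B + e) / (?A + e) * ?A\<^sup>2 + ?B\<^sup>2 / ((?B + e) / (?A + e))"
      unfolding eventually_at_right_field
    proof (intro exI[of _ 1] conjI allI impI)
      fix e :: real assume "0 < e"
      then show "?I \<le> (?B + e) / (?A + e) * ?A\<^sup>2 + ?B\<^sup>2 / ((?B + e) / (?A + e))"
        using AB by (intro t divide_pos_pos add_nonneg_pos)
    qed simp
  qed simp
qed

text \<open>Hoelder against the function 1, up to the factor 2. The pointwise inequality a \<le> t +
  t^(1-q) a^q is integrated; with \<open>N\<close> the integral of the q-th power and m the measure
  of \<open>U\<close>, the choice t = (N/m)^(1/q) makes both terms equal.\<close>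

lemma integral_norm_le_Lnorm:
  fixes f :: "'a::euclidean_space \<Rightarrow> 'b::euclidean_space"
  assumes f: "f \<in> Lspace q U" and q: "1 \<le> q" and U: "U \<in> lmeasurable" and m: "0 < measure lebesgue U"
  shows "integrable (lebesgue_on U) f"
    and "(LINT x|lebesgue_on U. norm (f x)) \<le> 2 * measure lebesgue U powr (1 - 1 / q) * Lnorm q U f"
proof -
  let ?M = "lebesgue_on U" and ?m = "measure lebesgue U"
  have fi: "integrable ?M (\<lambda>x. norm (f x) powr q)" and fm: "f \<in> borel_measurable ?M"
    using f by (auto simp: Lspace_def)
  have ci: "integrable ?M (\<lambda>x. c)" for c :: real
    by (rule finite_measure.integrable_const[OF finite_measure_lebesgue_on[OF U]])
  have measure_U: "measure ?M U = ?m"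
    using U by (intro measure_restrict_space) (auto simp: fmeasurableD)
  have young: "a \<le> t + t powr (1 - q) * a powr q" if "0 < t" "0 \<le> a" for a t :: real
  proof (cases "a \<le> t")
    case True
    then show ?thesis by (simp add: add_increasing2)
  next
    case False
    then have "a powr (1 - q) \<le> t powr (1 - q)" using that q by (intro powr_mono2') auto
    then have "a powr (1 - q) * a powr q \<le> t powr (1 - q) * a powr q" by (intro mult_right_mono) auto
    moreover have "a powr (1 - q) * a powr q = a" using False that by (simp flip: powr_add)
    ultimately show ?thesis using that by simp
  qed
  show int: "integrable ?M f"
  proof (rule Bochner_Integration.integrable_bound[OF _ fm])
    show "integrable ?M (\<lambda>x. 1 + 1 powr (1 - q) * norm (f x) powr q)" using fi ci by simp
    show "AE x in ?M. norm (f x) \<le> norm (1 + 1 powr (1 - q) * norm (f x) powr q)"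
      using young[of 1] by (intro AE_I2) (auto intro: order_trans[OF _ abs_ge_self])
  qed
  define N where "N = (LINT x|?M. norm (f x) powr q)"
  have N: "0 \<le> N" unfolding N_def by (rule Bochner_Integration.integral_nonneg) auto
  have t: "(LINT x|?M. norm (f x)) \<le> t * ?m + t powr (1 - q) * N" if "0 < t" for t
  proof -
    have "(LINT x|?M. norm (f x)) \<le> (LINT x|?M. t + t powr (1 - q) * norm (f x) powr q)"
      using int fi ci young[OF that] by (intro integral_mono) auto
    also have "\<dots> = t * ?m + t powr (1 - q) * N" using fi ci by (simp add: N_def measure_U)
    finally show ?thesis .
  qed
  show "(LINT x|?M. norm (f x)) \<le> 2 * ?m powr (1 - 1 / q) * Lnorm q U f"
  proof (cases "N = 0")
    case True
    then have "AE x in ?M. norm (f x) powr q = 0"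
      using fi by (subst (asm) N_def) (simp add: integral_nonneg_eq_0_iff_AE)
    then have "AE x in ?M. norm (f x) = 0" by eventually_elim auto
    then have "(LINT x|?M. norm (f x)) = 0" by (rule integral_eq_zero_AE)
    then show ?thesis by (simp add: Lnorm_nonneg)
  next
    case False
    then have N: "0 < N" using N by simp
    define t where "t = (N / ?m) powr (1 / q)"
    have "0 < t" using N m by (simp add: t_def)
    have 1: "t * ?m = ?m powr (1 - 1 / q) * N powr (1 / q)"
      using N m by (simp add: t_def powr_divide powr_diff)
    have "t powr (1 - q) * N = (N / ?m) powr (1 / q - 1) * N"
      using q by (simp add: t_def powr_powr right_diff_distrib)
    also have "\<dots> = ?m powr (1 - 1 / q) * N powr (1 / q)"
      using N m by (simp add: powr_divide powr_diff field_simps)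
    finally show ?thesis using t[OF \<open>0 < t\<close>] 1 by (simp add: Lnorm_def N_def)
  qed
qed

section \<open>A Poincare inequality for fractional Sobolev spaces\<close>

lemma sigma_finite_lebesgue_on:
  fixes U :: "'a::euclidean_space set"
  assumes "U \<in> sets lebesgue"
  shows "sigma_finite_measure (lebesgue_on U)"
proof (rule sigma_finite_measure_restrict_space)
  obtain A :: "'a set set" where A: "countable A" "A \<subseteq> sets lborel" "\<Union>A = space lborel" "\<forall>a\<in>A. emeasure lborel a \<noteq> \<infinity>"
    using lborel.sigma_finite_countable by metis
  show "sigma_finite_measure (lebesgue :: 'a measure)"
  proof
    show "\<exists>A. countable A \<and> A \<subseteq> sets lebesgue \<and> \<Union>A = space lebesgue \<and> (\<forall>a\<in>A. emeasure (lebesgue :: 'a measure) a \<noteq> \<infinity>)"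
      by (rule exI[of _ A]) (use A in \<open>auto simp: subset_eq\<close>)
  qed
qed (use assms in simp)

lemma measurable_lebesgue_on_AE:
  fixes f g :: "'a::euclidean_space \<Rightarrow> 'b::euclidean_space"
  assumes f: "f \<in> borel_measurable (lebesgue_on U)" and U: "U \<in> sets lebesgue"
    and eq: "AE x in lebesgue. x \<in> U \<longrightarrow> f x = g x"
  shows "g \<in> borel_measurable (lebesgue_on U)"
proof -
  have "(\<lambda>x. indicator U x *\<^sub>R g x) \<in> borel_measurable lebesgue"
  proof (rule borel_measurable_AE)
    show "(\<lambda>x. indicator U x *\<^sub>R f x) \<in> borel_measurable lebesgue"
      using f U by (subst (asm) borel_measurable_restrict_space_iff) auto
    show "AE x in lebesgue. indicator U x *\<^sub>R f x = indicator U x *\<^sub>R g x"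
      using eq by eventually_elim (auto simp: indicator_def)
  qed
  then show ?thesis using U by (subst borel_measurable_restrict_space_iff) auto
qed

lemma AE_lebesgue_on_iff:
  "U \<in> sets lebesgue \<Longrightarrow> (AE x in lebesgue_on U. P x) \<longleftrightarrow> (AE x in lebesgue. x \<in> U \<longrightarrow> P x)"
  by (subst AE_restrict_space_iff) auto

lemma Lspace_AE:
  assumes f: "f \<in> Lspace p U" and U: "U \<in> sets lebesgue" and eq: "AE x in lebesgue. x \<in> U \<longrightarrow> f x = g x"
  shows "g \<in> Lspace p U"
proof -
  have m: "g \<in> borel_measurable (lebesgue_on U)"
    by (rule measurable_lebesgue_on_AE[OF _ U eq]) (use f in \<open>simp add: Lspace_def\<close>)
  moreover have "integrable (lebesgue_on U) (\<lambda>x. norm (g x) powr p)"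
  proof (rule integrable_cong_AE_imp)
    show "integrable (lebesgue_on U) (\<lambda>x. norm (f x) powr p)" using f by (simp add: Lspace_def)
    show "AE x in lebesgue_on U. norm (f x) powr p = norm (g x) powr p"
      unfolding AE_lebesgue_on_iff[OF U] using eq by eventually_elim auto
  qed (use m in auto)
  ultimately show ?thesis by (simp add: Lspace_def)
qed

lemma Lnorm_AE:
  assumes f: "f \<in> Lspace p U" and U: "U \<in> sets lebesgue" and eq: "AE x in lebesgue. x \<in> U \<longrightarrow> f x = g x"
  shows "Lnorm p U g = Lnorm p U f"
proof -
  have "(LINT x|lebesgue_on U. norm (g x) powr p) = (LINT x|lebesgue_on U. norm (f x) powr p)"
  proof (rule integral_cong_AE)
    show "AE x in lebesgue_on U. norm (g x) powr p = norm (f x) powr p"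
      unfolding AE_lebesgue_on_iff[OF U] using eq by eventually_elim auto
  qed (use f Lspace_AE[OF assms] in \<open>auto simp: Lspace_def\<close>)
  then show ?thesis by (simp add: Lnorm_def)
qed

text \<open>Averaging over \<open>y\<close> shows that some value \<open>f y\<close> is a good constant approximation of \<open>f\<close>.\<close>

lemma ex_constant_approximation:
  fixes f :: "'a::euclidean_space \<Rightarrow> 'b::euclidean_space"
  assumes f: "f \<in> Lspace 2 U" and U: "U \<in> lmeasurable" and m: "0 < measure lebesgue U"
    and M: "(\<integral>\<^sup>+y. (\<integral>\<^sup>+x. ennreal ((norm (f x - f y))\<^sup>2) \<partial>lebesgue_on U) \<partial>lebesgue_on U) \<le> ennreal M"
    and "0 \<le> M"
  obtains a where "(Lnorm 2 U (\<lambda>x. f x - a))\<^sup>2 \<le> M / measure lebesgue U"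
proof -
  let ?L = "lebesgue_on U" and ?m = "measure lebesgue U"
  interpret sigma_finite_measure ?L using U by (intro sigma_finite_lebesgue_on) auto
  interpret pair_sigma_finite ?L ?L ..
  have [measurable]: "f \<in> borel_measurable ?L" using f by (simp add: Lspace_2_iff)
  define I where "I y = (\<integral>\<^sup>+x. ennreal ((norm (f x - f y))\<^sup>2) \<partial>?L)" for y
  have [measurable]: "I \<in> borel_measurable ?L"
    unfolding I_def by measurable
  have em: "emeasure ?L (space ?L) = ennreal ?m"
    using U by (simp add: emeasure_restrict_space fmeasurableD emeasure_eq_measure2)
  have "\<exists>y\<in>U. I y \<le> ennreal (M / ?m)"
  proof (rule ccontr)
    assume "\<not> ?thesis"
    then have less: "ennreal (M / ?m) < I y" if "y \<in> U" for y using that by (auto simp: not_le)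
    have "(\<integral>\<^sup>+y. ennreal (M / ?m) \<partial>?L) = ennreal M"
      using em m \<open>0 \<le> M\<close> by (simp flip: ennreal_mult)
    moreover have "(\<integral>\<^sup>+y. ennreal (M / ?m) \<partial>?L) < (\<integral>\<^sup>+y. I y \<partial>?L)"
    proof (rule nn_integral_less)
      show "(\<integral>\<^sup>+y. ennreal (M / ?m) \<partial>?L) \<noteq> \<infinity>" using calculation by simp
      show "AE y in ?L. ennreal (M / ?m) \<le> I y" using less by (intro AE_I2) (auto intro: less_imp_le)
      show "\<not> (AE y in ?L. I y \<le> ennreal (M / ?m))"
      proof
        assume "AE y in ?L. I y \<le> ennreal (M / ?m)"
        moreover have "AE y in ?L. ennreal (M / ?m) < I y" using less by (intro AE_I2) auto
        ultimately have "AE y in ?L. False" by eventually_elim (simp add: not_le[symmetric])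
        then have "emeasure ?L (space ?L) = 0" by (simp add: AE_iff_null null_setsD1)
        then show False using em m by simp
      qed
    qed auto
    ultimately show False using M by (simp add: I_def[symmetric])
  qed
  then obtain y where y: "I y \<le> ennreal (M / ?m)" by blast
  have "(LINT x|?L. (norm (f x - f y))\<^sup>2) \<le> M / ?m"
  proof -
    have "(LINT x|?L. (norm (f x - f y))\<^sup>2) = enn2real (I y)"
      unfolding I_def by (intro integral_eq_nn_integral) auto
    also have "\<dots> \<le> M / ?m" using y m \<open>0 \<le> M\<close> by (intro enn2real_leI) auto
    finally show ?thesis .
  qed
  then show ?thesis using that[of "f y"] by (simp add: Lnorm_2_sq)
qed

text \<open>Distances in \<open>U\<close> are at most \<open>h\<close>, so a squared increment is at
  most h^(d + 2r) times the kernel.\<close>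

lemma slobodeckij_double_integral:
  fixes f :: "'a::euclidean_space \<Rightarrow> 'b::euclidean_space"
  assumes f: "f \<in> sobolev r D" and r: "r \<noteq> 1" "0 < r" and U: "open U" "U \<subseteq> D" "open D"
    and h: "\<And>x y. x \<in> U \<Longrightarrow> y \<in> U \<Longrightarrow> norm (x - y) \<le> h"
  shows "(\<integral>\<^sup>+y. (\<integral>\<^sup>+x. ennreal ((norm (f x - f y))\<^sup>2) \<partial>lebesgue_on U) \<partial>lebesgue_on U)
    \<le> ennreal (h powr (real DIM('a) + 2 * r) * (sobolev_seminorm r U f)\<^sup>2)"
proof -
  let ?k = "slobodeckij_kernel r f" and ?e = "real DIM('a) + 2 * r"
  have DU: "U \<in> sets lebesgue" "D \<in> sets lebesgue" using U by auto
  interpret LU: sigma_finite_measure "lebesgue_on U" by (rule sigma_finite_lebesgue_on[OF DU(1)])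
  interpret LD: sigma_finite_measure "lebesgue_on D" by (rule sigma_finite_lebesgue_on[OF DU(2)])
  interpret PU: pair_sigma_finite "lebesgue_on U" "lebesgue_on U" ..
  have fD: "f \<in> borel_measurable (lebesgue_on D)" and kD: "integrable (lebesgue_on D \<Otimes>\<^sub>M lebesgue_on D) ?k"
    using f r by (auto simp: sobolev_def Lspace_2_iff)
  have [measurable]: "f \<in> borel_measurable (lebesgue_on U)"
    by (rule measurable_lebesgue_on_subset[OF fD U(2)])
  have id [measurable]: "(\<lambda>x. x) \<in> borel_measurable (lebesgue_on U)"
    by (rule measurable_restrict_space1) (auto intro!: measurable_completion)
  have km [measurable]: "?k \<in> borel_measurable (lebesgue_on U \<Otimes>\<^sub>M lebesgue_on U)"
    unfolding slobodeckij_kernel_def by measurable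
  have kpos: "0 \<le> ?k p" for p by (auto simp: slobodeckij_kernel_def split: prod.split)
  \<comment> \<open>The seminorm on \<open>U\<close> is a Bochner integral, which is 0 by convention
    for a non-integrable kernel. Finiteness, inherited from \<open>D\<close>, rules this
    out.\<close>
  have kUD: "(\<integral>\<^sup>+p. ennreal (?k p) \<partial>(lebesgue_on U \<Otimes>\<^sub>M lebesgue_on U)) < \<infinity>"
  proof -
    have "(\<integral>\<^sup>+p. ennreal (?k p) \<partial>(lebesgue_on U \<Otimes>\<^sub>M lebesgue_on U))
        = (\<integral>\<^sup>+x. (\<integral>\<^sup>+y. ennreal (?k (x, y)) \<partial>lebesgue_on U) \<partial>lebesgue_on U)"
      by (rule LU.nn_integral_fst[symmetric]) measurable
    also have "\<dots> = (\<integral>\<^sup>+x. (\<integral>\<^sup>+y. ennreal (?k (x, y)) * indicator U y \<partial>lebesgue) * indicator U x \<partial>lebesgue)"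
      using DU by (simp add: nn_integral_restrict_space)
    also have "\<dots> \<le> (\<integral>\<^sup>+x. (\<integral>\<^sup>+y. ennreal (?k (x, y)) * indicator D y \<partial>lebesgue) * indicator D x \<partial>lebesgue)"
      using U(2) by (intro nn_integral_mono mult_mono) (auto simp: indicator_def)
    also have "\<dots> = (\<integral>\<^sup>+x. (\<integral>\<^sup>+y. ennreal (?k (x, y)) \<partial>lebesgue_on D) \<partial>lebesgue_on D)"
      using DU by (simp add: nn_integral_restrict_space)
    also have "\<dots> = (\<integral>\<^sup>+p. ennreal (?k p) \<partial>(lebesgue_on D \<Otimes>\<^sub>M lebesgue_on D))"
      using kD by (intro LD.nn_integral_fst) auto
    also have "\<dots> < \<infinity>" using kD kpos by (simp add: integrable_iff_bounded)
    finally show ?thesis .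
  qed
  have "(\<integral>\<^sup>+y. (\<integral>\<^sup>+x. ennreal ((norm (f x - f y))\<^sup>2) \<partial>lebesgue_on U) \<partial>lebesgue_on U)
      \<le> (\<integral>\<^sup>+y. (\<integral>\<^sup>+x. ennreal (h powr ?e) * ennreal (?k (y, x)) \<partial>lebesgue_on U) \<partial>lebesgue_on U)"
  proof (intro nn_integral_mono)
    fix y x assume "y \<in> space (lebesgue_on U)" "x \<in> space (lebesgue_on U)"
    then have xy: "norm (y - x) \<le> h" using h by simp
    have "(norm (f x - f y))\<^sup>2 \<le> h powr ?e * ?k (y, x)"
    proof (cases "x = y")
      case False
      have "norm (y - x) powr ?e \<le> h powr ?e"
        using xy r by (intro powr_mono2) auto
      then have "(norm (f y - f x))\<^sup>2 * norm (y - x) powr ?e \<le> (norm (f y - f x))\<^sup>2 * h powr ?e"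
        by (intro mult_left_mono) auto
      then show ?thesis using False by (simp add: slobodeckij_kernel_def field_simps norm_minus_commute)
    qed (simp add: slobodeckij_kernel_def)
    then show "ennreal ((norm (f x - f y))\<^sup>2) \<le> ennreal (h powr ?e) * ennreal (?k (y, x))"
      by (simp flip: ennreal_mult'' add: kpos ennreal_leI)
  qed
  also have "\<dots> = (\<integral>\<^sup>+y. ennreal (h powr ?e) * (\<integral>\<^sup>+x. ennreal (?k (y, x)) \<partial>lebesgue_on U) \<partial>lebesgue_on U)"
    by (intro nn_integral_cong nn_integral_cmult) measurable
  also have "\<dots> = ennreal (h powr ?e) * (\<integral>\<^sup>+y. (\<integral>\<^sup>+x. ennreal (?k (y, x)) \<partial>lebesgue_on U) \<partial>lebesgue_on U)"
    by (intro nn_integral_cmult LU.borel_measurable_nn_integral) measurable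
  also have "(\<integral>\<^sup>+y. (\<integral>\<^sup>+x. ennreal (?k (y, x)) \<partial>lebesgue_on U) \<partial>lebesgue_on U)
      = (\<integral>\<^sup>+p. ennreal (?k p) \<partial>(lebesgue_on U \<Otimes>\<^sub>M lebesgue_on U))"
    by (rule LU.nn_integral_fst) measurable
  also have "\<dots> = ennreal ((sobolev_seminorm r U f)\<^sup>2)"
  proof -
    have "integral\<^sup>L (lebesgue_on U \<Otimes>\<^sub>M lebesgue_on U) ?k = enn2real (\<integral>\<^sup>+p. ennreal (?k p) \<partial>(lebesgue_on U \<Otimes>\<^sub>M lebesgue_on U))"
      using kpos by (intro integral_eq_nn_integral) auto
    moreover have "0 \<le> integral\<^sup>L (lebesgue_on U \<Otimes>\<^sub>M lebesgue_on U) ?k"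
      by (rule Bochner_Integration.integral_nonneg) (rule kpos)
    ultimately show ?thesis using kUD r by (simp add: sobolev_seminorm_def ennreal_enn2real_if)
  qed
  finally show ?thesis by (simp add: ennreal_mult'')
qed

text \<open>Jensen's inequality on the unit interval, from the nonnegativity of the squared
  deviation from the mean. For a non-integrable \<open>g\<close> the left side is 0 by
  convention.\<close>

lemma integral_sq_le:
  fixes g :: "real \<Rightarrow> real"
  assumes [measurable]: "g \<in> borel_measurable borel"
  shows "ennreal ((LINT t:{0..1}|lborel. g t)\<^sup>2) \<le> (\<integral>\<^sup>+t. indicator {0..1} t * ennreal ((g t)\<^sup>2) \<partial>lborel)"
proof (cases "(\<integral>\<^sup>+t. indicator {0..1} t * ennreal ((g t)\<^sup>2) \<partial>lborel) = \<infinity> \<or> \<not> set_integrable lborel {0..1} g")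
  case True
  then show ?thesis
    by (auto simp: set_integrable_def set_lebesgue_integral_def not_integrable_integral_eq)
next
  case False
  let ?k = "LINT t:{0..1}|lborel. g t"
  have nn: "(\<integral>\<^sup>+t. indicator {0..1} t * ennreal ((g t)\<^sup>2) \<partial>lborel) = (\<integral>\<^sup>+t. ennreal (indicator {0..1} t * (g t)\<^sup>2) \<partial>lborel)"
    by (rule nn_integral_cong) (simp add: indicator_def)
  have sq: "set_integrable lborel {0..1} (\<lambda>t. (g t)\<^sup>2)"
    unfolding set_integrable_def using False
    by (intro integrableI_nonneg) (auto simp: nn less_top)
  have int: "set_integrable lborel {0..1} g" using False by simp
  have c: "set_integrable lborel {0..1::real} (\<lambda>t. c)" for c :: real
    by (intro set_integrable_compact) auto
  have c_eq: "(LINT t:{0..1::real}|lborel. c) = c" for c :: real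
    by (subst set_integral_const) auto
  have "2 * ?k * ?k - ?k\<^sup>2 = (LINT t:{0..1}|lborel. 2 * ?k * g t - ?k\<^sup>2)"
    using int c by (simp add: set_integral_diff c_eq)
  also have "\<dots> \<le> (LINT t:{0..1}|lborel. (g t)\<^sup>2)"
    by (rule set_integral_mono)
      (use int c sq sum_squares_bound[of ?k] in \<open>auto intro!: set_integral_diff(1) simp: power2_diff algebra_simps\<close>)
  finally have "?k\<^sup>2 \<le> (LINT t:{0..1}|lborel. (g t)\<^sup>2)" by (simp add: power2_eq_square)
  then have "ennreal (?k\<^sup>2) \<le> ennreal (LINT t:{0..1}|lborel. (g t)\<^sup>2)" by (rule ennreal_leI)
  also have "\<dots> = (\<integral>\<^sup>+t. ennreal (indicator {0..1} t * (g t)\<^sup>2) \<partial>lborel)"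
    using sq unfolding set_lebesgue_integral_def set_integrable_def
    by (subst nn_integral_eq_integral) auto
  finally show ?thesis by (simp add: nn)
qed

section \<open>Translations, and increments of weakly differentiable functions\<close>

lemma lborel_integral_translate:
  fixes f :: "'a::euclidean_space \<Rightarrow> 'b::euclidean_space"
  assumes "f \<in> borel_measurable borel"
  shows "(LINT x|lborel. f (x + a)) = (LINT x|lborel. f x)"
    and "integrable lborel f \<Longrightarrow> integrable lborel (\<lambda>x. f (x + a))"
proof -
  have d: "distr lborel borel ((+) a) = (lborel :: 'a measure)" by (rule lborel_distr_plus)
  show "(LINT x|lborel. f (x + a)) = (LINT x|lborel. f x)"
    using assms by (subst (2) d[symmetric], subst integral_distr) (auto simp: add.commute)
  show "integrable lborel f \<Longrightarrow> integrable lborel (\<lambda>x. f (x + a))"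
    using assms by (subst (asm) d[symmetric], subst (asm) integrable_distr_eq) (auto simp: add.commute)
qed

lemma lborel_nn_integral_translate:
  fixes f :: "'a::euclidean_space \<Rightarrow> ennreal"
  assumes "f \<in> borel_measurable borel"
  shows "(\<integral>\<^sup>+x. f (x + a) \<partial>lborel) = (\<integral>\<^sup>+x. f x \<partial>lborel)"
proof -
  have d: "distr lborel borel ((+) a) = (lborel :: 'a measure)" by (rule lborel_distr_plus)
  show ?thesis
    using assms by (subst (2) d[symmetric], subst nn_integral_distr) (auto simp: add.commute)
qed

text \<open>This is the fundamental theorem of calculus along a segment, for weak derivatives.
  Tested with \<phi>, the increment becomes \<open>F\<close> integrated against
  \<open>\<phi> (y - a) - \<phi> y\<close>, which is the integral of minus the derivative of the
  shifted \<phi> in direction \<open>a\<close>. The weak equation for each shift and Fubini turn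
  this into the integral of \<gamma>. Convexity keeps the shifted supports in
  \<open>U\<close>.\<close>

lemma weak_increment:
  fixes F \<gamma> :: "'a::euclidean_space \<Rightarrow> real"
  assumes F: "F \<in> borel_measurable borel" "integrable lborel F"
    and \<gamma>: "\<gamma> \<in> borel_measurable borel" "integrable lborel \<gamma>"
    and U: "open U" "convex U"
    and weak: "\<And>\<psi>. \<psi> \<in> test_functions U \<Longrightarrow> (LINT x|lborel. F x * (grad \<psi> x \<bullet> a)) = - (LINT x|lborel. \<psi> x * \<gamma> x)"
  shows "AE x in lborel. x \<in> U \<longrightarrow> x + a \<in> U \<longrightarrow> F (x + a) - F x = (LINT t:{0..1}|lborel. \<gamma> (x + t *\<^sub>R a))"
proof -
  note [measurable] = F(1) \<gamma>(1)
  define W where "W = {x. x \<in> U \<and> x + a \<in> U}"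
  define k where "k x = (LINT t:{0..1}|lborel. \<gamma> (x + t *\<^sub>R a))" for x
  have W: "open W"
  proof -
    have "W = U \<inter> (\<lambda>x. x + a) -` U" by (auto simp: W_def)
    then show ?thesis using U(1) by (auto intro!: open_Int open_vimage continuous_intros)
  qed
  have segment: "x + t *\<^sub>R a \<in> U" if "x \<in> W" "0 \<le> t" "t \<le> 1" for x t
  proof -
    have "(1 - t) *\<^sub>R x + t *\<^sub>R (x + a) \<in> U"
      using that U(2) by (intro convexD_alt) (auto simp: W_def)
    then show ?thesis by (simp add: algebra_simps)
  qed
  have \<gamma>2: "integrable (lborel \<Otimes>\<^sub>M lborel) (\<lambda>(x, t). indicator {0..1} t *\<^sub>R \<gamma> (x + t *\<^sub>R a))"
  proof (subst integrable_iff_bounded, intro conjI)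
    show "(\<lambda>(x, t). indicator {0..1::real} t *\<^sub>R \<gamma> (x + t *\<^sub>R a)) \<in> borel_measurable (lborel \<Otimes>\<^sub>M lborel)" by measurable
    have "(\<integral>\<^sup>+p. ennreal (norm (case p of (x, t) \<Rightarrow> indicator {0..1::real} t *\<^sub>R \<gamma> (x + t *\<^sub>R a))) \<partial>(lborel \<Otimes>\<^sub>M lborel))
        = (\<integral>\<^sup>+t. (\<integral>\<^sup>+x. indicator {0..1} t * ennreal (norm (\<gamma> (x + t *\<^sub>R a))) \<partial>lborel) \<partial>lborel)"
      by (subst lborel_pair.nn_integral_snd[symmetric]) (auto intro!: nn_integral_cong simp: indicator_def)
    also have "\<dots> = (\<integral>\<^sup>+t. indicator {0..1::real} t * (\<integral>\<^sup>+x. ennreal (norm (\<gamma> x)) \<partial>lborel) \<partial>lborel)"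
      by (simp add: nn_integral_cmult lborel_nn_integral_translate[of "\<lambda>x. ennreal \<bar>\<gamma> x\<bar>"])
    also have "\<dots> = (\<integral>\<^sup>+x. ennreal (norm (\<gamma> x)) \<partial>lborel)" by (simp add: nn_integral_multc)
    also have "\<dots> < \<infinity>" using \<gamma>(2) by (simp add: integrable_iff_bounded)
    finally show "(\<integral>\<^sup>+p. ennreal (norm (case p of (x, t) \<Rightarrow> indicator {0..1::real} t *\<^sub>R \<gamma> (x + t *\<^sub>R a))) \<partial>(lborel \<Otimes>\<^sub>M lborel)) < \<infinity>" .
  qed
  have k: "integrable lborel k"
    unfolding k_def set_lebesgue_integral_def using lborel_pair.integrable_fst'[OF \<gamma>2] by simp
  have [measurable]: "k \<in> borel_measurable borel" using borel_measurable_integrable[OF k] by simp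
  have Fa: "integrable lborel (\<lambda>x. F (x + a))" by (rule lborel_integral_translate(2)[OF F])
  define H where "H x = F (x + a) - F x - k x" for x
  have [measurable]: "H \<in> borel_measurable borel" unfolding H_def by measurable
  have H: "integrable lborel H" unfolding H_def using Fa F(2) k by simp
  have "AE x in lebesgue. x \<in> W \<longrightarrow> H x = 0"
  proof (rule fundamental_lemma[OF W])
    have "integrable lebesgue H" using H by (simp add: integrable_completion)
    then show "locally_integrable_on H W"
      unfolding locally_integrable_on_def set_integrable_def
      by (blast intro: integrable_mult_indicator lmeasurable_compact fmeasurableD)
    fix \<phi> assume \<phi>: "\<phi> \<in> test_functions W"
    note c1 = test_function_C1[OF \<phi>]
    note [measurable] = C1_measurable[OF c1]
    obtain C where C: "compact C" "C \<subseteq> W" "\<And>x. x \<notin> C \<Longrightarrow> \<phi> x = 0" "\<And>x. x \<notin> C \<Longrightarrow> grad \<phi> x = 0"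
      using test_function_support[OF \<phi>] by blast
    have "bounded (\<phi> ` C)" "bounded (grad \<phi> ` C)"
      by (intro compact_imp_bounded compact_continuous_image C1_continuous c1 C)+
    then obtain M\<^sub>1 M\<^sub>2 where "\<And>x. x \<in> C \<Longrightarrow> norm (\<phi> x) \<le> M\<^sub>1" "\<And>x. x \<in> C \<Longrightarrow> norm (grad \<phi> x) \<le> M\<^sub>2"
      by (auto simp: bounded_iff)
    then have M1: "\<bar>\<phi> x\<bar> \<le> \<bar>M\<^sub>1\<bar>" and M2: "norm (grad \<phi> x) \<le> \<bar>M\<^sub>2\<bar>" for x
      using C(3,4)[of x] by (cases "x \<in> C"; force)+
    have \<phi>bound: "\<bar>\<phi> x * c\<bar> \<le> \<bar>M\<^sub>1\<bar> * \<bar>c\<bar>" for x c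
      using M1 by (auto simp: abs_mult intro: mult_right_mono)
    have \<phi>int: "integrable lborel (\<lambda>x. \<phi> x * G x)" if G: "integrable lborel G" for G
    proof (rule Bochner_Integration.integrable_bound)
      show "integrable lborel (\<lambda>x. \<bar>M\<^sub>1\<bar> * G x)" using G by simp
      have "G \<in> borel_measurable borel" using borel_measurable_integrable[OF G] by simp
      then show "(\<lambda>x. \<phi> x * G x) \<in> borel_measurable lborel" by simp
      show "AE x in lborel. norm (\<phi> x * G x) \<le> norm (\<bar>M\<^sub>1\<bar> * G x)"
        using \<phi>bound by (intro AE_I2) (auto simp: abs_mult)
    qed
    have translated: "(\<lambda>y. \<phi> (y - t *\<^sub>R a)) \<in> test_functions U" "grad (\<lambda>y. \<phi> (y - t *\<^sub>R a)) y = grad \<phi> (y - t *\<^sub>R a)"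
      if t: "0 \<le> t" "t \<le> 1" for t y
    proof -
      have sm: "smooth \<phi>" using \<phi> by (simp add: test_functions_def)
      show "grad (\<lambda>y. \<phi> (y - t *\<^sub>R a)) y = grad \<phi> (y - t *\<^sub>R a)"
        using smooth_translate(2)[OF sm, of "- (t *\<^sub>R a)" y] by simp
      let ?C = "(\<lambda>x. x + t *\<^sub>R a) ` C"
      have cC: "compact ?C" by (intro compact_continuous_image continuous_intros C)
      have sub: "closure {y. \<phi> (y - t *\<^sub>R a) \<noteq> 0} \<subseteq> ?C"
      proof (rule closure_minimal[OF _ compact_imp_closed[OF cC]], clarify)
        fix y assume "\<phi> (y - t *\<^sub>R a) \<noteq> 0"
        then have "y - t *\<^sub>R a \<in> C" using C(3) by blast
        then show "y \<in> ?C" by (force simp: image_iff)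
      qed
      then have "compact (closure {y. \<phi> (y - t *\<^sub>R a) \<noteq> 0})"
        using bounded_subset[OF compact_imp_bounded[OF cC]] by (simp add: compact_eq_bounded_closed)
      moreover have "?C \<subseteq> U" using segment C(2) t by auto
      ultimately show "(\<lambda>y. \<phi> (y - t *\<^sub>R a)) \<in> test_functions U"
        using smooth_translate(1)[OF sm, of "- (t *\<^sub>R a)"] sub by (auto simp: test_functions_def)
    qed
    have FTC: "(LINT t|lborel. indicator {0..1} t *\<^sub>R - (grad \<phi> (y - t *\<^sub>R a) \<bullet> a)) = \<phi> (y - a) - \<phi> y" for y
    proof -
      have "(LINT t|lborel. - (grad \<phi> (y - t *\<^sub>R a) \<bullet> a) * indicator {0..1} t) = \<phi> (y - 1 *\<^sub>R a) - \<phi> (y - 0 *\<^sub>R a)"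
      proof (rule integral_FTC_Icc_real)
        fix t :: real
        have "((\<lambda>t. \<phi> (y - t *\<^sub>R a)) has_derivative (\<lambda>h. grad \<phi> (y - t *\<^sub>R a) \<bullet> (- (h *\<^sub>R a)))) (at t)"
          by (rule has_derivative_compose[OF _ C1_has_derivative[OF c1, of _ UNIV]]) (auto intro!: derivative_eq_intros)
        then show "((\<lambda>t. \<phi> (y - t *\<^sub>R a)) has_real_derivative - (grad \<phi> (y - t *\<^sub>R a) \<bullet> a)) (at t)"
          unfolding has_field_derivative_def by (rule has_derivative_eq_rhs) (auto simp: mult.commute)
        have "continuous_on UNIV (\<lambda>t. - (grad \<phi> (y - t *\<^sub>R a) \<bullet> a))"
          by (intro continuous_intros continuous_on_compose2[OF C1_continuous(2)[OF c1, of UNIV]]) auto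
        then show "isCont (\<lambda>t. - (grad \<phi> (y - t *\<^sub>R a) \<bullet> a)) t"
          by (simp add: continuous_on_eq_continuous_at)
      qed simp
      then show ?thesis by (simp add: mult.commute)
    qed
    have int1: "integrable (lborel \<Otimes>\<^sub>M lborel) (\<lambda>(y, t). indicator {0..1} t *\<^sub>R (F y * - (grad \<phi> (y - t *\<^sub>R a) \<bullet> a)))"
    proof (rule Bochner_Integration.integrable_bound)
      have "integrable lborel (\<lambda>t::real. indicator {0..1} t :: real)" by simp
      with F(2) show "integrable (lborel \<Otimes>\<^sub>M lborel) (\<lambda>(y, t::real). (\<bar>M\<^sub>2\<bar> * norm a * F y) * indicator {0..1} t)"
        by (intro lborel_pair.Fubini_integrable) (simp_all add: abs_mult)
      show "(\<lambda>(y, t). indicator {0..1::real} t *\<^sub>R (F y * - (grad \<phi> (y - t *\<^sub>R a) \<bullet> a))) \<in> borel_measurable (lborel \<Otimes>\<^sub>M lborel)"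
        by measurable
      have "\<bar>grad \<phi> z \<bullet> a\<bar> * \<bar>c\<bar> \<le> \<bar>M\<^sub>2\<bar> * norm a * \<bar>c\<bar>" for z c
        using order_trans[OF Cauchy_Schwarz_ineq2 mult_right_mono[OF M2 norm_ge_zero]] by (intro mult_right_mono) auto
      then show "AE p in lborel \<Otimes>\<^sub>M lborel. norm (case p of (y, t) \<Rightarrow> indicator {0..1::real} t *\<^sub>R (F y * - (grad \<phi> (y - t *\<^sub>R a) \<bullet> a)))
          \<le> norm (case p of (y, t) \<Rightarrow> (\<bar>M\<^sub>2\<bar> * norm a * F y) * indicator {0..1::real} t)"
        by (intro AE_I2) (auto simp: abs_mult indicator_def mult.commute split: prod.split)
    qed
    have int2: "integrable (lborel \<Otimes>\<^sub>M lborel) (\<lambda>(x, t). indicator {0..1} t *\<^sub>R (\<phi> x * \<gamma> (x + t *\<^sub>R a)))"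
    proof (rule Bochner_Integration.integrable_bound)
      show "integrable (lborel \<Otimes>\<^sub>M lborel) (\<lambda>p. \<bar>M\<^sub>1\<bar> * (case p of (x, t) \<Rightarrow> indicator {0..1} t *\<^sub>R \<gamma> (x + t *\<^sub>R a)))"
        using \<gamma>2 by simp
      show "(\<lambda>(x, t). indicator {0..1::real} t *\<^sub>R (\<phi> x * \<gamma> (x + t *\<^sub>R a))) \<in> borel_measurable (lborel \<Otimes>\<^sub>M lborel)"
        by measurable
      show "AE p in lborel \<Otimes>\<^sub>M lborel. norm (case p of (x, t) \<Rightarrow> indicator {0..1::real} t *\<^sub>R (\<phi> x * \<gamma> (x + t *\<^sub>R a)))
          \<le> norm (\<bar>M\<^sub>1\<bar> * (case p of (x, t) \<Rightarrow> indicator {0..1} t *\<^sub>R \<gamma> (x + t *\<^sub>R a)))"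
        using \<phi>bound by (intro AE_I2) (auto simp: abs_mult indicator_def split: prod.split)
    qed
    have "(LINT x|lborel. \<phi> x * F (x + a)) - (LINT x|lborel. \<phi> x * F x) = (LINT y|lborel. F y * (\<phi> (y - a) - \<phi> y))"
    proof -
      have "(LINT x|lborel. \<phi> x * F (x + a)) = (LINT y|lborel. \<phi> (y - a) * F y)"
        using lborel_integral_translate(1)[of "\<lambda>y. \<phi> (y - a) * F y" a] by simp
      moreover have "integrable lborel (\<lambda>y. \<phi> (y - a) * F y)"
        using lborel_integral_translate(2)[of "\<lambda>x. \<phi> x * F (x + a)" "- a"] \<phi>int[OF Fa] by simp
      ultimately show ?thesis using \<phi>int[OF F(2)]
        by (simp add: algebra_simps)
    qed
    also have "\<dots> = (LINT y|lborel. (LINT t|lborel. indicator {0..1} t *\<^sub>R (F y * - (grad \<phi> (y - t *\<^sub>R a) \<bullet> a))))"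
    proof (rule Bochner_Integration.integral_cong)
      fix y
      have "(LINT t|lborel. indicator {0..1} t *\<^sub>R (F y * - (grad \<phi> (y - t *\<^sub>R a) \<bullet> a)))
          = (LINT t|lborel. F y * (indicator {0..1} t *\<^sub>R - (grad \<phi> (y - t *\<^sub>R a) \<bullet> a)))"
        by (simp add: mult_ac)
      also have "\<dots> = F y * (\<phi> (y - a) - \<phi> y)"
        unfolding FTC[symmetric] by (rule integral_mult_right_zero)
      finally show "F y * (\<phi> (y - a) - \<phi> y) = (LINT t|lborel. indicator {0..1} t *\<^sub>R (F y * - (grad \<phi> (y - t *\<^sub>R a) \<bullet> a)))" by simp
    qed simp
    also have "\<dots> = (LINT t|lborel. (LINT y|lborel. indicator {0..1} t *\<^sub>R (F y * - (grad \<phi> (y - t *\<^sub>R a) \<bullet> a))))"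
      by (rule lborel_pair.Fubini_integral[OF int1, symmetric])
    also have "\<dots> = (LINT t|lborel. (LINT x|lborel. indicator {0..1} t *\<^sub>R (\<phi> x * \<gamma> (x + t *\<^sub>R a))))"
    proof (rule Bochner_Integration.integral_cong)
      fix t :: real
      show "(LINT y|lborel. indicator {0..1} t *\<^sub>R (F y * - (grad \<phi> (y - t *\<^sub>R a) \<bullet> a)))
          = (LINT x|lborel. indicator {0..1} t *\<^sub>R (\<phi> x * \<gamma> (x + t *\<^sub>R a)))"
      proof (cases "t \<in> {0..1}")
        case True
        have "(LINT y|lborel. F y * (grad \<phi> (y - t *\<^sub>R a) \<bullet> a)) = - (LINT y|lborel. \<phi> (y - t *\<^sub>R a) * \<gamma> y)"
          using weak[OF translated(1)[of t]] translated(2)[of t] True by simp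
        also have "(LINT y|lborel. \<phi> (y - t *\<^sub>R a) * \<gamma> y) = (LINT x|lborel. \<phi> x * \<gamma> (x + t *\<^sub>R a))"
          using lborel_integral_translate(1)[of "\<lambda>y. \<phi> (y - t *\<^sub>R a) * \<gamma> y" "t *\<^sub>R a"] by simp
        finally show ?thesis using True by simp
      qed simp
    qed simp
    also have "\<dots> = (LINT x|lborel. (LINT t|lborel. indicator {0..1} t *\<^sub>R (\<phi> x * \<gamma> (x + t *\<^sub>R a))))"
      by (rule lborel_pair.Fubini_integral[OF int2])
    also have "\<dots> = (LINT x|lborel. \<phi> x * k x)"
    proof (rule Bochner_Integration.integral_cong)
      fix x
      have "(LINT t|lborel. indicator {0..1} t *\<^sub>R (\<phi> x * \<gamma> (x + t *\<^sub>R a))) = (LINT t|lborel. \<phi> x * (indicator {0..1} t *\<^sub>R \<gamma> (x + t *\<^sub>R a)))"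
        by (simp add: mult_ac)
      then show "(LINT t|lborel. indicator {0..1} t *\<^sub>R (\<phi> x * \<gamma> (x + t *\<^sub>R a))) = \<phi> x * k x"
        by (simp only: k_def set_lebesgue_integral_def integral_mult_right_zero)
    qed simp
    finally have eq: "(LINT x|lborel. \<phi> x * F (x + a)) - (LINT x|lborel. \<phi> x * F x) = (LINT x|lborel. \<phi> x * k x)" .
    have "(LINT x|lebesgue_on W. H x * \<phi> x) = (LINT x|lebesgue_on UNIV. H x * \<phi> x)"
      using W C by (intro integral_lebesgue_on_support) auto
    also have "\<dots> = (LINT x|lborel. H x * \<phi> x)"
      by (subst integral_lebesgue_on_lborel) (simp_all add: set_lebesgue_integral_def)
    also have "\<dots> = (LINT x|lborel. \<phi> x * F (x + a) - \<phi> x * F x - \<phi> x * k x)"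
      by (simp add: H_def algebra_simps)
    also have "\<dots> = 0"
      using \<phi>int[OF F(2)] \<phi>int[OF Fa] \<phi>int[OF k] eq by simp
    finally show "(LINT x|lebesgue_on W. H x * \<phi> x) = 0" .
  qed
  then have "AE x in lborel. x \<in> W \<longrightarrow> H x = 0" by (simp add: AE_completion_iff)
  then show ?thesis by eventually_elim (auto simp: W_def H_def k_def)
qed


text \<open>Shifts and Fubini are carried out with Borel functions, for which joint measurability in
  the point and the shift is automatic; the extension by zero allows integration over the whole
  space.\<close>

lemma borel_representative:
  fixes f :: "'a::euclidean_space \<Rightarrow> real"
  assumes "f \<in> borel_measurable (lebesgue_on U)" "open U"
  obtains F where "F \<in> borel_measurable borel" "\<And>x. x \<notin> U \<Longrightarrow> F x = 0" "AE x in lebesgue. x \<in> U \<longrightarrow> F x = f x"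
proof -
  have U: "U \<in> sets lebesgue" using assms(2) by auto
  have "(\<lambda>x. indicator U x *\<^sub>R f x) \<in> borel_measurable lebesgue"
    using assms(1) U by (subst (asm) borel_measurable_restrict_space_iff) auto
  from completion_ex_borel_measurable_real[OF this]
  obtain g where g: "g \<in> borel_measurable lborel" "AE x in lborel. indicator U x *\<^sub>R f x = g x" by blast
  show ?thesis
  proof (rule that[of "\<lambda>x. indicator U x * g x"])
    show "(\<lambda>x. indicator U x * g x) \<in> borel_measurable borel" using g(1) assms(2) by simp
    show "AE x in lebesgue. x \<in> U \<longrightarrow> indicator U x * g x = f x"
      using AE_completion[OF g(2)] by eventually_elim auto
  qed simp
qed

lemma representative_integral:
  fixes f F :: "'a::euclidean_space \<Rightarrow> real"
  assumes f: "f \<in> borel_measurable (lebesgue_on U)" and U: "open U"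
    and F: "F \<in> borel_measurable borel" "\<And>x. x \<notin> U \<Longrightarrow> F x = 0" "AE x in lebesgue. x \<in> U \<longrightarrow> F x = f x"
    and w: "w \<in> borel_measurable borel"
  shows "(LINT x|lborel. w x * F x) = (LINT x|lebesgue_on U. w x * f x)"
proof -
  have UL: "U \<in> sets lebesgue" using U by auto
  have wU: "w \<in> borel_measurable (lebesgue_on U)" "F \<in> borel_measurable (lebesgue_on U)"
    using w F(1) by (auto intro!: measurable_restrict_space1 measurable_completion)
  have "(LINT x|lborel. w x * F x) = (LINT x|lebesgue_on UNIV. w x * F x)"
    using w F(1) by (subst integral_lebesgue_on_lborel) (auto simp: set_lebesgue_integral_def)
  also have "\<dots> = (LINT x|lebesgue_on U. w x * F x)"
    using F(2) UL by (intro integral_lebesgue_on_support) auto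
  also have "\<dots> = (LINT x|lebesgue_on U. w x * f x)"
  proof (rule integral_cong_AE)
    show "AE x in lebesgue_on U. w x * F x = w x * f x"
      using F(3) UL by (subst AE_restrict_space_iff) (auto elim: eventually_mono)
  qed (use f wU in auto)
  finally show ?thesis .
qed

text \<open>The substitution x = y + a turns the double integral into an integral over shifts
  \<open>a\<close>. For a fixed shift, \<open>weak_increment\<close> and
  \<open>integral_sq_le\<close> bound the integral of the squared increment by |a|^2 times the
  squared norm of \<open>G\<close>. Only shifts in the ball of radius \<open>h\<close> occur, and
  its volume gives the remaining factor.\<close>

lemma gradient_double_integral:
  fixes f :: "'a::euclidean_space \<Rightarrow> real"
  assumes f: "f \<in> Lspace 2 U" and G: "has_weak_grad U f G" "G \<in> Lspace 2 U"
    and U: "open U" "convex U" "U \<in> lmeasurable" "0 < measure lebesgue U"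
    and h: "\<And>x y. x \<in> U \<Longrightarrow> y \<in> U \<Longrightarrow> norm (x - y) \<le> h" "0 \<le> h"
  shows "(\<integral>\<^sup>+y. (\<integral>\<^sup>+x. ennreal ((f x - f y)\<^sup>2) \<partial>lebesgue_on U) \<partial>lebesgue_on U)
    \<le> ennreal (unit_ball_vol (real DIM('a)) * h ^ DIM('a) * (h\<^sup>2 * (Lnorm 2 U G)\<^sup>2))"
proof -
  have UL: "U \<in> sets lebesgue" using U by auto
  have fm: "f \<in> borel_measurable (lebesgue_on U)" using f by (simp add: Lspace_2_iff)
  have Gm: "G \<in> borel_measurable (lebesgue_on U)" using G by (simp add: Lspace_2_iff)
  obtain F where F: "F \<in> borel_measurable borel" "\<And>x. x \<notin> U \<Longrightarrow> F x = 0" "AE x in lebesgue. x \<in> U \<longrightarrow> F x = f x"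
    using borel_representative[OF fm U(1)] by metis
  have integrable_rep: "integrable lborel R"
    if R: "R \<in> borel_measurable borel" "\<And>x. x \<notin> U \<Longrightarrow> R x = 0" "AE x in lebesgue. x \<in> U \<longrightarrow> R x = g x"
      and g: "g \<in> Lspace 2 U" for R g :: "'a \<Rightarrow> real"
  proof -
    have gi: "integrable (lebesgue_on U) g" by (rule integral_norm_le_Lnorm(1)[OF g _ U(3,4)]) simp
    have Rm: "R \<in> borel_measurable lebesgue" using R(1) by (auto intro!: measurable_completion)
    have "integrable lebesgue R"
    proof (rule integrable_cong_AE_imp[OF _ Rm])
      show "integrable lebesgue (\<lambda>x. indicator U x *\<^sub>R g x)"
        using gi by (simp add: lebesgue_on_integral_eq(2)[OF UL] set_integrable_def)
      show "AE x in lebesgue. indicator U x *\<^sub>R g x = R x"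
        using R(3) by eventually_elim (use R(2) in \<open>auto simp: indicator_def\<close>)
    qed
    then show ?thesis using R(1) by (simp add: integrable_completion)
  qed
  have [measurable]: "F \<in> borel_measurable borel" "U \<in> sets borel" using F(1) U(1) by auto
  let ?L = "(Lnorm 2 U G)\<^sup>2"
  have nnG: "(\<integral>\<^sup>+x. ennreal ((norm (G x))\<^sup>2) \<partial>lebesgue_on U) = ennreal ?L"
    using G(2) unfolding Lnorm_2_sq by (intro nn_integral_eq_integral) (auto simp: Lspace_2_iff)
  have translation: "(\<integral>\<^sup>+x. indicator {x. x \<in> U \<and> x + a \<in> U} x * ennreal ((F (x + a) - F x)\<^sup>2) \<partial>lborel) \<le> ennreal ((norm a)\<^sup>2 * ?L)" for a
  proof -
    have Ga: "(\<lambda>x. G x \<bullet> a) \<in> Lspace 2 U"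
    proof (rule Lspace_2_bound)
      show "integrable (lebesgue_on U) (\<lambda>x. (norm (G x))\<^sup>2 * (norm a)\<^sup>2)"
        using G(2) by (simp add: Lspace_2_iff)
      show "(norm (G x \<bullet> a))\<^sup>2 \<le> (norm (G x))\<^sup>2 * (norm a)\<^sup>2" for x
        using Cauchy_Schwarz_ineq[of "G x" a] by (simp add: power2_norm_eq_inner)
    qed (use Gm in simp)
    then have Gam: "(\<lambda>x. G x \<bullet> a) \<in> borel_measurable (lebesgue_on U)" by (simp add: Lspace_2_iff)
    obtain \<gamma> where \<gamma>: "\<gamma> \<in> borel_measurable borel" "\<And>x. x \<notin> U \<Longrightarrow> \<gamma> x = 0" "AE x in lebesgue. x \<in> U \<longrightarrow> \<gamma> x = G x \<bullet> a"
      using borel_representative[OF Gam U(1)] by metis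
    note [measurable] = \<gamma>(1)
    have "AE x in lborel. x \<in> U \<longrightarrow> x + a \<in> U \<longrightarrow> F (x + a) - F x = (LINT t:{0..1}|lborel. \<gamma> (x + t *\<^sub>R a))"
    proof (rule weak_increment[OF F(1) integrable_rep[OF F f] \<gamma>(1) integrable_rep[OF \<gamma> Ga] U(1,2)])
      fix \<psi> assume \<psi>: "\<psi> \<in> test_functions U"
      note [measurable] = C1_measurable[OF test_function_C1[OF \<psi>]]
      note i = test_function_integrable(1,2)[OF \<psi> U(1)]
      have lf: "locally_integrable_on f U" "locally_integrable_on G U" using G(1) by (auto simp: has_weak_grad_def)
      have "(LINT x|lborel. F x * (grad \<psi> x \<bullet> a)) = (LINT x|lborel. (grad \<psi> x \<bullet> a) * F x)" by (simp add: mult.commute)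
      also have "\<dots> = (LINT x|lebesgue_on U. (grad \<psi> x \<bullet> a) * f x)"
        by (rule representative_integral[OF fm U(1) F]) measurable
      also have "\<dots> = (LINT x|lebesgue_on U. (f x *\<^sub>R grad \<psi> x) \<bullet> a)" by (simp add: mult.commute)
      also have "\<dots> = (LINT x|lebesgue_on U. f x *\<^sub>R grad \<psi> x) \<bullet> a" by (intro integral_inner_left i lf)
      also have "\<dots> = - ((LINT x|lebesgue_on U. \<psi> x *\<^sub>R G x) \<bullet> a)" using G(1) \<psi> by (simp add: has_weak_grad_def)
      also have "(LINT x|lebesgue_on U. \<psi> x *\<^sub>R G x) \<bullet> a = (LINT x|lebesgue_on U. (\<psi> x *\<^sub>R G x) \<bullet> a)"
        by (intro integral_inner_left[symmetric] i lf)
      also have "\<dots> = (LINT x|lborel. \<psi> x * \<gamma> x)"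
        using representative_integral[OF Gam U(1) \<gamma>, of \<psi>] by simp
      finally show "(LINT x|lborel. F x * (grad \<psi> x \<bullet> a)) = - (LINT x|lborel. \<psi> x * \<gamma> x)" .
    qed
    then have "(\<integral>\<^sup>+x. indicator {x. x \<in> U \<and> x + a \<in> U} x * ennreal ((F (x + a) - F x)\<^sup>2) \<partial>lborel)
        \<le> (\<integral>\<^sup>+x. (\<integral>\<^sup>+t. indicator {0..1} t * ennreal ((\<gamma> (x + t *\<^sub>R a))\<^sup>2) \<partial>lborel) \<partial>lborel)"
    proof (intro nn_integral_mono_AE, elim eventually_mono)
      fix x
      assume x: "x \<in> U \<longrightarrow> x + a \<in> U \<longrightarrow> F (x + a) - F x = (LINT t:{0..1}|lborel. \<gamma> (x + t *\<^sub>R a))"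
      have "ennreal ((LINT t:{0..1}|lborel. \<gamma> (x + t *\<^sub>R a))\<^sup>2) \<le> (\<integral>\<^sup>+t. indicator {0..1} t * ennreal ((\<gamma> (x + t *\<^sub>R a))\<^sup>2) \<partial>lborel)"
        by (rule integral_sq_le) measurable
      then show "indicator {x. x \<in> U \<and> x + a \<in> U} x * ennreal ((F (x + a) - F x)\<^sup>2)
          \<le> (\<integral>\<^sup>+t. indicator {0..1} t * ennreal ((\<gamma> (x + t *\<^sub>R a))\<^sup>2) \<partial>lborel)"
        using x by (cases "x \<in> U \<and> x + a \<in> U") simp_all
    qed
    also have "\<dots> = (\<integral>\<^sup>+t. (\<integral>\<^sup>+x. indicator {0..1} t * ennreal ((\<gamma> (x + t *\<^sub>R a))\<^sup>2) \<partial>lborel) \<partial>lborel)"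
      by (rule lborel_pair.Fubini'[symmetric]) measurable
    also have "\<dots> = (\<integral>\<^sup>+t. indicator {0..1::real} t * (\<integral>\<^sup>+x. ennreal ((\<gamma> x)\<^sup>2) \<partial>lborel) \<partial>lborel)"
      by (simp add: nn_integral_cmult lborel_nn_integral_translate[of "\<lambda>x. ennreal ((\<gamma> x)\<^sup>2)"])
    also have "\<dots> = (\<integral>\<^sup>+x. ennreal ((\<gamma> x)\<^sup>2) \<partial>lborel)" by (simp add: nn_integral_multc)
    also have "\<dots> = (\<integral>\<^sup>+x. ennreal ((\<gamma> x)\<^sup>2) \<partial>lebesgue)" by (simp add: nn_integral_completion)
    also have "\<dots> \<le> (\<integral>\<^sup>+x. ennreal ((norm a)\<^sup>2) * ennreal ((norm (G x))\<^sup>2) * indicator U x \<partial>lebesgue)"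
      using \<gamma>(3)
    proof (intro nn_integral_mono_AE, elim eventually_mono)
      fix x assume x: "x \<in> U \<longrightarrow> \<gamma> x = G x \<bullet> a"
      have "(G x \<bullet> a)\<^sup>2 \<le> (norm a)\<^sup>2 * (norm (G x))\<^sup>2"
        using Cauchy_Schwarz_ineq[of "G x" a] by (simp add: power2_norm_eq_inner mult.commute)
      then show "ennreal ((\<gamma> x)\<^sup>2) \<le> ennreal ((norm a)\<^sup>2) * ennreal ((norm (G x))\<^sup>2) * indicator U x"
        using x \<gamma>(2)[of x] by (cases "x \<in> U") (simp_all flip: ennreal_mult)
    qed
    also have "\<dots> = (\<integral>\<^sup>+x. ennreal ((norm a)\<^sup>2) * ennreal ((norm (G x))\<^sup>2) \<partial>lebesgue_on U)"
      using UL by (simp add: nn_integral_restrict_space)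
    also have "\<dots> = ennreal ((norm a)\<^sup>2) * ennreal ?L"
      using Gm by (subst nn_integral_cmult) (auto simp: nnG)
    finally show ?thesis by (simp add: ennreal_mult)
  qed
  have "(\<integral>\<^sup>+y. (\<integral>\<^sup>+x. ennreal ((f x - f y)\<^sup>2) \<partial>lebesgue_on U) \<partial>lebesgue_on U)
      = (\<integral>\<^sup>+y. (\<integral>\<^sup>+x. ennreal ((f x - f y)\<^sup>2) * indicator U x \<partial>lebesgue) * indicator U y \<partial>lebesgue)"
    using UL by (simp add: nn_integral_restrict_space)
  also have "\<dots> = (\<integral>\<^sup>+y. (\<integral>\<^sup>+x. ennreal ((F x - F y)\<^sup>2) * indicator U x \<partial>lebesgue) * indicator U y \<partial>lebesgue)"
    using F(3)
  proof (intro nn_integral_cong_AE, elim eventually_mono)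
    fix y assume y: "y \<in> U \<longrightarrow> F y = f y"
    have "(\<integral>\<^sup>+x. ennreal ((f x - f y)\<^sup>2) * indicator U x \<partial>lebesgue) = (\<integral>\<^sup>+x. ennreal ((F x - f y)\<^sup>2) * indicator U x \<partial>lebesgue)"
      using F(3) by (intro nn_integral_cong_AE, elim eventually_mono) (auto simp: indicator_def)
    then show "(\<integral>\<^sup>+x. ennreal ((f x - f y)\<^sup>2) * indicator U x \<partial>lebesgue) * indicator U y
        = (\<integral>\<^sup>+x. ennreal ((F x - F y)\<^sup>2) * indicator U x \<partial>lebesgue) * indicator U y"
      using y by (simp add: indicator_def)
  qed
  also have "\<dots> = (\<integral>\<^sup>+y. (\<integral>\<^sup>+x. ennreal ((F x - F y)\<^sup>2) * indicator U x * indicator U y \<partial>lborel) \<partial>lborel)"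
    by (simp add: nn_integral_completion nn_integral_multc)
  also have "\<dots> = (\<integral>\<^sup>+y. (\<integral>\<^sup>+a. ennreal ((F (a + y) - F y)\<^sup>2) * indicator U (a + y) * indicator U y \<partial>lborel) \<partial>lborel)"
    by (intro nn_integral_cong lborel_nn_integral_translate[symmetric]) measurable
  also have "\<dots> = (\<integral>\<^sup>+a. (\<integral>\<^sup>+y. ennreal ((F (a + y) - F y)\<^sup>2) * indicator U (a + y) * indicator U y \<partial>lborel) \<partial>lborel)"
    by (rule lborel_pair.Fubini') measurable
  also have "\<dots> \<le> (\<integral>\<^sup>+a. ennreal (h\<^sup>2 * ?L) * indicator (cball 0 h) a \<partial>(lborel :: 'a measure))"
  proof (rule nn_integral_mono)
    fix a :: 'a
    show "(\<integral>\<^sup>+y. ennreal ((F (a + y) - F y)\<^sup>2) * indicator U (a + y) * indicator U y \<partial>lborel) \<le> ennreal (h\<^sup>2 * ?L) * indicator (cball 0 h) a"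
    proof (cases "norm a \<le> h")
      case True
      have "(\<integral>\<^sup>+y. ennreal ((F (a + y) - F y)\<^sup>2) * indicator U (a + y) * indicator U y \<partial>lborel)
          = (\<integral>\<^sup>+x. indicator {x. x \<in> U \<and> x + a \<in> U} x * ennreal ((F (x + a) - F x)\<^sup>2) \<partial>lborel)"
        by (rule nn_integral_cong) (auto simp: indicator_def add.commute)
      also have "\<dots> \<le> ennreal ((norm a)\<^sup>2 * ?L)" by (rule translation)
      also have "\<dots> \<le> ennreal (h\<^sup>2 * ?L)"
        using True by (intro ennreal_leI mult_right_mono power_mono) auto
      finally show ?thesis using True by simp
    next
      case False
      have "indicator U (a + y) * indicator U y = (0::ennreal)" for y
        using h(1)[of "a + y" y] False by (auto simp: indicator_def)
      then have "(\<integral>\<^sup>+y. ennreal ((F (a + y) - F y)\<^sup>2) * indicator U (a + y) * indicator U y \<partial>lborel) = 0"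
        by (simp only: mult.assoc mult_zero_right nn_integral_const mult_zero_left)
      then show ?thesis by simp
    qed
  qed
  also have "\<dots> = ennreal (h\<^sup>2 * ?L) * emeasure lborel (cball (0::'a) h)"
    by (rule nn_integral_cmult_indicator) simp
  also have "emeasure lborel (cball (0::'a) h) = ennreal (unit_ball_vol (real DIM('a)) * h ^ DIM('a))"
    using emeasure_cball[OF h(2), of "0::'a"] by simp
  also have "ennreal (h\<^sup>2 * ?L) * \<dots> = ennreal (unit_ball_vol (real DIM('a)) * h ^ DIM('a) * (h\<^sup>2 * ?L))"
    using h(2) by (subst ennreal_mult[symmetric]) (auto simp: mult_ac)
  finally show ?thesis .
qed

text \<open>Both seminorms bound the double integral of squared increments, with factor 1 in the
  fractional case and the volume of the unit ball for r = 1; the sum of these factors serves both.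
  The lower bound \<open>m\<close> replaces the measure of \<open>U\<close>, so that only the shape
  quotient h^d / m remains.\<close>

lemma sobolev_poincare:
  fixes v :: "'a::euclidean_space \<Rightarrow> 'b::euclidean_space"
  assumes v: "v \<in> sobolev r D" and r: "0 < r" "r \<le> 1" and D: "open D" "U \<subseteq> D"
    and U: "open U" "convex U" "U \<in> lmeasurable" "0 < m" "m \<le> measure lebesgue U"
    and h: "\<And>x y. x \<in> U \<Longrightarrow> y \<in> U \<Longrightarrow> norm (x - y) \<le> h" "0 < h"
  obtains a where "(Lnorm 2 U (\<lambda>x. v x - a))\<^sup>2
    \<le> (1 + unit_ball_vol (real DIM('a))) * (h ^ DIM('a) / m) * (h powr (2 * r) * (sobolev_seminorm r U v)\<^sup>2)"
proof -
  let ?\<omega> = "unit_ball_vol (real DIM('a))" and ?S = "(sobolev_seminorm r U v)\<^sup>2"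
  define M where "M = (1 + ?\<omega>) * h ^ DIM('a) * (h powr (2 * r) * ?S)"
  have M: "0 \<le> M" using h by (simp add: M_def)
  have mU: "0 < measure lebesgue U" using U by linarith
  have vU: "v \<in> Lspace 2 U"
    by (rule Lspace_subset[of _ _ D]) (use v D U in \<open>auto simp: sobolev_def\<close>)
  have "(\<integral>\<^sup>+y. (\<integral>\<^sup>+x. ennreal ((norm (v x - v y))\<^sup>2) \<partial>lebesgue_on U) \<partial>lebesgue_on U) \<le> ennreal M"
  proof (cases "r = 1")
    case False
    have "(\<integral>\<^sup>+y. (\<integral>\<^sup>+x. ennreal ((norm (v x - v y))\<^sup>2) \<partial>lebesgue_on U) \<partial>lebesgue_on U) \<le> ennreal (h powr (real DIM('a) + 2 * r) * ?S)"
      by (rule slobodeckij_double_integral[OF v False r(1) U(1) D(2,1) h(1)])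
    also have "\<dots> \<le> ennreal M"
    proof (rule ennreal_leI)
      have "h powr (real DIM('a) + 2 * r) * ?S = 1 * h ^ DIM('a) * (h powr (2 * r) * ?S)"
        using h by (simp add: powr_add powr_realpow)
      also have "\<dots> \<le> M" unfolding M_def using h by (intro mult_right_mono) auto
      finally show "h powr (real DIM('a) + 2 * r) * ?S \<le> M" .
    qed
    finally show ?thesis .
  next
    case True
    interpret LU: sigma_finite_measure "lebesgue_on U" using U by (intro sigma_finite_lebesgue_on) auto
    have vm [measurable]: "v \<in> borel_measurable (lebesgue_on U)" using vU by (simp add: Lspace_2_iff)
    let ?w = "\<lambda>i. weak_grad U (\<lambda>x. v x \<bullet> i)"
    have comp: "(\<integral>\<^sup>+y. (\<integral>\<^sup>+x. ennreal ((v x \<bullet> i - v y \<bullet> i)\<^sup>2) \<partial>lebesgue_on U) \<partial>lebesgue_on U)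
        \<le> ennreal (?\<omega> * h ^ DIM('a) * (h\<^sup>2 * (Lnorm 2 U (?w i))\<^sup>2))" if i: "i \<in> Basis" for i
    proof (rule gradient_double_integral[OF Lspace_2_component[OF vU i] _ _ U(1-3) mU h(1)])
      obtain G where G: "has_weak_grad D (\<lambda>x. v x \<bullet> i) G" and L: "weak_grad D (\<lambda>x. v x \<bullet> i) \<in> Lspace 2 D"
        using v True i by (auto simp: sobolev_def)
      \<comment> \<open>The gradient chosen on \<open>U\<close> need not be the restriction of the
        one chosen on \<open>D\<close>; uniqueness almost everywhere transfers the square
        integrability.\<close>
      note GD = has_weak_grad_subset[OF weak_grad_works[OF G] D(2) U(1) D(1)]
      show "has_weak_grad U (\<lambda>x. v x \<bullet> i) (?w i)" by (rule weak_grad_works[OF GD])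
      have LU: "weak_grad D (\<lambda>x. v x \<bullet> i) \<in> Lspace 2 U"
        by (rule Lspace_subset[OF L D(2)]) (use D U in auto)
      show "?w i \<in> Lspace 2 U"
        by (rule Lspace_AE[OF LU]) (use U weak_grad_AE[OF U(1) GD] in \<open>auto elim: eventually_mono\<close>)
    qed (use h in auto)
    have "(\<integral>\<^sup>+y. (\<integral>\<^sup>+x. ennreal ((norm (v x - v y))\<^sup>2) \<partial>lebesgue_on U) \<partial>lebesgue_on U)
        = (\<integral>\<^sup>+y. (\<integral>\<^sup>+x. (\<Sum>i\<in>Basis. ennreal ((v x \<bullet> i - v y \<bullet> i)\<^sup>2)) \<partial>lebesgue_on U) \<partial>lebesgue_on U)"
    proof (intro nn_integral_cong)
      fix x y
      have "(norm (v x - v y))\<^sup>2 = (\<Sum>i\<in>Basis. (v x \<bullet> i - v y \<bullet> i)\<^sup>2)"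
        unfolding power2_norm_eq_inner by (subst euclidean_inner) (simp add: inner_diff_left power2_eq_square)
      then show "ennreal ((norm (v x - v y))\<^sup>2) = (\<Sum>i\<in>Basis. ennreal ((v x \<bullet> i - v y \<bullet> i)\<^sup>2))"
        by simp
    qed
    also have "\<dots> = (\<Sum>i\<in>Basis. (\<integral>\<^sup>+y. (\<integral>\<^sup>+x. ennreal ((v x \<bullet> i - v y \<bullet> i)\<^sup>2) \<partial>lebesgue_on U) \<partial>lebesgue_on U))"
    proof -
      have "(\<integral>\<^sup>+x. (\<Sum>i\<in>Basis. ennreal ((v x \<bullet> i - v y \<bullet> i)\<^sup>2)) \<partial>lebesgue_on U)
          = (\<Sum>i\<in>Basis. (\<integral>\<^sup>+x. ennreal ((v x \<bullet> i - v y \<bullet> i)\<^sup>2) \<partial>lebesgue_on U))" for y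
        by (rule nn_integral_sum) measurable
      moreover have "(\<lambda>y. \<integral>\<^sup>+x. ennreal ((v x \<bullet> i - v y \<bullet> i)\<^sup>2) \<partial>lebesgue_on U) \<in> borel_measurable (lebesgue_on U)" for i
        by measurable
      ultimately show ?thesis by (simp add: nn_integral_sum)
    qed
    also have "\<dots> \<le> (\<Sum>i\<in>Basis. ennreal (?\<omega> * h ^ DIM('a) * (h\<^sup>2 * (Lnorm 2 U (?w i))\<^sup>2)))"
      by (intro sum_mono comp)
    also have "\<dots> = ennreal (\<Sum>i\<in>Basis. ?\<omega> * h ^ DIM('a) * (h\<^sup>2 * (Lnorm 2 U (?w i))\<^sup>2))"
      using h(2) by (intro sum_ennreal) auto
    also have "(\<Sum>i\<in>Basis. ?\<omega> * h ^ DIM('a) * (h\<^sup>2 * (Lnorm 2 U (?w i))\<^sup>2)) = ?\<omega> * h ^ DIM('a) * (h\<^sup>2 * ?S)"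
      using True by (simp add: sobolev_seminorm_def sum_nonneg flip: sum_distrib_left)
    also have "ennreal \<dots> \<le> ennreal M"
    proof (rule ennreal_leI)
      have "h powr (2 * r) = h\<^sup>2" using h True by (simp add: powr_numeral)
      then show "?\<omega> * h ^ DIM('a) * (h\<^sup>2 * ?S) \<le> M"
        unfolding M_def using h by (intro mult_mono) auto
    qed
    finally show ?thesis .
  qed
  from ex_constant_approximation[OF vU U(3) mU this M]
  obtain a where a: "(Lnorm 2 U (\<lambda>x. v x - a))\<^sup>2 \<le> M / measure lebesgue U" by metis
  also have "\<dots> \<le> M / m" using M U by (intro divide_left_mono mult_pos_pos) auto
  finally show ?thesis using that[of a] by (simp add: M_def)
qed

section \<open>Bump functions\<close>

definition bump :: "'a::euclidean_space \<Rightarrow> real \<Rightarrow> 'a \<Rightarrow> real" where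
  "bump c \<rho> x = flat 0 (1 - (norm (x - c) / \<rho>)\<^sup>2)"

lemma bump_elementary: "bump c \<rho> \<in> elementary"
proof -
  have "(\<lambda>x. flat 0 (1 - inverse (\<rho>\<^sup>2) * (norm (x - c))\<^sup>2)) \<in> elementary"
    by (intro elementary.flat elementary_diff elementary.mult elementary.const elementary_norm_sq)
  then show ?thesis by (simp add: bump_def[abs_def] power_divide field_simps)
qed

lemma bump_bounds: "0 \<le> bump c \<rho> x" "bump c \<rho> x \<le> 1"
  by (simp_all add: bump_def flat_nonneg flat_0_le_1)

lemma bump_eq_0: "0 < \<rho> \<Longrightarrow> \<rho> \<le> norm (x - c) \<Longrightarrow> bump c \<rho> x = 0"
  by (simp add: bump_def flat_eq_0 power_divide)

text \<open>Within half the radius the argument of \<open>flat 0\<close> is at least 3/4, and the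
  inverse of 3/4 gives the exponent.\<close>

lemma bump_lower: 
  assumes "0 < \<rho>" "norm (x - c) \<le> \<rho> / 2"
  shows "exp (- 4 / 3) \<le> bump c \<rho> x"
proof -
  have "(norm (x - c) / \<rho>)\<^sup>2 \<le> (1 / 2)\<^sup>2"
    using assms by (intro power_mono) (auto simp: field_simps)
  then have t: "3 / 4 \<le> 1 - (norm (x - c) / \<rho>)\<^sup>2" by (simp add: power2_eq_square)
  then have "inverse (1 - (norm (x - c) / \<rho>)\<^sup>2) \<le> inverse (3 / 4)"
    by (intro le_imp_inverse_le) auto
  then show ?thesis using t by (simp add: bump_def flat_def)
qed

text \<open>\<open>flat 2\<close> is the derivative of \<open>flat 0\<close>. The bound follows from
  s / 2 \<le> exp (s / 2) with s = 1 / t and is the source of the 8 in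
  \<open>norm_grad_bump_le\<close>.\<close>

lemma flat_2_le: "flat 2 t \<le> 4"
proof (cases "0 < t")
  case True
  define s where "s = inverse t"
  have s: "0 < s" using True by (simp add: s_def)
  have "(s / 2)\<^sup>2 \<le> (exp (s / 2))\<^sup>2"
    using s exp_ge_add_one_self[of "s / 2"] by (intro power_mono) linarith+
  also have "\<dots> = exp s" by (simp add: power2_eq_square flip: exp_add)
  finally have "s\<^sup>2 \<le> 4 * exp s" by (simp add: power_divide)
  then have "exp (- s) * s\<^sup>2 \<le> exp (- s) * (4 * exp s)" by (intro mult_left_mono) auto
  also have "\<dots> = 4" by (simp add: exp_minus)
  finally show ?thesis using True by (simp add: flat_def s_def)
qed (simp add: flat_eq_0)

lemma norm_grad_bump_le:
  assumes "0 < \<rho>"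
  shows "norm (grad (bump c \<rho>) x) \<le> 8 / \<rho>"
proof -
  define t where "t = 1 - (norm (x - c) / \<rho>)\<^sup>2"
  have inner: "((\<lambda>x. 1 - (norm (x - c) / \<rho>)\<^sup>2) has_derivative (\<lambda>h. - (2 * ((x - c) \<bullet> h) / \<rho>\<^sup>2))) (at x)"
  proof -
    have eq: "(\<lambda>x. 1 - (norm (x - c) / \<rho>)\<^sup>2) = (\<lambda>x. 1 - ((x - c) \<bullet> (x - c)) * inverse (\<rho>\<^sup>2))"
      by (simp add: power_divide power2_norm_eq_inner) (simp add: divide_inverse)
    have "((\<lambda>x. (x - c) \<bullet> (x - c)) has_derivative (\<lambda>h. (x - c) \<bullet> h + h \<bullet> (x - c))) (at x)"
      by (rule has_derivative_inner) (auto intro!: derivative_eq_intros)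
    then have "((\<lambda>x. 1 - (x - c) \<bullet> (x - c) * inverse (\<rho>\<^sup>2)) has_derivative
        (\<lambda>h. 0 - ((x - c) \<bullet> h + h \<bullet> (x - c)) * inverse (\<rho>\<^sup>2))) (at x)"
      by (intro has_derivative_diff has_derivative_const has_derivative_mult_left)
    then show ?thesis
      unfolding eq by (rule has_derivative_eq_rhs) (auto simp: inner_commute divide_inverse)
  qed
  have "(bump c \<rho> has_derivative (\<lambda>h. flat 2 t * - (2 * ((x - c) \<bullet> h) / \<rho>\<^sup>2))) (at x)"
    unfolding bump_def[abs_def] t_def
    using has_derivative_compose[OF inner flat_has_real_derivative[of 0, unfolded has_field_derivative_def]]
    by (simp add: numeral_2_eq_2)
  also have "(\<lambda>h. flat 2 t * - (2 * ((x - c) \<bullet> h) / \<rho>\<^sup>2)) = (\<lambda>h. (- (2 * flat 2 t / \<rho>\<^sup>2) *\<^sub>R (x - c)) \<bullet> h)"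
    by (rule ext, subst inner_scaleR_left) (simp add: mult_ac)
  finally have g: "grad (bump c \<rho>) x = - (2 * flat 2 t / \<rho>\<^sup>2) *\<^sub>R (x - c)" by (rule grad_unique)
  show ?thesis
  proof (cases "norm (x - c) \<le> \<rho>")
    case True
    have "norm (grad (bump c \<rho>) x) = 2 * flat 2 t / \<rho>\<^sup>2 * norm (x - c)"
      using flat_nonneg[of 2 t] by (simp add: g)
    also have "\<dots> \<le> 2 * 4 / \<rho>\<^sup>2 * \<rho>"
      using True flat_2_le[of t] flat_nonneg[of 2 t] by (intro mult_mono divide_right_mono) auto
    finally show ?thesis using assms by (simp add: power2_eq_square)
  next
    case False
    then have "1 \<le> norm (x - c) / \<rho>" using assms by simp
    then have "t \<le> 0" by (simp add: t_def)
    then show ?thesis using assms by (simp add: g flat_eq_0)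
  qed
qed

section \<open>Simplicial meshes of a Lipschitz domain\<close>

text \<open>A mesh covers the closure of \<open>D\<close>, and open sets covered by cells must be
  recognised as parts of \<open>D\<close>; this excludes slits. If a boundary point \<open>x\<close>
  were interior to the closure, then the lowered point \<open>x - t *\<^sub>R e\<close> would be a
  limit of points of \<open>D\<close>, although near \<open>x\<close> all of these lie above the
  Lipschitz graph.\<close>

lemma interior_closure_lipschitz_domain:
  fixes D :: "'a::euclidean_space set"
  assumes D: "open D" and lip: "lipschitz_boundary D"
  shows "interior (closure D) = D"
proof (rule ccontr)
  assume "interior (closure D) \<noteq> D"
  moreover have "D \<subseteq> interior (closure D)" by (rule interior_maximal[OF closure_subset D])
  ultimately obtain x where x: "x \<in> interior (closure D)" "x \<notin> D" by blast
  then have "x \<in> frontier D"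
    using interior_subset interior_open[OF D] by (auto simp: frontier_def)
  then obtain \<rho> e L and \<phi> :: "'a \<Rightarrow> real" where \<rho>: "0 < \<rho>" and e: "norm e = 1"
    and L: "L-lipschitz_on {y. y \<bullet> e = 0} \<phi>"
    and epi: "\<And>y. y \<in> ball x \<rho> \<Longrightarrow> y \<in> D \<longleftrightarrow> \<phi> (y - (y \<bullet> e) *\<^sub>R e) < y \<bullet> e"
    using lip unfolding lipschitz_boundary_def by blast
  have L0: "0 \<le> L" by (rule lipschitz_on_nonneg[OF L])
  have ee: "e \<bullet> e = 1" using e by (simp add: norm_eq_1)
  define Q where "Q y = y - (y \<bullet> e) *\<^sub>R e" for y
  have Qe: "Q y \<bullet> e = 0" for y by (simp add: Q_def inner_diff_left ee)
  have Qdist: "norm (Q y - Q y') \<le> 2 * norm (y - y')" for y y'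
  proof -
    have "Q y - Q y' = (y - y') - ((y - y') \<bullet> e) *\<^sub>R e" by (simp add: Q_def algebra_simps)
    also have "norm \<dots> \<le> norm (y - y') + norm (((y - y') \<bullet> e) *\<^sub>R e)" by (rule norm_triangle_ineq4)
    also have "\<dots> \<le> 2 * norm (y - y')" using Cauchy_Schwarz_ineq2[of "y - y'" e] e by simp
    finally show ?thesis .
  qed
  obtain r where r: "0 < r" "ball x r \<subseteq> closure D" using x(1) by (auto simp: mem_interior)
  define t where "t = min r \<rho> / 2"
  have t: "0 < t" "t < r" "2 * t \<le> \<rho>" using r \<rho> by (auto simp: t_def)
  \<comment> \<open>Within distance \<delta> of the lowered point the height changes by at most
    \<delta> and the graph by at most 2 L \<delta>, the 2 being the Lipschitz constant used for the
    projection \<open>Q\<close>. The sum is exactly the descent \<open>t\<close>, which yields the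
    contradiction.\<close>
  define \<delta> where "\<delta> = t / (2 * L + 1)"
  have \<delta>: "0 < \<delta>" "\<delta> \<le> t" "2 * L * \<delta> + \<delta> = t"
  proof -
    show "0 < \<delta>" using t L0 by (simp add: \<delta>_def)
    have "\<delta> * (2 * L + 1) = t" using L0 by (simp add: \<delta>_def)
    then show "2 * L * \<delta> + \<delta> = t" by (simp add: algebra_simps)
    then show "\<delta> \<le> t" using L0 \<open>0 < \<delta>\<close> by (smt (verit) mult_nonneg_nonneg)
  qed
  have "x - t *\<^sub>R e \<in> closure D" using r t e by (auto simp: subset_eq dist_norm)
  then obtain y where y: "y \<in> D" "dist y (x - t *\<^sub>R e) < \<delta>" using \<delta>(1) by (meson closure_approachable)
  have "dist x y \<le> dist x (x - t *\<^sub>R e) + dist (x - t *\<^sub>R e) y" by (rule dist_triangle)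
  also have "\<dots> < t + t" using y(2) \<delta> e t by (simp add: dist_norm norm_minus_commute)
  finally have "y \<in> ball x \<rho>" using t by simp
  then have "\<phi> (Q y) < y \<bullet> e" using y epi by (simp add: Q_def)
  moreover have "x \<bullet> e \<le> \<phi> (Q x)" using epi[of x] \<rho> x(2) by (simp add: Q_def)
  moreover have "\<phi> (Q x) - \<phi> (Q y) \<le> 2 * L * \<delta>"
  proof -
    have "Q (x - t *\<^sub>R e) = Q x" by (simp add: Q_def inner_diff_left ee algebra_simps)
    then have "norm (Q x - Q y) \<le> 2 * \<delta>" using Qdist[of "x - t *\<^sub>R e" y] y(2) by (simp add: dist_norm norm_minus_commute)
    then have "L * dist (Q x) (Q y) \<le> L * (2 * \<delta>)" using L0 by (intro mult_left_mono) (simp_all add: dist_norm)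
    moreover have "dist (\<phi> (Q x)) (\<phi> (Q y)) \<le> L * dist (Q x) (Q y)"
      using Qe by (intro lipschitz_onD[OF L]) auto
    ultimately show ?thesis by (simp add: dist_real_def)
  qed
  moreover have "y \<bullet> e < x \<bullet> e - t + \<delta>"
  proof -
    have "(y - (x - t *\<^sub>R e)) \<bullet> e \<le> norm (y - (x - t *\<^sub>R e)) * norm e"
      using Cauchy_Schwarz_ineq2 abs_le_D1 by blast
    then have "(y - (x - t *\<^sub>R e)) \<bullet> e < \<delta>" using y(2) e by (simp add: dist_norm)
    then show ?thesis by (simp add: inner_diff_left ee)
  qed
  ultimately show False using \<delta>(3) by simp
qed

lemma mem_interior_simplex:
  fixes K :: "'a::euclidean_space set"
  assumes K: "int DIM('a) simplex K" and pos: "\<And>w. w \<in> vertices K \<Longrightarrow> 0 < bary K w y"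
  shows "y \<in> interior K"
proof -
  let ?S = "\<Inter>w\<in>vertices K. {x. 0 < bary K w x}"
  have "open ?S"
    by (intro open_INT simplex_vertices(2)[OF K] ballI open_Collect_less continuous_intros)
  moreover have "?S \<subseteq> K" using mem_simplex_iff[OF K] by (auto intro: less_imp_le)
  ultimately have "?S \<subseteq> interior K" by (rule interior_maximal[rotated])
  then show ?thesis using pos by blast
qed

locale mesh_on_domain =
  fixes D :: "'a::euclidean_space set" and \<T> :: "'a set set" and \<sigma> :: real
  assumes domain: "polyhedral_lipschitz_domain D" and mesh: "simplicial_mesh D \<T>"
    and shape: "\<And>K. K \<in> \<T> \<Longrightarrow> diameter K / inball_diameter K \<le> \<sigma>"
    and dim: "2 \<le> DIM('a)"
begin

lemma finite_mesh: "finite \<T>"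
  and simplex_mesh: "K \<in> \<T> \<Longrightarrow> int DIM('a) simplex K"
  and face_mesh: "K \<in> \<T> \<Longrightarrow> K' \<in> \<T> \<Longrightarrow> K \<inter> K' face_of K"
  and Union_mesh: "\<Union>\<T> = closure D"
  using mesh by (auto simp: simplicial_mesh_def triangulation_def)

lemma open_D: "open D" and bounded_D: "bounded D"
  using domain by (auto simp: polyhedral_lipschitz_domain_def)

lemma D_lmeasurable: "D \<in> lmeasurable"
  using open_D bounded_D by (simp add: lmeasurable_open)

lemma D_sets: "D \<in> sets lebesgue"
  using open_D by auto

lemma measure_D_pos: "0 < measure lebesgue D"
proof -
  have "D \<noteq> {}" using domain by (simp add: polyhedral_lipschitz_domain_def)
  then show ?thesis
    using open_not_negligible[OF open_D] D_lmeasurable by (simp add: negligible_iff_measure zero_less_measure_iff)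
qed

lemma interior_closure_D: "interior (closure D) = D"
  using domain by (intro interior_closure_lipschitz_domain) (auto simp: polyhedral_lipschitz_domain_def)

lemma interior_cell_subset: "K \<in> \<T> \<Longrightarrow> interior K \<subseteq> D"
  using interior_mono[of K "closure D"] Union_mesh interior_closure_D by auto

text \<open>All cells have full dimension, whereas a cell contained in another one would be a proper
  face of it.\<close>

lemma inter_neq:
  assumes "K \<in> \<T>" "K' \<in> \<T>" "K \<noteq> K'"
  shows "K \<inter> K' \<noteq> K"
proof
  assume eq: "K \<inter> K' = K"
  have "K face_of K'" using face_mesh[OF assms(2,1)] eq by (simp add: Int_commute)
  then have "aff_dim K < aff_dim K'"
    using convex_simplex[OF simplex_mesh[OF assms(2)]] assms(3) by (intro face_of_aff_dim_lt)
  moreover have "aff_dim K = int DIM('a)" "aff_dim K' = int DIM('a)"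
    using aff_dim_simplex[OF simplex_mesh[OF assms(1)]] aff_dim_simplex[OF simplex_mesh[OF assms(2)]] by simp_all
  ultimately show False by simp
qed

lemma interior_disjoint:
  assumes "K \<in> \<T>" "K' \<in> \<T>" "K \<noteq> K'"
  shows "interior K \<inter> K' = {}"
  using face_of_disjoint_interior[OF face_mesh[OF assms(1,2)] inter_neq[OF assms]] interior_subset by blast

text \<open>The open cells are disjoint and contained in \<open>D\<close>, and weak derivatives make
  sense on them; the frontiers left out are null.\<close>

lemma cell_partition: "AE x in lebesgue. indicator D x = (\<Sum>K\<in>\<T>. indicator (interior K) x :: real)"
proof -
  have "AE x in lebesgue. \<forall>K\<in>\<T>. x \<notin> frontier K"
  proof (subst AE_ball_countable, rule countable_finite[OF finite_mesh], rule ballI)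
    fix K assume "K \<in> \<T>"
    then have "negligible (frontier K)"
      by (intro negligible_convex_frontier convex_simplex[OF simplex_mesh])
    then show "AE x in lebesgue. x \<notin> frontier K" by (intro AE_not_in) (simp only: negligible_iff_null_sets)
  qed
  then show ?thesis
  proof eventually_elim
    case (elim x)
    show ?case
    proof (cases "x \<in> D")
      case True
      then obtain K where K: "K \<in> \<T>" "x \<in> K" using Union_mesh closure_subset by blast
      then have xK: "x \<in> interior K"
        using elim closed_simplex[OF simplex_mesh[OF K(1)]] by (auto simp: frontier_def)
      have "(\<Sum>K\<in>\<T>. indicator (interior K) x :: real) = (\<Sum>K'\<in>{K}. indicator (interior K') x)"
      proof (rule sum.mono_neutral_right)
        show "\<forall>i\<in>\<T> - {K}. indicator (interior i) x = 0"
        proof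
          fix i assume "i \<in> \<T> - {K}"
          then have "x \<notin> interior i" using interior_disjoint[of i K] K by blast
          then show "indicator (interior i) x = 0" by simp
        qed
      qed (use finite_mesh K in auto)
      then show ?thesis using True xK by simp
    next
      case False
      then have "x \<notin> interior K" if "K \<in> \<T>" for K using interior_cell_subset[OF that] by blast
      then show ?thesis using False by simp
    qed
  qed
qed

lemma integral_cells:
  fixes f :: "'a \<Rightarrow> real"
  assumes f: "integrable (lebesgue_on D) f"
  shows "(LINT x|lebesgue_on D. f x) = (\<Sum>K\<in>\<T>. LINT x|lebesgue_on (interior K). f x)"
proof -
  have iK: "integrable lebesgue (\<lambda>x. indicator (interior K) x *\<^sub>R f x)" if "K \<in> \<T>" for K
    using integrable_lebesgue_on_subset[OF f interior_cell_subset[OF that]] D_sets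
    by (simp add: lebesgue_on_integral_eq set_integrable_def)
  have "(LINT x|lebesgue_on D. f x) = (LINT x|lebesgue. indicator D x *\<^sub>R f x)"
    using D_sets by (simp add: lebesgue_on_integral_eq set_lebesgue_integral_def)
  also have "\<dots> = (LINT x|lebesgue. (\<Sum>K\<in>\<T>. indicator (interior K) x *\<^sub>R f x))"
  proof (rule integral_cong_AE)
    show "(\<lambda>x. indicator D x *\<^sub>R f x) \<in> borel_measurable lebesgue"
      using f D_sets by (simp add: lebesgue_on_integral_eq set_integrable_def borel_measurable_integrable)
    show "(\<lambda>x. \<Sum>K\<in>\<T>. indicator (interior K) x *\<^sub>R f x) \<in> borel_measurable lebesgue"
      using iK by (intro borel_measurable_sum) (auto intro: borel_measurable_integrable)
    show "AE x in lebesgue. indicator D x *\<^sub>R f x = (\<Sum>K\<in>\<T>. indicator (interior K) x *\<^sub>R f x)"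
      using cell_partition by eventually_elim (simp add: sum_distrib_right)
  qed
  also have "\<dots> = (\<Sum>K\<in>\<T>. LINT x|lebesgue. indicator (interior K) x *\<^sub>R f x)"
    by (intro Bochner_Integration.integral_sum iK)
  also have "\<dots> = (\<Sum>K\<in>\<T>. LINT x|lebesgue_on (interior K). f x)"
    by (simp add: lebesgue_on_integral_eq set_lebesgue_integral_def)
  finally show ?thesis .
qed

section \<open>Facets and their adjacent cells\<close>

definition flags :: "('a set \<times> 'a) set" where
  "flags = (SIGMA K:\<T>. vertices K)"

text \<open>A facet is represented by its vertex set, so that a facet seen from two cells is
  literally the same object. A pair (K, z) names the facet opposite \<open>z\<close> together with a
  side of it, and \<open>star\<close> collects the sides.\<close>

definition facet :: "'a set \<times> 'a \<Rightarrow> 'a set" where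
  "facet p = vertices (fst p) - {snd p}"

definition star :: "'a set \<Rightarrow> ('a set \<times> 'a) set" where
  "star F = {p \<in> flags. facet p = F}"

definition center :: "'a set \<Rightarrow> 'a" where
  "center F = (\<Sum>w\<in>F. (1 / real DIM('a)) *\<^sub>R w)"

lemma finite_flags: "finite flags"
  unfolding flags_def using finite_mesh simplex_vertices(2)[OF simplex_mesh] by auto

lemma finite_star: "finite (star F)"
  by (rule finite_subset[OF _ finite_flags]) (auto simp: star_def)

lemma starD:
  assumes "(K, z) \<in> star F"
  shows "K \<in> \<T>" "z \<in> vertices K" "vertices K - {z} = F" "vertices K = insert z F" "z \<notin> F"
    "finite F" "card F = DIM('a)" "int DIM('a) simplex K" "diameter K / inball_diameter K \<le> \<sigma>"
proof -
  show a: "K \<in> \<T>" "z \<in> vertices K" "vertices K - {z} = F" "vertices K = insert z F" "z \<notin> F"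
    using assms by (auto simp: star_def flags_def facet_def)
  show K: "int DIM('a) simplex K" by (rule simplex_mesh[OF a(1)])
  show "finite F" "card F = DIM('a)"
    using simplex_vertices(2,3)[OF K] a by auto
  show "diameter K / inball_diameter K \<le> \<sigma>" by (rule shape[OF a(1)])
qed

lemma bary_center:
  assumes "(K, z) \<in> star F"
  shows "bary K z (center F) = 0" "w \<in> F \<Longrightarrow> bary K w (center F) = 1 / real DIM('a)"
proof -
  note S = starD[OF assms]
  have b: "bary K w (center F) = (\<Sum>v\<in>F. 1 / real DIM('a) * bary K w v)" for w
    unfolding center_def by (rule bary_affine_combination) (use S in auto)
  show "bary K z (center F) = 0"
    unfolding b by (rule sum.neutral) (use S in \<open>auto simp: bary_vertex[OF S(8)]\<close>)
  assume w: "w \<in> F"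
  have "bary K w (center F) = (\<Sum>v\<in>F. if v = w then 1 / real DIM('a) else 0)"
    unfolding b by (rule sum.cong) (use S w in \<open>auto simp: bary_vertex[OF S(8)]\<close>)
  then show "bary K w (center F) = 1 / real DIM('a)" using S(6) w by simp
qed

lemma center_in_cell:
  assumes "(K, z) \<in> star F"
  shows "center F \<in> K"
  using bary_center[OF assms] starD[OF assms] mem_simplex_iff[of K "center F"] by auto

text \<open>If both apexes were on the same side of the facet, the segment from the center of the
  facet to the apex of the second cell would start inside the interior of the first one, while
  staying in the second; but the interior of a cell misses all other cells.\<close>

lemma star_opposite:
  assumes 1: "(K\<^sub>1, z\<^sub>1) \<in> star F" and 2: "(K\<^sub>2, z\<^sub>2) \<in> star F" and neq: "K\<^sub>1 \<noteq> K\<^sub>2"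
  shows "bary K\<^sub>1 z\<^sub>1 z\<^sub>2 < 0"
proof (rule ccontr)
  note S1 = starD[OF 1] and S2 = starD[OF 2]
  assume "\<not> bary K\<^sub>1 z\<^sub>1 z\<^sub>2 < 0"
  moreover have "bary K\<^sub>1 z\<^sub>1 z\<^sub>2 \<noteq> 0"
  proof
    assume "bary K\<^sub>1 z\<^sub>1 z\<^sub>2 = 0"
    moreover have "bary K\<^sub>2 z\<^sub>2 z\<^sub>1 * bary K\<^sub>1 z\<^sub>1 z\<^sub>2 = 1"
      by (rule bary_opposite(2)[OF S1(8) S2(8) S1(2) S2(2)]) (simp only: S1(3) S2(3))
    ultimately show False by simp
  qed
  ultimately have pos: "0 < bary K\<^sub>1 z\<^sub>1 z\<^sub>2" by simp
  define y where "y e = center F + e *\<^sub>R (z\<^sub>2 - center F)" for e :: real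
  have b: "bary K\<^sub>1 w (y e) = (1 - e) * bary K\<^sub>1 w (center F) + e * bary K\<^sub>1 w z\<^sub>2" for w e
    unfolding y_def by (rule bary_dilation)
  have "\<forall>\<^sub>F e in at_right 0. \<forall>w\<in>F. 0 < bary K\<^sub>1 w (y e)"
  proof (rule eventually_ball_finite[OF S1(6)], rule ballI)
    fix w assume w: "w \<in> F"
    have "((\<lambda>e. bary K\<^sub>1 w (y e)) \<longlongrightarrow> (1 - 0) * bary K\<^sub>1 w (center F) + 0 * bary K\<^sub>1 w z\<^sub>2) (at_right 0)"
      unfolding b by (intro tendsto_intros)
    moreover have "0 < (1 - 0) * bary K\<^sub>1 w (center F) + 0 * bary K\<^sub>1 w z\<^sub>2"
      using bary_center(2)[OF 1 w] by simp
    ultimately show "\<forall>\<^sub>F e in at_right 0. 0 < bary K\<^sub>1 w (y e)" by (rule order_tendstoD(1))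
  qed
  moreover have "\<forall>\<^sub>F e in at_right 0. 0 < e \<and> e < (1::real)"
    unfolding eventually_at_right_field by (intro exI[of _ 1]) auto
  ultimately have ev: "\<forall>\<^sub>F e in at_right 0. (\<forall>w\<in>F. 0 < bary K\<^sub>1 w (y e)) \<and> 0 < e \<and> e < (1::real)"
    by eventually_elim auto
  have "\<exists>e. (\<forall>w\<in>F. 0 < bary K\<^sub>1 w (y e)) \<and> 0 < e \<and> e < (1::real)"
    by (rule eventually_happens'[OF _ ev]) simp
  then obtain e where e: "\<And>w. w \<in> F \<Longrightarrow> 0 < bary K\<^sub>1 w (y e)" "0 < e" "e < 1"
    by blast
  have "0 < bary K\<^sub>1 z\<^sub>1 (y e)" using pos e bary_center(1)[OF 1] by (simp add: b)
  then have "y e \<in> interior K\<^sub>1"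
    using e(1) S1(4) by (intro mem_interior_simplex[OF S1(8)]) auto
  moreover have "y e \<in> K\<^sub>2"
  proof -
    have "z\<^sub>2 \<in> K\<^sub>2" using vertices_subset[OF S2(8)] S2(2) by auto
    then have "(1 - e) *\<^sub>R center F + e *\<^sub>R z\<^sub>2 \<in> K\<^sub>2"
      using e center_in_cell[OF 2] convex_simplex[OF S2(8)] by (intro convexD_alt) auto
    then show ?thesis by (simp add: y_def algebra_simps)
  qed
  ultimately show False using interior_disjoint[OF S1(1) S2(1) neq] by blast
qed

lemma star_inj:
  assumes "(K, z) \<in> star F" "(K, z') \<in> star F"
  shows "z = z'"
  using starD[OF assms(1)] starD[OF assms(2)] by auto

text \<open>The apex coordinates of two different cells at the facet are proportional with a
  negative factor. For three cells, one of these factors would be the product of two others.\<close>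

lemma card_star_le_2: "card (star F) \<le> 2"
proof (rule ccontr)
  assume "\<not> card (star F) \<le> 2"
  then obtain S where S: "S \<subseteq> star F" "card S = 3"
    using obtain_subset_with_card_n[of 3 "star F"] by force
  obtain p q r where "S = {p, q, r}" and pqr0: "p \<noteq> q" "q \<noteq> r" "p \<noteq> r"
    using S(2) card_3_iff[of S] by metis
  then have pqr: "p \<in> star F" "q \<in> star F" "r \<in> star F" using S(1) by auto
  obtain K\<^sub>1 z\<^sub>1 K\<^sub>2 z\<^sub>2 K\<^sub>3 z\<^sub>3 where eq: "p = (K\<^sub>1, z\<^sub>1)" "q = (K\<^sub>2, z\<^sub>2)" "r = (K\<^sub>3, z\<^sub>3)"
    by (cases p, cases q, cases r)
  note s = pqr[unfolded eq]
  have neq: "K\<^sub>1 \<noteq> K\<^sub>2" "K\<^sub>2 \<noteq> K\<^sub>3" "K\<^sub>1 \<noteq> K\<^sub>3"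
    using pqr0 star_inj[OF s(1), of z\<^sub>2] star_inj[OF s(2), of z\<^sub>3] star_inj[OF s(1), of z\<^sub>3] s
    by (auto simp: eq)
  have "bary K\<^sub>3 z\<^sub>3 z\<^sub>1 = bary K\<^sub>3 z\<^sub>3 z\<^sub>2 * bary K\<^sub>2 z\<^sub>2 z\<^sub>1"
    using starD[OF s(2)] starD[OF s(3)] by (intro bary_opposite(1)) auto
  moreover have "bary K\<^sub>3 z\<^sub>3 z\<^sub>1 < 0" "bary K\<^sub>3 z\<^sub>3 z\<^sub>2 < 0" "bary K\<^sub>2 z\<^sub>2 z\<^sub>1 < 0"
    using star_opposite s neq by metis+
  ultimately show False using mult_neg_neg[of "bary K\<^sub>3 z\<^sub>3 z\<^sub>2" "bary K\<^sub>2 z\<^sub>2 z\<^sub>1"] by simp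
qed

text \<open>The intersection is a common face, spanned by a set \<open>c\<close> of vertices of
  \<open>K\<close>. If \<open>c\<close> contained \<open>F\<close>, then \<open>F\<close> would
  consist of vertices of \<open>K'\<close> and be a facet of \<open>K'\<close>. So some vertex of
  \<open>F\<close> is missing from \<open>c\<close>, and its coordinate vanishes on the
  face.\<close>

lemma intersection_misses_facet:
  assumes p: "(K, z) \<in> star F" and K': "K' \<in> \<T>" "\<And>z'. (K', z') \<notin> star F"
  obtains w where "w \<in> F" "\<And>x. x \<in> K \<Longrightarrow> x \<in> K' \<Longrightarrow> bary K w x = 0"
proof -
  note S = starD[OF p] and V = simplex_vertices[OF starD(8)[OF p]] and V' = simplex_vertices[OF simplex_mesh[OF K'(1)]]
  have neq: "K \<noteq> K'" using K' p by auto
  have "K \<inter> K' face_of convex hull vertices K" using face_mesh[OF S(1) K'(1)] V(4) by simp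
  then obtain c where c: "c \<subseteq> vertices K" "K \<inter> K' = convex hull c"
    using face_of_convex_hull_affine_independent[OF V(1)] by blast
  have "K' \<inter> K face_of convex hull vertices K'" using face_mesh[OF K'(1) S(1)] V'(4) by simp
  then obtain c' where c': "c' \<subseteq> vertices K'" "K' \<inter> K = convex hull c'"
    using face_of_convex_hull_affine_independent[OF V'(1)] by blast
  have "\<not> F \<subseteq> c"
  proof
    assume "F \<subseteq> c"
    moreover have "c \<noteq> vertices K" using inter_neq[OF S(1) K'(1) neq] c V(4) by auto
    ultimately have cF: "c = F" using c(1) S(4) by auto
    \<comment> \<open>The extreme points of the common face determine its vertices in either cell,
      so \<open>c\<close> and \<open>c'\<close> coincide.\<close>
    have "c = {x. x extreme_point_of (convex hull c)}"
      using extreme_point_of_convex_hull_affine_independent[OF affine_independent_subset[OF V(1) c(1)]] by auto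
    also have "convex hull c = convex hull c'" using c c' by (simp add: Int_commute)
    also have "{x. x extreme_point_of (convex hull c')} = c'"
      using extreme_point_of_convex_hull_affine_independent[OF affine_independent_subset[OF V'(1) c'(1)]] by auto
    finally have sub: "F \<subseteq> vertices K'" using c'(1) cF by simp
    have "card (vertices K' - F) = 1"
      using sub S(6,7) V'(2,3) by (simp add: card_Diff_subset)
    then obtain z' where "vertices K' - F = {z'}" by (auto simp: card_1_singleton_iff)
    then have "(K', z') \<in> star F" using sub K'(1) by (auto simp: star_def flags_def facet_def)
    then show False using K'(2) by blast
  qed
  then obtain w where w: "w \<in> F" "w \<notin> c" by blast
  have "bary K w x = 0" if "x \<in> K" "x \<in> K'" for x
  proof -
    have fc: "finite c" using c(1) V(2) finite_subset by blast
    have "x \<in> convex hull c" using that c by blast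
    then obtain u where u: "sum u c = 1" "(\<Sum>v\<in>c. u v *\<^sub>R v) = x" by (auto simp: convex_hull_finite[OF fc])
    have "bary K w x = (\<Sum>v\<in>c. u v * bary K w v)"
      using bary_affine_combination[OF fc u(1)] u(2) by simp
    also have "\<dots> = 0"
    proof (rule sum.neutral, rule ballI)
      fix v assume "v \<in> c"
      then have "v \<noteq> w" "v \<in> vertices K" "w \<in> vertices K" using w c(1) S(4) by auto
      then show "u v * bary K w v = 0" by (simp add: bary_vertex[OF S(8)])
    qed
    finally show ?thesis .
  qed
  with w(1) show ?thesis by (rule that)
qed

text \<open>Moving \<open>x\<close> slightly towards the center of the facet yields a point of
  \<open>D\<close> that lies in no other cell, by \<open>intersection_misses_facet\<close>. A
  neighbourhood of this point would be covered by \<open>K\<close> alone, although the coordinate of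
  \<open>z\<close> turns negative across the facet.\<close>

lemma facet_interior_boundary:
  assumes star: "star F = {(K, z)}" and x: "x \<in> K" "bary K z x = 0" "x \<in> D"
  shows False
proof -
  have p: "(K, z) \<in> star F" using star by simp
  note S = starD[OF p]
  define y where "y e = x + e *\<^sub>R (center F - x)" for e :: real
  have b: "bary K w (y e) = (1 - e) * bary K w x + e * bary K w (center F)" for w e
    unfolding y_def by (rule bary_dilation)
  have cy: "continuous_on UNIV y" unfolding y_def by (intro continuous_intros)
  have "open (y -` D)" using open_D cy by (simp add: continuous_on_open_vimage)
  moreover have "0 \<in> y -` D" using x by (simp add: y_def)
  ultimately obtain r where r: "0 < r" "ball 0 r \<subseteq> y -` D" by (meson open_contains_ball)
  define e where "e = min (r / 2) (1 / 2)"
  have e: "0 < e" "e < 1" "y e \<in> D" using r by (auto simp: e_def subset_eq)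
  have by0: "bary K z (y e) = 0" using x bary_center(1)[OF p] by (simp add: b)
  have byF: "0 < bary K w (y e)" if "w \<in> F" for w
  proof -
    have "0 \<le> bary K w x" using x(1) mem_simplex_iff[OF S(8), of x] S(4) that by auto
    then show ?thesis using e bary_center(2)[OF p that] dim by (auto simp: b intro!: add_nonneg_pos)
  qed
  have yK': "y e \<notin> K'" if K': "K' \<in> \<T>" "K' \<noteq> K" for K'
  proof
    assume yK': "y e \<in> K'"
    have "(K', z') \<notin> star F" for z' using star K' by auto
    then obtain w where w: "w \<in> F" "\<And>x. x \<in> K \<Longrightarrow> x \<in> K' \<Longrightarrow> bary K w x = 0"
      using intersection_misses_facet[OF p K'(1)] by metis
    have "y e \<in> K" using byF by0 S(4) less_imp_le by (subst mem_simplex_iff[OF S(8)]) auto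
    then show False using w yK' byF by fastforce
  qed
  let ?O = "D - \<Union>(\<T> - {K})"
  have "closed (\<Union>(\<T> - {K}))"
    using finite_mesh closed_simplex[OF simplex_mesh] by (intro closed_Union) auto
  then have O: "open ?O" using open_D by (rule open_Diff[rotated])
  have OK: "?O \<subseteq> K" using Union_mesh closure_subset by blast
  have "y e \<in> ?O" using e yK' by blast
  then obtain \<rho> where \<rho>: "0 < \<rho>" "ball (y e) \<rho> \<subseteq> K" using O OK by (meson open_contains_ball subset_trans)
  have yK: "y e \<in> K" using \<rho> by auto
  have zn: "z \<noteq> y e" using by0 bary_vertex[OF S(8) S(2) S(2)] by auto
  define s where "s = \<rho> / (2 * norm (z - y e))"
  have s: "0 < s" using \<rho> zn by (simp add: s_def)
  have "y e + (- s) *\<^sub>R (z - y e) \<in> ball (y e) \<rho>"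
    using \<rho> zn by (simp add: dist_norm s_def)
  then have "y e + (- s) *\<^sub>R (z - y e) \<in> K" using \<rho> by blast
  then have "0 \<le> bary K z (y e + (- s) *\<^sub>R (z - y e))" using mem_simplex_iff[OF S(8)] S(2) by blast
  also have "\<dots> = - s" unfolding bary_dilation using by0 bary_vertex[OF S(8) S(2) S(2)] by simp
  finally show False using s by simp
qed

text \<open>Along an edge of the common facet the coordinate of one endpoint falls from 1 to 0, so
  the edge is at least as long as the inverse of the gradient bound in the first cell; it is at most
  as long as the diameter of the second. The facet has an edge because d \<ge> 2.\<close>

lemma diameter_star_le:
  assumes 1: "(K\<^sub>1, z\<^sub>1) \<in> star F" and 2: "(K\<^sub>2, z\<^sub>2) \<in> star F"
  shows "diameter K\<^sub>1 \<le> \<sigma> * diameter K\<^sub>2"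
proof -
  note S1 = starD[OF 1] and S2 = starD[OF 2]
  obtain w v where wv: "w \<in> F" "v \<in> F" "w \<noteq> v"
  proof -
    have "\<not> (\<exists>w. F \<subseteq> {w})" using S1(6,7) dim card_mono[of "{_}" F] by fastforce
    then show ?thesis using that by blast
  qed
  have "1 = bary_grad K\<^sub>1 w \<bullet> (w - v)"
    using bary_grad_vertices[OF S1(8), of w v] wv S1(4) by auto
  also have "\<dots> \<le> norm (bary_grad K\<^sub>1 w) * norm (w - v)"
    using Cauchy_Schwarz_ineq2 abs_le_D1 by blast
  also have "\<dots> \<le> \<sigma> / diameter K\<^sub>1 * diameter K\<^sub>2"
  proof (intro mult_mono)
    show "norm (bary_grad K\<^sub>1 w) \<le> \<sigma> / diameter K\<^sub>1"
      using norm_bary_grad_le[OF S1(8,9)] wv S1(4) by auto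
    show "norm (w - v) \<le> diameter K\<^sub>2"
      using wv S2(4) vertices_subset[OF S2(8)]
        diameter_bounded_bound[OF compact_imp_bounded[OF compact_simplex[OF S2(8)]], of w v]
      by (auto simp: dist_norm)
    show "0 \<le> \<sigma> / diameter K\<^sub>1"
      using shape_constant_pos[OF S1(8,9)] diameter_simplex_pos[OF S1(8)] by simp
  qed simp
  finally show ?thesis using diameter_simplex_pos[OF S1(8)] by (simp add: field_simps)
qed

end

section \<open>Smooth functions as Sobolev functions and as liftings of their boundary
  values\<close>

lemma continuous_times_integrable:
  fixes u g :: "'a::euclidean_space \<Rightarrow> real"
  assumes u: "continuous_on UNIV u" and U: "bounded U" "U \<in> sets lebesgue" and g: "integrable (lebesgue_on U) g"
  shows "integrable (lebesgue_on U) (\<lambda>x. g x * u x)"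
proof -
  have "(\<lambda>x. u x * g x) absolutely_integrable_on U"
  proof (rule absolutely_integrable_bounded_measurable_product[OF bilinear_times])
    show "u \<in> borel_measurable (lebesgue_on U)"
      using u by (auto intro!: measurable_restrict_space1 measurable_completion borel_measurable_continuous_onI)
    have "bounded (u ` closure U)"
      using U by (intro compact_imp_bounded compact_continuous_image continuous_on_subset[OF u]) (auto simp: compact_closure)
    then show "bounded (u ` U)" by (rule bounded_subset) (use closure_subset in blast)
  qed (use U g in \<open>auto simp: lebesgue_on_integral_eq\<close>)
  then show ?thesis using U by (simp add: lebesgue_on_integral_eq mult.commute)
qed

lemma continuous_in_Lspace_2:
  fixes u :: "'a::euclidean_space \<Rightarrow> 'b::euclidean_space"
  assumes u: "continuous_on UNIV u" and U: "bounded U" "U \<in> lmeasurable"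
  shows "u \<in> Lspace 2 U"
proof -
  have "bounded (u ` closure U)"
    using U by (intro compact_imp_bounded compact_continuous_image continuous_on_subset[OF u]) (auto simp: compact_closure)
  then obtain M where "\<And>x. x \<in> closure U \<Longrightarrow> norm (u x) \<le> M" by (auto simp: bounded_iff)
  then show ?thesis
    using u U closure_subset[of U]
    by (intro bounded_in_Lspace_2[where M=M])
      (auto intro!: measurable_restrict_space1 measurable_completion borel_measurable_continuous_onI)
qed

lemma grad_cong:
  assumes "open S" "x \<in> S" "\<And>y. y \<in> S \<Longrightarrow> u y = w y" "C1 w"
  shows "grad u x = grad w x"
proof (rule grad_unique)
  show "(u has_derivative (\<bullet>) (grad w x)) (at x)"
    using has_derivative_transform_within_open[OF C1_has_derivative[OF assms(4), of x UNIV] assms(1,2), of u] assms(3) by simp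
qed

lemma smooth_in_sobolev_1:
  assumes u: "smooth u" and U: "open U" "bounded U"
  shows "u \<in> sobolev 1 U" and "weak_grad U u \<in> Lspace 2 U"
    and "AE x in lebesgue. x \<in> U \<longrightarrow> weak_grad U u x = grad u x"
proof -
  have Ul: "U \<in> lmeasurable" using U by (simp add: lmeasurable_open)
  note c = C1_continuous[OF smooth_C1[OF u], of UNIV]
  note w = smooth_has_weak_grad[OF u U(1)]
  show AE: "AE x in lebesgue. x \<in> U \<longrightarrow> weak_grad U u x = grad u x" by (rule weak_grad_AE[OF U(1) w])
  show L: "weak_grad U u \<in> Lspace 2 U"
    by (rule Lspace_AE[OF continuous_in_Lspace_2[OF c(2) U(2) Ul]]) (use AE U in \<open>auto elim: eventually_mono\<close>)
  show "u \<in> sobolev 1 U"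
    using continuous_in_Lspace_2[OF c(1) U(2) Ul] w L by (auto simp: sobolev_def)
qed

lemma smooth_has_trace:
  assumes u: "smooth u" and D: "open D" "bounded D"
  shows "has_trace D u u"
proof -
  have "u \<in> borel_measurable (surface_measure (frontier D))"
  proof -
    have "sets (measure_of UNIV (sets borel) (hausdorff_outer_measure (DIM('a) - 1) :: 'a set \<Rightarrow> ennreal)) = sets borel"
      using sets.sigma_sets_eq[of "borel :: 'a measure"] by simp
    then have "u \<in> borel_measurable (measure_of UNIV (sets borel) (hausdorff_outer_measure (DIM('a) - 1)))"
      using C1_measurable(1)[OF smooth_C1[OF u]] by (simp cong: measurable_cong_sets)
    then show ?thesis unfolding surface_measure_def by (rule measurable_restrict_space1)
  qed
  moreover have "sobolev_seminorm 1 D (\<lambda>x. u x - u x) = 0"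
  proof -
    have z: "smooth (\<lambda>x::'a. 0)" by (rule elementary_smooth[OF elementary.const])
    have gz: "grad (\<lambda>x::'a. 0) x = 0" for x by (rule grad_eq_0[of UNIV]) auto
    have "Lnorm 2 D (weak_grad D (\<lambda>x. 0)) = Lnorm 2 D (\<lambda>x. 0 :: 'a)"
      by (rule Lnorm_AE[OF continuous_in_Lspace_2])
        (use smooth_in_sobolev_1(3)[OF z D] D in \<open>auto simp: gz lmeasurable_open elim: eventually_mono\<close>)
    then show ?thesis by (simp add: sobolev_seminorm_def Lnorm_def)
  qed
  ultimately show ?thesis
    using smooth_in_sobolev_1(1)[OF u D]
    unfolding has_trace_def by (intro conjI exI[of _ "\<lambda>_. u"]) (simp_all add: u Lnorm_def)
qed

section \<open>Jumps of piecewise constant fields\<close>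

locale div_field_on_mesh = mesh_on_domain +
  fixes v :: "'a \<Rightarrow> 'a" and q :: real
  assumes v_Hdiv: "v \<in> Hdiv q D" and q_ge_1: "1 \<le> q"
begin

lemma v_L2: "v \<in> Lspace 2 D" and div_Lq: "weak_div D v \<in> Lspace q D"
  and has_div: "has_weak_div D v (weak_div D v)"
  using v_Hdiv weak_div_works by (auto simp: Hdiv_def)

end

context mesh_on_domain
begin

lemma measure_interior_cell:
  assumes "K \<in> \<T>"
  shows "measure lebesgue (interior K) = measure lborel K" "interior K \<in> lmeasurable"
proof -
  note S = simplex_mesh[OF assms]
  have "negligible (frontier K)" by (intro negligible_convex_frontier convex_simplex[OF S])
  then have "negligible (K - interior K)"
    by (rule negligible_subset) (use closure_subset in \<open>auto simp: frontier_def\<close>)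
  moreover have "K \<in> lmeasurable" by (rule lmeasurable_compact[OF compact_simplex[OF S]])
  ultimately have "measure lebesgue (interior K) = measure lebesgue K"
    using interior_subset[of K] by (intro measure_negligible_symdiff) (auto simp: Un_absorb1 Diff_eq_empty_iff[THEN iffD2])
  then show "measure lebesgue (interior K) = measure lborel K"
    using compact_simplex[OF S] by (simp add: borel_compact)
  show "interior K \<in> lmeasurable"
    using compact_imp_bounded[OF compact_simplex[OF S]] by (intro lmeasurable_open) (auto intro: bounded_subset[OF _ interior_subset])
qed

lemma integral_interior_cell:
  fixes G :: "'a \<Rightarrow> real"
  assumes "K \<in> \<T>" and G: "G \<in> borel_measurable borel"
  shows "(LINT x|lebesgue_on (interior K). G x) = (LINT x:K|lborel. G x)"
proof -
  note S = simplex_mesh[OF assms(1)]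
  have "negligible (frontier K)" by (intro negligible_convex_frontier convex_simplex[OF S])
  then have AE: "AE x in lebesgue. x \<notin> frontier K" by (intro AE_not_in) (simp only: negligible_iff_null_sets)
  have Kb: "K \<in> sets borel" using compact_simplex[OF S] by (rule borel_compact)
  have m: "G \<in> borel_measurable lebesgue" using G by (auto intro!: measurable_completion)
  have "(LINT x|lebesgue_on (interior K). G x) = (LINT x|lebesgue. indicator (interior K) x *\<^sub>R G x)"
    by (simp add: lebesgue_on_integral_eq set_lebesgue_integral_def)
  also have "\<dots> = (LINT x|lebesgue. indicator K x *\<^sub>R G x)"
  proof (rule integral_cong_AE)
    show "AE x in lebesgue. indicator (interior K) x *\<^sub>R G x = indicator K x *\<^sub>R G x"
      using AE by eventually_elim (use closed_simplex[OF S] interior_subset[of K] in \<open>auto simp: frontier_def indicator_def\<close>)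
  qed (use Kb in \<open>auto simp del: real_scaleR_def intro!: borel_measurable_scaleR borel_measurable_indicator m\<close>)
  also have "\<dots> = (LINT x:K|lborel. G x)"
    unfolding set_lebesgue_integral_def using G Kb by (intro integral_completion) auto
  finally show ?thesis .
qed

section \<open>Bumps at the centers of facets\<close>

lemma shape_pos: "(K, z) \<in> star F \<Longrightarrow> 0 < \<sigma>"
  using shape_constant_pos starD(8,9) by blast

lemma diameter_star_pos: "(K, z) \<in> star F \<Longrightarrow> 0 < diameter K"
  using diameter_simplex_pos starD(8) by blast

text \<open>Small enough for \<open>3/2\<close> times the ball around the center of a facet of \<open>K\<close> to stay away from
  the other facets of both adjacent cells.\<close>

definition radius :: "'a set \<Rightarrow> real" where
  "radius K = diameter K / (2 * real DIM('a) * \<sigma>\<^sup>2)"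

lemma radius_pos:
  assumes "(K, z) \<in> star F"
  shows "0 < radius K"
  unfolding radius_def using shape_pos[OF assms] diameter_star_pos[OF assms] by (intro divide_pos_pos) auto

text \<open>The coordinate equals 1/d at the center and changes by at most 3/(4d) in the ball. One
  factor \<sigma> in the radius absorbs the gradient bound, the other the comparison of the
  diameters of \<open>K\<close> and \<open>K\<^sub>0\<close>, since the radius may be that of the
  neighbour.\<close>

lemma bary_near_center:
  assumes p: "(K, z) \<in> star F" and p0: "(K\<^sub>0, z\<^sub>0) \<in> star F" and w: "w \<in> F"
    and x: "norm (x - center F) \<le> 3 / 2 * radius K\<^sub>0"
  shows "0 < bary K w x"
proof -
  note S = starD[OF p]
  have n: "0 < real DIM('a)" by simp
  have "norm (bary_grad K w) * norm (x - center F) \<le> \<sigma> / diameter K * (3 / 2 * radius K\<^sub>0)"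
    using norm_bary_grad_le[OF S(8,9)] S(4) w x shape_pos[OF p] diameter_star_pos[OF p] by (intro mult_mono) auto
  also have "\<dots> = 3 / (4 * real DIM('a)) * (diameter K\<^sub>0 / (\<sigma> * diameter K))"
    using shape_pos[OF p] by (simp add: radius_def power2_eq_square)
  also have "\<dots> \<le> 3 / (4 * real DIM('a)) * 1"
    using diameter_star_le[OF p0 p] shape_pos[OF p] diameter_star_pos[OF p] by (intro mult_left_mono) auto
  also have "\<dots> < 1 / real DIM('a)" using n by (simp add: field_simps)
  finally have "norm (bary_grad K w) * norm (x - center F) < 1 / real DIM('a)" .
  moreover have "\<bar>bary_grad K w \<bullet> (x - center F)\<bar> \<le> norm (bary_grad K w) * norm (x - center F)"
    by (rule Cauchy_Schwarz_ineq2)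
  moreover have "bary K w x = 1 / real DIM('a) + bary_grad K w \<bullet> (x - center F)"
    using bary_diff[of K w x "center F"] bary_center(2)[OF p w] by simp
  ultimately show ?thesis by linarith
qed

lemma near_center_in_cell:
  assumes p: "(K, z) \<in> star F" and p0: "(K\<^sub>0, z\<^sub>0) \<in> star F"
    and x: "norm (x - center F) \<le> 3 / 2 * radius K\<^sub>0" "0 \<le> bary K z x"
  shows "x \<in> K"
  using starD(4,8)[OF p] x bary_near_center[OF p p0 _ x(1)]
  by (auto simp: mem_simplex_iff[OF starD(8)[OF p]] intro: less_imp_le)

text \<open>The two apex coordinates are negative multiples of each other, so at each point one of
  them is nonnegative, and near the center the remaining coordinates are positive anyway.\<close>

lemma near_center_in_star:
  assumes p: "(K\<^sub>1, z\<^sub>1) \<in> star F" "(K\<^sub>2, z\<^sub>2) \<in> star F" and neq: "K\<^sub>1 \<noteq> K\<^sub>2" and p0: "(K\<^sub>0, z\<^sub>0) \<in> star F"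
    and x: "norm (x - center F) \<le> 3 / 2 * radius K\<^sub>0"
  shows "x \<in> K\<^sub>1 \<union> K\<^sub>2"
proof -
  note S1 = starD[OF p(1)] and S2 = starD[OF p(2)]
  have "bary K\<^sub>2 z\<^sub>2 x = bary K\<^sub>2 z\<^sub>2 z\<^sub>1 * bary K\<^sub>1 z\<^sub>1 x"
    by (rule bary_opposite(1)[OF S1(8) S2(8) S1(2) S2(2)]) (simp only: S1(3) S2(3))
  moreover have "bary K\<^sub>2 z\<^sub>2 z\<^sub>1 < 0" using star_opposite[OF p(2,1)] neq by simp
  ultimately have "0 \<le> bary K\<^sub>1 z\<^sub>1 x \<or> 0 \<le> bary K\<^sub>2 z\<^sub>2 x"
    using mult_nonpos_nonpos[of "bary K\<^sub>2 z\<^sub>2 z\<^sub>1" "bary K\<^sub>1 z\<^sub>1 x"] by linarith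
  then show ?thesis using near_center_in_cell[OF _ p0 x] p by auto
qed

definition star_bump :: "'a set \<Rightarrow> 'a set \<Rightarrow> 'a \<Rightarrow> real" where
  "star_bump F K = bump (center F) (radius K)"

lemma star_bump_smooth: "smooth (star_bump F K)"
  unfolding star_bump_def by (rule elementary_smooth[OF bump_elementary])

lemmas star_bump_C1 = smooth_C1[OF star_bump_smooth]

lemma star_bump_eq_0:
  assumes p0: "(K\<^sub>0, z\<^sub>0) \<in> star F" and x: "radius K\<^sub>0 < norm (x - center F)"
  shows "star_bump F K\<^sub>0 x = 0" "grad (star_bump F K\<^sub>0) x = 0"
proof -
  have 0: "star_bump F K\<^sub>0 y = 0" if "radius K\<^sub>0 < norm (y - center F)" for y
    unfolding star_bump_def using that by (intro bump_eq_0 radius_pos[OF p0]) simp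
  show "star_bump F K\<^sub>0 x = 0" using 0 x .
  show "grad (star_bump F K\<^sub>0) x = 0"
    by (rule grad_eq_0[of "{y. radius K\<^sub>0 < norm (y - center F)}"])
      (use 0 x in \<open>auto intro!: open_Collect_less continuous_intros\<close>)
qed

text \<open>The contraction by \<open>s\<close> towards the center of the facet sends
  \<open>K\<^sub>0\<close> into the ball of half the radius, where \<open>bump_lower\<close> holds;
  then \<open>cone_flux_simplex_lower_bound\<close> applies.\<close>

lemma star_bump_lower_bound:
  assumes p0: "(K\<^sub>0, z\<^sub>0) \<in> star F"
  shows "exp (- 4 / 3) * (1 / (4 * real DIM('a) * \<sigma>\<^sup>2)) ^ (DIM('a) - 1)
    \<le> cone_flux K\<^sub>0 z\<^sub>0 (star_bump F K\<^sub>0) / measure lborel K\<^sub>0"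
proof -
  note S = starD[OF p0]
  define s where "s = 1 / (4 * real DIM('a) * \<sigma>\<^sup>2)"
  have \<sigma>: "1 \<le> \<sigma>"
    using diameter_star_le[OF p0 p0] diameter_star_pos[OF p0] by (simp add: mult_le_cancel_right1)
  have "1 * 1 \<le> (4 * real DIM('a)) * \<sigma>\<^sup>2" using dim \<sigma> by (intro mult_mono) (auto simp: one_le_power)
  then have s: "0 < s" "s \<le> 1" using \<sigma> by (auto simp: s_def)
  have sr: "s * diameter K\<^sub>0 = radius K\<^sub>0 / 2" by (simp add: s_def radius_def)
  have "exp (- 4 / 3) * (measure lborel K\<^sub>0 * s ^ (DIM('a) - 1)) \<le> cone_flux K\<^sub>0 z\<^sub>0 (star_bump F K\<^sub>0)"
  proof (rule cone_flux_simplex_lower_bound[OF S(8) star_bump_C1 S(2) _ center_in_cell[OF p0] bary_center(1)[OF p0] s])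
    show "0 \<le> star_bump F K\<^sub>0 x" for x by (simp add: star_bump_def bump_bounds)
    fix x assume "x \<in> K\<^sub>0"
    then have "norm (x - center F) \<le> diameter K\<^sub>0"
      using diameter_bounded_bound[OF compact_imp_bounded[OF compact_simplex[OF S(8)]] _ center_in_cell[OF p0], of x]
      by (simp add: dist_norm)
    then have "s * norm (x - center F) \<le> s * diameter K\<^sub>0" using s by (intro mult_left_mono) auto
    then show "exp (- 4 / 3) \<le> star_bump F K\<^sub>0 (center F + s *\<^sub>R (x - center F))"
      unfolding star_bump_def using s sr by (intro bump_lower radius_pos[OF p0]) simp
  qed simp
  then show ?thesis
    using measure_simplex_pos[OF S(8)] by (simp add: s_def pos_le_divide_eq mult_ac)
qed

text \<open>The flux of the constant through the facet, divided by d: the gradient is minus the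
  outward normal over the height, and the volume of the cell is height times area over d.\<close>

definition normal_flux :: "('a set \<Rightarrow> 'a) \<Rightarrow> 'a set \<times> 'a \<Rightarrow> real" where
  "normal_flux a p = - (a (fst p) \<bullet> bary_grad (fst p) (snd p)) * measure lborel (fst p)"

text \<open>The outward fluxes from both sides are added, since their normals are opposite; on a
  boundary facet the sum is the flux itself.\<close>

definition jump :: "('a set \<Rightarrow> 'a) \<Rightarrow> 'a set \<Rightarrow> real" where
  "jump a F = (\<Sum>p\<in>star F. normal_flux a p)"

lemma cone_flux_star:
  assumes "(K, z) \<in> star F" "(K', z') \<in> star F" "C1 u"
  shows "cone_flux K z u / measure lborel K = cone_flux K' z' u / measure lborel K'"
  using starD[OF assms(1)] starD[OF assms(2)] assms(3) by (intro cone_flux_common_facet) auto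

text \<open>The bump vanishes on every other facet of the adjacent cells, so of the terms in
  \<open>integral_const_inner_grad\<close> only the one belonging to \<open>F\<close> survives. The
  quotient of flux and volume is the same from both sides and factors out.\<close>

lemma jump_times_bump_flux:
  assumes p0: "(K\<^sub>0, z\<^sub>0) \<in> star F"
  shows "(\<Sum>(K, z)\<in>star F. LINT x|lebesgue_on (interior K). a K \<bullet> grad (star_bump F K\<^sub>0) x)
    = jump a F * (cone_flux K\<^sub>0 z\<^sub>0 (star_bump F K\<^sub>0) / measure lborel K\<^sub>0)"
proof -
  let ?\<phi> = "star_bump F K\<^sub>0"
  have *: "(LINT x|lebesgue_on (interior K). a K \<bullet> grad ?\<phi> x) = normal_flux a (K, z) * (cone_flux K\<^sub>0 z\<^sub>0 ?\<phi> / measure lborel K\<^sub>0)"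
    if p: "(K, z) \<in> star F" for K z
  proof -
    note S = starD[OF p]
    have "(LINT x|lebesgue_on (interior K). a K \<bullet> grad ?\<phi> x) = (LINT x:K|lborel. a K \<bullet> grad ?\<phi> x)"
      using C1_measurable[OF star_bump_C1[of F K\<^sub>0]] by (intro integral_interior_cell S(1)) measurable
    also have "\<dots> = (\<Sum>w\<in>insert z F. - (a K \<bullet> bary_grad K w) * cone_flux K w ?\<phi>)"
      unfolding integral_const_inner_grad[OF S(8) star_bump_C1] S(4) ..
    also have "\<dots> = - (a K \<bullet> bary_grad K z) * cone_flux K z ?\<phi>"
    proof -
      have "cone_flux K w ?\<phi> = 0" if w: "w \<in> F" for w
      proof (rule cone_flux_facet_zero[OF S(8) star_bump_C1])
        fix x assume "x \<in> K" "bary K w x = 0"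
        then have "\<not> norm (x - center F) \<le> 3 / 2 * radius K\<^sub>0" using bary_near_center[OF p p0 w, of x] by auto
        then show "?\<phi> x = 0" using radius_pos[OF p0] by (intro star_bump_eq_0[OF p0]) simp
      qed (use w S(4) in simp)
      then show ?thesis using S(5,6) by simp
    qed
    also have "\<dots> = normal_flux a (K, z) * (cone_flux K z ?\<phi> / measure lborel K)"
      using measure_simplex_pos[OF S(8)] by (simp add: normal_flux_def)
    finally show ?thesis using cone_flux_star[OF p p0 star_bump_C1] by simp
  qed
  show ?thesis
    unfolding jump_def sum_distrib_right
  proof (rule sum.cong[OF refl])
    fix p assume "p \<in> star F"
    then show "(case p of (K, z) \<Rightarrow> LINT x|lebesgue_on (interior K). a K \<bullet> grad ?\<phi> x)
        = normal_flux a p * (cone_flux K\<^sub>0 z\<^sub>0 ?\<phi> / measure lborel K\<^sub>0)"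
      using *[of "fst p" "snd p"] by (simp add: case_prod_unfold)
  qed
qed

end

context div_field_on_mesh
begin

lemma integrable_div_pairing:
  assumes "C1 u"
  shows "integrable (lebesgue_on D) (\<lambda>x. v x \<bullet> grad u x + weak_div D v x * u x)"
proof -
  have "integrable (lebesgue_on D) (\<lambda>x. v x \<bullet> grad u x)"
    by (rule integral_inner_bound(1)[OF v_L2 continuous_in_Lspace_2[OF C1_continuous(2)[OF assms] bounded_D D_lmeasurable]])
  moreover have "integrable (lebesgue_on D) (\<lambda>x. weak_div D v x * u x)"
    by (rule continuous_times_integrable[OF C1_continuous(1)[OF assms] bounded_D D_sets
          integral_norm_le_Lnorm(1)[OF div_Lq q_ge_1 D_lmeasurable measure_D_pos]])
  ultimately show ?thesis by simp
qed

text \<open>The two adjacent cells cover a ball slightly larger than the support of the bump, so the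
  bump is a test function on \<open>D\<close> and the definition of the weak divergence applies. The
  other cells do not see it.\<close>

lemma bump_pairing_interior:
  assumes p: "(K\<^sub>1, z\<^sub>1) \<in> star F" "(K\<^sub>2, z\<^sub>2) \<in> star F" "K\<^sub>1 \<noteq> K\<^sub>2" and p0: "(K\<^sub>0, z\<^sub>0) \<in> star F"
  shows "(\<Sum>(K, z)\<in>star F. LINT x|lebesgue_on (interior K).
    v x \<bullet> grad (star_bump F K\<^sub>0) x + weak_div D v x * star_bump F K\<^sub>0 x) = 0"
proof -
  let ?\<phi> = "star_bump F K\<^sub>0" and ?B = "\<lambda>r. cball (center F) r"
  let ?f = "\<lambda>x. v x \<bullet> grad ?\<phi> x + weak_div D v x * ?\<phi> x"
  note r = radius_pos[OF p0]
  have "closure {x. ?\<phi> x \<noteq> 0} \<subseteq> ?B (radius K\<^sub>0)"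
  proof (rule closure_minimal, rule subsetI)
    fix x assume "x \<in> {x. ?\<phi> x \<noteq> 0}"
    then have "\<not> radius K\<^sub>0 < norm (x - center F)" using star_bump_eq_0(1)[OF p0] by blast
    then show "x \<in> ?B (radius K\<^sub>0)" by (simp add: dist_norm norm_minus_commute)
  qed simp
  moreover have "?B (radius K\<^sub>0) \<subseteq> D"
  proof -
    have "ball (center F) (3 / 2 * radius K\<^sub>0) \<subseteq> K\<^sub>1 \<union> K\<^sub>2"
    proof
      fix x assume "x \<in> ball (center F) (3 / 2 * radius K\<^sub>0)"
      then show "x \<in> K\<^sub>1 \<union> K\<^sub>2"
        by (intro near_center_in_star[OF p p0]) (simp add: dist_norm norm_minus_commute)
    qed
    also have "\<dots> \<subseteq> closure D" using starD(1)[OF p(1)] starD(1)[OF p(2)] Union_mesh by auto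
    \<comment> \<open>An open ball covered by the closure of \<open>D\<close> lies in
      \<open>D\<close>, because \<open>D\<close> is the interior of its closure. The factor 3/2
      leaves room for the closed ball containing the support.\<close>
    finally have "ball (center F) (3 / 2 * radius K\<^sub>0) \<subseteq> D"
      using interior_maximal[OF _ open_ball] interior_closure_D by metis
    moreover have "?B (radius K\<^sub>0) \<subseteq> ball (center F) (3 / 2 * radius K\<^sub>0)" using r by auto
    ultimately show ?thesis by blast
  qed
  ultimately have \<phi>: "?\<phi> \<in> test_functions D"
    using star_bump_smooth by (auto simp: test_functions_def compact_eq_bounded_closed intro: bounded_subset[OF bounded_cball])
  have loc: "locally_integrable_on v D" "locally_integrable_on (weak_div D v) D" using has_div by (auto simp: has_weak_div_def)
  have "(LINT x|lebesgue_on D. ?f x) = (LINT x|lebesgue_on D. v x \<bullet> grad ?\<phi> x) + (LINT x|lebesgue_on D. weak_div D v x * ?\<phi> x)"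
    using test_function_integrable(3)[OF \<phi> open_D loc(1)] test_function_integrable(1)[OF \<phi> open_D loc(2)]
    by (intro Bochner_Integration.integral_add) (simp_all add: mult.commute)
  also have "\<dots> = 0" using has_div \<phi> by (simp add: has_weak_div_def)
  also have "(LINT x|lebesgue_on D. ?f x) = (\<Sum>K\<in>\<T>. LINT x|lebesgue_on (interior K). ?f x)"
    by (rule integral_cells[OF integrable_div_pairing[OF star_bump_C1]])
  also have "\<dots> = (\<Sum>K\<in>fst ` star F. LINT x|lebesgue_on (interior K). ?f x)"
  proof (rule sum.mono_neutral_right[OF finite_mesh])
    show "fst ` star F \<subseteq> \<T>" using starD(1) by auto
    show "\<forall>K\<in>\<T> - fst ` star F. (LINT x|lebesgue_on (interior K). ?f x) = 0"
    proof
      fix K assume "K \<in> \<T> - fst ` star F"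
      then have K: "K \<in> \<T>" "K \<noteq> K\<^sub>1" "K \<noteq> K\<^sub>2" using p by force+
      have "?f x = 0" if "x \<in> interior K" for x
      proof -
        have "x \<notin> K\<^sub>1 \<union> K\<^sub>2"
          using that interior_disjoint[OF K(1) starD(1)[OF p(1)] K(2)] interior_disjoint[OF K(1) starD(1)[OF p(2)] K(3)] by auto
        then have "\<not> norm (x - center F) \<le> 3 / 2 * radius K\<^sub>0" using near_center_in_star[OF p p0] by blast
        then have "radius K\<^sub>0 < norm (x - center F)" using r by simp
        then show ?thesis using star_bump_eq_0[OF p0] by simp
      qed
      then have "(LINT x|lebesgue_on (interior K). ?f x) = (LINT x|lebesgue_on (interior K). 0)"
        by (intro Bochner_Integration.integral_cong) auto
      then show "(LINT x|lebesgue_on (interior K). ?f x) = 0" by simp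
    qed
  qed
  also have "\<dots> = (\<Sum>p\<in>star F. LINT x|lebesgue_on (interior (fst p)). ?f x)"
    by (subst sum.reindex) (auto simp: inj_on_def intro: star_inj)
  finally show ?thesis by (simp add: case_prod_unfold)
qed

text \<open>The bump reaches across the boundary facet, so the vanishing normal trace takes the
  place of the weak divergence. Its support may also meet cells beyond the facet; a smooth step in
  the coordinate of \<open>z\<close> equals 1 on \<open>K\<close> and removes them. The product is a
  smooth lifting of its own boundary values.\<close>

lemma bump_pairing_boundary:
  assumes star: "star F = {(K, z)}" and trace: "has_normal_trace D v (\<lambda>_. 0)"
  shows "(LINT x|lebesgue_on (interior K). v x \<bullet> grad (star_bump F K) x + weak_div D v x * star_bump F K x) = 0"
proof -
  have p: "(K, z) \<in> star F" using star by simp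
  note S = starD[OF p] and r = radius_pos[OF p]
  let ?\<phi> = "star_bump F K"
  \<comment> \<open>The other cells within reach of the bump. The coordinate of \<open>z\<close> is
    negative on them, and compactness turns this into a margin \<delta>. The margin may depend on
    the mesh but enters no estimate, because the cut-off bump agrees with the bump on
    \<open>K\<close> and vanishes on the other cells.\<close>
  define Q where "Q = \<Union>(\<T> - {K}) \<inter> cball (center F) (radius K)"
  have Q: "compact Q"
    unfolding Q_def using finite_mesh closed_simplex[OF simplex_mesh]
    by (intro closed_Int_compact closed_Union) auto
  have Qneg: "bary K z x < 0" if xQ: "x \<in> Q" for x
  proof (rule ccontr)
    assume "\<not> bary K z x < 0"
    obtain K' where K': "K' \<in> \<T>" "K' \<noteq> K" "x \<in> K'" using xQ by (auto simp: Q_def)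
    have x: "norm (x - center F) \<le> 3 / 2 * radius K"
      using xQ r by (simp add: Q_def dist_norm norm_minus_commute)
    have xK: "x \<in> K" using near_center_in_cell[OF p p x] \<open>\<not> bary K z x < 0\<close> by simp
    have "(K', z') \<notin> star F" for z' using star K' by auto
    then obtain w where "w \<in> F" "\<And>x. x \<in> K \<Longrightarrow> x \<in> K' \<Longrightarrow> bary K w x = 0"
      using intersection_misses_facet[OF p K'(1)] by metis
    then show False using bary_near_center[OF p p _ x, of w] xK K'(3) by simp
  qed
  obtain \<delta> where \<delta>: "0 < \<delta>" "\<And>x. x \<in> Q \<Longrightarrow> bary K z x \<le> - \<delta>"
  proof (cases "Q = {}")
    case False
    obtain x where "x \<in> Q" "\<And>y. y \<in> Q \<Longrightarrow> bary K z y \<le> bary K z x"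
      using continuous_attains_sup[OF Q False continuous_on_bary] by blast
    then show ?thesis using that[of "- bary K z x"] Qneg by auto
  qed (use that[of 1] in auto)
  \<comment> \<open>The usual smooth step, 0 up to -\<delta> and 1 from 0 on.\<close>
  define s where "s t = flat 0 (t + \<delta>) * inverse (flat 0 (t + \<delta>) + flat 0 (- t))" for t
  have den: "0 < flat 0 (t + \<delta>) + flat 0 (- t)" for t
    using flat_pos[of "t + \<delta>" 0] flat_pos[of "- t" 0] flat_nonneg[of 0 "t + \<delta>"] flat_nonneg[of 0 "- t"] \<delta>(1)
    by (cases "0 \<le> t") auto
  have s1: "s t = 1" if "0 \<le> t" for t using that den[of t] by (simp add: s_def flat_eq_0[of "- t"])
  have s0: "s t = 0" if "t \<le> - \<delta>" for t using that by (simp add: s_def flat_eq_0)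
  define l where "l x = ?\<phi> x * s (bary K z x)" for x
  have "bary K z \<in> elementary"
  proof -
    have "(\<lambda>x. x \<bullet> bary_grad K z + (1 - bary_grad K z \<bullet> z)) \<in> elementary"
      by (intro elementary.add elementary.inner elementary.const)
    then show ?thesis by (simp add: bary_def[abs_def] inner_diff_right inner_commute algebra_simps)
  qed
  then have "l \<in> elementary"
    unfolding l_def[abs_def] s_def star_bump_def using den
    by (intro elementary.mult elementary.flat elementary.add elementary.const elementary.inverse elementary_minus bump_elementary)
      (auto simp: less_imp_neq[symmetric])
  then have l: "smooth l" by (rule elementary_smooth)
  have lK: "l x = ?\<phi> x" if "x \<in> K" for x
    using that S(2) mem_simplex_iff[OF S(8)] by (simp add: l_def s1)
  have l0: "l x = 0" if "K' \<in> \<T>" "K' \<noteq> K" "x \<in> K'" for K' x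
  proof (cases "radius K < norm (x - center F)")
    case True
    then show ?thesis by (simp add: l_def star_bump_eq_0[OF p])
  next
    case False
    then have "x \<in> Q" using that by (auto simp: Q_def dist_norm norm_minus_commute)
    then show ?thesis using \<delta>(2) by (simp add: l_def s0)
  qed
  let ?f = "\<lambda>x. v x \<bullet> grad l x + weak_div D v x * l x"
  have tr: "has_trace D l l" by (rule smooth_has_trace[OF l open_D bounded_D])
  then have "l \<in> boundary_H_half D" by (auto simp: boundary_H_half_def)
  then have "0 = (LINT x|lebesgue_on D. v x \<bullet> weak_grad D l x + weak_div D v x * l x)"
    using trace tr by (simp add: has_normal_trace_def)
  also have "\<dots> = (LINT x|lebesgue_on D. ?f x)"
  proof (rule integral_cong_AE)
    note L = smooth_in_sobolev_1[OF l open_D bounded_D]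
    have [measurable]: "v \<in> borel_measurable (lebesgue_on D)" "weak_grad D l \<in> borel_measurable (lebesgue_on D)"
        "weak_div D v \<in> borel_measurable (lebesgue_on D)" "l \<in> borel_measurable (lebesgue_on D)"
      using v_L2 div_Lq L(1,2) by (auto simp: Lspace_def sobolev_def)
    show "(\<lambda>x. v x \<bullet> weak_grad D l x + weak_div D v x * l x) \<in> borel_measurable (lebesgue_on D)" by measurable
    show "?f \<in> borel_measurable (lebesgue_on D)"
      by (rule borel_measurable_integrable[OF integrable_div_pairing[OF smooth_C1[OF l]]])
    show "AE x in lebesgue_on D. v x \<bullet> weak_grad D l x + weak_div D v x * l x = ?f x"
      unfolding AE_lebesgue_on_iff[OF D_sets] using L(3) by eventually_elim simp
  qed
  also have "\<dots> = (\<Sum>K'\<in>\<T>. LINT x|lebesgue_on (interior K'). ?f x)"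
    by (rule integral_cells[OF integrable_div_pairing[OF smooth_C1[OF l]]])
  also have "\<dots> = (\<Sum>K'\<in>{K}. LINT x|lebesgue_on (interior K'). ?f x)"
  proof (rule sum.mono_neutral_right[OF finite_mesh])
    show "\<forall>K'\<in>\<T> - {K}. (LINT x|lebesgue_on (interior K'). ?f x) = 0"
    proof
      fix K' assume K': "K' \<in> \<T> - {K}"
      have "?f x = 0" if x: "x \<in> interior K'" for x
      proof -
        have "l y = 0" if "y \<in> interior K'" for y using l0[of K' y] K' that interior_subset by auto
        then show ?thesis using x grad_eq_0[of "interior K'" x l] by simp
      qed
      then have "(LINT x|lebesgue_on (interior K'). ?f x) = (LINT x|lebesgue_on (interior K'). 0)"
        by (intro Bochner_Integration.integral_cong) auto
      then show "(LINT x|lebesgue_on (interior K'). ?f x) = 0" by simp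
    qed
  qed (use S in auto)
  also have "\<dots> = (LINT x|lebesgue_on (interior K). v x \<bullet> grad ?\<phi> x + weak_div D v x * ?\<phi> x)"
  proof -
    have "?f x = v x \<bullet> grad ?\<phi> x + weak_div D v x * ?\<phi> x" if x: "x \<in> interior K" for x
    proof -
      have "l y = ?\<phi> y" if "y \<in> interior K" for y using lK[of y] that interior_subset by auto
      then show ?thesis using x grad_cong[of "interior K" x l ?\<phi>] star_bump_C1 by simp
    qed
    then have "(LINT x|lebesgue_on (interior K). ?f x) = (LINT x|lebesgue_on (interior K). v x \<bullet> grad ?\<phi> x + weak_div D v x * ?\<phi> x)"
      by (intro Bochner_Integration.integral_cong) auto
    then show ?thesis by simp
  qed
  finally show ?thesis by simp
qed

text \<open>The pairing of \<open>v\<close> with the bump vanishes, so the jump is expressed by the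
  constants minus \<open>v\<close> and by the divergence. The factor 16 is 8 from the gradient of
  the bump times 2 from Hoelder; the bump itself is at most 1. The alternative in the hypotheses
  corresponds to the interior and the boundary version of the pairing.\<close>

lemma jump_bound:
  assumes p0: "(K\<^sub>0, z\<^sub>0) \<in> star F" and c: "card (star F) = 2 \<or> has_normal_trace D v (\<lambda>_. 0)"
  shows "\<bar>jump a F\<bar> * (exp (- 4 / 3) * (1 / (4 * real DIM('a) * \<sigma>\<^sup>2)) ^ (DIM('a) - 1))
    \<le> (\<Sum>(K, z)\<in>star F. 16 / radius K\<^sub>0 * measure lborel K powr (1 / 2) * Lnorm 2 (interior K) (\<lambda>x. v x - a K)
        + 2 * measure lborel K powr (1 - 1 / q) * Lnorm q (interior K) (weak_div D v))"
proof -
  let ?\<phi> = "star_bump F K\<^sub>0"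
  let ?f = "\<lambda>x. v x \<bullet> grad ?\<phi> x + weak_div D v x * ?\<phi> x"
  note r = radius_pos[OF p0]
  have zero: "(\<Sum>(K, z)\<in>star F. LINT x|lebesgue_on (interior K). ?f x) = 0"
  proof (cases "card (star F) = 2")
    case True
    then obtain p' where p': "p' \<in> star F" "p' \<noteq> (K\<^sub>0, z\<^sub>0)"
      using p0 by (metis card_2_iff insert_iff)
    obtain K' z' where eq: "p' = (K', z')" by (cases p')
    have "K' \<noteq> K\<^sub>0" using p' star_inj p0 eq by blast
    then show ?thesis using bump_pairing_interior[OF p0 _ _ p0] p' eq by metis
  next
    case False
    have "card (star F) \<noteq> 0" using p0 finite_star by auto
    then have "card (star F) = 1" using False card_star_le_2[of F] by linarith
    then have "star F = {(K\<^sub>0, z\<^sub>0)}" using p0 by (auto simp: card_1_singleton_iff)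
    then show ?thesis using bump_pairing_boundary c False by simp
  qed
  have cell: "\<bar>(LINT x|lebesgue_on (interior K). a K \<bullet> grad ?\<phi> x) - (LINT x|lebesgue_on (interior K). ?f x)\<bar>
      \<le> 16 / radius K\<^sub>0 * measure lborel K powr (1 / 2) * Lnorm 2 (interior K) (\<lambda>x. v x - a K)
        + 2 * measure lborel K powr (1 - 1 / q) * Lnorm q (interior K) (weak_div D v)"
    if p: "(K, z) \<in> star F" for K z
  proof -
    note S = starD[OF p]
    let ?U = "interior K" and ?g = "weak_div D v"
    note Ul = measure_interior_cell[OF S(1)]
    have Us: "?U \<in> sets lebesgue" by auto
    have m: "0 < measure lebesgue ?U" using measure_simplex_pos[OF S(8)] Ul(1) by simp
    have bU: "bounded ?U" using bounded_subset[OF bounded_D interior_cell_subset[OF S(1)]] .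
    have va: "(\<lambda>x. v x - a K) \<in> Lspace 2 ?U"
      by (intro Lspace_2_diff Lspace_subset[OF v_L2 interior_cell_subset[OF S(1)] Us D_sets]
          continuous_in_Lspace_2[OF continuous_on_const bU Ul(2)])
    have gq: "?g \<in> Lspace q ?U" by (rule Lspace_subset[OF div_Lq interior_cell_subset[OF S(1)] Us D_sets])
    have fi: "integrable (lebesgue_on ?U) ?f"
      by (rule integrable_lebesgue_on_subset[OF integrable_div_pairing[OF star_bump_C1] interior_cell_subset[OF S(1)] Us D_sets])
    have ai: "integrable (lebesgue_on ?U) (\<lambda>x. a K \<bullet> grad ?\<phi> x)"
      by (rule integral_inner_bound(1); rule continuous_in_Lspace_2; intro continuous_on_const C1_continuous star_bump_C1 bU Ul)
    note va_int = integral_norm_le_Lnorm[OF va _ Ul(2) m, simplified]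
    note g_int = integral_norm_le_Lnorm[OF gq q_ge_1 Ul(2) m]
    have diff: "(LINT x|lebesgue_on ?U. a K \<bullet> grad ?\<phi> x) - (LINT x|lebesgue_on ?U. ?f x)
        = (LINT x|lebesgue_on ?U. a K \<bullet> grad ?\<phi> x - ?f x)"
      by (rule Bochner_Integration.integral_diff[OF ai fi, symmetric])
    have "\<bar>LINT x|lebesgue_on ?U. a K \<bullet> grad ?\<phi> x - ?f x\<bar> \<le> (LINT x|lebesgue_on ?U. \<bar>a K \<bullet> grad ?\<phi> x - ?f x\<bar>)"
      by (rule integral_abs_bound)
    also have "\<dots> \<le> (LINT x|lebesgue_on ?U. 8 / radius K\<^sub>0 * norm (v x - a K) + norm (?g x))"
    proof (rule integral_mono)
      show "integrable (lebesgue_on ?U) (\<lambda>x. \<bar>a K \<bullet> grad ?\<phi> x - ?f x\<bar>)" using ai fi by (intro integrable_abs) simp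
      show "integrable (lebesgue_on ?U) (\<lambda>x. 8 / radius K\<^sub>0 * norm (v x - a K) + norm (?g x))"
        using va_int(1) g_int(1) by simp
      fix x
      have "\<bar>(v x - a K) \<bullet> grad ?\<phi> x\<bar> \<le> norm (v x - a K) * norm (grad ?\<phi> x)" by (rule Cauchy_Schwarz_ineq2)
      also have "\<dots> \<le> norm (v x - a K) * (8 / radius K\<^sub>0)"
        using norm_grad_bump_le[OF r, of "center F" x] by (intro mult_left_mono) (auto simp: star_bump_def)
      finally have 1: "\<bar>(v x - a K) \<bullet> grad ?\<phi> x\<bar> \<le> 8 / radius K\<^sub>0 * norm (v x - a K)" by (simp add: mult.commute)
      have 2: "\<bar>?g x * ?\<phi> x\<bar> \<le> norm (?g x)"
        using bump_bounds[of "center F" "radius K\<^sub>0" x] by (simp add: star_bump_def abs_mult mult_left_le)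
      have "a K \<bullet> grad ?\<phi> x - ?f x = - ((v x - a K) \<bullet> grad ?\<phi> x) - ?g x * ?\<phi> x" by (simp add: inner_diff_left)
      then show "\<bar>a K \<bullet> grad ?\<phi> x - ?f x\<bar> \<le> 8 / radius K\<^sub>0 * norm (v x - a K) + norm (?g x)" using 1 2 by linarith
    qed
    also have "\<dots> = 8 / radius K\<^sub>0 * (LINT x|lebesgue_on ?U. norm (v x - a K)) + (LINT x|lebesgue_on ?U. norm (?g x))"
      using va_int(1) g_int(1) by simp
    also have "\<dots> \<le> 8 / radius K\<^sub>0 * (2 * measure lebesgue ?U powr (1 / 2) * Lnorm 2 ?U (\<lambda>x. v x - a K))
        + 2 * measure lebesgue ?U powr (1 - 1 / q) * Lnorm q ?U ?g"
      using va_int(2) g_int(2) r by (intro add_mono mult_left_mono) auto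
    finally show ?thesis unfolding diff using Ul(1) by (simp add: mult_ac)
  qed
  let ?b = "cone_flux K\<^sub>0 z\<^sub>0 ?\<phi> / measure lborel K\<^sub>0"
  have "\<bar>jump a F\<bar> * (exp (- 4 / 3) * (1 / (4 * real DIM('a) * \<sigma>\<^sup>2)) ^ (DIM('a) - 1)) \<le> \<bar>jump a F\<bar> * ?b"
    using star_bump_lower_bound[OF p0] by (intro mult_left_mono) auto
  also have "\<dots> \<le> \<bar>jump a F * ?b\<bar>" unfolding abs_mult by (intro mult_left_mono abs_ge_self abs_ge_zero)
  also have "jump a F * ?b = (\<Sum>(K, z)\<in>star F. (LINT x|lebesgue_on (interior K). a K \<bullet> grad ?\<phi> x) - (LINT x|lebesgue_on (interior K). ?f x))"
    unfolding jump_times_bump_flux[OF p0, symmetric] using zero by (simp add: case_prod_unfold sum_subtractf)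
  also have "\<bar>\<dots>\<bar> \<le> (\<Sum>(K, z)\<in>star F. 16 / radius K\<^sub>0 * measure lborel K powr (1 / 2) * Lnorm 2 (interior K) (\<lambda>x. v x - a K)
        + 2 * measure lborel K powr (1 - 1 / q) * Lnorm q (interior K) (weak_div D v))"
    by (intro sum_abs[THEN order_trans] sum_mono) (use cell in auto)
  finally show ?thesis .
qed

end

section \<open>Raviart--Thomas fields\<close>

lemma finite_multi_indices: "finite (multi_indices k :: ('a::euclidean_space \<Rightarrow> nat) set)"
proof (rule finite_subset)
  show "(multi_indices k :: ('a \<Rightarrow> nat) set) \<subseteq> {f. (\<forall>x. (x \<in> Basis \<longrightarrow> f x \<in> {..k}) \<and> (x \<notin> Basis \<longrightarrow> f x = 0))}"
  proof clarify
    fix \<alpha> :: "'a \<Rightarrow> nat" and b assume \<alpha>: "\<alpha> \<in> multi_indices k"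
    then have "\<alpha> b \<le> k" if "b \<in> Basis"
      using member_le_sum[of b Basis \<alpha>] that by (force simp: multi_indices_def)
    with \<alpha> show "(b \<in> Basis \<longrightarrow> \<alpha> b \<in> {..k}) \<and> (b \<notin> Basis \<longrightarrow> \<alpha> b = 0)" by (auto simp: multi_indices_def)
  qed
  show "finite {f. (\<forall>x. (x \<in> (Basis::'a set) \<longrightarrow> f x \<in> {..k}) \<and> (x \<notin> Basis \<longrightarrow> f x = (0::nat)))}"
    by (rule finite_set_of_finite_funs) auto
qed

lemma const_in_polys: "(\<lambda>x::'a::euclidean_space. c) \<in> polys k"
proof -
  let ?c = "\<lambda>\<alpha>::'a \<Rightarrow> nat. if \<alpha> = (\<lambda>_. 0) then c else 0"
  have "(\<Sum>\<alpha>\<in>multi_indices k. ?c \<alpha> * (\<Prod>b\<in>Basis. (x \<bullet> b) ^ \<alpha> b)) = c" for x :: 'a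
  proof -
    have "(\<Sum>\<alpha>\<in>multi_indices k. ?c \<alpha> * (\<Prod>b\<in>Basis. (x \<bullet> b) ^ \<alpha> b))
        = (\<Sum>\<alpha>\<in>{\<lambda>_. 0}. ?c \<alpha> * (\<Prod>b\<in>Basis. (x \<bullet> b) ^ \<alpha> b))"
      by (rule sum.mono_neutral_right[OF finite_multi_indices]) (auto simp: multi_indices_def)
    then show ?thesis by simp
  qed
  then show ?thesis unfolding polys_def by (auto intro!: exI[of _ ?c])
qed

lemma affine_in_RT_polys: "(\<lambda>x::'a::euclidean_space. p + s *\<^sub>R x) \<in> RT_polys k"
  unfolding RT_polys_def
  by (intro CollectI exI[of _ "\<lambda>_. p"] exI[of _ "\<lambda>_. s"]) (simp add: const_in_polys)

context mesh_on_domain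
begin

text \<open>Up to scaling, \<open>x - z\<close> is the lowest-order Raviart--Thomas shape function of the facet opposite
  \<open>z\<close>. The number \<open>\<alpha> F\<close> is the share of the flux jump that is removed on each side of \<open>F\<close>: one half
  on interior facets; on boundary facets 0 if the normal trace is free, and 1 if it has to vanish.\<close>

definition rt_coeff :: "('a set \<Rightarrow> 'a) \<Rightarrow> ('a set \<Rightarrow> real) \<Rightarrow> 'a set \<times> 'a \<Rightarrow> real" where
  "rt_coeff a \<alpha> p = (normal_flux a p - \<alpha> (facet p) * jump a (facet p)) / measure lborel (fst p)"

definition rt_cell :: "('a set \<Rightarrow> 'a) \<Rightarrow> ('a set \<Rightarrow> real) \<Rightarrow> 'a set \<Rightarrow> 'a \<Rightarrow> 'a" where
  "rt_cell a \<alpha> K x = (\<Sum>z\<in>vertices K. rt_coeff a \<alpha> (K, z) *\<^sub>R (x - z))"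

text \<open>Open cells keep the pieces disjoint. The value 0 on the facets is a convention on a null
  set.\<close>

definition rt_field :: "('a set \<Rightarrow> 'a) \<Rightarrow> ('a set \<Rightarrow> real) \<Rightarrow> 'a \<Rightarrow> 'a" where
  "rt_field a \<alpha> x = (\<Sum>K\<in>\<T>. indicator (interior K) x *\<^sub>R rt_cell a \<alpha> K x)"

definition rt_div :: "('a set \<Rightarrow> 'a) \<Rightarrow> ('a set \<Rightarrow> real) \<Rightarrow> 'a \<Rightarrow> real" where
  "rt_div a \<alpha> x = (\<Sum>K\<in>\<T>. indicator (interior K) x *\<^sub>R (real DIM('a) * (\<Sum>z\<in>vertices K. rt_coeff a \<alpha> (K, z))))"

lemma sum_indicator_interior:
  fixes f :: "'a set \<Rightarrow> 'b::real_vector"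
  assumes "K \<in> \<T>" "x \<in> interior K"
  shows "(\<Sum>K'\<in>\<T>. indicator (interior K') x *\<^sub>R f K') = f K"
proof -
  have "(\<Sum>K'\<in>\<T>. indicator (interior K') x *\<^sub>R f K') = (\<Sum>K'\<in>{K}. indicator (interior K') x *\<^sub>R f K')"
  proof (rule sum.mono_neutral_right[OF finite_mesh])
    show "\<forall>i\<in>\<T> - {K}. indicator (interior i) x *\<^sub>R f i = 0"
    proof
      fix i assume "i \<in> \<T> - {K}"
      then have "x \<notin> interior i" using interior_disjoint[of i K] assms interior_subset[of K] by blast
      then show "indicator (interior i) x *\<^sub>R f i = 0" by simp
    qed
  qed (use assms in auto)
  then show ?thesis using assms by simp
qed

lemma rt_field_interior:
  assumes "K \<in> \<T>" "x \<in> interior K"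
  shows "rt_field a \<alpha> x = rt_cell a \<alpha> K x"
    and "rt_div a \<alpha> x = real DIM('a) * (\<Sum>z\<in>vertices K. rt_coeff a \<alpha> (K, z))"
  unfolding rt_field_def rt_div_def by (rule sum_indicator_interior[OF assms])+

lemma continuous_on_rt_cell: "continuous_on S (rt_cell a \<alpha> K)"
  unfolding rt_cell_def[abs_def] by (intro continuous_intros)

lemma Lspace_2_indicator_sum:
  fixes f :: "'a set \<Rightarrow> 'a \<Rightarrow> 'b::euclidean_space"
  assumes "\<And>K. continuous_on UNIV (f K)"
  shows "(\<lambda>x. \<Sum>K\<in>\<T>. indicator (interior K) x *\<^sub>R f K x) \<in> Lspace 2 D"
  using finite_mesh
proof induction
  case empty
  show ?case by (simp add: Lspace_def)
next
  case (insert K T)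
  have "(\<lambda>x. indicator (interior K) x *\<^sub>R f K x) \<in> Lspace 2 D"
  proof (rule Lspace_2_bound)
    show "integrable (lebesgue_on D) (\<lambda>x. (norm (f K x))\<^sup>2)"
      using continuous_in_Lspace_2[OF assms bounded_D D_lmeasurable] by (simp add: Lspace_2_iff)
    show "(\<lambda>x. indicator (interior K) x *\<^sub>R f K x) \<in> borel_measurable (lebesgue_on D)"
    proof (intro measurable_restrict_space1 measurable_completion borel_measurable_scaleR borel_measurable_indicator)
      show "f K \<in> borel_measurable lborel" using borel_measurable_continuous_onI[OF assms] by simp
    qed simp
    show "(norm (indicator (interior K) x *\<^sub>R f K x))\<^sup>2 \<le> (norm (f K x))\<^sup>2" for x by (simp add: indicator_def)
  qed
  from Lspace_2_add[OF this insert.IH] show ?case by (simp only: sum.insert[OF insert.hyps])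
qed

lemma rt_field_L2: "rt_field a \<alpha> \<in> Lspace 2 D" "rt_div a \<alpha> \<in> Lspace 2 D"
  unfolding rt_field_def[abs_def] rt_div_def[abs_def]
  by (intro Lspace_2_indicator_sum continuous_on_rt_cell continuous_on_const)+

lemma Lspace_2_locally_integrable:
  fixes f :: "'a \<Rightarrow> 'b::euclidean_space"
  assumes "f \<in> Lspace 2 D"
  shows "locally_integrable_on f D"
  unfolding locally_integrable_on_def
proof (intro allI impI)
  fix C assume C: "compact C \<and> C \<subseteq> D"
  have "integrable (lebesgue_on D) f"
    by (rule integral_norm_le_Lnorm(1)[OF assms _ D_lmeasurable measure_D_pos]) simp
  then have "set_integrable lebesgue D f" by (simp add: lebesgue_on_integral_eq D_sets)
  then show "f absolutely_integrable_on C"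
    by (rule set_integrable_subset) (use C lmeasurable_compact fmeasurableD in auto)
qed

lemma integrable_rt_pairing:
  assumes "C1 u"
  shows "integrable (lebesgue_on D) (\<lambda>x. rt_field a \<alpha> x \<bullet> grad u x + rt_div a \<alpha> x * u x)"
proof -
  have "u \<in> Lspace 2 D" "grad u \<in> Lspace 2 D"
    by (intro continuous_in_Lspace_2 C1_continuous assms bounded_D D_lmeasurable)+
  then show ?thesis
    using integral_inner_bound(1)[OF rt_field_L2(1)] integral_inner_bound(1)[OF rt_field_L2(2)]
    by (intro Bochner_Integration.integrable_add) auto
qed

text \<open>Integrating by parts over the cells leaves, for each facet, the sum of the outward fluxes from
  both sides. The condition on \<open>\<alpha>\<close> makes this sum vanish.\<close>

lemma rt_pairing_zero:
  assumes u: "C1 u"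
    and bal: "\<And>F K z. (K, z) \<in> star F \<Longrightarrow> \<alpha> F * real (card (star F)) = 1 \<or> cone_flux K z u = 0"
  shows "(LINT x|lebesgue_on D. rt_field a \<alpha> x \<bullet> grad u x + rt_div a \<alpha> x * u x) = 0"
proof -
  let ?c = "rt_coeff a \<alpha>" and ?n = "real DIM('a)"
  let ?h = "\<lambda>p. ?c p * cone_flux (fst p) (snd p) u"
  have cell: "(LINT x|lebesgue_on (interior K). rt_field a \<alpha> x \<bullet> grad u x + rt_div a \<alpha> x * u x)
      = (\<Sum>z\<in>vertices K. ?c (K, z) * cone_flux K z u)" if K: "K \<in> \<T>" for K
  proof -
    note S = simplex_mesh[OF K]
    have "(LINT x|lebesgue_on (interior K). rt_field a \<alpha> x \<bullet> grad u x + rt_div a \<alpha> x * u x)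
        = (LINT x|lebesgue_on (interior K). (\<Sum>z\<in>vertices K. ?c (K, z) * ((x - z) \<bullet> grad u x + ?n * u x)))"
    proof (rule Bochner_Integration.integral_cong[OF refl])
      fix x assume "x \<in> space (lebesgue_on (interior K))"
      then have x: "x \<in> interior K" by simp
      show "rt_field a \<alpha> x \<bullet> grad u x + rt_div a \<alpha> x * u x = (\<Sum>z\<in>vertices K. ?c (K, z) * ((x - z) \<bullet> grad u x + ?n * u x))"
        unfolding rt_field_interior[OF K x] rt_cell_def
        by (simp add: inner_sum_left sum_distrib_left sum_distrib_right distrib_left sum.distrib mult_ac)
    qed
    also have "\<dots> = (LINT x:K|lborel. \<Sum>z\<in>vertices K. ?c (K, z) * ((x - z) \<bullet> grad u x + ?n * u x))"
    proof (rule integral_interior_cell[OF K])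
      note [measurable] = C1_measurable[OF u]
      show "(\<lambda>x. \<Sum>z\<in>vertices K. ?c (K, z) * ((x - z) \<bullet> grad u x + ?n * u x)) \<in> borel_measurable borel" by measurable
    qed
    also have "\<dots> = (\<Sum>z\<in>vertices K. LINT x:K|lborel. ?c (K, z) * ((x - z) \<bullet> grad u x + ?n * u x))"
      by (intro set_integral_finite_sum set_integrable_mult_right impI cone_flux_integrable u compact_simplex[OF S])
    also have "\<dots> = (\<Sum>z\<in>vertices K. ?c (K, z) * cone_flux K z u)"
      by (simp only: cone_flux_def set_integral_mult_right)
    finally show ?thesis .
  qed
  have "(LINT x|lebesgue_on D. rt_field a \<alpha> x \<bullet> grad u x + rt_div a \<alpha> x * u x)
      = (\<Sum>K\<in>\<T>. \<Sum>z\<in>vertices K. ?c (K, z) * cone_flux K z u)"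
    unfolding integral_cells[OF integrable_rt_pairing[OF u]] by (rule sum.cong) (simp_all add: cell)
  also have "\<dots> = (\<Sum>p\<in>flags. ?h p)"
    unfolding flags_def using finite_mesh simplex_vertices(2)[OF simplex_mesh]
    by (subst sum.Sigma) (auto simp: case_prod_unfold)
  also have "\<dots> = (\<Sum>F\<in>facet ` flags. \<Sum>p\<in>star F. ?h p)"
    unfolding star_def by (rule sum.image_gen[OF finite_flags])
  also have "\<dots> = 0"
  proof (rule sum.neutral, rule ballI)
    fix F assume "F \<in> facet ` flags"
    then obtain K\<^sub>0 z\<^sub>0 where p0: "(K\<^sub>0, z\<^sub>0) \<in> star F" by (auto simp: star_def)
    define b where "b = cone_flux K\<^sub>0 z\<^sub>0 u / measure lborel K\<^sub>0"
    have h: "?h p = (normal_flux a p - \<alpha> F * jump a F) * b" if "p \<in> star F" for p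
    proof -
      obtain K z where Kz: "p = (K, z)" by (cases p)
      then have p: "p = (K, z)" "(K, z) \<in> star F" using that by simp_all
      have "facet p = F" using that by (simp add: star_def)
      moreover have "cone_flux K z u = b * measure lborel K"
        using cone_flux_star[OF p(2) p0 u] measure_simplex_pos[OF starD(8)[OF p(2)]] by (simp add: b_def field_simps)
      ultimately show ?thesis
        using measure_simplex_pos[OF starD(8)[OF p(2)]] by (simp add: rt_coeff_def p(1))
    qed
    have "(\<Sum>p\<in>star F. ?h p) = (\<Sum>p\<in>star F. (normal_flux a p - \<alpha> F * jump a F) * b)"
      by (rule sum.cong[OF refl h])
    also have "\<dots> = (jump a F - real (card (star F)) * (\<alpha> F * jump a F)) * b"
      by (simp add: jump_def sum_subtractf flip: sum_distrib_right)
    also have "\<dots> = (1 - \<alpha> F * real (card (star F))) * jump a F * b" by (simp add: algebra_simps)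
    also have "\<dots> = 0" using bal[OF p0] by (auto simp: b_def)
    finally show "(\<Sum>p\<in>star F. ?h p) = 0" .
  qed
  finally show ?thesis .
qed

text \<open>The weak divergence is tested with functions vanishing near the boundary, so the
  condition is imposed on interior facets alone; boundary facets remain free for the two choices of
  \<alpha>.\<close>

definition admissible :: "('a set \<Rightarrow> real) \<Rightarrow> bool" where
  "admissible \<alpha> \<longleftrightarrow> (\<forall>F. card (star F) = 2 \<longrightarrow> \<alpha> F = 1 / 2)"

lemma star_cases:
  assumes "(K, z) \<in> star F"
  shows "card (star F) = 2 \<or> star F = {(K, z)}"
proof -
  have "card (star F) \<noteq> 0" using assms finite_star by auto
  then have "card (star F) = 1 \<or> card (star F) = 2" using card_star_le_2[of F] by linarith
  then show ?thesis using assms by (auto simp: card_1_singleton_iff)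
qed

text \<open>On interior facets the fluxes cancel by admissibility. A boundary facet is disjoint from
  \<open>D\<close>, so a test function vanishes on it and has no flux through it.\<close>

lemma rt_field_has_weak_div:
  assumes "admissible \<alpha>"
  shows "has_weak_div D (rt_field a \<alpha>) (rt_div a \<alpha>)"
  unfolding has_weak_div_def
proof (intro conjI ballI)
  show loc: "locally_integrable_on (rt_field a \<alpha>) D" "locally_integrable_on (rt_div a \<alpha>) D"
    by (intro Lspace_2_locally_integrable rt_field_L2)+
  fix u assume u: "u \<in> test_functions D"
  have "(LINT x|lebesgue_on D. rt_field a \<alpha> x \<bullet> grad u x + rt_div a \<alpha> x * u x) = 0"
  proof (rule rt_pairing_zero[OF test_function_C1[OF u]])
    fix F K z assume p: "(K, z) \<in> star F"
    note S = starD[OF p]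
    show "\<alpha> F * real (card (star F)) = 1 \<or> cone_flux K z u = 0"
    proof (cases "card (star F) = 2")
      case True
      then show ?thesis using assms by (simp add: admissible_def)
    next
      case False
      then have star: "star F = {(K, z)}" using star_cases[OF p] by simp
      obtain C where C: "C \<subseteq> D" "\<And>x. x \<notin> C \<Longrightarrow> u x = 0" using test_function_support[OF u] by blast
      have "cone_flux K z u = 0"
        using facet_interior_boundary[OF star] C
        by (intro cone_flux_facet_zero[OF S(8) test_function_C1[OF u] S(2)]) blast
      then show ?thesis by simp
    qed
  qed
  moreover have "(LINT x|lebesgue_on D. rt_field a \<alpha> x \<bullet> grad u x + rt_div a \<alpha> x * u x)
      = (LINT x|lebesgue_on D. rt_field a \<alpha> x \<bullet> grad u x) + (LINT x|lebesgue_on D. rt_div a \<alpha> x * u x)"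
    using test_function_integrable(3)[OF u open_D loc(1)] test_function_integrable(1)[OF u open_D loc(2)]
    by (intro Bochner_Integration.integral_add) (simp_all add: mult.commute)
  ultimately show "(LINT x|lebesgue_on D. rt_field a \<alpha> x \<bullet> grad u x) = - (LINT x|lebesgue_on D. rt_div a \<alpha> x * u x)"
    by simp
qed

lemma weak_div_rt_field_AE:
  assumes "admissible \<alpha>"
  shows "AE x in lebesgue. x \<in> D \<longrightarrow> rt_div a \<alpha> x = weak_div D (rt_field a \<alpha>) x"
  using weak_div_AE[OF open_D rt_field_has_weak_div[OF assms, of a]] by eventually_elim simp

lemma rt_field_in_RT_space:
  assumes "admissible \<alpha>"
  shows "rt_field a \<alpha> \<in> RT_space k D \<T>"
proof -
  have "weak_div D (rt_field a \<alpha>) \<in> Lspace 2 D"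
    by (rule Lspace_AE[OF rt_field_L2(2) D_sets weak_div_rt_field_AE[OF assms]])
  then have "rt_field a \<alpha> \<in> Hdiv 2 D"
    using rt_field_L2(1) rt_field_has_weak_div[OF assms] by (auto simp: Hdiv_def)
  moreover have "\<exists>p\<in>RT_polys k. AE x in lebesgue_on K. rt_field a \<alpha> x = p x" if K: "K \<in> \<T>" for K
  proof (rule bexI[of _ "rt_cell a \<alpha> K"])
    note S = simplex_mesh[OF K]
    have "negligible (frontier K)" by (intro negligible_convex_frontier convex_simplex[OF S])
    then have AE: "AE x in lebesgue. x \<notin> frontier K" by (intro AE_not_in) (simp only: negligible_iff_null_sets)
    have Ks: "K \<in> sets lebesgue" by (rule fmeasurableD[OF lmeasurable_compact[OF compact_simplex[OF S]]])
    show "AE x in lebesgue_on K. rt_field a \<alpha> x = rt_cell a \<alpha> K x"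
      unfolding AE_lebesgue_on_iff[OF Ks] using AE
      by eventually_elim (use closed_simplex[OF S] rt_field_interior(1)[OF K] in \<open>auto simp: frontier_def\<close>)
    have eq: "rt_cell a \<alpha> K = (\<lambda>x. - (\<Sum>z\<in>vertices K. rt_coeff a \<alpha> (K, z) *\<^sub>R z) + (\<Sum>z\<in>vertices K. rt_coeff a \<alpha> (K, z)) *\<^sub>R x)"
      by (auto simp: rt_cell_def scaleR_diff_right sum_subtractf scaleR_sum_left)
    show "rt_cell a \<alpha> K \<in> RT_polys k" unfolding eq by (rule affine_in_RT_polys)
  qed
  ultimately show ?thesis by (simp add: RT_space_def)
qed

text \<open>With weight 1 on boundary facets the pairing is zero for every smooth function, not only
  for test functions. By the definition of \<open>has_trace\<close> a lifting is a limit of smooth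
  functions in H^1, and the pairing is continuous there.\<close>

lemma rt_field_normal_trace_zero:
  assumes \<alpha>: "\<And>F. \<alpha> F = 1 / real (card (star F))"
  shows "has_normal_trace D (rt_field a \<alpha>) (\<lambda>_. 0)"
  unfolding has_normal_trace_def
proof (intro ballI allI impI)
  fix w l assume "has_trace D l w"
  then obtain u where l: "l \<in> sobolev 1 D" and u: "\<And>n. smooth (u n)"
    and u0: "(\<lambda>n. Lnorm 2 D (\<lambda>x. u n x - l x)) \<longlonglongrightarrow> 0"
    and u1: "(\<lambda>n. sobolev_seminorm 1 D (\<lambda>x. u n x - l x)) \<longlonglongrightarrow> 0"
    by (auto simp: has_trace_def)
  have adm: "admissible \<alpha>" by (simp add: admissible_def \<alpha>)
  let ?v = "rt_field a \<alpha>" and ?d = "rt_div a \<alpha>"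
  have lL: "l \<in> Lspace 2 D" and gl: "has_weak_grad D l (weak_grad D l)" "weak_grad D l \<in> Lspace 2 D"
    using l by (auto simp: sobolev_def intro: weak_grad_works)
  let ?I = "LINT x|lebesgue_on D. ?v x \<bullet> weak_grad D l x + ?d x * l x"
  have "(LINT x|lebesgue_on D. ?v x \<bullet> weak_grad D l x + weak_div D ?v x * l x) = ?I"
  proof (rule integral_cong_AE)
    have [measurable]: "?v \<in> borel_measurable (lebesgue_on D)" "?d \<in> borel_measurable (lebesgue_on D)"
      "l \<in> borel_measurable (lebesgue_on D)" "weak_grad D l \<in> borel_measurable (lebesgue_on D)"
      using lL gl rt_field_L2 by (auto simp: Lspace_2_iff)
    have [measurable]: "weak_div D ?v \<in> borel_measurable (lebesgue_on D)"
      by (rule measurable_lebesgue_on_AE[OF _ D_sets weak_div_rt_field_AE[OF adm]]) measurable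
    show "(\<lambda>x. ?v x \<bullet> weak_grad D l x + weak_div D ?v x * l x) \<in> borel_measurable (lebesgue_on D)"
      "(\<lambda>x. ?v x \<bullet> weak_grad D l x + ?d x * l x) \<in> borel_measurable (lebesgue_on D)" by measurable
    show "AE x in lebesgue_on D. ?v x \<bullet> weak_grad D l x + weak_div D ?v x * l x = ?v x \<bullet> weak_grad D l x + ?d x * l x"
      unfolding AE_lebesgue_on_iff[OF D_sets] using weak_div_rt_field_AE[OF adm, of a] by eventually_elim simp
  qed
  moreover have "\<bar>?I\<bar> \<le> 2 * Lnorm 2 D ?v * sobolev_seminorm 1 D (\<lambda>x. u n x - l x) + 2 * Lnorm 2 D ?d * Lnorm 2 D (\<lambda>x. u n x - l x)" for n
  proof -
    have cu: "u n \<in> Lspace 2 D" "grad (u n) \<in> Lspace 2 D"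
      by (intro continuous_in_Lspace_2 C1_continuous smooth_C1 u bounded_D D_lmeasurable)+
    have e: "(\<lambda>x. u n x - l x) \<in> Lspace 2 D" "(\<lambda>x. grad (u n) x - weak_grad D l x) \<in> Lspace 2 D"
      by (intro Lspace_2_diff cu lL gl)+
    have AE: "AE x in lebesgue. x \<in> D \<longrightarrow> weak_grad D (\<lambda>x. u n x - l x) x = grad (u n) x - weak_grad D l x"
      by (rule weak_grad_AE[OF open_D has_weak_grad_diff[OF smooth_has_weak_grad[OF u open_D] gl(1) open_D]])
    have sem: "sobolev_seminorm 1 D (\<lambda>x. u n x - l x) = Lnorm 2 D (\<lambda>x. grad (u n) x - weak_grad D l x)"
    proof -
      have "Lnorm 2 D (weak_grad D (\<lambda>x. u n x - l x)) = Lnorm 2 D (\<lambda>x. grad (u n) x - weak_grad D l x)"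
        by (rule Lnorm_AE[OF e(2) D_sets]) (use AE in \<open>auto elim: eventually_mono\<close>)
      then show ?thesis by (simp add: sobolev_seminorm_def Lnorm_nonneg)
    qed
    have zero: "(LINT x|lebesgue_on D. ?v x \<bullet> grad (u n) x + ?d x * u n x) = 0"
    proof (rule rt_pairing_zero[OF smooth_C1[OF u]])
      fix F K z assume "(K, z) \<in> star F"
      then have "card (star F) \<noteq> 0" using finite_star by auto
      then show "\<alpha> F * real (card (star F)) = 1 \<or> cone_flux K z (u n) = 0" by (simp add: \<alpha>)
    qed
    note i1 = integral_inner_bound[OF rt_field_L2(1)[of a \<alpha>] e(2)]
    note i2 = integral_inner_bound[OF rt_field_L2(2)[of a \<alpha>] e(1)]
    have il: "integrable (lebesgue_on D) (\<lambda>x. ?v x \<bullet> weak_grad D l x + ?d x * l x)"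
      using integral_inner_bound(1)[OF rt_field_L2(1) gl(2)] integral_inner_bound(1)[OF rt_field_L2(2) lL]
      by (intro Bochner_Integration.integrable_add) auto
    have "- ?I = (LINT x|lebesgue_on D. ?v x \<bullet> grad (u n) x + ?d x * u n x) - ?I" using zero by simp
    also have "\<dots> = (LINT x|lebesgue_on D. (?v x \<bullet> grad (u n) x + ?d x * u n x) - (?v x \<bullet> weak_grad D l x + ?d x * l x))"
      by (rule Bochner_Integration.integral_diff[OF integrable_rt_pairing[OF smooth_C1[OF u]] il, symmetric])
    also have "\<dots> = (LINT x|lebesgue_on D. ?v x \<bullet> (grad (u n) x - weak_grad D l x) + ?d x \<bullet> (u n x - l x))"
      by (rule Bochner_Integration.integral_cong) (auto simp: inner_diff_right algebra_simps)
    also have "\<dots> = (LINT x|lebesgue_on D. ?v x \<bullet> (grad (u n) x - weak_grad D l x)) + (LINT x|lebesgue_on D. ?d x \<bullet> (u n x - l x))"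
      by (rule Bochner_Integration.integral_add[OF i1(1) i2(1)])
    finally show ?thesis using i1(2) i2(2) unfolding sem by linarith
  qed
  moreover have "(\<lambda>n. 2 * Lnorm 2 D ?v * sobolev_seminorm 1 D (\<lambda>x. u n x - l x) + 2 * Lnorm 2 D ?d * Lnorm 2 D (\<lambda>x. u n x - l x)) \<longlonglongrightarrow> 0"
    using tendsto_add[OF tendsto_mult[OF tendsto_const u1] tendsto_mult[OF tendsto_const u0],
        of "2 * Lnorm 2 D ?v" "2 * Lnorm 2 D ?d"] by simp
  ultimately have "\<bar>?I\<bar> \<le> 0" by (intro tendsto_lowerbound[where F=sequentially]) auto
  with \<open>(LINT x|lebesgue_on D. ?v x \<bullet> weak_grad D l x + weak_div D ?v x * l x) = ?I\<close>
  show "0 = (LINT x|lebesgue_on D. ?v x \<bullet> weak_grad D l x + weak_div D ?v x * l x)" by simp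
qed

text \<open>By \<open>sum_bary_grad\<close> the constant is the combination of the fields x - z with
  coefficients \<open>normal_flux\<close> over volume. These cancel against the same terms in
  \<open>rt_coeff\<close>, and only the jumps remain.\<close>

lemma rt_cell_minus_const:
  assumes K: "K \<in> \<T>"
  shows "a K - rt_cell a \<alpha> K x = (\<Sum>z\<in>vertices K. (\<alpha> (vertices K - {z}) * jump a (vertices K - {z}) / measure lborel K) *\<^sub>R (x - z))"
proof -
  note S = simplex_mesh[OF K]
  have "(\<Sum>z\<in>vertices K. (- (a K \<bullet> bary_grad K z)) *\<^sub>R (x - z))
      = - ((\<Sum>z\<in>vertices K. a K \<bullet> bary_grad K z) *\<^sub>R x) + (\<Sum>z\<in>vertices K. (a K \<bullet> bary_grad K z) *\<^sub>R z)"
    by (simp add: scaleR_diff_right sum_subtractf sum_negf scaleR_sum_left)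
  then have aK: "a K = (\<Sum>z\<in>vertices K. (- (a K \<bullet> bary_grad K z)) *\<^sub>R (x - z))"
    by (simp add: sum_bary_grad[OF S])
  have "a K - rt_cell a \<alpha> K x = (\<Sum>z\<in>vertices K. (- (a K \<bullet> bary_grad K z)) *\<^sub>R (x - z) - rt_coeff a \<alpha> (K, z) *\<^sub>R (x - z))"
    by (subst aK) (simp add: rt_cell_def sum_subtractf)
  also have "\<dots> = (\<Sum>z\<in>vertices K. (\<alpha> (vertices K - {z}) * jump a (vertices K - {z}) / measure lborel K) *\<^sub>R (x - z))"
  proof (rule sum.cong[OF refl])
    fix z
    have "- (a K \<bullet> bary_grad K z) - rt_coeff a \<alpha> (K, z) = \<alpha> (vertices K - {z}) * jump a (vertices K - {z}) / measure lborel K"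
      using measure_simplex_pos[OF S] by (simp add: rt_coeff_def normal_flux_def facet_def field_simps)
    then show "(- (a K \<bullet> bary_grad K z)) *\<^sub>R (x - z) - rt_coeff a \<alpha> (K, z) *\<^sub>R (x - z)
        = (\<alpha> (vertices K - {z}) * jump a (vertices K - {z}) / measure lborel K) *\<^sub>R (x - z)"
      by (simp only: scaleR_diff_left[symmetric])
  qed
  finally show ?thesis .
qed

end

section \<open>The error estimate\<close>

definition volume_const :: "nat \<Rightarrow> real \<Rightarrow> real" where
  "volume_const n \<sigma> = unit_ball_vol (real n) / (4 * \<sigma>) ^ n"

definition bump_flux_const :: "nat \<Rightarrow> real \<Rightarrow> real" where
  "bump_flux_const n \<sigma> = exp (- 4 / 3) * (1 / (4 * real n * \<sigma>\<^sup>2)) ^ (n - 1)"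

text \<open>The summands belong to the L2 term and the divergence term in \<open>jump_bound\<close>.
  2048 is 2 times 32^2, since 16 over the radius is 32 d \<sigma>^2 over the diameter, and 8 is 2
  times 2^2; the leading 2 comes from squaring a sum. The rest are volume quotients bounded by shape
  regularity.\<close>

definition cell_const :: "nat \<Rightarrow> real \<Rightarrow> real \<Rightarrow> real" where
  "cell_const n \<sigma> q = 2048 * (real n)\<^sup>2 * \<sigma> ^ 4 * (unit_ball_vol (real n) * \<sigma> ^ n / volume_const n \<sigma>)
     + 8 * (\<sigma> ^ (n + 2) / volume_const n \<sigma>) * unit_ball_vol (real n) powr (2 - 2 / q)"

text \<open>The 2 is the maximal number of cells at a facet, from the square of the sum over the
  star; the lower bound for the flux of the bump is divided out.\<close>

definition jump_const :: "nat \<Rightarrow> real \<Rightarrow> real \<Rightarrow> real" where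
  "jump_const n \<sigma> q = 2 / (bump_flux_const n \<sigma>)\<^sup>2 * cell_const n \<sigma> q"

context mesh_on_domain
begin

lemma volume_bounds:
  assumes "K \<in> \<T>"
  shows "0 < \<sigma>" "0 < volume_const DIM('a) \<sigma>"
    "volume_const DIM('a) \<sigma> * diameter K ^ DIM('a) \<le> measure lborel K"
    "measure lborel K \<le> unit_ball_vol (real DIM('a)) * diameter K ^ DIM('a)"
proof -
  note S = simplex_mesh[OF assms]
  show \<sigma>: "0 < \<sigma>" by (rule shape_constant_pos[OF S shape[OF assms]])
  then show "0 < volume_const DIM('a) \<sigma>" by (simp add: volume_const_def)
  show "volume_const DIM('a) \<sigma> * diameter K ^ DIM('a) \<le> measure lborel K"
    using measure_simplex_lower[OF S shape[OF assms]] by (simp add: volume_const_def power_divide)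
  show "measure lborel K \<le> unit_ball_vol (real DIM('a)) * diameter K ^ DIM('a)"
    by (rule measure_simplex_upper[OF S])
qed

lemma const_pos: 
  assumes "0 < \<sigma>"
  shows "0 < bump_flux_const DIM('a) \<sigma>" "0 \<le> cell_const DIM('a) \<sigma> q" "0 \<le> jump_const DIM('a) \<sigma> q"
proof -
  show "0 < bump_flux_const DIM('a) \<sigma>" using assms by (simp add: bump_flux_const_def)
  show c: "0 \<le> cell_const DIM('a) \<sigma> q" using assms by (simp add: cell_const_def volume_const_def)
  show "0 \<le> jump_const DIM('a) \<sigma> q" unfolding jump_const_def by (intro mult_nonneg_nonneg c) simp
qed

end

context div_field_on_mesh
begin

definition div_weight :: "'a set \<Rightarrow> real" where
  "div_weight K = diameter K powr (2 + 2 * real DIM('a) * (1 / 2 - 1 / q))"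

definition local_error :: "('a set \<Rightarrow> 'a) \<Rightarrow> 'a set \<Rightarrow> real" where
  "local_error a K = (Lnorm 2 (interior K) (\<lambda>x. v x - a K))\<^sup>2
     + div_weight K * (Lnorm q (interior K) (weak_div D v))\<^sup>2"

lemma local_error_nonneg: "0 \<le> local_error a K"
  by (simp add: local_error_def div_weight_def)

text \<open>In the L2 term the diameter cancels against the radius of the bump, and a quotient of
  neighbouring volumes remains. In the divergence term the powers of h combine to d (2 - 2/q) + 2 -
  d = 2 + 2d (1/2 - 1/q), which is the exponent of \<open>div_weight\<close>.\<close>

lemma cell_term_bound:
  assumes p0: "(K\<^sub>0, z\<^sub>0) \<in> star F" and p: "(K, z) \<in> star F"
  shows "(16 / radius K\<^sub>0 * measure lborel K powr (1 / 2) * Lnorm 2 (interior K) (\<lambda>x. v x - a K)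
      + 2 * measure lborel K powr (1 - 1 / q) * Lnorm q (interior K) (weak_div D v))\<^sup>2
      * ((diameter K\<^sub>0)\<^sup>2 / measure lborel K\<^sub>0) \<le> cell_const DIM('a) \<sigma> q * local_error a K"
proof -
  let ?n = "DIM('a)" and ?\<omega> = "unit_ball_vol (real DIM('a))"
  define h0 h m0 m E N \<kappa> where defs: "h0 = diameter K\<^sub>0" "h = diameter K" "m0 = measure lborel K\<^sub>0"
    "m = measure lborel K" "E = Lnorm 2 (interior K) (\<lambda>x. v x - a K)"
    "N = Lnorm q (interior K) (weak_div D v)" "\<kappa> = volume_const ?n \<sigma>"
  have pos: "0 < h0" "0 < h" "0 < m0" "0 < m" "0 \<le> E" "0 \<le> N"
    using diameter_star_pos[OF p0] diameter_star_pos[OF p] measure_simplex_pos[OF starD(8)[OF p0]]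
      measure_simplex_pos[OF starD(8)[OF p]] by (auto simp: defs Lnorm_nonneg)
  have \<sigma>: "0 < \<sigma>" "0 < \<kappa>" and m0: "\<kappa> * h0 ^ ?n \<le> m0" and m: "m \<le> ?\<omega> * h ^ ?n"
    using volume_bounds[OF starD(1)[OF p0]] volume_bounds(4)[OF starD(1)[OF p]] by (auto simp: defs)
  have h: "h0 \<le> \<sigma> * h" "h \<le> \<sigma> * h0"
    using diameter_star_le[OF p0 p] diameter_star_le[OF p p0] by (auto simp: defs)
  \<comment> \<open>Everything is to be expressed through the diameter of \<open>K\<close>; passing
    from the volume of its neighbour costs the factor \<sigma>^d.\<close>
  have inv_m0: "1 / m0 \<le> \<sigma> ^ ?n / (\<kappa> * h ^ ?n)"
  proof -
    have "h ^ ?n \<le> (\<sigma> * h0) ^ ?n" using h pos by (intro power_mono) auto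
    then have "\<kappa> * h ^ ?n \<le> \<kappa> * (\<sigma> ^ ?n * h0 ^ ?n)" using \<sigma> by (intro mult_left_mono) (auto simp: power_mult_distrib)
    also have "\<dots> = \<sigma> ^ ?n * (\<kappa> * h0 ^ ?n)" by simp
    also have "\<dots> \<le> \<sigma> ^ ?n * m0" using m0 \<sigma> by (intro mult_left_mono) auto
    finally show ?thesis using pos \<sigma> by (simp add: divide_simps mult_ac)
  qed
  define x y where "x = 16 / radius K\<^sub>0 * m powr (1 / 2) * E" and "y = 2 * m powr (1 - 1 / q) * N"
  have x2: "x\<^sup>2 * (h0\<^sup>2 / m0) \<le> 1024 * (real ?n)\<^sup>2 * \<sigma> ^ 4 * (?\<omega> * \<sigma> ^ ?n / \<kappa>) * E\<^sup>2"
  proof -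
    have "x\<^sup>2 * (h0\<^sup>2 / m0) = 1024 * (real ?n)\<^sup>2 * \<sigma> ^ 4 * (m * (1 / m0)) * E\<^sup>2"
    proof -
      have "(m powr (1 / 2))\<^sup>2 = m" using pos by (simp add: powr_half_sqrt)
      moreover have "16 / radius K\<^sub>0 = 32 * real ?n * \<sigma>\<^sup>2 / h0" by (simp add: radius_def defs)
      ultimately have "x\<^sup>2 = (32 * real ?n * \<sigma>\<^sup>2 / h0)\<^sup>2 * m * E\<^sup>2" by (simp only: x_def power_mult_distrib)
      then show ?thesis using pos by (simp add: power_mult_distrib power_divide)
    qed
    also have "m * (1 / m0) \<le> (?\<omega> * h ^ ?n) * (\<sigma> ^ ?n / (\<kappa> * h ^ ?n))"
      using m inv_m0 pos by (intro mult_mono) auto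
    also have "\<dots> = ?\<omega> * \<sigma> ^ ?n / \<kappa>" using pos by simp
    finally show ?thesis using \<sigma> by (simp add: mult_left_mono mult_right_mono)
  qed
  have y2: "y\<^sup>2 * (h0\<^sup>2 / m0) \<le> 4 * (\<sigma> ^ (?n + 2) / \<kappa>) * ?\<omega> powr (2 - 2 / q) * (div_weight K * N\<^sup>2)"
  proof -
    have mp: "(m powr (1 - 1 / q))\<^sup>2 \<le> ?\<omega> powr (2 - 2 / q) * h powr (real ?n * (2 - 2 / q))"
    proof -
      have "(m powr (1 - 1 / q))\<^sup>2 = m powr (2 - 2 / q)"
        using pos by (simp add: power2_eq_square flip: powr_add)
      also have "\<dots> \<le> (?\<omega> * h ^ ?n) powr (2 - 2 / q)"
        using m pos q_ge_1 by (intro powr_mono2) (auto simp: field_simps)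
      also have "\<dots> = ?\<omega> powr (2 - 2 / q) * h powr (real ?n * (2 - 2 / q))"
        using pos by (simp add: powr_mult powr_powr flip: powr_realpow)
      finally show ?thesis .
    qed
    have hm: "h0\<^sup>2 / m0 \<le> \<sigma> ^ (?n + 2) / \<kappa> * (h\<^sup>2 / h ^ ?n)"
    proof -
      have "h0\<^sup>2 * (1 / m0) \<le> (\<sigma> * h)\<^sup>2 * (\<sigma> ^ ?n / (\<kappa> * h ^ ?n))"
        using h inv_m0 pos by (intro mult_mono power_mono) auto
      then show ?thesis by (simp add: power_mult_distrib power_add mult_ac power2_eq_square)
    qed
    have "y\<^sup>2 * (h0\<^sup>2 / m0) = 4 * (m powr (1 - 1 / q))\<^sup>2 * N\<^sup>2 * (h0\<^sup>2 / m0)" by (simp add: y_def power_mult_distrib)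
    also have "\<dots> \<le> 4 * (?\<omega> powr (2 - 2 / q) * h powr (real ?n * (2 - 2 / q))) * N\<^sup>2 * (\<sigma> ^ (?n + 2) / \<kappa> * (h\<^sup>2 / h ^ ?n))"
      using mp hm pos by (intro mult_mono) auto
    also have "\<dots> = 4 * (\<sigma> ^ (?n + 2) / \<kappa>) * ?\<omega> powr (2 - 2 / q) * ((h powr (real ?n * (2 - 2 / q)) * (h\<^sup>2 / h ^ ?n)) * N\<^sup>2)"
      by (simp add: mult_ac)
    also have "h powr (real ?n * (2 - 2 / q)) * (h\<^sup>2 / h ^ ?n) = div_weight K"
    proof -
      have "h\<^sup>2 / h ^ ?n = h powr (2 - real ?n)" using pos by (simp add: powr_diff powr_realpow flip: powr_numeral)
      then have "h powr (real ?n * (2 - 2 / q)) * (h\<^sup>2 / h ^ ?n) = h powr (real ?n * (2 - 2 / q) + (2 - real ?n))"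
        by (simp add: powr_add)
      also have "real ?n * (2 - 2 / q) + (2 - real ?n) = 2 + 2 * real ?n * (1 / 2 - 1 / q)" by (simp add: algebra_simps)
      finally show ?thesis by (simp add: div_weight_def defs)
    qed
    finally show ?thesis .
  qed
  have "(x + y)\<^sup>2 * (h0\<^sup>2 / m0) \<le> (2 * x\<^sup>2 + 2 * y\<^sup>2) * (h0\<^sup>2 / m0)"
    using norm_add_sq_le[of x y] pos by (intro mult_right_mono) auto
  also have "\<dots> = 2 * (x\<^sup>2 * (h0\<^sup>2 / m0)) + 2 * (y\<^sup>2 * (h0\<^sup>2 / m0))" by (simp only: distrib_right mult.assoc)
  also have "\<dots> \<le> (2048 * (real ?n)\<^sup>2 * \<sigma> ^ 4 * (?\<omega> * \<sigma> ^ ?n / \<kappa>)) * E\<^sup>2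
      + (8 * (\<sigma> ^ (?n + 2) / \<kappa>) * ?\<omega> powr (2 - 2 / q)) * (div_weight K * N\<^sup>2)"
    using x2 y2 by linarith
  also have "\<dots> \<le> cell_const ?n \<sigma> q * E\<^sup>2 + cell_const ?n \<sigma> q * (div_weight K * N\<^sup>2)"
    unfolding cell_const_def defs(7)[symmetric]
    using \<sigma> by (intro add_mono mult_right_mono) (auto simp: div_weight_def)
  also have "\<dots> = cell_const ?n \<sigma> q * local_error a K" by (simp add: local_error_def defs distrib_left)
  finally show ?thesis by (simp add: x_def y_def defs)
qed

text \<open>The weight, squared diameter over volume, bounds up to a constant the squared L2 norm of
  the shape function with coefficient 1 over volume, so this is the form in which
  \<open>rt_cell_error\<close> uses the jumps.\<close>

lemma jump_sq_bound:
  assumes p0: "(K\<^sub>0, z\<^sub>0) \<in> star F" and c: "card (star F) = 2 \<or> has_normal_trace D v (\<lambda>_. 0)"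
  shows "(jump a F)\<^sup>2 * ((diameter K\<^sub>0)\<^sup>2 / measure lborel K\<^sub>0)
    \<le> jump_const DIM('a) \<sigma> q * (\<Sum>p\<in>star F. local_error a (fst p))"
proof -
  let ?b = "bump_flux_const DIM('a) \<sigma>" and ?t = "(diameter K\<^sub>0)\<^sup>2 / measure lborel K\<^sub>0"
  let ?X = "\<lambda>p. 16 / radius K\<^sub>0 * measure lborel (fst p) powr (1 / 2) * Lnorm 2 (interior (fst p)) (\<lambda>x. v x - a (fst p))
      + 2 * measure lborel (fst p) powr (1 - 1 / q) * Lnorm q (interior (fst p)) (weak_div D v)"
  have b: "0 < ?b" using const_pos(1) volume_bounds(1)[OF starD(1)[OF p0]] by simp
  have t: "0 \<le> ?t" by simp
  have "\<bar>jump a F\<bar> * ?b \<le> (\<Sum>p\<in>star F. ?X p)"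
    using jump_bound[OF p0 c, of a] by (simp add: bump_flux_const_def case_prod_unfold)
  then have "(\<bar>jump a F\<bar> * ?b)\<^sup>2 \<le> (\<Sum>p\<in>star F. ?X p)\<^sup>2" using b by (intro power_mono) auto
  also have "\<dots> \<le> (\<Sum>p\<in>star F. (?X p)\<^sup>2) * real (card (star F))"
    by (rule sum_squared_le_sum_of_squares)
  also have "\<dots> \<le> (\<Sum>p\<in>star F. (?X p)\<^sup>2) * 2"
    using card_star_le_2[of F] by (intro mult_left_mono sum_nonneg) auto
  finally have "(\<bar>jump a F\<bar> * ?b)\<^sup>2 * ?t \<le> (\<Sum>p\<in>star F. (?X p)\<^sup>2) * 2 * ?t" using t by (rule mult_right_mono)
  also have "\<dots> = 2 * (\<Sum>p\<in>star F. (?X p)\<^sup>2 * ?t)" by (simp add: sum_distrib_right sum_distrib_left mult_ac)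
  also have "\<dots> \<le> 2 * (\<Sum>p\<in>star F. cell_const DIM('a) \<sigma> q * local_error a (fst p))"
    using cell_term_bound[OF p0, of _ _ a] by (intro mult_left_mono sum_mono) auto
  finally have "(jump a F)\<^sup>2 * ?b\<^sup>2 * ?t \<le> 2 * (cell_const DIM('a) \<sigma> q * (\<Sum>p\<in>star F. local_error a (fst p)))"
    by (simp add: power_mult_distrib sum_distrib_left)
  then have "(jump a F)\<^sup>2 * ?t \<le> 2 * (cell_const DIM('a) \<sigma> q * (\<Sum>p\<in>star F. local_error a (fst p))) / ?b\<^sup>2"
    using b by (simp add: pos_le_divide_eq mult_ac)
  then show ?thesis by (simp add: jump_const_def mult_ac)
qed

text \<open>The error splits into v - a and the difference in \<open>rt_cell_minus_const\<close>, a
  sum of d + 1 multiples of x - z, whose length is at most the diameter. The second condition on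
  \<alpha> says that a jump is used only where it has been estimated.\<close>

lemma rt_cell_error:
  assumes K: "K \<in> \<T>" and \<alpha>: "\<And>F. \<bar>\<alpha> F\<bar> \<le> 1"
    "\<And>F p. p \<in> star F \<Longrightarrow> \<alpha> F = 0 \<or> card (star F) = 2 \<or> has_normal_trace D v (\<lambda>_. 0)"
  shows "(Lnorm 2 (interior K) (\<lambda>x. v x - rt_field a \<alpha> x))\<^sup>2
    \<le> 2 * local_error a K + 2 * (real DIM('a) + 1) * jump_const DIM('a) \<sigma> q *
        (\<Sum>z\<in>vertices K. \<Sum>p\<in>star (vertices K - {z}). local_error a (fst p))"
proof -
  note S = simplex_mesh[OF K] and Ul = measure_interior_cell[OF K]
  let ?U = "interior K" and ?n = "real DIM('a)" and ?m = "measure lborel K" and ?h = "diameter K"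
  let ?R = "\<Sum>z\<in>vertices K. \<Sum>p\<in>star (vertices K - {z}). local_error a (fst p)"
  have Us: "?U \<in> sets lebesgue" by auto
  have bU: "bounded ?U" using bounded_subset[OF bounded_D interior_cell_subset[OF K]] .
  have m: "0 < ?m" by (rule measure_simplex_pos[OF S])
  define c where "c z = \<alpha> (vertices K - {z}) * jump a (vertices K - {z}) / ?m" for z
  define B where "B = (?n + 1) * (\<Sum>z\<in>vertices K. (c z)\<^sup>2) * ?h\<^sup>2"
  have pt: "(norm (a K - rt_cell a \<alpha> K x))\<^sup>2 \<le> B" if x: "x \<in> ?U" for x
  proof -
    have "norm (a K - rt_cell a \<alpha> K x) \<le> (\<Sum>z\<in>vertices K. norm (c z *\<^sub>R (x - z)))"
      unfolding rt_cell_minus_const[OF K] c_def[symmetric] by (rule norm_sum)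
    also have "\<dots> \<le> (\<Sum>z\<in>vertices K. \<bar>c z\<bar> * ?h)"
    proof (rule sum_mono)
      fix z assume z: "z \<in> vertices K"
      have "norm (x - z) \<le> ?h"
        using diameter_bounded_bound[OF compact_imp_bounded[OF compact_simplex[OF S]], of x z]
          x z vertices_subset[OF S] interior_subset by (auto simp: dist_norm)
      then show "norm (c z *\<^sub>R (x - z)) \<le> \<bar>c z\<bar> * ?h" by (simp add: mult_left_mono)
    qed
    finally have "(norm (a K - rt_cell a \<alpha> K x))\<^sup>2 \<le> (\<Sum>z\<in>vertices K. \<bar>c z\<bar> * ?h)\<^sup>2"
      by (intro power_mono) auto
    also have "\<dots> \<le> (\<Sum>z\<in>vertices K. (\<bar>c z\<bar> * ?h)\<^sup>2) * real (card (vertices K))"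
      by (rule sum_squared_le_sum_of_squares)
    also have "\<dots> = B"
      using simplex_vertices(3)[OF S] by (simp add: B_def power_mult_distrib mult_ac flip: sum_distrib_left)
    finally show ?thesis .
  qed
  have "B * ?m \<le> (?n + 1) * (jump_const DIM('a) \<sigma> q * ?R)"
  proof -
    have "(c z)\<^sup>2 * ?h\<^sup>2 * ?m \<le> jump_const DIM('a) \<sigma> q * (\<Sum>p\<in>star (vertices K - {z}). local_error a (fst p))"
      if z: "z \<in> vertices K" for z
    proof -
      let ?F = "vertices K - {z}"
      have p: "(K, z) \<in> star ?F" using K z by (simp add: star_def flags_def facet_def)
      have nn: "0 \<le> jump_const DIM('a) \<sigma> q * (\<Sum>p\<in>star ?F. local_error a (fst p))"
        using const_pos(3) volume_bounds(1)[OF K] by (intro mult_nonneg_nonneg sum_nonneg local_error_nonneg) simp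
      show ?thesis
      proof (cases "\<alpha> ?F = 0")
        case True
        then show ?thesis using nn by (simp add: c_def)
      next
        case False
        have "(c z)\<^sup>2 * ?h\<^sup>2 * ?m = (\<alpha> ?F)\<^sup>2 * ((jump a ?F)\<^sup>2 * (?h\<^sup>2 / ?m))"
          using m by (simp add: c_def power_mult_distrib power_divide power2_eq_square)
        also have "\<dots> \<le> 1 * ((jump a ?F)\<^sup>2 * (?h\<^sup>2 / ?m))"
          using \<alpha>(1)[of ?F] m by (intro mult_right_mono) (auto simp: abs_square_le_1)
        also have "\<dots> \<le> jump_const DIM('a) \<sigma> q * (\<Sum>p\<in>star ?F. local_error a (fst p))"
          using jump_sq_bound[OF p] \<alpha>(2)[OF p] False by simp
        finally show ?thesis .
      qed
    qed
    then have "(\<Sum>z\<in>vertices K. (c z)\<^sup>2 * ?h\<^sup>2 * ?m) \<le> (\<Sum>z\<in>vertices K. jump_const DIM('a) \<sigma> q * (\<Sum>p\<in>star (vertices K - {z}). local_error a (fst p)))"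
      by (rule sum_mono)
    then have "(?n + 1) * ((\<Sum>z\<in>vertices K. (c z)\<^sup>2) * ?h\<^sup>2 * ?m) \<le> (?n + 1) * (jump_const DIM('a) \<sigma> q * ?R)"
      by (intro mult_left_mono) (simp_all add: sum_distrib_right sum_distrib_left)
    then show ?thesis by (simp add: B_def mult_ac)
  qed
  moreover have "(Lnorm 2 ?U (\<lambda>x. v x - rt_field a \<alpha> x))\<^sup>2 \<le> 2 * (Lnorm 2 ?U (\<lambda>x. v x - a K))\<^sup>2 + 2 * (B * ?m)"
  proof -
    have vU: "v \<in> Lspace 2 ?U" "rt_field a \<alpha> \<in> Lspace 2 ?U"
      by (intro Lspace_subset[OF _ interior_cell_subset[OF K] Us D_sets] v_L2 rt_field_L2)+
    have va: "(\<lambda>x. v x - a K) \<in> Lspace 2 ?U"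
      by (intro Lspace_2_diff vU continuous_in_Lspace_2[OF continuous_on_const bU Ul(2)])
    have e: "(\<lambda>x. v x - rt_field a \<alpha> x) \<in> Lspace 2 ?U" by (intro Lspace_2_diff vU)
    have ci: "integrable (lebesgue_on ?U) (\<lambda>x. 2 * B)"
      by (rule finite_measure.integrable_const[OF finite_measure_lebesgue_on[OF Ul(2)]])
    have vai: "integrable (lebesgue_on ?U) (\<lambda>x. 2 * (norm (v x - a K))\<^sup>2)" using va by (simp add: Lspace_2_iff)
    have "(LINT x|lebesgue_on ?U. (norm (v x - rt_field a \<alpha> x))\<^sup>2) \<le> (LINT x|lebesgue_on ?U. 2 * (norm (v x - a K))\<^sup>2 + 2 * B)"
    proof (rule integral_mono)
      show "integrable (lebesgue_on ?U) (\<lambda>x. (norm (v x - rt_field a \<alpha> x))\<^sup>2)" using e by (simp add: Lspace_2_iff)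
      show "integrable (lebesgue_on ?U) (\<lambda>x. 2 * (norm (v x - a K))\<^sup>2 + 2 * B)" by (rule Bochner_Integration.integrable_add[OF vai ci])
      fix x assume "x \<in> space (lebesgue_on ?U)"
      then have x: "x \<in> ?U" by simp
      have "(norm (v x - rt_field a \<alpha> x))\<^sup>2 \<le> 2 * (norm (v x - a K))\<^sup>2 + 2 * (norm (a K - rt_cell a \<alpha> K x))\<^sup>2"
        using norm_add_sq_le[of "v x - a K" "a K - rt_cell a \<alpha> K x"] by (simp add: rt_field_interior(1)[OF K x])
      then show "(norm (v x - rt_field a \<alpha> x))\<^sup>2 \<le> 2 * (norm (v x - a K))\<^sup>2 + 2 * B" using pt[OF x] by linarith
    qed
    also have "\<dots> = 2 * (LINT x|lebesgue_on ?U. (norm (v x - a K))\<^sup>2) + 2 * (B * ?m)"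
    proof -
      have "measure (lebesgue_on ?U) ?U = ?m" unfolding Ul(1)[symmetric] using Us by (intro measure_restrict_space) auto
      then show ?thesis unfolding Bochner_Integration.integral_add[OF vai ci] by simp
    qed
    finally show ?thesis by (simp add: Lnorm_2_sq)
  qed
  moreover have "(Lnorm 2 ?U (\<lambda>x. v x - a K))\<^sup>2 \<le> local_error a K"
    by (simp add: local_error_def div_weight_def)
  ultimately have "(Lnorm 2 ?U (\<lambda>x. v x - rt_field a \<alpha> x))\<^sup>2
      \<le> 2 * local_error a K + 2 * ((?n + 1) * (jump_const DIM('a) \<sigma> q * ?R))"
    by linarith
  then show ?thesis by (simp only: mult.assoc)
qed

text \<open>Summation over the cells counts a local error once for every side of each facet of its
  cell, hence at most 2 (d + 1) times. Together with the factor d + 1 from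
  \<open>rt_cell_error\<close> this gives the square.\<close>

lemma rt_field_error:
  assumes \<alpha>: "\<And>F. \<bar>\<alpha> F\<bar> \<le> 1"
    "\<And>F p. p \<in> star F \<Longrightarrow> \<alpha> F = 0 \<or> card (star F) = 2 \<or> has_normal_trace D v (\<lambda>_. 0)"
  shows "(Lnorm 2 D (\<lambda>x. v x - rt_field a \<alpha> x))\<^sup>2
    \<le> (2 + 4 * (real DIM('a) + 1)\<^sup>2 * jump_const DIM('a) \<sigma> q) * (\<Sum>K\<in>\<T>. local_error a K)"
proof -
  let ?n = "real DIM('a)" and ?J = "jump_const DIM('a) \<sigma> q" and ?S = "\<Sum>K\<in>\<T>. local_error a K"
  \<comment> \<open>The constants are defined for every real \<sigma>; its positivity follows from
    the existence of a cell.\<close>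
  have J: "0 \<le> ?J"
  proof -
    have "D \<noteq> {}" using domain by (simp add: polyhedral_lipschitz_domain_def)
    then have "\<T> \<noteq> {}" using Union_mesh closure_subset by fastforce
    then show ?thesis using const_pos(3) volume_bounds(1) by blast
  qed
  have count: "(\<Sum>K\<in>\<T>. \<Sum>z\<in>vertices K. \<Sum>p\<in>star (vertices K - {z}). local_error a (fst p)) \<le> 2 * (?n + 1) * ?S"
  proof -
    have "(\<Sum>K\<in>\<T>. \<Sum>z\<in>vertices K. \<Sum>p\<in>star (vertices K - {z}). local_error a (fst p))
        = (\<Sum>p\<in>flags. \<Sum>p'\<in>star (facet p). local_error a (fst p'))"
      unfolding flags_def using finite_mesh simplex_vertices(2)[OF simplex_mesh]
      by (subst sum.Sigma) (auto simp: case_prod_unfold facet_def)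
    also have "\<dots> = (\<Sum>p\<in>flags. \<Sum>p'\<in>{p' \<in> flags. facet p' = facet p}. local_error a (fst p'))" by (simp add: star_def)
    also have "\<dots> = (\<Sum>p'\<in>flags. \<Sum>p\<in>{p \<in> flags. facet p' = facet p}. local_error a (fst p'))"
      by (rule sum.swap_restrict[OF finite_flags finite_flags])
    also have "\<dots> = (\<Sum>p'\<in>flags. real (card (star (facet p'))) * local_error a (fst p'))"
    proof (rule sum.cong[OF refl])
      fix p'
      have "{p \<in> flags. facet p' = facet p} = star (facet p')" by (auto simp: star_def)
      then show "(\<Sum>p\<in>{p \<in> flags. facet p' = facet p}. local_error a (fst p')) = real (card (star (facet p'))) * local_error a (fst p')"
        by simp
    qed
    also have "\<dots> \<le> (\<Sum>p'\<in>flags. 2 * local_error a (fst p'))"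
      using card_star_le_2 by (intro sum_mono mult_right_mono local_error_nonneg) simp
    also have "\<dots> = (\<Sum>K\<in>\<T>. \<Sum>z\<in>vertices K. 2 * local_error a K)"
      unfolding flags_def using finite_mesh simplex_vertices(2)[OF simplex_mesh]
      by (subst sum.Sigma) (auto simp: case_prod_unfold)
    also have "\<dots> = (\<Sum>K\<in>\<T>. (?n + 1) * (2 * local_error a K))"
      by (rule sum.cong) (simp_all add: simplex_vertices(3)[OF simplex_mesh])
    also have "\<dots> = 2 * (?n + 1) * ?S" by (simp add: mult_ac flip: sum_distrib_left)
    finally show ?thesis .
  qed
  have e: "(\<lambda>x. v x - rt_field a \<alpha> x) \<in> Lspace 2 D" by (intro Lspace_2_diff v_L2 rt_field_L2)
  have "(Lnorm 2 D (\<lambda>x. v x - rt_field a \<alpha> x))\<^sup>2 = (\<Sum>K\<in>\<T>. (Lnorm 2 (interior K) (\<lambda>x. v x - rt_field a \<alpha> x))\<^sup>2)"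
    using e unfolding Lnorm_2_sq by (intro integral_cells) (simp add: Lspace_2_iff)
  also have "\<dots> \<le> (\<Sum>K\<in>\<T>. 2 * local_error a K + 2 * (?n + 1) * ?J *
        (\<Sum>z\<in>vertices K. \<Sum>p\<in>star (vertices K - {z}). local_error a (fst p)))"
    by (intro sum_mono rt_cell_error \<alpha>)
  also have "\<dots> = 2 * ?S + 2 * (?n + 1) * ?J * (\<Sum>K\<in>\<T>. \<Sum>z\<in>vertices K. \<Sum>p\<in>star (vertices K - {z}). local_error a (fst p))"
    by (simp add: sum.distrib sum_distrib_left)
  also have "\<dots> \<le> 2 * ?S + 2 * (?n + 1) * ?J * (2 * (?n + 1) * ?S)"
    using J count by (intro add_left_mono mult_left_mono) auto
  also have "\<dots> = (2 + 4 * (?n + 1)\<^sup>2 * ?J) * ?S" by (simp add: power2_eq_square algebra_simps)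
  finally show ?thesis .
qed

text \<open>On a cell the lower volume bound in \<open>sobolev_poincare\<close> is
  \<open>volume_const\<close> times the d-th power of the diameter, which reduces the shape quotient
  to a constant. Adding 1 gives a single factor for both terms of the local error.\<close>

lemma ex_good_constants:
  assumes v: "v \<in> sobolev r D" and r: "0 < r" "r \<le> 1"
  obtains a where "\<And>K. K \<in> \<T> \<Longrightarrow> local_error a K
    \<le> (1 + (1 + unit_ball_vol (real DIM('a))) / volume_const DIM('a) \<sigma>) *
       (diameter K powr (2 * r) * (sobolev_seminorm r (interior K) v)\<^sup>2
         + div_weight K * (Lnorm q (interior K) (weak_div D v))\<^sup>2)"
proof -
  let ?\<omega> = "unit_ball_vol (real DIM('a))" and ?\<kappa> = "volume_const DIM('a) \<sigma>"
  have "\<exists>b. (Lnorm 2 (interior K) (\<lambda>x. v x - b))\<^sup>2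
      \<le> (1 + ?\<omega>) / ?\<kappa> * (diameter K powr (2 * r) * (sobolev_seminorm r (interior K) v)\<^sup>2)" if K: "K \<in> \<T>" for K
  proof -
    note S = simplex_mesh[OF K] and V = volume_bounds[OF K]
    have hp: "0 < diameter K" by (rule diameter_simplex_pos[OF S])
    obtain b where "(Lnorm 2 (interior K) (\<lambda>x. v x - b))\<^sup>2
        \<le> (1 + ?\<omega>) * (diameter K ^ DIM('a) / (?\<kappa> * diameter K ^ DIM('a))) * (diameter K powr (2 * r) * (sobolev_seminorm r (interior K) v)\<^sup>2)"
    proof (rule sobolev_poincare[OF v r open_D interior_cell_subset[OF K] open_interior _ _ _ _ _ hp])
      show "convex (interior K)" by (intro convex_interior convex_simplex[OF S])
      show "interior K \<in> lmeasurable" by (rule measure_interior_cell(2)[OF K])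
      show "0 < ?\<kappa> * diameter K ^ DIM('a)" using V hp by simp
      show "?\<kappa> * diameter K ^ DIM('a) \<le> measure lebesgue (interior K)" using V measure_interior_cell(1)[OF K] by simp
      show "norm (x - y) \<le> diameter K" if "x \<in> interior K" "y \<in> interior K" for x y
        using diameter_bounded_bound[OF compact_imp_bounded[OF compact_simplex[OF S]], of x y] that interior_subset
        by (auto simp: dist_norm)
    qed
    then show ?thesis using hp by auto
  qed
  then obtain a where a: "\<And>K. K \<in> \<T> \<Longrightarrow> (Lnorm 2 (interior K) (\<lambda>x. v x - a K))\<^sup>2
      \<le> (1 + ?\<omega>) / ?\<kappa> * (diameter K powr (2 * r) * (sobolev_seminorm r (interior K) v)\<^sup>2)" by metis
  show ?thesis
  proof (rule that[of a])
    fix K assume K: "K \<in> \<T>"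
    let ?s = "diameter K powr (2 * r) * (sobolev_seminorm r (interior K) v)\<^sup>2"
    let ?g = "div_weight K * (Lnorm q (interior K) (weak_div D v))\<^sup>2"
    let ?c = "(1 + ?\<omega>) / ?\<kappa>"
    have c: "0 \<le> ?c" using volume_bounds(2)[OF K] by simp
    have sg: "0 \<le> ?s" "0 \<le> ?g" by (auto simp: div_weight_def)
    have "local_error a K \<le> ?c * ?s + ?g" using a[OF K] by (simp add: local_error_def)
    also have "\<dots> \<le> ?c * ?s + ?g + (?s + ?c * ?g)"
      using add_nonneg_nonneg[OF sg(1) mult_nonneg_nonneg[OF c sg(2)]] by linarith
    also have "\<dots> = (1 + ?c) * (?s + ?g)" by (simp only: distrib_left distrib_right mult_1)
    finally show "local_error a K \<le> (1 + ?c) * (?s + ?g)" .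
  qed
qed

end

text \<open>Under the root stand the stability of the correction from \<open>rt_field_error\<close>
  and the quality of the constants from \<open>ex_good_constants\<close>. Since the approximants are
  affine on each cell, one value serves every degree.\<close>

definition approximation_const :: "nat \<Rightarrow> real \<Rightarrow> real \<Rightarrow> real" where
  "approximation_const n \<sigma> q = sqrt ((2 + 4 * (real n + 1)\<^sup>2 * jump_const n \<sigma> q)
     * (1 + (1 + unit_ball_vol (real n)) / volume_const n \<sigma>))"

lemma (in div_field_on_mesh) ex_rt_approximation:
  assumes v: "v \<in> sobolev r D" and r: "0 < r" "r \<le> 1"
    and \<alpha>: "\<And>F. \<bar>\<alpha> F\<bar> \<le> 1"
    "\<And>F p. p \<in> star F \<Longrightarrow> \<alpha> F = 0 \<or> card (star F) = 2 \<or> has_normal_trace D v (\<lambda>_. 0)"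
  shows "\<exists>a. Lnorm 2 D (\<lambda>x. v x - rt_field a \<alpha> x) \<le> approximation_const DIM('a) \<sigma> q *
    sqrt (\<Sum>K\<in>\<T>. diameter K powr (2 * r) * (sobolev_seminorm r (interior K) v)\<^sup>2
      + diameter K powr (2 + 2 * real DIM('a) * (1 / 2 - 1 / q)) * (Lnorm q (interior K) (weak_div D v))\<^sup>2)"
proof -
  let ?J = "2 + 4 * (real DIM('a) + 1)\<^sup>2 * jump_const DIM('a) \<sigma> q"
  let ?c = "1 + (1 + unit_ball_vol (real DIM('a))) / volume_const DIM('a) \<sigma>"
  let ?t = "\<lambda>K. diameter K powr (2 * r) * (sobolev_seminorm r (interior K) v)\<^sup>2
      + div_weight K * (Lnorm q (interior K) (weak_div D v))\<^sup>2"
  obtain a where a: "\<And>K. K \<in> \<T> \<Longrightarrow> local_error a K \<le> ?c * ?t K"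
    using ex_good_constants[OF v r] by metis
  have "\<T> \<noteq> {}"
    using domain Union_mesh closure_subset by (fastforce simp: polyhedral_lipschitz_domain_def)
  then have J: "0 \<le> ?J" using const_pos(3) volume_bounds(1) by (metis add_nonneg_nonneg all_not_in_conv mult_nonneg_nonneg zero_le_numeral zero_le_power2)
  have "(Lnorm 2 D (\<lambda>x. v x - rt_field a \<alpha> x))\<^sup>2 \<le> ?J * (\<Sum>K\<in>\<T>. local_error a K)"
    by (rule rt_field_error[OF \<alpha>])
  also have "\<dots> \<le> ?J * (\<Sum>K\<in>\<T>. ?c * ?t K)" using J a by (intro mult_left_mono sum_mono)
  also have "\<dots> = (?J * ?c) * (\<Sum>K\<in>\<T>. ?t K)" by (simp only: sum_distrib_left[symmetric] mult.assoc)
  finally have "Lnorm 2 D (\<lambda>x. v x - rt_field a \<alpha> x) \<le> sqrt ((?J * ?c) * (\<Sum>K\<in>\<T>. ?t K))"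
    by (rule real_le_rsqrt)
  then show ?thesis
    by (intro exI[of _ a]) (simp only: real_sqrt_mult approximation_const_def div_weight_def)
qed

theorem corollary3p2:
  fixes k :: nat and r q \<sigma> :: real
  assumes "DIM('a::euclidean_space) \<ge> 2"
    and "0 < r" and "r \<le> 1"
    and "2 * real DIM('a) / (2 + real DIM('a)) < q" and "q \<le> 2"
  shows "\<exists>c::real. \<forall>(D::'a set) (H::'h set) (\<T>::'h \<Rightarrow> 'a set set).
    polyhedral_lipschitz_domain D \<longrightarrow> shape_regular_mesh_family \<sigma> D H \<T> \<longrightarrow>
    (\<forall>v \<in> sobolev r D \<inter> Hdiv q D. \<forall>h\<in>H.
       let bound = c * sqrt (\<Sum>K\<in>\<T> h.
             diameter K powr (2 * r) * (sobolev_seminorm r (interior K) v)\<^sup>2 +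
             diameter K powr (2 + 2 * real DIM('a) * (1 / 2 - 1 / q)) *
               (Lnorm q (interior K) (weak_div D v))\<^sup>2)
       in (INF vh\<in>RT_space k D (\<T> h). Lnorm 2 D (\<lambda>x. v x - vh x)) \<le> bound \<and>
          (has_normal_trace D v (\<lambda>_. 0) \<longrightarrow>
             (INF vh\<in>RT_space0 k D (\<T> h). Lnorm 2 D (\<lambda>x. v x - vh x)) \<le> bound))"
proof (intro exI[of _ "approximation_const DIM('a) \<sigma> q"] allI impI ballI)
  fix D :: "'a set" and H :: "'h set" and \<T> :: "'h \<Rightarrow> 'a set set" and v and h
  assume D: "polyhedral_lipschitz_domain D" and \<T>: "shape_regular_mesh_family \<sigma> D H \<T>"
    and v: "v \<in> sobolev r D \<inter> Hdiv q D" and h: "h \<in> H"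
  \<comment> \<open>For d \<ge> 2 the quotient 2d/(2+d) is at least 1, which puts \<open>q\<close>
    in the range of Hoelder's inequality for the divergence.\<close>
  have q: "1 \<le> q"
  proof -
    have "1 \<le> 2 * real DIM('a) / (2 + real DIM('a))" using assms(1) by simp
    then show ?thesis using assms(4) by linarith
  qed
  interpret div_field_on_mesh D "\<T> h" \<sigma> v q
    by unfold_locales (use D \<T> h v q assms(1) in \<open>auto simp: shape_regular_mesh_family_def\<close>)
  \<comment> \<open>An infimum of reals is known to lie below the members only for sets bounded
    below, here by 0.\<close>
  have INF_le: "(INF vh\<in>X. Lnorm 2 D (\<lambda>x. v x - vh x)) \<le> Lnorm 2 D (\<lambda>x. v x - w x)" if "w \<in> X" for X w
    using that by (intro cINF_lower bdd_belowI[of _ 0]) (auto simp: Lnorm_nonneg)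
  let ?bound = "approximation_const DIM('a) \<sigma> q * sqrt (\<Sum>K\<in>\<T> h.
             diameter K powr (2 * r) * (sobolev_seminorm r (interior K) v)\<^sup>2 +
             diameter K powr (2 + 2 * real DIM('a) * (1 / 2 - 1 / q)) *
               (Lnorm q (interior K) (weak_div D v))\<^sup>2)"
  have "(INF vh\<in>RT_space k D (\<T> h). Lnorm 2 D (\<lambda>x. v x - vh x)) \<le> ?bound"
  proof -
    \<comment> \<open>Half of the jump is removed on each side of an interior facet. Boundary fluxes
      are left as they are, so only jumps across interior facets need an estimate.\<close>
    define \<alpha> where "\<alpha> F = (if card (star F) = 2 then 1 / 2 else 0 :: real)" for F
    have \<alpha>: "\<bar>\<alpha> F\<bar> \<le> 1" "\<alpha> F = 0 \<or> card (star F) = 2 \<or> has_normal_trace D v (\<lambda>_. 0)" "admissible \<alpha>" for F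
      by (auto simp: \<alpha>_def admissible_def)
    have "\<exists>a. Lnorm 2 D (\<lambda>x. v x - rt_field a \<alpha> x) \<le> ?bound"
      by (rule ex_rt_approximation) (use v assms(2,3) \<alpha>(1,2) in auto)
    then obtain a where "Lnorm 2 D (\<lambda>x. v x - rt_field a \<alpha> x) \<le> ?bound" ..
    then show ?thesis using INF_le[OF rt_field_in_RT_space[OF \<alpha>(3)]] order_trans by blast
  qed
  moreover have "(INF vh\<in>RT_space0 k D (\<T> h). Lnorm 2 D (\<lambda>x. v x - vh x)) \<le> ?bound"
    if trace: "has_normal_trace D v (\<lambda>_. 0)"
  proof -
    \<comment> \<open>One half on interior facets and 1 on boundary facets, where the whole flux is
      removed. For sets that are no facet the star is empty, and division by zero gives 0, which
      respects the bound by 1.\<close>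
    define \<alpha> where "\<alpha> F = 1 / real (card (star F))" for F
    have \<alpha>: "\<bar>\<alpha> F\<bar> \<le> 1" "admissible \<alpha>" for F
      by (auto simp: \<alpha>_def admissible_def divide_le_eq_1)
    have "\<exists>a. Lnorm 2 D (\<lambda>x. v x - rt_field a \<alpha> x) \<le> ?bound"
      by (rule ex_rt_approximation) (use v assms(2,3) \<alpha>(1) trace in auto)
    then obtain a where a: "Lnorm 2 D (\<lambda>x. v x - rt_field a \<alpha> x) \<le> ?bound" ..
    have "rt_field a \<alpha> \<in> RT_space0 k D (\<T> h)"
      using rt_field_in_RT_space[OF \<alpha>(2)] rt_field_normal_trace_zero[of \<alpha> a] by (simp add: RT_space0_def \<alpha>_def)
    then show ?thesis using INF_le a order_trans by blast
  qed
  ultimately show "let bound = ?bound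
       in (INF vh\<in>RT_space k D (\<T> h). Lnorm 2 D (\<lambda>x. v x - vh x)) \<le> bound \<and>
          (has_normal_trace D v (\<lambda>_. 0) \<longrightarrow>
             (INF vh\<in>RT_space0 k D (\<T> h). Lnorm 2 D (\<lambda>x. v x - vh x)) \<le> bound)"
    by (simp add: Let_def)
qed

end
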